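(* Let $n\ge7$ be an integer and $B=\{x\in\mathbb{R}^3:|x|<1\}$. Let $q\in C^n_c(B)$ and $a\in\partial B$. Then the point source problem $$(\partial_t^2-\Delta-q)U^a(x,t)=\delta(x-a,t),\quad x\in\mathbb{R}^3,\ t\in\mathbb{R},\qquad U^a(x,t)=0,\quad x\in\mathbb{R}^3,\ t<0,$$ has a unique solution $U^a$ in the set of distributions of order $n$ on $\mathbb{R}^3\times\mathbb{R}$. It is given by $$U^a(x,t)=\frac{\delta(t-|x-a|)}{4\pi|x-a|}+H(t-|x-a|)\,r^a(x,t),$$ where $r^a\in C^1(\mathbb{R}^3\times\mathbb{R})$. For any $T>0$ and $\mathcal{M}\ge\|q\|_{C^7}$ it has the norm estimate $$\|r^a\|_{C^1(\mathbb{R}^3\times[0,T])}\le C_{T,\mathcal{M}},$$ where $C_{T,\mathcal{M}}<\infty$ depends only on $T$ and $\mathcal{M}$. Moreover $U^a$ is $C^1$-smooth outside the light cone $t=|x-a|$. In particular the map $(a,\tau)\mapsto U^a(a,2\tau)$ is well defined $\partial B\times(0,1)\to\mathbb{C}$ and is continuously differentiable in $\tau$. Furthermore, for any $\mathcal{M}<\infty$ there is $C_{\mathcal{M}}<\infty$ depending only on $\mathcal{M}$ such that if $q_1,q_2\in C^n_c(B)$ satisfy $\|q_j\|_{C^7}\le\mathcal{M}$ and $U_1^a,U_2^a$ are the corresponding solutions, then for $\beta\in\{0,1\}$ $$\sup_{a\in\partial B}\ \sup_{0<\tau<1}\left|\partial_\tau^\beta(U_1^a-U_2^a)(a,2\tau)\right|\le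 C_{\mathcal{M}}\|q_1-q_2\|_{C^7}.$$
   Context: $\delta$ and $H$ are the Dirac delta distribution and the Heaviside function on $\mathbb{R}$; $\delta(x-a,t)$ is the Dirac delta at $(a,0)\in\mathbb{R}^3\times\mathbb{R}$. Equations are understood in the sense of distributions. $C^n_c(B)$ is the set of $n$ times continuously differentiable functions $B\to\mathbb{C}$ with compact support in $B$, extended by zero to $\mathbb{R}^3$. The norm is $\|f\|_{C^s(X)}=\sum_{|\alpha|\le s}\sup_X|\partial^\alpha f|$, and $\|\cdot\|_{C^7}$ is the case $s=7$. *)

theory Defs
  imports "HOL-Analysis.Analysis" "HOL-Library.Multiset"
begin

section \<open>Functions of class \<open>C\<^sup>k\<close>\<close>

definition partial_deriv ::
  "'a \<Rightarrow> ('a::euclidean_space \<Rightarrow> 'b::real_normed_vector) \<Rightarrow> 'a \<Rightarrow> 'b" where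
  "partial_deriv b f x = frechet_derivative f (at x) b"

text \<open>The set \<open>X\<close> is meant to be open.\<close>

primrec Ck_on ::
  "nat \<Rightarrow> 'a::euclidean_space set \<Rightarrow> ('a \<Rightarrow> 'b::real_normed_vector) \<Rightarrow> bool" where
  "Ck_on 0 X f \<longleftrightarrow> continuous_on X f"
| "Ck_on (Suc k) X f \<longleftrightarrow>
     (\<forall>x\<in>X. f differentiable (at x)) \<and> (\<forall>b\<in>Basis. Ck_on k X (partial_deriv b f))"

text \<open>A multi-index \<open>\<alpha>\<close> is represented by the multiset in which the basis vector \<open>b\<close> occurs
  \<open>\<alpha>\<^sub>b\<close> times, so that \<open>|\<alpha>|\<close> is its size.\<close>

definition multi_indices :: "nat \<Rightarrow> 'a::euclidean_space multiset set" where
  "multi_indices s = {\<alpha>. set_mset \<alpha> \<subseteq> Basis \<and> size \<alpha> \<le> s}"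

text \<open>The order of differentiation is irrelevant for functions of class \<open>C\<^sup>k\<close> with \<open>k \<ge> |\<alpha>|\<close>,
  and the operator is only applied to such functions.\<close>

definition multi_deriv ::
  "'a multiset \<Rightarrow> ('a::euclidean_space \<Rightarrow> 'b::real_normed_vector) \<Rightarrow> 'a \<Rightarrow> 'b" where
  "multi_deriv \<alpha> f = foldr partial_deriv (SOME bs. mset bs = \<alpha>) f"

text \<open>The norm is extended-real valued, so that a bound on it includes boundedness of the
  derivatives.\<close>

definition Ck_norm ::
  "nat \<Rightarrow> 'a::euclidean_space set \<Rightarrow> ('a \<Rightarrow> 'b::real_normed_vector) \<Rightarrow> ereal" where
  "Ck_norm s X f = (\<Sum>\<alpha>\<in>multi_indices s. SUP x\<in>X. ereal (norm (multi_deriv \<alpha> f x)))"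

definition fsupp :: "('a::topological_space \<Rightarrow> 'b::zero) \<Rightarrow> 'a set" where
  "fsupp f = closure {x. f x \<noteq> 0}"

definition Cc :: "nat \<Rightarrow> 'a::euclidean_space set \<Rightarrow> ('a \<Rightarrow> complex) set" where
  "Cc n X = {f. Ck_on n X f \<and> compact (fsupp f) \<and> fsupp f \<subseteq> X}"

definition test_functions :: "'a::euclidean_space set \<Rightarrow> ('a \<Rightarrow> complex) set" where
  "test_functions X = (\<Inter>n. Cc n X)"


section \<open>Distributions\<close>

text \<open>Linear forms on a space \<open>E\<close> of compactly supported functions that satisfy
  \<open>|U(\<phi>)| \<le> C \<Sum>\<^bsub>|\<alpha>| \<le> n\<^esub> sup |\<partial>\<^sup>\<alpha>\<phi>|\<close> for all \<open>\<phi> \<in> E\<close> supported in \<open>K\<close>, with a constant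
  \<open>C\<close> depending on the compact set \<open>K\<close>. They are undefined outside \<open>E\<close>, so that equality in
  HOL is equality of forms on \<open>E\<close>.\<close>

definition continuous_forms ::
  "('a::euclidean_space \<Rightarrow> complex) set \<Rightarrow> nat \<Rightarrow> (('a \<Rightarrow> complex) \<Rightarrow> complex) set" where
  "continuous_forms E n = {U \<in> extensional E.
     (\<forall>\<phi>\<in>E. \<forall>\<psi>\<in>E. U (\<lambda>x. \<phi> x + \<psi> x) = U \<phi> + U \<psi>) \<and>
     (\<forall>c. \<forall>\<phi>\<in>E. U (\<lambda>x. c * \<phi> x) = c * U \<phi>) \<and>
     (\<forall>K. compact K \<longrightarrow>
        (\<exists>C::real. \<forall>\<phi>\<in>E. fsupp \<phi> \<subseteq> K \<longrightarrow>
           ereal (cmod (U \<phi>)) \<le> ereal C * Ck_norm n UNIV \<phi>))}"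

text \<open>As usual, a distribution ``of order \<open>n\<close>'' is one of order at most \<open>n\<close>.\<close>

definition distributions_of_order ::
  "nat \<Rightarrow> (('a::euclidean_space \<Rightarrow> complex) \<Rightarrow> complex) set" where
  "distributions_of_order n = continuous_forms (test_functions UNIV) n"

text \<open>A distribution of order \<open>n\<close> extends uniquely to a linear form on \<open>C\<^sup>n\<close> functions with compact
  support that satisfies the same kind of estimates. Its product with a function \<open>f\<close> that is
  merely \<open>C\<^sup>n\<close> is defined through this extension, since \<open>f\<phi>\<close> is no test function in general.\<close>

definition order_extension ::
  "nat \<Rightarrow> (('a::euclidean_space \<Rightarrow> complex) \<Rightarrow> complex) \<Rightarrow> ('a \<Rightarrow> complex) \<Rightarrow> complex" where
  "order_extension n U =
     (THE V. V \<in> continuous_forms (Cc n UNIV) n \<and> (\<forall>\<phi>\<in>test_functions UNIV. V \<phi> = U \<phi>))"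

definition dist_mult ::
  "nat \<Rightarrow> ('a::euclidean_space \<Rightarrow> complex) \<Rightarrow> (('a \<Rightarrow> complex) \<Rightarrow> complex) \<Rightarrow>
    ('a \<Rightarrow> complex) \<Rightarrow> complex" where
  "dist_mult n f U = (\<lambda>\<phi>\<in>test_functions UNIV. order_extension n U (\<lambda>x. f x * \<phi> x))"

definition dist_deriv ::
  "'a::euclidean_space \<Rightarrow> (('a \<Rightarrow> complex) \<Rightarrow> complex) \<Rightarrow> ('a \<Rightarrow> complex) \<Rightarrow> complex" where
  "dist_deriv b U = (\<lambda>\<phi>\<in>test_functions UNIV. - U (partial_deriv b \<phi>))"

definition dirac_delta :: "'a::euclidean_space \<Rightarrow> ('a \<Rightarrow> complex) \<Rightarrow> complex" where
  "dirac_delta p = (\<lambda>\<phi>\<in>test_functions UNIV. \<phi> p)"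

definition regular_dist ::
  "('a::euclidean_space \<Rightarrow> complex) \<Rightarrow> ('a \<Rightarrow> complex) \<Rightarrow> complex" where
  "regular_dist f = (\<lambda>\<phi>\<in>test_functions UNIV. LINT x|lborel. f x * \<phi> x)"

definition dist_zero_on ::
  "'a::euclidean_space set \<Rightarrow> (('a \<Rightarrow> complex) \<Rightarrow> complex) \<Rightarrow> bool" where
  "dist_zero_on X U \<longleftrightarrow> (\<forall>\<phi>\<in>test_functions X. U \<phi> = 0)"

text \<open>The distribution \<open>U\<close> is given by the function \<open>u\<close> on the open set \<open>X\<close>; the values of \<open>u\<close>
  outside \<open>X\<close> play no role.\<close>

definition dist_given_on ::
  "'a::euclidean_space set \<Rightarrow> ('a \<Rightarrow> complex) \<Rightarrow> (('a \<Rightarrow> complex) \<Rightarrow> complex) \<Rightarrow> bool" where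
  "dist_given_on X u U \<longleftrightarrow> (\<forall>\<phi>\<in>test_functions X. U \<phi> = (LINT x|lborel. u x * \<phi> x))"

text \<open>The value at \<open>p\<close> of a distribution that is a continuous function near \<open>p\<close>.\<close>

definition has_dist_value ::
  "(('a::euclidean_space \<Rightarrow> complex) \<Rightarrow> complex) \<Rightarrow> 'a \<Rightarrow> complex \<Rightarrow> bool" where
  "has_dist_value U p c \<longleftrightarrow>
     (\<exists>X u. open X \<and> p \<in> X \<and> continuous_on X u \<and> dist_given_on X u U \<and> u p = c)"

definition dist_value :: "(('a::euclidean_space \<Rightarrow> complex) \<Rightarrow> complex) \<Rightarrow> 'a \<Rightarrow> complex" where
  "dist_value U p = (THE c. has_dist_value U p c)"


section \<open>The point source problem\<close>

type_synonym spacetime = "(real^3) \<times> real"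

type_synonym spacetime_dist = "(spacetime \<Rightarrow> complex) \<Rightarrow> complex"

definition dist_wave_op :: "spacetime_dist \<Rightarrow> spacetime_dist" where
  "dist_wave_op U \<phi> =
     dist_deriv (0, 1) (dist_deriv (0, 1) U) \<phi>
     - (\<Sum>i\<in>UNIV. dist_deriv (axis i 1, 0) (dist_deriv (axis i 1, 0) U) \<phi>)"

definition point_source_solution ::
  "nat \<Rightarrow> (real^3 \<Rightarrow> complex) \<Rightarrow> real^3 \<Rightarrow> spacetime_dist \<Rightarrow> bool" where
  "point_source_solution n q a U \<longleftrightarrow>
     U \<in> distributions_of_order n \<and>
     (\<forall>\<phi>\<in>test_functions UNIV.
        dist_wave_op U \<phi> - dist_mult n (\<lambda>(x, t). q x) U \<phi> = dirac_delta (a, 0) \<phi>) \<and>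
     dist_zero_on {(x, t). t < 0} U"

text \<open>The distribution \<open>\<delta>(t - |x - a|) / (4\<pi>|x - a|)\<close>: integrating out \<open>t\<close> evaluates the test
  function at \<open>t = |x - a|\<close>.\<close>

definition cone_delta :: "real^3 \<Rightarrow> spacetime_dist" where
  "cone_delta a = (\<lambda>\<phi>\<in>test_functions UNIV.
     LINT x|lborel. \<phi> (x, norm (x - a)) / complex_of_real (4 * pi * norm (x - a)))"

text \<open>The value at \<open>0\<close> is immaterial for the distributions considered here.\<close>

definition heaviside :: "real \<Rightarrow> complex" where
  "heaviside s = (if s < 0 then 0 else 1)"

end

theory Submission
  imports Defs "HOL-Real_Asymp.Real_Asymp"
begin

text \<open>
  Retarded and advanced potentials invert the wave operator in dimension three, and they scale the weight
  \<open>exp (l t)\<close> by \<open>1 / l\<^sup>2\<close>. All estimates are bounds of derivatives by such weights.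

  The regular part of the solution is a progressing wave expansion in powers of \<open>s = t\<^sup>2 - |x - a|\<^sup>2\<close>: inside the
  cone it equals \<open>A\<^sub>1 + s A\<^sub>2 + s\<^sup>2 A\<^sub>3 / 2 + W\<close>. The coefficients solve transport equations along the rays from \<open>a\<close>,
  so each of them is a mean over a ray and costs two derivatives of \<open>q\<close>; this is where \<open>C\<^sup>7\<close> is used. The expansion
  solves the equation up to a source proportional to \<open>s\<^sup>2\<close>, which is \<open>C\<^sup>1\<close> across the cone, and \<open>W\<close> is the solution
  of the corresponding Volterra equation, obtained as a Neumann series. Green's identity in the cone shows that the
  boundary terms reproduce the point source. The expansion depends on \<open>q\<close> in a Lipschitz way, which gives stability.

  For uniqueness, the difference of two solutions is tested against the advanced potential of a test function, cut off
  in the past where the difference vanishes. This moves the equation onto the test function and gains a factor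
  \<open>1 / l\<^sup>2\<close>; iteration shows that the difference vanishes.
\<close>

section \<open>Functions of class \<open>C\<^sup>k\<close>\<close>

text \<open>The obstacle is that the regular part must be \<open>C^1\<close> up to the light cone,
  with bounds that do not see \<open>a\<close>. The estimates used for potentials gain no
  derivative, so the source of \<open>W\<close> has to be \<open>C^1\<close> itself. Cutting off
  powers of s at the cone gives a jump at power 0 and a kink at power 1; the square is the first
  power that becomes \<open>C^1\<close>. Cancelling the lower powers takes three coefficients, which
  lie in \<open>C^7\<close>, \<open>C^5\<close> and \<open>C^3\<close> and leave a source
  coefficient in \<open>C^1\<close>. The first coefficient is fixed on the cone: twice the transport
  operator \<open>d_t + d_r + 1/r\<close> applied to it must equal \<open>q / (4 pi r)\<close>, the
  density with which \<open>q\<close> acts on the delta shell. This is the origin of the factor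
  \<open>1 / (8 pi)\<close>. A further point is the meaning of the product of \<open>q\<close> and
  \<open>U\<close>: \<open>q \<phi>\<close> is only \<open>C^n\<close>, so \<open>U\<close> is first
  extended to such functions by mollification, and uniqueness is proved for the extended
  forms.\<close>

lemma partial_deriv_eq: "(f has_derivative f') (at x) \<Longrightarrow> partial_deriv b f x = f' b"
  unfolding partial_deriv_def by (metis frechet_derivative_at)

lemma partial_deriv_cong_open:
  assumes "open X" "x \<in> X" "\<And>y. y \<in> X \<Longrightarrow> f y = g y"
  shows "partial_deriv b f x = partial_deriv b g x"
proof -
  have "(f has_derivative D) (at x) \<longleftrightarrow> (g has_derivative D) (at x)" for D
    using assms by (metis has_derivative_transform_within_open)
  then show ?thesis by (simp add: partial_deriv_def frechet_derivative_def)
qed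

lemma has_derivative_partial:
  assumes "f differentiable (at x)"
  shows "(f has_derivative (\<lambda>h. \<Sum>b\<in>Basis. (h \<bullet> b) *\<^sub>R partial_deriv b f x)) (at x)"
proof -
  have D: "(f has_derivative frechet_derivative f (at x)) (at x)"
    using assms by (simp add: frechet_derivative_works)
  then have L: "linear (frechet_derivative f (at x))"
    by (rule has_derivative_linear)
  have "frechet_derivative f (at x) h = (\<Sum>b\<in>Basis. (h \<bullet> b) *\<^sub>R partial_deriv b f x)" for h
  proof -
    have "frechet_derivative f (at x) h = frechet_derivative f (at x) (\<Sum>b\<in>Basis. (h \<bullet> b) *\<^sub>R b)"
      by (simp add: euclidean_representation)
    also have "\<dots> = (\<Sum>b\<in>Basis. (h \<bullet> b) *\<^sub>R partial_deriv b f x)"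
      unfolding partial_deriv_def by (simp add: L linear_sum linear_scale)
    finally show ?thesis .
  qed
  then have "frechet_derivative f (at x) = (\<lambda>h. \<Sum>b\<in>Basis. (h \<bullet> b) *\<^sub>R partial_deriv b f x)"
    by blast
  with D show ?thesis by simp
qed

lemma Ck_on_imp_continuous_on: "Ck_on k X f \<Longrightarrow> continuous_on X f"
  by (cases k) (auto intro!: continuous_at_imp_continuous_on differentiable_imp_continuous_within)

lemma Ck_on_Suc_imp: "Ck_on (Suc k) X f \<Longrightarrow> Ck_on k X f"
proof (induction k arbitrary: f)
  case 0
  then show ?case using Ck_on_imp_continuous_on by (metis Ck_on.simps(1))
next
  case (Suc k)
  then show ?case by (metis Ck_on.simps(2))
qed

lemma Ck_on_mono: "Ck_on k X f \<Longrightarrow> j \<le> k \<Longrightarrow> Ck_on j X f"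
  by (induction k) (auto simp del: Ck_on.simps simp: le_Suc_eq dest: Ck_on_Suc_imp)

lemma Ck_on_cong:
  "open X \<Longrightarrow> Ck_on k X f \<Longrightarrow> (\<And>x. x \<in> X \<Longrightarrow> f x = g x) \<Longrightarrow> Ck_on k X g"
proof (induction k arbitrary: f g)
  case 0
  then show ?case by (metis Ck_on.simps(1) continuous_on_cong)
next
  case (Suc k)
  have "g differentiable (at x)" if "x \<in> X" for x
    using Suc.prems that unfolding Ck_on.simps differentiable_def
    by (metis has_derivative_transform_within_open)
  moreover have "Ck_on k X (partial_deriv b g)" if "b \<in> Basis" for b
    using that Suc.prems partial_deriv_cong_open[of X _ f g b]
    by (rule_tac Suc.IH[of "partial_deriv b f"]) auto
  ultimately show ?case by simp
qed

lemma Ck_on_subset: "Ck_on k X f \<Longrightarrow> Y \<subseteq> X \<Longrightarrow> Ck_on k Y f"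
proof (induction k arbitrary: f)
  case 0 then show ?case by (auto intro: continuous_on_subset)
next
  case (Suc k) then show ?case by auto
qed

lemma Ck_on_Un: "open X \<Longrightarrow> open Y \<Longrightarrow> Ck_on k X f \<Longrightarrow> Ck_on k Y f \<Longrightarrow> Ck_on k (X \<union> Y) f"
proof (induction k arbitrary: f)
  case 0 then show ?case by (auto intro: continuous_on_open_Un)
next
  case (Suc k) then show ?case by auto
qed

section \<open>Weighted bounds for all derivatives\<close>

text \<open>One pointwise weight serves all orders up to \<open>k\<close> and all orders of
  differentiation. A weight may grow, as \<open>exp (l t)\<close> does, and every operation on
  functions needs only one rule that says what happens to the weight.\<close>

primrec Ckb ::
  "nat \<Rightarrow> ('a \<Rightarrow> real) \<Rightarrow> ('a::euclidean_space \<Rightarrow> 'b::real_normed_vector) \<Rightarrow> bool" where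
  "Ckb 0 w f \<longleftrightarrow> (\<forall>x. norm (f x) \<le> w x) \<and> continuous_on UNIV f"
| "Ckb (Suc k) w f \<longleftrightarrow> (\<forall>x. norm (f x) \<le> w x) \<and> (\<forall>x. f differentiable (at x)) \<and>
     (\<forall>b\<in>Basis. Ckb k w (partial_deriv b f))"

lemma Ckb_bound: "Ckb k w f \<Longrightarrow> norm (f x) \<le> w x"
  by (cases k) auto

lemma Ckb_weight_nonneg: "Ckb k w f \<Longrightarrow> 0 \<le> w x"
  using Ckb_bound norm_ge_zero order_trans by blast

lemma Ckb_imp_Ck_on: "Ckb k w f \<Longrightarrow> Ck_on k UNIV f"
  by (induction k arbitrary: f) auto

lemma Ckb_continuous: "Ckb k w f \<Longrightarrow> continuous_on UNIV f"
  using Ckb_imp_Ck_on Ck_on_imp_continuous_on by blast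

lemma Ckb_Suc_imp: "Ckb (Suc k) w f \<Longrightarrow> Ckb k w f"
proof (induction k arbitrary: f)
  case 0
  then show ?case using Ckb_continuous[OF 0] by auto
next
  case (Suc k)
  then show ?case by (metis Ckb.simps(2))
qed

lemma Ckb_order_mono: "Ckb k w f \<Longrightarrow> j \<le> k \<Longrightarrow> Ckb j w f"
  by (induction k) (auto simp del: Ckb.simps simp: le_Suc_eq dest: Ckb_Suc_imp)

lemma Ckb_mono: "Ckb k w f \<Longrightarrow> (\<And>x. w x \<le> w' x) \<Longrightarrow> Ckb k w' f"
  by (induction k arbitrary: f) (auto intro: order_trans)

lemma partial_deriv_const [simp]: "partial_deriv b (\<lambda>x. c) = (\<lambda>x. 0)"
  by (rule ext, rule partial_deriv_eq) auto

lemma Ckb_const: "norm c \<le> A \<Longrightarrow> Ckb k (\<lambda>x. A) (\<lambda>x. c)"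
proof (induction k arbitrary: c)
  case (Suc k)
  then show ?case using Suc.IH[of 0] order_trans[OF norm_ge_zero Suc.prems] by simp
qed auto

lemma Ckb_zero: "(\<And>x. 0 \<le> w x) \<Longrightarrow> Ckb k w (\<lambda>x. 0)"
  by (induction k) auto

lemma partial_deriv_add:
  "f differentiable (at x) \<Longrightarrow> g differentiable (at x) \<Longrightarrow>
    partial_deriv b (\<lambda>x. f x + g x) x = partial_deriv b f x + partial_deriv b g x"
  unfolding frechet_derivative_works
  by (drule (1) has_derivative_add, drule partial_deriv_eq) (simp add: partial_deriv_def)

lemma partial_deriv_diff:
  "f differentiable (at x) \<Longrightarrow> g differentiable (at x) \<Longrightarrow>
    partial_deriv b (\<lambda>x. f x - g x) x = partial_deriv b f x - partial_deriv b g x"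
  unfolding frechet_derivative_works
  by (drule (1) has_derivative_diff, drule partial_deriv_eq) (simp add: partial_deriv_def)

lemma partial_deriv_scaleR:
  "f differentiable (at x) \<Longrightarrow>
    partial_deriv b (\<lambda>x. c *\<^sub>R f x) x = c *\<^sub>R partial_deriv b f x"
  unfolding frechet_derivative_works
  by (drule has_derivative_scaleR_right, drule partial_deriv_eq) (simp add: partial_deriv_def)

lemma partial_deriv_mult:
  fixes f g :: "'a::euclidean_space \<Rightarrow> 'b::real_normed_algebra"
  assumes "f differentiable (at x)" "g differentiable (at x)"
  shows "partial_deriv b (\<lambda>x. f x * g x) x = partial_deriv b f x * g x + f x * partial_deriv b g x"
proof -
  have "((\<lambda>x. f x * g x) has_derivative
      (\<lambda>h. f x * frechet_derivative g (at x) h + frechet_derivative f (at x) h * g x)) (at x)"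
    using assms by (intro has_derivative_mult) (auto simp: frechet_derivative_works[symmetric])
  from partial_deriv_eq[OF this] show ?thesis by (simp add: partial_deriv_def)
qed

lemma Ckb_add:
  "Ckb k v f \<Longrightarrow> Ckb k w g \<Longrightarrow> Ckb k (\<lambda>x. v x + w x) (\<lambda>x. f x + g x)"
proof (induction k arbitrary: f g)
  case 0 then show ?case by (auto intro!: continuous_intros norm_triangle_mono)
next
  case (Suc k)
  have "partial_deriv b (\<lambda>x. f x + g x) = (\<lambda>x. partial_deriv b f x + partial_deriv b g x)" for b
    using Suc.prems by (intro ext partial_deriv_add) auto
  then show ?case using Suc by (auto intro!: norm_triangle_mono)
qed

lemma Ckb_scaleR:
  "Ckb k w f \<Longrightarrow> Ckb k (\<lambda>x. \<bar>c\<bar> * w x) (\<lambda>x. c *\<^sub>R f x)"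
proof (induction k arbitrary: f)
  case 0 then show ?case by (auto intro!: continuous_intros mult_left_mono)
next
  case (Suc k)
  have "partial_deriv b (\<lambda>x. c *\<^sub>R f x) = (\<lambda>x. c *\<^sub>R partial_deriv b f x)" for b
    using Suc.prems by (intro ext partial_deriv_scaleR) auto
  then show ?case using Suc by (auto intro!: mult_left_mono)
qed

lemma Ckb_uminus: "Ckb k w f \<Longrightarrow> Ckb k w (\<lambda>x. - f x)"
  using Ckb_scaleR[of k w f "-1"] by simp

lemma Ckb_diff:
  "Ckb k v f \<Longrightarrow> Ckb k w g \<Longrightarrow> Ckb k (\<lambda>x. v x + w x) (\<lambda>x. f x - g x)"
  using Ckb_add[of k v f w "\<lambda>x. - g x"] Ckb_uminus by auto

lemma Ckb_sum:
  "finite I \<Longrightarrow> (\<And>i. i \<in> I \<Longrightarrow> Ckb k (w i) (f i)) \<Longrightarrow>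
    Ckb k (\<lambda>x. \<Sum>i\<in>I. w i x) (\<lambda>x. \<Sum>i\<in>I. f i x)"
proof (induction I rule: finite_induct)
  case empty then show ?case by (auto intro: Ckb_zero)
next
  case (insert i I) then show ?case by (auto intro: Ckb_add)
qed

text \<open>By the Leibniz rule each further derivative doubles the number of terms, whence the
  factor \<open>2 ^ k\<close>.\<close>

lemma Ckb_mult:
  fixes f g :: "'a::euclidean_space \<Rightarrow> 'b::real_normed_algebra"
  shows "Ckb k v f \<Longrightarrow> Ckb k w g \<Longrightarrow> Ckb k (\<lambda>x. 2 ^ k * (v x * w x)) (\<lambda>x. f x * g x)"
proof (induction k arbitrary: f g)
  case 0
  have "norm (f x * g x) \<le> v x * w x" for x
    by (rule order_trans[OF norm_mult_ineq mult_mono])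
      (use 0 Ckb_weight_nonneg[OF 0(1)] in auto)
  then show ?case using 0 by (auto intro!: continuous_intros)
next
  case (Suc k)
  have nn: "0 \<le> v x" "0 \<le> w x" for x
    using Suc.prems Ckb_weight_nonneg by blast+
  have b: "norm (f x * g x) \<le> 2 ^ Suc k * (v x * w x)" for x
  proof -
    have "norm (f x * g x) \<le> v x * w x"
      by (rule order_trans[OF norm_mult_ineq mult_mono]) (use Suc.prems nn in auto)
    also have "\<dots> \<le> 2 ^ Suc k * (v x * w x)"
      using mult_right_mono[of 1 "2 ^ Suc k" "v x * w x"] nn one_le_power[of "2::real" "Suc k"] by simp
    finally show ?thesis .
  qed
  have pd: "partial_deriv b (\<lambda>x. f x * g x)
      = (\<lambda>x. partial_deriv b f x * g x + f x * partial_deriv b g x)" for b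
    using Suc.prems by (intro ext partial_deriv_mult) auto
  have "Ckb k (\<lambda>x. 2 ^ Suc k * (v x * w x)) (partial_deriv b (\<lambda>x. f x * g x))" if "b \<in> Basis" for b
    unfolding pd
    by (rule Ckb_mono[OF Ckb_add[OF Suc.IH Suc.IH]])
      (use Suc.prems that Ckb_Suc_imp in \<open>auto simp: algebra_simps\<close>)
  then show ?case using b Suc.prems by auto
qed

lemma Ckb_cmult:
  fixes f :: "'a::euclidean_space \<Rightarrow> complex"
  assumes "Ckb k w f"
  shows "Ckb k (\<lambda>x. cmod c * w x) (\<lambda>x. c * f x)"
  using assms
proof (induction k arbitrary: f)
  case 0 then show ?case by (auto intro!: continuous_intros mult_left_mono simp: norm_mult)
next
  case (Suc k)
  have "partial_deriv b (\<lambda>x. c * f x) = (\<lambda>x. c * partial_deriv b f x)" for b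
    using Suc.prems by (intro ext) (subst partial_deriv_mult, auto)
  then show ?case using Suc by (auto intro!: mult_left_mono simp: norm_mult)
qed

text \<open>Every \<open>C^k\<close> function satisfies \<open>Ckb\<close> with a weight made from
  its own derivatives. Closure rules for \<open>Ck_on\<close> on the whole space therefore follow
  from those for \<open>Ckb\<close>.\<close>

lemma Ckb_exists: "Ck_on k UNIV f \<Longrightarrow> \<exists>w. Ckb k w f"
proof (induction k arbitrary: f)
  case 0 then show ?case by (intro exI[of _ "\<lambda>x. norm (f x)"]) auto
next
  case (Suc k)
  then have "\<forall>b\<in>Basis. \<exists>w. Ckb k w (partial_deriv b f)" by auto
  then obtain w where w: "\<And>b. b \<in> Basis \<Longrightarrow> Ckb k (w b) (partial_deriv b f)" by metis
  then have nn: "\<And>b x. b \<in> Basis \<Longrightarrow> 0 \<le> w b x" using Ckb_weight_nonneg by blast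
  have "Ckb k (\<lambda>x. norm (f x) + (\<Sum>b\<in>Basis. w b x)) (partial_deriv b f)" if "b \<in> Basis" for b
    using that nn by (intro Ckb_mono[OF w[OF that]])
      (auto intro!: add_increasing member_le_sum)
  then have "Ckb (Suc k) (\<lambda>x. norm (f x) + (\<Sum>b\<in>Basis. w b x)) f"
    using Suc.prems nn by (auto simp: sum_nonneg)
  then show ?case by blast
qed

lemma Ck_on_UNIV_iff: "Ck_on k UNIV f \<longleftrightarrow> (\<exists>w. Ckb k w f)"
  using Ckb_exists Ckb_imp_Ck_on by blast

lemma Ck_on_add: "Ck_on k UNIV f \<Longrightarrow> Ck_on k UNIV g \<Longrightarrow> Ck_on k UNIV (\<lambda>x. f x + g x)"
  using Ckb_add unfolding Ck_on_UNIV_iff by blast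

lemma Ck_on_diff: "Ck_on k UNIV f \<Longrightarrow> Ck_on k UNIV g \<Longrightarrow> Ck_on k UNIV (\<lambda>x. f x - g x)"
  using Ckb_diff unfolding Ck_on_UNIV_iff by blast

lemma Ck_on_mult:
  fixes f g :: "'a::euclidean_space \<Rightarrow> 'b::real_normed_algebra"
  shows "Ck_on k UNIV f \<Longrightarrow> Ck_on k UNIV g \<Longrightarrow> Ck_on k UNIV (\<lambda>x. f x * g x)"
  using Ckb_mult unfolding Ck_on_UNIV_iff by blast

lemma Ck_on_sum:
  assumes "finite I" "\<And>i. i \<in> I \<Longrightarrow> Ck_on k UNIV (f i)"
  shows "Ck_on k UNIV (\<lambda>x. \<Sum>i\<in>I. f i x)"
proof -
  from assms(2) have "\<forall>i\<in>I. \<exists>w. Ckb k w (f i)" unfolding Ck_on_UNIV_iff by blast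
  then obtain w where w: "\<And>i. i \<in> I \<Longrightarrow> Ckb k (w i) (f i)" by metis
  have "Ckb k (\<lambda>x. \<Sum>i\<in>I. w i x) (\<lambda>x. \<Sum>i\<in>I. f i x)"
    by (rule Ckb_sum[OF assms(1) w])
  then show ?thesis unfolding Ck_on_UNIV_iff by blast
qed

lemma Ck_on_const: "Ck_on k UNIV (\<lambda>x. c)"
  using Ckb_const[OF order_refl] unfolding Ck_on_UNIV_iff by blast

text \<open>If \<open>l\<close> sends each basis vector to a multiple, of modulus at most 1, of a
  basis vector, then a partial derivative of the composition is such a multiple of a single partial
  derivative of \<open>f\<close>, and the weight does not grow. Translations, contractions and the
  projection to space are all of this kind; for the projection the factor of the time direction is
  0.\<close>

lemma Ckb_compose_linear:
  fixes f :: "'c::euclidean_space \<Rightarrow> 'b::real_normed_vector" and l :: "'a::euclidean_space \<Rightarrow> 'c"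
  assumes l: "bounded_linear l"
    and lb: "\<And>b. b \<in> Basis \<Longrightarrow> l b = \<alpha> b *\<^sub>R \<beta> b \<and> \<beta> b \<in> Basis \<and> \<bar>\<alpha> b\<bar> \<le> 1"
  shows "Ckb k w f \<Longrightarrow> Ckb k (\<lambda>x. w (l x + v)) (\<lambda>x. f (l x + v))"
    and "(\<And>x. f differentiable (at x)) \<Longrightarrow> b \<in> Basis \<Longrightarrow>
      partial_deriv b (\<lambda>x. f (l x + v)) = (\<lambda>x. \<alpha> b *\<^sub>R partial_deriv (\<beta> b) f (l x + v))"
proof -
  have der: "((\<lambda>x. f (l x + v)) has_derivative (\<lambda>h. frechet_derivative f (at (l x + v)) (l h))) (at x)"
    if "\<And>x. f differentiable (at x)" for f :: "'c \<Rightarrow> 'b" and x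
  proof -
    have "((\<lambda>x. l x + v) has_derivative l) (at x)"
      using has_derivative_add_const[OF bounded_linear.has_derivative[OF l has_derivative_ident]] by simp
    moreover have "(f has_derivative frechet_derivative f (at (l x + v))) (at (l x + v))"
      using that frechet_derivative_works by blast
    ultimately show ?thesis by (rule has_derivative_compose)
  qed
  have pd: "partial_deriv b (\<lambda>x. f (l x + v)) = (\<lambda>x. \<alpha> b *\<^sub>R partial_deriv (\<beta> b) f (l x + v))"
    if "\<And>x. f differentiable (at x)" "b \<in> Basis" for f :: "'c \<Rightarrow> 'b" and b
  proof
    fix x
    have "linear (frechet_derivative f (at (l x + v)))"
      using that(1) frechet_derivative_works has_derivative_linear by blast
    then show "partial_deriv b (\<lambda>x. f (l x + v)) x = \<alpha> b *\<^sub>R partial_deriv (\<beta> b) f (l x + v)"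
      using partial_deriv_eq[OF der[OF that(1)], of b x] lb[OF that(2)]
      by (simp add: linear_scale partial_deriv_def)
  qed
  then show "(\<And>x. f differentiable (at x)) \<Longrightarrow> b \<in> Basis \<Longrightarrow>
      partial_deriv b (\<lambda>x. f (l x + v)) = (\<lambda>x. \<alpha> b *\<^sub>R partial_deriv (\<beta> b) f (l x + v))"
    by blast
  show "Ckb k w f \<Longrightarrow> Ckb k (\<lambda>x. w (l x + v)) (\<lambda>x. f (l x + v))"
  proof (induction k arbitrary: f)
    case 0
    have "continuous_on UNIV (\<lambda>x. l x + v)"
      using l by (intro continuous_on_add linear_continuous_on continuous_on_const) auto
    from continuous_on_compose2[OF _ this, of UNIV f] 0 show ?case by simp
  next
    case (Suc k)
    have "Ckb k (\<lambda>x. w (l x + v)) (partial_deriv b (\<lambda>x. f (l x + v)))" if "b \<in> Basis" for b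
    proof -
      have "Ckb k (\<lambda>x. w (l x + v)) (\<lambda>x. partial_deriv (\<beta> b) f (l x + v))"
        using Suc lb[OF that] by auto
      from Ckb_scaleR[OF this, of "\<alpha> b"]
      have "Ckb k (\<lambda>x. \<bar>\<alpha> b\<bar> * w (l x + v)) (partial_deriv b (\<lambda>x. f (l x + v)))"
        using pd[OF _ that, of f] Suc.prems by auto
      moreover have "\<bar>\<alpha> b\<bar> * w (l x + v) \<le> w (l x + v)" for x
        using mult_right_mono[of "\<bar>\<alpha> b\<bar>" 1 "w (l x + v)"] lb[OF that]
          Ckb_weight_nonneg[OF Suc.prems] by simp
      ultimately show ?thesis by (rule Ckb_mono)
    qed
    then show ?case using Suc.prems der[of f] unfolding Ckb.simps differentiable_def by auto
  qed
qed

lemma Ckb_translate: "Ckb k w f \<Longrightarrow> Ckb k (\<lambda>x. w (x + v)) (\<lambda>x. f (x + v))"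
  using Ckb_compose_linear(1)[of "\<lambda>x. x" "\<lambda>_. 1" "\<lambda>x. x" k w f v] by auto

lemma partial_deriv_translate:
  "(\<And>x. f differentiable (at x)) \<Longrightarrow> b \<in> Basis \<Longrightarrow>
    partial_deriv b (\<lambda>x. f (x + v)) = (\<lambda>x. partial_deriv b f (x + v))"
  using Ckb_compose_linear(2)[of "\<lambda>x. x" "\<lambda>_. 1" "\<lambda>x. x" f b v] by auto

section \<open>The norm and the symmetry of derivatives\<close>

abbreviation partials :: "'a list \<Rightarrow> ('a::euclidean_space \<Rightarrow> 'b::real_normed_vector) \<Rightarrow> 'a \<Rightarrow> 'b" where
  "partials bs f \<equiv> foldr partial_deriv bs f"

lemma finite_multi_indices [simp]: "finite (multi_indices s :: 'a::euclidean_space multiset set)"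
proof -
  have "multi_indices s \<subseteq> mset ` {bs. set bs \<subseteq> (Basis :: 'a set) \<and> length bs \<le> s}"
  proof
    fix \<alpha> :: "'a multiset" assume "\<alpha> \<in> multi_indices s"
    moreover obtain bs where "mset bs = \<alpha>" using ex_mset by blast
    ultimately show "\<alpha> \<in> mset ` {bs. set bs \<subseteq> Basis \<and> length bs \<le> s}"
      unfolding multi_indices_def by (intro image_eqI[of _ _ bs]) auto
  qed
  then show ?thesis
    using finite_surj[OF finite_lists_length_le[OF finite_Basis]] by blast
qed

lemma empty_in_multi_indices: "{#} \<in> multi_indices s"
  by (simp add: multi_indices_def)

lemma multi_deriv_empty [simp]: "multi_deriv {#} f = f"
  by (simp add: multi_deriv_def)

lemma multi_deriv_partials:
  assumes "\<alpha> \<in> multi_indices s"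
  obtains bs where "set bs \<subseteq> Basis" "length bs \<le> s" "mset bs = \<alpha>" "multi_deriv \<alpha> f = partials bs f"
proof -
  let ?bs = "SOME bs. mset bs = \<alpha>"
  have "mset ?bs = \<alpha>" using ex_mset[of \<alpha>] by (rule someI_ex)
  then have "set_mset \<alpha> = set ?bs" "size \<alpha> = length ?bs"
    using set_mset_mset[of ?bs] size_mset[of ?bs] by auto
  with \<open>mset ?bs = \<alpha>\<close> assms show ?thesis
    by (intro that[of ?bs]) (auto simp: multi_indices_def multi_deriv_def)
qed

lemma Ckb_partials:
  "Ckb k w f \<Longrightarrow> set bs \<subseteq> Basis \<Longrightarrow> length bs + j \<le> k \<Longrightarrow> Ckb j w (partials bs f)"
proof (induction bs arbitrary: j)
  case Nil then show ?case using Ckb_order_mono by auto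
next
  case (Cons b bs)
  then have "Ckb (Suc j) w (partials bs f)" by (intro Cons.IH) auto
  then show ?case using Cons.prems by auto
qed

lemma Ckb_iff_partials:
  "Ckb k w f \<longleftrightarrow> Ck_on k UNIV f \<and>
    (\<forall>bs x. set bs \<subseteq> Basis \<longrightarrow> length bs \<le> k \<longrightarrow> norm (partials bs f x) \<le> w x)"
proof
  assume "Ckb k w f"
  then show "Ck_on k UNIV f \<and> (\<forall>bs x. set bs \<subseteq> Basis \<longrightarrow> length bs \<le> k \<longrightarrow> norm (partials bs f x) \<le> w x)"
    using Ckb_imp_Ck_on Ckb_bound[OF Ckb_partials[of k w f _ 0]] by auto
next
  show "Ck_on k UNIV f \<and> (\<forall>bs x. set bs \<subseteq> Basis \<longrightarrow> length bs \<le> k \<longrightarrow> norm (partials bs f x) \<le> w x)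
    \<Longrightarrow> Ckb k w f"
  proof (induction k arbitrary: f)
    case 0 then show ?case by (auto dest: spec[of _ "[]"])
  next
    case (Suc k)
    have "norm (f x) \<le> w x" for x
      using Suc.prems by (auto dest: spec[of _ "[]"])
    moreover have "Ckb k w (partial_deriv b f)" if b: "b \<in> Basis" for b
    proof (rule Suc.IH, intro conjI allI impI)
      fix bs :: "'a list" and x
      assume "set bs \<subseteq> Basis" "length bs \<le> k"
      \<comment> \<open>\<open>foldr\<close> applies the last entry of the list first, so the
        derivative taken before those in \<open>bs\<close> is appended at the end.\<close>
      then show "norm (partials bs (partial_deriv b f) x) \<le> w x"
        using Suc.prems b by (auto dest!: spec[of _ "bs @ [b]"])
    qed (use Suc.prems b in auto)
    ultimately show ?case using Suc.prems by auto
  qed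
qed

lemma Ck_norm_le:
  fixes f :: "'a::euclidean_space \<Rightarrow> 'b::real_normed_vector"
  assumes "Ckb s w f" "\<And>x. x \<in> X \<Longrightarrow> w x \<le> A" "X \<noteq> {}"
  shows "Ck_norm s X f \<le> ereal (real (card (multi_indices s :: 'a multiset set)) * A)"
proof -
  have "(SUP x\<in>X. ereal (norm (multi_deriv \<alpha> f x))) \<le> ereal A" if "\<alpha> \<in> multi_indices s" for \<alpha>
  proof -
    from that obtain bs where bs: "set bs \<subseteq> Basis" "length bs \<le> s" "multi_deriv \<alpha> f = partials bs f"
      using multi_deriv_partials by metis
    have "norm (partials bs f x) \<le> A" if "x \<in> X" for x
      using assms(1) bs assms(2)[OF that] unfolding Ckb_iff_partials by (meson order_trans)
    then show ?thesis using bs by (auto intro: SUP_least)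
  qed
  then have "Ck_norm s X f \<le> (\<Sum>\<alpha>\<in>(multi_indices s :: 'a multiset set). ereal A)"
    unfolding Ck_norm_def by (intro sum_mono)
  then show ?thesis by simp
qed

lemma Ck_norm_ge:
  assumes "\<alpha> \<in> multi_indices s" "x \<in> X"
  shows "ereal (norm (multi_deriv \<alpha> f x)) \<le> Ck_norm s X f"
proof -
  have nn: "0 \<le> (SUP x\<in>X. ereal (norm (multi_deriv \<beta> f x)))" for \<beta>
    using assms(2) by (intro SUP_upper2[OF assms(2)]) auto
  have "ereal (norm (multi_deriv \<alpha> f x)) \<le> (SUP x\<in>X. ereal (norm (multi_deriv \<alpha> f x)))"
    using assms(2) by (intro SUP_upper)
  also have "\<dots> \<le> Ck_norm s X f"
    unfolding Ck_norm_def sum.remove[OF finite_multi_indices assms(1)]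
    using nn by (intro add_increasing2 sum_nonneg) auto
  finally show ?thesis .
qed

lemma Ck_norm_nonneg: "X \<noteq> {} \<Longrightarrow> 0 \<le> Ck_norm s X f"
  using Ck_norm_ge[OF empty_in_multi_indices] ereal_less_eq(3)[of 0] norm_ge_zero order_trans
  by (metis ex_in_conv zero_ereal_def)

section \<open>Symmetry of mixed partial derivatives\<close>

lemma vector_differentiable_bound:
  fixes f :: "real \<Rightarrow> 'b::real_normed_vector"
  assumes "\<And>s. s \<in> {a..b} \<Longrightarrow> (f has_vector_derivative f' s) (at s within {a..b})"
    and "\<And>s. s \<in> {a..b} \<Longrightarrow> norm (f' s) \<le> B" and "a \<le> b"
  shows "norm (f b - f a) \<le> B * norm (b - a)"
proof (rule differentiable_bound[of "{a..b}" f "\<lambda>s h. h *\<^sub>R f' s"])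
  show "onorm (\<lambda>h. h *\<^sub>R f' s) \<le> B" if "s \<in> {a..b}" for s
    using assms(2)[OF that] by (intro onorm_le) (simp add: mult.commute[of B] mult_left_mono)
qed (use assms in \<open>auto simp: has_vector_derivative_def\<close>)

text \<open>The mean value inequality is used twice, in direction \<open>b\<close> for the
  derivative along \<open>c\<close> and then in direction \<open>c\<close>. The second difference is
  symmetric in \<open>b\<close> and \<open>c\<close>, so it can be compared with both mixed
  derivatives.\<close>

lemma second_difference_bound:
  fixes f :: "'a::euclidean_space \<Rightarrow> 'b::real_normed_vector"
  assumes f: "Ck_on 2 UNIV f" and b: "b \<in> Basis" and c: "c \<in> Basis" and e: "0 < e"
  shows "\<exists>d>0. \<forall>h. 0 < h \<and> h < d \<longrightarrow>
    norm (f (x + h *\<^sub>R b + h *\<^sub>R c) - f (x + h *\<^sub>R b) - f (x + h *\<^sub>R c) + f x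
      - (h * h) *\<^sub>R partial_deriv b (partial_deriv c f) x) \<le> e * (h * h)"
proof -
  define A where "A = partial_deriv b (partial_deriv c f) x"
  have f': "\<And>y. f differentiable (at y)" "\<And>y. partial_deriv c f differentiable (at y)"
    and cont: "continuous_on UNIV (partial_deriv b (partial_deriv c f))"
    using f b c by (auto simp: numeral_2_eq_2)
  have line: "((\<lambda>s. g (y + s *\<^sub>R v)) has_vector_derivative partial_deriv v g (y + s *\<^sub>R v)) (at s within T)"
    if "\<And>y. g differentiable (at y)" for g :: "'a \<Rightarrow> 'b" and y v s T
  proof -
    have g: "(g has_derivative frechet_derivative g (at (y + s *\<^sub>R v))) (at (y + s *\<^sub>R v))"
      using that frechet_derivative_works by blast
    have "((\<lambda>s. y + s *\<^sub>R v) has_derivative (\<lambda>h. h *\<^sub>R v)) (at s within T)"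
      by (auto intro!: derivative_eq_intros)
    from has_derivative_compose[OF this g]
    have "((\<lambda>s. g (y + s *\<^sub>R v)) has_derivative
        (\<lambda>h. frechet_derivative g (at (y + s *\<^sub>R v)) (h *\<^sub>R v))) (at s within T)" .
    then show ?thesis
      unfolding has_vector_derivative_def partial_deriv_def
      by (simp add: linear_scale[OF has_derivative_linear[OF g]])
  qed
  obtain d where d: "d > 0" "\<And>y. dist y x < d \<Longrightarrow> norm (partial_deriv b (partial_deriv c f) y - A) < e"
    using cont e unfolding continuous_on_iff A_def dist_norm by (metis UNIV_I dist_norm)
  have "norm (f (x + h *\<^sub>R b + h *\<^sub>R c) - f (x + h *\<^sub>R b) - f (x + h *\<^sub>R c) + f x - (h * h) *\<^sub>R A)
      \<le> e * (h * h)" if h: "0 < h" "h < d / 2" for h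
  proof -
    have inner: "norm (partial_deriv c f (x + k *\<^sub>R c + h *\<^sub>R b) - partial_deriv c f (x + k *\<^sub>R c) - h *\<^sub>R A) \<le> e * h"
      if k: "k \<in> {0..h}" for k
    proof -
      define \<phi> where "\<phi> s = partial_deriv c f (x + k *\<^sub>R c + s *\<^sub>R b) - s *\<^sub>R A" for s
      have "norm (\<phi> h - \<phi> 0) \<le> e * norm (h - 0)"
      proof (rule vector_differentiable_bound)
        fix s assume s: "s \<in> {0..h}"
        show "(\<phi> has_vector_derivative (partial_deriv b (partial_deriv c f) (x + k *\<^sub>R c + s *\<^sub>R b) - A))
            (at s within {0..h})"
          unfolding \<phi>_def
          by (intro has_vector_derivative_diff line f') (auto intro!: derivative_eq_intros)
        have "dist (x + k *\<^sub>R c + s *\<^sub>R b) x \<le> norm (k *\<^sub>R c) + norm (s *\<^sub>R b)"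
          using norm_triangle_ineq[of "k *\<^sub>R c" "s *\<^sub>R b"] by (simp add: dist_norm add.assoc)
        also have "\<dots> < d" using k s h b c by (simp add: norm_Basis)
        finally show "norm (partial_deriv b (partial_deriv c f) (x + k *\<^sub>R c + s *\<^sub>R b) - A) \<le> e"
          using d(2) less_imp_le by blast
      qed (use h in auto)
      then show ?thesis using h by (simp add: \<phi>_def algebra_simps)
    qed
    define \<psi> where "\<psi> k = f (x + h *\<^sub>R b + k *\<^sub>R c) - f (x + k *\<^sub>R c) - k *\<^sub>R (h *\<^sub>R A)" for k
    have "norm (\<psi> h - \<psi> 0) \<le> (e * h) * norm (h - 0)"
    proof (rule vector_differentiable_bound)
      fix k assume k: "k \<in> {0..h}"
      show "(\<psi> has_vector_derivative (partial_deriv c f (x + h *\<^sub>R b + k *\<^sub>R c)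
          - partial_deriv c f (x + k *\<^sub>R c) - h *\<^sub>R A)) (at k within {0..h})"
        unfolding \<psi>_def by (intro has_vector_derivative_diff line f') (auto intro!: derivative_eq_intros)
      show "norm (partial_deriv c f (x + h *\<^sub>R b + k *\<^sub>R c) - partial_deriv c f (x + k *\<^sub>R c) - h *\<^sub>R A) \<le> e * h"
        using inner[OF k] by (simp add: add_ac)
    qed (use h in auto)
    then show ?thesis using h by (simp add: \<psi>_def algebra_simps)
  qed
  then show ?thesis unfolding A_def[symmetric] using d(1) by (intro exI[of _ "d / 2"]) auto
qed

lemma partial_deriv_commute:
  fixes f :: "'a::euclidean_space \<Rightarrow> 'b::real_normed_vector"
  assumes f: "Ck_on 2 UNIV f" and b: "b \<in> Basis" and c: "c \<in> Basis"
  shows "partial_deriv b (partial_deriv c f) = partial_deriv c (partial_deriv b f)"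
proof
  fix x
  let ?A = "partial_deriv b (partial_deriv c f) x" and ?B = "partial_deriv c (partial_deriv b f) x"
  have "norm (?A - ?B) \<le> 0"
  proof (rule field_le_epsilon)
    fix e :: real assume e: "0 < e"
    obtain d1 d2 where d: "d1 > 0" "d2 > 0"
      and 1: "\<And>h. 0 < h \<and> h < d1 \<Longrightarrow> norm (f (x + h *\<^sub>R b + h *\<^sub>R c) - f (x + h *\<^sub>R b) - f (x + h *\<^sub>R c) + f x
        - (h * h) *\<^sub>R ?A) \<le> e / 2 * (h * h)"
      and 2: "\<And>h. 0 < h \<and> h < d2 \<Longrightarrow> norm (f (x + h *\<^sub>R c + h *\<^sub>R b) - f (x + h *\<^sub>R c) - f (x + h *\<^sub>R b) + f x
        - (h * h) *\<^sub>R ?B) \<le> e / 2 * (h * h)"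
      using second_difference_bound[OF f b c, of "e/2" x] second_difference_bound[OF f c b, of "e/2" x] e
      by (metis half_gt_zero)
    define h where "h = min d1 d2 / 2"
    have h: "0 < h" "h < d1" "h < d2" using d by (auto simp: h_def)
    have "(h * h) *\<^sub>R (?A - ?B) =
        (f (x + h *\<^sub>R c + h *\<^sub>R b) - f (x + h *\<^sub>R c) - f (x + h *\<^sub>R b) + f x - (h * h) *\<^sub>R ?B)
        - (f (x + h *\<^sub>R b + h *\<^sub>R c) - f (x + h *\<^sub>R b) - f (x + h *\<^sub>R c) + f x - (h * h) *\<^sub>R ?A)"
      by (simp add: algebra_simps)
    then have "norm ((h * h) *\<^sub>R (?A - ?B)) \<le> e / 2 * (h * h) + e / 2 * (h * h)"
      by (simp only:) (intro order_trans[OF norm_triangle_ineq4 add_mono[OF 2 1]], use h in auto)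
    then have "(h * h) * norm (?A - ?B) \<le> (h * h) * e"
      by (simp only: norm_scaleR) (simp add: field_simps)
    then show "norm (?A - ?B) \<le> 0 + e" using h by simp
  qed
  then show "?A = ?B" by simp
qed

lemma Ck_on_partials:
  "Ck_on k UNIV f \<Longrightarrow> set bs \<subseteq> Basis \<Longrightarrow> length bs + j \<le> k \<Longrightarrow> Ck_on j UNIV (partials bs f)"
  using Ckb_partials unfolding Ck_on_UNIV_iff by blast

lemma partials_move:
  assumes "Ck_on k UNIV f" "b \<in> Basis"
  shows "set bs \<subseteq> Basis \<Longrightarrow> length bs < k \<Longrightarrow>
    partials bs (partial_deriv b f) = partial_deriv b (partials bs f)"
proof (induction bs)
  case (Cons c bs)
  then have "Ck_on 2 UNIV (partials bs f)"
    using assms by (intro Ck_on_partials[OF assms(1)]) auto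
  then show ?case using Cons assms(2) partial_deriv_commute by auto
qed simp

text \<open>Adjacent derivatives commute, so the list picked by \<open>SOME\<close> in
  \<open>multi_deriv\<close> may be replaced by any list with the same entries.\<close>

lemma partials_permute:
  assumes "Ck_on k UNIV f"
  shows "mset bs = mset cs \<Longrightarrow> set bs \<subseteq> Basis \<Longrightarrow> length bs \<le> k \<Longrightarrow> partials bs f = partials cs f"
proof (induction bs arbitrary: cs)
  case (Cons b bs)
  then obtain ys zs where cs: "cs = ys @ b # zs"
    by (metis list.set_intros(1) mset_eq_setD split_list)
  with Cons.prems have m: "mset bs = mset (ys @ zs)" by simp
  have l: "length cs = Suc (length bs)" "set cs \<subseteq> Basis"
    using mset_eq_length[OF Cons.prems(1)] mset_eq_setD[OF Cons.prems(1)] Cons.prems(2) by auto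
  have "partials cs f = partials ys (partial_deriv b (partials zs f))" by (simp add: cs)
  also have "\<dots> = partial_deriv b (partials ys (partials zs f))"
    using l cs Cons.prems
    by (intro partials_move[of "Suc (length ys)"] Ck_on_partials[OF assms]) auto
  also have "\<dots> = partial_deriv b (partials bs f)"
    using Cons.IH[OF m] Cons.prems by simp
  finally show ?case by simp
qed simp

text \<open>Each ordered derivative equals one summand of the norm, and all summands are
  nonnegative. The norm in the theorem thus bounds every derivative with no loss in the
  constant.\<close>

lemma Ck_norm_imp_Ckb:
  fixes f :: "'a::euclidean_space \<Rightarrow> 'b::real_normed_vector"
  assumes f: "Ck_on s UNIV f" and M: "Ck_norm s UNIV f \<le> ereal M"
  shows "Ckb s (\<lambda>x. M) f"
  unfolding Ckb_iff_partials
proof (intro conjI allI impI f)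
  fix bs :: "'a list" and x
  assume bs: "set bs \<subseteq> Basis" "length bs \<le> s"
  then have m: "mset bs \<in> multi_indices s" by (auto simp: multi_indices_def)
  obtain cs where "mset cs = mset bs" "multi_deriv (mset bs) f = partials cs f"
    using multi_deriv_partials[OF m] by metis
  then have "multi_deriv (mset bs) f = partials bs f"
    using partials_permute[OF f _ bs, of cs] by simp
  then have "ereal (norm (partials bs f x)) \<le> ereal M"
    using order_trans[OF Ck_norm_ge[OF m, of x UNIV f] M] by simp
  then show "norm (partials bs f x) \<le> M" by simp
qed

section \<open>Differentiation under the integral sign\<close>

text \<open>Dominated convergence for a continuous parameter, by reduction to sequences. As the
  bound holds only near \<open>p\<close>, the first \<open>N\<close> members of each sequence are
  dropped.\<close>

lemma integral_tendsto_dominated: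
  fixes s :: "'a::metric_space \<Rightarrow> 'c \<Rightarrow> 'b::{banach, second_countable_topology}"
  assumes meas: "\<And>x. s x \<in> borel_measurable M" "f \<in> borel_measurable M" and g: "integrable M g"
    and bound: "eventually (\<lambda>x. \<forall>y. norm (s x y) \<le> g y) (at p)"
    and lim: "AE y in M. ((\<lambda>x. s x y) \<longlongrightarrow> f y) (at p)"
  shows "((\<lambda>x. integral\<^sup>L M (s x)) \<longlongrightarrow> integral\<^sup>L M f) (at p)"
  unfolding tendsto_at_iff_sequentially comp_def
proof (intro allI impI)
  fix X assume X: "\<forall>i. X i \<in> UNIV - {p}" "X \<longlonglongrightarrow> p"
  then have X': "filterlim X (at p) sequentially"
    by (auto simp: filterlim_at)
  from eventually_compose_filterlim[OF bound this] obtain N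
    where N: "\<And>n y. N \<le> n \<Longrightarrow> norm (s (X n) y) \<le> g y"
    by (auto simp: eventually_sequentially)
  show "(\<lambda>n. integral\<^sup>L M (s (X n))) \<longlonglongrightarrow> integral\<^sup>L M f"
  proof (rule LIMSEQ_offset[of _ N], rule integral_dominated_convergence)
    show "AE y in M. (\<lambda>n. s (X (n + N)) y) \<longlonglongrightarrow> f y"
      using lim
    proof eventually_elim
      case (elim y)
      from LIMSEQ_ignore_initial_segment[OF filterlim_compose[OF elim X'], of N] show ?case .
    qed
  qed (use meas g N in auto)
qed

text \<open>Dominated convergence for the remainder of the first order expansion, divided by the
  norm of the increment. Measurability of the derivatives is a conclusion, since they are limits of
  measurable difference quotients.\<close>

lemma has_derivative_integral:
  fixes f :: "'c \<Rightarrow> 'a::euclidean_space \<Rightarrow> 'b::{banach, second_countable_topology}"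
  assumes r: "r > 0" and diff: "\<And>y x. x \<in> ball p r \<Longrightarrow> f y differentiable (at x)"
    and bound: "\<And>y x. x \<in> ball p r \<Longrightarrow> norm (f y x) \<le> g y"
      "\<And>y x b. x \<in> ball p r \<Longrightarrow> b \<in> Basis \<Longrightarrow> norm (partial_deriv b (f y) x) \<le> g y"
    and g: "integrable M g" and meas: "\<And>x. (\<lambda>y. f y x) \<in> borel_measurable M"
  shows "\<And>b. b \<in> Basis \<Longrightarrow> (\<lambda>y. partial_deriv b (f y) p) \<in> borel_measurable M"
    and "((\<lambda>x. \<integral>y. f y x \<partial>M) has_derivative
      (\<lambda>h. \<Sum>b\<in>Basis. (h \<bullet> b) *\<^sub>R (\<integral>y. partial_deriv b (f y) p \<partial>M))) (at p)"
proof -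
  have p: "p \<in> ball p r" using r by simp
  show meas': "(\<lambda>y. partial_deriv b (f y) p) \<in> borel_measurable M" if b: "b \<in> Basis" for b
  proof (rule borel_measurable_LIMSEQ_metric)
    fix n
    show "(\<lambda>y. (f y (p + inverse (real (Suc n)) *\<^sub>R b) - f y p) /\<^sub>R inverse (real (Suc n))) \<in> borel_measurable M"
      using meas by measurable
  next
    fix y
    have D: "(f y has_derivative (\<lambda>h. \<Sum>b\<in>Basis. (h \<bullet> b) *\<^sub>R partial_deriv b (f y) p)) (at (p + 0 *\<^sub>R b))"
      using has_derivative_partial[OF diff[OF p]] by simp
    have "((\<lambda>s. p + s *\<^sub>R b) has_derivative (\<lambda>h. h *\<^sub>R b)) (at 0)"
      by (auto intro!: derivative_eq_intros)
    from has_derivative_compose[OF this D]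
    have "((\<lambda>s. f y (p + s *\<^sub>R b)) has_derivative
        (\<lambda>s. \<Sum>c\<in>Basis. ((s *\<^sub>R b) \<bullet> c) *\<^sub>R partial_deriv c (f y) p)) (at 0)" .
    moreover have "(\<Sum>c\<in>Basis. ((s *\<^sub>R b) \<bullet> c) *\<^sub>R partial_deriv c (f y) p) = s *\<^sub>R partial_deriv b (f y) p" for s
    proof -
      have "(\<Sum>c\<in>Basis. ((s *\<^sub>R b) \<bullet> c) *\<^sub>R partial_deriv c (f y) p)
          = (\<Sum>c\<in>Basis. if c = b then s *\<^sub>R partial_deriv b (f y) p else 0)"
        using b by (intro sum.cong) (auto simp: inner_Basis)
      then show ?thesis using b by simp
    qed
    ultimately have "((\<lambda>s. f y (p + s *\<^sub>R b)) has_vector_derivative partial_deriv b (f y) p) (at 0)"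
      by (simp add: has_vector_derivative_def)
    then have L: "((\<lambda>h. norm (f y (p + h *\<^sub>R b) - f y p - h *\<^sub>R partial_deriv b (f y) p) / norm h) \<longlongrightarrow> 0) (at 0)"
      by (auto simp: has_vector_derivative_def has_derivative_at)
    have "norm (f y (p + h *\<^sub>R b) - f y p - h *\<^sub>R partial_deriv b (f y) p) / norm h
        = norm ((f y (p + h *\<^sub>R b) - f y p) /\<^sub>R h - partial_deriv b (f y) p)" if "h \<noteq> 0" for h
    proof -
      have "f y (p + h *\<^sub>R b) - f y p - h *\<^sub>R partial_deriv b (f y) p
          = h *\<^sub>R ((f y (p + h *\<^sub>R b) - f y p) /\<^sub>R h - partial_deriv b (f y) p)"
        using that by (simp add: scaleR_diff_right)
      then show ?thesis using that by (simp only: norm_scaleR) simp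
    qed
    then have "((\<lambda>h. norm ((f y (p + h *\<^sub>R b) - f y p) /\<^sub>R h - partial_deriv b (f y) p)) \<longlongrightarrow> 0) (at 0)"
      by (intro Lim_transform_eventually[OF L]) (auto simp: eventually_at intro!: exI[of _ 1])
    then have "((\<lambda>h. (f y (p + h *\<^sub>R b) - f y p) /\<^sub>R h) \<longlongrightarrow> partial_deriv b (f y) p) (at 0)"
      using LIM_zero_cancel tendsto_norm_zero_iff by blast
    then show "(\<lambda>n. (f y (p + inverse (real (Suc n)) *\<^sub>R b) - f y p) /\<^sub>R inverse (real (Suc n)))
        \<longlonglongrightarrow> partial_deriv b (f y) p"
      by (rule filterlim_compose[of _ _ "at 0" "\<lambda>n. inverse (real (Suc n))"])
        (use LIMSEQ_inverse_real_of_nat in \<open>auto simp: filterlim_at simp del: of_nat_Suc\<close>)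
  qed
  let ?D = "\<lambda>y h. \<Sum>b\<in>Basis. (h \<bullet> b) *\<^sub>R partial_deriv b (f y) p"
  have int: "integrable M (\<lambda>y. f y x)" if "x \<in> ball p r" for x
    using bound(1)[OF that] order_trans[OF _ abs_ge_self]
    by (intro Bochner_Integration.integrable_bound[OF g meas]) auto
  have int': "integrable M (\<lambda>y. partial_deriv b (f y) p)" if "b \<in> Basis" for b
    using bound(2)[OF p that] order_trans[OF _ abs_ge_self]
    by (intro Bochner_Integration.integrable_bound[OF g meas'[OF that]]) auto
  have intD: "integrable M (\<lambda>y. ?D y h)" for h using int' by auto
  have eqD: "(\<integral>y. ?D y h \<partial>M) = (\<Sum>b\<in>Basis. (h \<bullet> b) *\<^sub>R (\<integral>y. partial_deriv b (f y) p \<partial>M))" for h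
    using int' by (subst Bochner_Integration.integral_sum) auto
  have Dle: "norm (\<Sum>b\<in>Basis. (h \<bullet> b) *\<^sub>R partial_deriv b (f y) x) \<le> (real DIM('a) * g y) * norm h"
    if "x \<in> ball p r" for x y h
  proof -
    have "norm (\<Sum>b\<in>Basis. (h \<bullet> b) *\<^sub>R partial_deriv b (f y) x) \<le> (\<Sum>b\<in>(Basis :: 'a set). norm h * g y)"
    proof (rule sum_norm_le)
      fix b :: 'a assume b: "b \<in> Basis"
      show "norm ((h \<bullet> b) *\<^sub>R partial_deriv b (f y) x) \<le> norm h * g y"
        using bound(2)[OF that b] Basis_le_norm[OF b, of h] by (auto intro!: mult_mono)
    qed
    then show ?thesis by (simp add: mult_ac)
  qed
  let ?q = "\<lambda>h y. (f y (p + h) - f y p - ?D y h) /\<^sub>R norm h"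
  have "((\<lambda>h. \<integral>y. ?q h y \<partial>M) \<longlongrightarrow> (\<integral>y. 0 \<partial>M)) (at 0)"
  proof (rule integral_tendsto_dominated)
    \<comment> \<open>Both the increment of \<open>f y\<close> and its linear part are at most
      \<open>DIM('a) * g y\<close> times the norm of \<open>h\<close>, the former by the mean value
      inequality.\<close>
    show "integrable M (\<lambda>y. 2 * (real DIM('a) * g y))" using g by auto
    show "(\<lambda>y. ?q h y) \<in> borel_measurable M" for h
      using meas borel_measurable_integrable[OF intD] by measurable
    show "AE y in M. ((\<lambda>h. ?q h y) \<longlongrightarrow> 0) (at 0)"
    proof (rule AE_I2)
      fix y
      have "(f y has_derivative ?D y) (at p)" by (rule has_derivative_partial[OF diff[OF p]])
      then have "((\<lambda>h. norm (f y (p + h) - f y p - ?D y h) / norm h) \<longlongrightarrow> 0) (at 0)"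
        unfolding has_derivative_at by blast
      then have "((\<lambda>h. norm (?q h y)) \<longlongrightarrow> 0) (at 0)"
        by (simp add: divide_inverse mult.commute)
      then show "((\<lambda>h. ?q h y) \<longlongrightarrow> 0) (at 0)"
        by (rule tendsto_norm_zero_cancel)
    qed
    have "norm (?q h y) \<le> 2 * (real DIM('a) * g y)" if h: "h \<noteq> 0" "norm h < r" for h y
    proof -
      have "norm (f y (p + h) - f y p) \<le> (real DIM('a) * g y) * norm (p + h - p)"
      proof (rule differentiable_bound[of "ball p r" "f y" "\<lambda>x h. \<Sum>b\<in>Basis. (h \<bullet> b) *\<^sub>R partial_deriv b (f y) x"])
        fix x assume x: "x \<in> ball p r"
        show "(f y has_derivative (\<lambda>h. \<Sum>b\<in>Basis. (h \<bullet> b) *\<^sub>R partial_deriv b (f y) x)) (at x within ball p r)"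
          using has_derivative_at_withinI[OF has_derivative_partial[OF diff[OF x]]] .
        show "onorm (\<lambda>h. \<Sum>b\<in>Basis. (h \<bullet> b) *\<^sub>R partial_deriv b (f y) x) \<le> real DIM('a) * g y"
          using Dle[OF x] by (intro onorm_le) auto
      qed (use h r in \<open>auto simp: dist_norm\<close>)
      then have "norm (f y (p + h) - f y p - ?D y h) \<le> (real DIM('a) * g y) * norm h + (real DIM('a) * g y) * norm h"
        using Dle[OF p, of h y] norm_triangle_ineq4[of "f y (p + h) - f y p" "?D y h"]
        by (linarith | simp add: mult_ac)
      then have "norm (f y (p + h) - f y p - ?D y h) / norm h \<le> 2 * (real DIM('a) * g y)"
        using h by (subst pos_divide_le_eq) (auto simp: mult_ac)
      then show ?thesis by (simp add: divide_inverse mult.commute)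
    qed
    then show "\<forall>\<^sub>F h in at 0. \<forall>y. norm (?q h y) \<le> 2 * (real DIM('a) * g y)"
      unfolding eventually_at by (intro exI[of _ r]) (use r in \<open>auto simp: dist_norm\<close>)
  qed auto
  then have lim: "((\<lambda>h. norm (\<integral>y. ?q h y \<partial>M)) \<longlongrightarrow> 0) (at 0)" using tendsto_norm_zero by force
  have eq: "norm (\<integral>y. ?q h y \<partial>M) = norm ((\<integral>y. f y (p + h) \<partial>M) - (\<integral>y. f y p \<partial>M) - (\<integral>y. ?D y h \<partial>M)) / norm h"
    if "h \<noteq> 0" "norm h < r" for h
  proof -
    have "(\<integral>y. ?q h y \<partial>M) = ((\<integral>y. f y (p + h) \<partial>M) - (\<integral>y. f y p \<partial>M) - (\<integral>y. ?D y h \<partial>M)) /\<^sub>R norm h"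
      using int[of "p + h"] int[OF p] intD[of h] that by (simp add: dist_norm)
    then show ?thesis by (simp only: norm_scaleR) (simp add: divide_inverse mult.commute)
  qed
  have "((\<lambda>h. norm ((\<integral>y. f y (p + h) \<partial>M) - (\<integral>y. f y p \<partial>M) - (\<integral>y. ?D y h \<partial>M)) / norm h) \<longlongrightarrow> 0) (at 0)"
  proof (rule Lim_transform_eventually[OF lim])
    show "\<forall>\<^sub>F h in at 0. norm (\<integral>y. ?q h y \<partial>M)
        = norm ((\<integral>y. f y (p + h) \<partial>M) - (\<integral>y. f y p \<partial>M) - (\<integral>y. ?D y h \<partial>M)) / norm h"
      unfolding eventually_at by (intro exI[of _ r]) (use r eq in \<open>auto simp: dist_norm\<close>)
  qed
  then show "((\<lambda>x. \<integral>y. f y x \<partial>M) has_derivative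
      (\<lambda>h. \<Sum>b\<in>Basis. (h \<bullet> b) *\<^sub>R (\<integral>y. partial_deriv b (f y) p \<partial>M))) (at p)"
    unfolding has_derivative_at eqD
    by (auto intro!: bounded_linear_sum bounded_linear_scaleR_const bounded_linear_inner_left)
qed

text \<open>The local majorants in \<open>loc\<close> only justify differentiation; the size of the
  result comes from integrating the weights. The measure is arbitrary, so that potentials, means
  over rays, mollifications and, with the counting measure, series are all covered.\<close>

lemma Ckb_integral:
  fixes f :: "'c \<Rightarrow> 'a::euclidean_space \<Rightarrow> 'b::{banach, second_countable_topology}"
  assumes f: "\<And>y. Ckb k (w y) (f y)"
    and meas: "\<And>x. (\<lambda>y. f y x) \<in> borel_measurable M"
    and loc: "\<And>p. \<exists>r>0. \<exists>g. integrable M g \<and> (\<forall>y. \<forall>x\<in>ball p r. w y x \<le> g y)"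
    and W: "\<And>x. (\<integral>\<^sup>+ y. ennreal (w y x) \<partial>M) \<le> ennreal (W x)" "\<And>x. 0 \<le> W x"
  shows "Ckb k W (\<lambda>x. \<integral>y. f y x \<partial>M)"
    and "0 < k \<Longrightarrow> b \<in> Basis \<Longrightarrow>
      partial_deriv b (\<lambda>x. \<integral>y. f y x \<partial>M) = (\<lambda>x. \<integral>y. partial_deriv b (f y) x \<partial>M)"
proof -
  have bound: "norm (\<integral>y. f y x \<partial>M) \<le> W x"
    if f: "\<And>y. Ckb k (w y) (f y)" and meas: "\<And>x. (\<lambda>y. f y x) \<in> borel_measurable M"
    for k x and f :: "'c \<Rightarrow> 'a \<Rightarrow> 'b"
  proof -
    obtain r g where r: "r > 0" "integrable M g" "\<forall>y. \<forall>x'\<in>ball x r. w y x' \<le> g y"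
      using loc[of x] by blast
    then have "norm (f y x) \<le> norm (g y)" for y
      using Ckb_bound[OF f, of y x] by (auto intro: order_trans dest!: spec[of _ y] bspec[of _ _ x])
    then have "integrable M (\<lambda>y. f y x)"
      by (intro Bochner_Integration.integrable_bound[OF r(2) meas]) auto
    then have "ennreal (norm (\<integral>y. f y x \<partial>M)) \<le> (\<integral>\<^sup>+ y. ennreal (norm (f y x)) \<partial>M)"
      by (rule integral_norm_bound_ennreal)
    also have "\<dots> \<le> (\<integral>\<^sup>+ y. ennreal (w y x) \<partial>M)"
      using Ckb_bound[OF f] by (intro nn_integral_mono ennreal_leI)
    also have "\<dots> \<le> ennreal (W x)" by (rule W)
    finally show ?thesis using W(2) by simp
  qed
  have der: "(\<forall>x. (\<lambda>y. partial_deriv b (f y) x) \<in> borel_measurable M) \<and>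
      (\<lambda>x. \<integral>y. f y x \<partial>M) differentiable (at p) \<and>
      partial_deriv b (\<lambda>x. \<integral>y. f y x \<partial>M) p = (\<integral>y. partial_deriv b (f y) p \<partial>M)"
    if f: "\<And>y. Ckb (Suc k) (w y) (f y)" and meas: "\<And>x. (\<lambda>y. f y x) \<in> borel_measurable M"
      and b: "b \<in> Basis" for k b p and f :: "'c \<Rightarrow> 'a \<Rightarrow> 'b"
  proof -
    have *: "(\<lambda>y. partial_deriv b (f y) p) \<in> borel_measurable M \<and>
      ((\<lambda>x. \<integral>y. f y x \<partial>M) has_derivative
      (\<lambda>h. \<Sum>b\<in>Basis. (h \<bullet> b) *\<^sub>R (\<integral>y. partial_deriv b (f y) p \<partial>M))) (at p)" for p
    proof -
      obtain r g where r: "r > 0" "integrable M g" "\<And>y x. x\<in>ball p r \<Longrightarrow> w y x \<le> g y"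
        using loc[of p] by blast
      have 1: "f y differentiable (at x)" for y x using f by auto
      have 2: "norm (f y x) \<le> g y" if "x \<in> ball p r" for y x
        using Ckb_bound[OF f] r(3)[OF that] order_trans by blast
      have "norm (partial_deriv c (f y) x) \<le> w y x" if "c \<in> Basis" for y x c
        using f[of y] that by (intro Ckb_bound[of k]) auto
      then have 3: "norm (partial_deriv c (f y) x) \<le> g y" if "x \<in> ball p r" "c \<in> Basis" for y x c
        using r(3)[OF that(1)] that(2) order_trans by blast
      show ?thesis
        using has_derivative_integral[of r p f g M] 1 2 3 r meas b by blast
    qed
    have "(\<Sum>c\<in>Basis. (b \<bullet> c) *\<^sub>R (\<integral>y. partial_deriv c (f y) p \<partial>M)) = (\<integral>y. partial_deriv b (f y) p \<partial>M)"
    proof -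
      have "(\<Sum>c\<in>Basis. (b \<bullet> c) *\<^sub>R (\<integral>y. partial_deriv c (f y) p \<partial>M))
          = (\<Sum>c\<in>Basis. if c = b then (\<integral>y. partial_deriv b (f y) p \<partial>M) else 0)"
        using b by (intro sum.cong) (auto simp: inner_Basis)
      then show ?thesis using b by simp
    qed
    with partial_deriv_eq[OF conjunct2[OF *], of b p] * show ?thesis
      unfolding differentiable_def by auto
  qed
  show "0 < k \<Longrightarrow> b \<in> Basis \<Longrightarrow>
      partial_deriv b (\<lambda>x. \<integral>y. f y x \<partial>M) = (\<lambda>x. \<integral>y. partial_deriv b (f y) x \<partial>M)"
    using der[of "k - 1" f b] f meas by (auto simp del: Ckb.simps)
  show "Ckb k W (\<lambda>x. \<integral>y. f y x \<partial>M)"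
    using f meas
  proof (induction k arbitrary: f)
    case 0
    have "continuous (at p) (\<lambda>x. \<integral>y. f y x \<partial>M)" for p
    proof -
      obtain r g where r: "r > 0" "integrable M g" "\<And>y x. x\<in>ball p r \<Longrightarrow> w y x \<le> g y"
        using loc[of p] by blast
      have le: "norm (f y x) \<le> g y" if "x \<in> ball p r" for x y
        using Ckb_bound[OF 0(1), of y x] r(3)[OF that, of y] by linarith
      show ?thesis
        unfolding continuous_at
      proof (rule integral_tendsto_dominated[OF _ _ r(2)])
      show "\<forall>\<^sub>F x in at p. \<forall>y. norm (f y x) \<le> g y"
        unfolding eventually_at using r(1) le
        by (intro exI[of _ r]) (auto simp: dist_commute)
      show "AE y in M. ((\<lambda>x. f y x) \<longlongrightarrow> f y p) (at p)"
        using 0(1) by (auto simp: continuous_on_eq_continuous_at continuous_at)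
      qed (use 0 in auto)
    qed
    then show ?case
      using bound[OF 0] by (auto intro!: continuous_at_imp_continuous_on)
  next
    case (Suc k)
    have "Ckb k W (partial_deriv b (\<lambda>x. \<integral>y. f y x \<partial>M))" if b: "b \<in> Basis" for b
    proof -
      have "Ckb k W (\<lambda>x. \<integral>y. partial_deriv b (f y) x \<partial>M)"
        using Suc.prems der[OF Suc.prems b] b by (intro Suc.IH) auto
      moreover have "partial_deriv b (\<lambda>x. \<integral>y. f y x \<partial>M) = (\<lambda>x. \<integral>y. partial_deriv b (f y) x \<partial>M)"
        using der[OF Suc.prems b] by blast
      ultimately show ?thesis by simp
    qed
    moreover have "(\<lambda>x. \<integral>y. f y x \<partial>M) differentiable (at x)" for x
      using der[OF Suc.prems SOME_Basis] by blast
    ultimately show ?case using bound[OF Suc.prems] by auto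
  qed
qed

section \<open>Integrals on Euclidean space\<close>

lemma compact_fsupp_iff:
  fixes f :: "'a::euclidean_space \<Rightarrow> 'b::zero"
  shows "compact (fsupp f) \<longleftrightarrow> (\<exists>R. \<forall>x. R < norm x \<longrightarrow> f x = 0)"
proof
  assume "compact (fsupp f)"
  then obtain R where "\<And>x. x \<in> fsupp f \<Longrightarrow> norm x \<le> R"
    using compact_imp_bounded[of "fsupp f"] by (auto simp: bounded_iff)
  then show "\<exists>R. \<forall>x. R < norm x \<longrightarrow> f x = 0"
    using closure_subset[of "{x. f x \<noteq> 0}"] unfolding fsupp_def by (metis (mono_tags) linorder_not_le mem_Collect_eq subsetD)
next
  assume "\<exists>R. \<forall>x. R < norm x \<longrightarrow> f x = 0"
  then obtain R where R: "\<And>x. f x \<noteq> 0 \<Longrightarrow> norm x \<le> R" by (metis linorder_not_le)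
  then have "fsupp f \<subseteq> cball 0 R"
    unfolding fsupp_def by (intro closure_minimal) (auto simp: dist_norm)
  then show "compact (fsupp f)"
    unfolding fsupp_def by (meson bounded_cball bounded_subset closed_closure compact_eq_bounded_closed)
qed

lemma fsupp_zero: "x \<notin> fsupp f \<Longrightarrow> f x = 0"
  using closure_subset[of "{x. f x \<noteq> 0}"] by (auto simp: fsupp_def)

lemma fsupp_subset_iff: "closed S \<Longrightarrow> fsupp f \<subseteq> S \<longleftrightarrow> (\<forall>x. x \<notin> S \<longrightarrow> f x = 0)"
  unfolding fsupp_def using closure_subset[of "{x. f x \<noteq> 0}"]
  by (metis (mono_tags, lifting) closure_minimal mem_Collect_eq subset_iff)

lemma partial_deriv_zero_outside_fsupp: "x \<notin> fsupp f \<Longrightarrow> partial_deriv b f x = 0"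
  by (subst partial_deriv_cong_open[of "- fsupp f" x f "\<lambda>_. 0" b])
    (simp_all add: fsupp_zero, simp add: fsupp_def open_Compl)

lemma fsupp_partial_deriv: "fsupp (partial_deriv b f) \<subseteq> fsupp f"
  using partial_deriv_zero_outside_fsupp[of _ f b]
  by (subst fsupp_subset_iff) (auto simp: fsupp_def)

lemma integrable_continuous_compact:
  fixes f :: "'a::euclidean_space \<Rightarrow> 'b::{banach, second_countable_topology}"
  assumes "continuous_on UNIV f" "compact (fsupp f)"
  shows "integrable lborel f"
proof -
  have "integrable lborel (\<lambda>x. indicator (fsupp f) x *\<^sub>R f x)"
    using assms by (intro borel_integrable_compact) (auto intro: continuous_on_subset)
  moreover have "(\<lambda>x. indicator (fsupp f) x *\<^sub>R f x) = f"
    using fsupp_zero[of _ f] by (auto simp: indicator_def)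
  ultimately show ?thesis by simp
qed

lemma bounded_continuous_compact:
  fixes f :: "'a::euclidean_space \<Rightarrow> 'b::real_normed_vector"
  assumes "continuous_on UNIV f" "compact (fsupp f)"
  shows "\<exists>B\<ge>0. \<forall>x. norm (f x) \<le> B"
proof -
  have "compact (f ` fsupp f)"
    using assms by (intro compact_continuous_image) (auto intro: continuous_on_subset)
  then obtain B where B: "\<And>x. x \<in> fsupp f \<Longrightarrow> norm (f x) \<le> B"
    using compact_imp_bounded[of "f ` fsupp f"] by (auto simp: bounded_iff)
  have "norm (f x) \<le> max B 0" for x
    using B[of x] fsupp_zero[of x f] by (cases "x \<in> fsupp f") auto
  then show ?thesis by (intro exI[of _ "max B 0"]) auto
qed

text \<open>Measurability is not assumed: a translate of a nonmeasurable function is nonmeasurable,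
  and then both integrals are 0 by convention.\<close>

lemma integral_lborel_translate:
  fixes f :: "'a::euclidean_space \<Rightarrow> 'b::{banach, second_countable_topology}"
  shows "(\<integral>x. f (x + v) \<partial>lborel) = (\<integral>x. f x \<partial>lborel)"
    and "integrable lborel (\<lambda>x. f (x + v)) \<longleftrightarrow> integrable lborel f"
proof -
  have *: "distr lborel borel (\<lambda>x. x + v) = (lborel :: 'a measure)" for v
  proof -
    have "(\<lambda>x. x + v) = (+) v" by (auto simp: add.commute)
    then show ?thesis using lborel_distr_plus[of v] by simp
  qed
  show "(\<integral>x. f (x + v) \<partial>lborel) = (\<integral>x. f x \<partial>lborel)"
  proof (cases "f \<in> borel_measurable borel")
    case True
    then show ?thesis by (subst (2) *[of v, symmetric], subst integral_distr) auto
  next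
    case False
    have "(\<lambda>x. f (x + v)) \<notin> borel_measurable borel"
    proof
      assume "(\<lambda>x. f (x + v)) \<in> borel_measurable borel"
      then have "(\<lambda>x. f (x + v)) \<circ> (\<lambda>x. x - v) \<in> borel_measurable borel"
        by (intro measurable_comp[of _ _ borel]) auto
      with False show False by (simp add: comp_def)
    qed
    with False have "\<not> integrable lborel f" "\<not> integrable lborel (\<lambda>x. f (x + v))"
      using borel_measurable_integrable by fastforce+
    then show ?thesis by (simp add: not_integrable_integral_eq)
  qed
  show "integrable lborel (\<lambda>x. f (x + v)) \<longleftrightarrow> integrable lborel f"
  proof
    assume "integrable lborel f"
    then show "integrable lborel (\<lambda>x. f (x + v))"
      using integrable_distr[of "\<lambda>x. x + v" lborel borel f] *[of v] by simp
  next
    assume "integrable lborel (\<lambda>x. f (x + v))"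
    moreover have "distr lborel borel (\<lambda>x. x - v) = (lborel :: 'a measure)"
      using *[of "- v"] by simp
    ultimately show "integrable lborel f"
      using integrable_distr[of "\<lambda>x. x - v" lborel borel "\<lambda>x. f (x + v)"] by simp
  qed
qed

lemma integral_lborel_minus:
  fixes f :: "'a::euclidean_space \<Rightarrow> 'b::{banach, second_countable_topology}"
  assumes "f \<in> borel_measurable borel"
  shows "(\<integral>x. f (- x) \<partial>lborel) = (\<integral>x. f x \<partial>lborel)"
proof -
  have "(lborel :: 'a measure) = distr lborel borel uminus"
    using lborel_affine[of "-1 :: real" "0 :: 'a"] by (simp add: density_1)
  then have "(\<integral>x. f x \<partial>lborel) = (\<integral>x. f x \<partial>distr lborel borel uminus)" by simp
  then show ?thesis using assms by (simp add: integral_distr)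
qed

text \<open>Every difference quotient has integral 0 by translation invariance, and the quotients
  converge dominatedly to the derivative. No iterated integral is involved.\<close>

lemma integral_partial_deriv_zero:
  fixes g :: "'a::euclidean_space \<Rightarrow> 'b::{banach, second_countable_topology}"
  assumes g: "Ck_on 1 UNIV g" "compact (fsupp g)" and b: "b \<in> Basis"
  shows "(\<integral>x. partial_deriv b g x \<partial>lborel) = 0"
proof -
  have dg: "\<And>x. g differentiable (at x)" and cb: "\<And>c. c \<in> Basis \<Longrightarrow> continuous_on UNIV (partial_deriv c g)"
    using g(1) by (auto simp: One_nat_def)
  have supp: "compact (fsupp (partial_deriv c g))" for c
    using g(2) fsupp_partial_deriv[of c g]
    by (metis closed_closure compact_Int_closed fsupp_def inf.absorb2)
  obtain B where B: "B \<ge> 0" "\<And>x. norm (partial_deriv b g x) \<le> B"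
    using bounded_continuous_compact[OF cb[OF b] supp] by blast
  obtain R where R: "\<And>x. R < norm x \<Longrightarrow> g x = 0"
    using g(2) unfolding compact_fsupp_iff by blast
  have contg: "continuous_on UNIV g" using Ck_on_imp_continuous_on[OF g(1)] .
  have int: "integrable lborel g" by (rule integrable_continuous_compact[OF contg g(2)])
  have line: "((\<lambda>s. g (y + s *\<^sub>R b)) has_vector_derivative partial_deriv b g (y + s *\<^sub>R b)) (at s within T)" for y s T
  proof -
    have g: "(g has_derivative frechet_derivative g (at (y + s *\<^sub>R b))) (at (y + s *\<^sub>R b))"
      using dg frechet_derivative_works by blast
    have "((\<lambda>s. y + s *\<^sub>R b) has_derivative (\<lambda>h. h *\<^sub>R b)) (at s within T)"
      by (auto intro!: derivative_eq_intros)
    from has_derivative_compose[OF this g] show ?thesis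
      unfolding has_vector_derivative_def partial_deriv_def
      by (simp add: linear_scale[OF has_derivative_linear[OF g]])
  qed
  define h where "h n = inverse (real (Suc n))" for n
  have h: "0 < h n" "h n \<le> 1" for n by (auto simp: h_def inverse_le_1_iff)
  have h00: "h n \<noteq> 0" for n using h(1)[of n] by simp
  have h0: "h \<longlonglongrightarrow> 0"
    using LIMSEQ_inverse_real_of_nat unfolding h_def[abs_def] .
  define s where "s n x = (g (x + h n *\<^sub>R b) - g x) /\<^sub>R h n" for n x
  have "(\<lambda>n. \<integral>x. s n x \<partial>lborel) \<longlonglongrightarrow> (\<integral>x. partial_deriv b g x \<partial>lborel)"
  proof (rule integral_dominated_convergence)
    \<comment> \<open>The steps \<open>h n\<close> are at most 1, so all difference quotients vanish
      outside the ball of radius \<open>R + 1\<close>.\<close>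
    show "integrable lborel (\<lambda>x. indicator (cball 0 (R + 1)) x *\<^sub>R B)"
      by (intro borel_integrable_compact) auto
    show "AE x in lborel. (\<lambda>n. s n x) \<longlonglongrightarrow> partial_deriv b g x"
    proof (rule AE_I2)
      fix x
      have "((\<lambda>k. norm (g (x + k *\<^sub>R b) - g x - k *\<^sub>R partial_deriv b g x) / norm k) \<longlongrightarrow> 0) (at 0)"
        using line[of x 0 UNIV] by (simp add: has_vector_derivative_def has_derivative_at)
      then have "(\<lambda>n. norm (g (x + h n *\<^sub>R b) - g x - h n *\<^sub>R partial_deriv b g x) / norm (h n)) \<longlonglongrightarrow> 0"
        by (rule filterlim_compose[of _ _ "at 0" h])
          (use h0 h00 in \<open>auto simp: filterlim_at\<close>)
      moreover have "norm (g (x + h n *\<^sub>R b) - g x - h n *\<^sub>R partial_deriv b g x) / norm (h n)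
          = norm (s n x - partial_deriv b g x)" for n
      proof -
        have "g (x + h n *\<^sub>R b) - g x - h n *\<^sub>R partial_deriv b g x = h n *\<^sub>R (s n x - partial_deriv b g x)"
          using h[of n] by (simp add: s_def scaleR_diff_right)
        then show ?thesis using h[of n] by (simp only: norm_scaleR) simp
      qed
      ultimately show "(\<lambda>n. s n x) \<longlonglongrightarrow> partial_deriv b g x"
        using LIM_zero_cancel tendsto_norm_zero_iff by fastforce
    qed
    show "AE x in lborel. norm (s n x) \<le> indicator (cball 0 (R + 1)) x *\<^sub>R B" for n
    proof (rule AE_I2)
      fix x
      show "norm (s n x) \<le> indicator (cball 0 (R + 1)) x *\<^sub>R B"
      proof (cases "norm x \<le> R + 1")
        case True
        have "norm (g (x + h n *\<^sub>R b) - g (x + 0 *\<^sub>R b)) \<le> B * norm (h n - 0)"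
          using line B h(1)[of n] by (intro vector_differentiable_bound) auto
        moreover have "norm (s n x) = norm (g (x + h n *\<^sub>R b) - g x) / h n"
          using h[of n] by (simp add: s_def divide_inverse mult.commute)
        ultimately show ?thesis using True h[of n] by (simp add: pos_divide_le_eq)
      next
        case False
        have "norm (h n *\<^sub>R b) \<le> 1" using h[of n] b by simp
        then have "norm (x + h n *\<^sub>R b) > R"
          using False norm_diff_ineq[of x "h n *\<^sub>R b"] by linarith
        then show ?thesis using False R by (simp add: s_def)
      qed
    qed
    show "s n \<in> borel_measurable lborel" for n
      unfolding s_def using borel_measurable_continuous_onI[OF contg] by measurable
    show "partial_deriv b g \<in> borel_measurable lborel"
      using borel_measurable_continuous_onI[OF cb[OF b]] by simp
  qed
  moreover have "(\<integral>x. s n x \<partial>lborel) = 0" for n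
    using int unfolding s_def by (simp add: integral_lborel_translate)
  ultimately have "(\<lambda>n. 0) \<longlonglongrightarrow> (\<integral>x. partial_deriv b g x \<partial>lborel)" by simp
  from LIMSEQ_unique[OF this tendsto_const] show ?thesis .
qed

section \<open>Integration of radial functions\<close>

text \<open>Polar coordinates for radial functions. The half lines generate the Borel sets, and on
  \<open>{..r}\<close> both measures give the volume \<open>4/3 pi r^3\<close> of a ball.\<close>

lemma distr_norm_lborel:
  "distr (lborel :: (real^3) measure) borel norm
    = density lborel (\<lambda>s. ennreal (4 * pi * s\<^sup>2) * indicator {0..} s)"
proof (rule measure_eqI_generator_eq[where E="range (\<lambda>r::real. {..r})" and \<Omega>=UNIV and A="\<lambda>i. {..real i}"])
  show "Int_stable (range (\<lambda>r::real. {..r}))" by (auto simp: Int_stable_def)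
  have *: "emeasure (distr (lborel :: (real^3) measure) borel norm) {..r} = ennreal (4 / 3 * pi * max 0 r ^ 3)" for r
  proof (cases "r \<ge> 0")
    case True
    have "norm -` {..r} = cball (0 :: real^3) r" by (auto simp: dist_norm)
    then show ?thesis using True emeasure_cball[OF True, of "0 :: real^3"]
      by (simp add: emeasure_distr unit_ball_vol_3 ennreal_mult'')
  next
    case False
    then have "norm -` {..r} = ({} :: (real^3) set)" by (auto simp: not_le dest: le_less_trans)
    then show ?thesis using False by (simp add: emeasure_distr)
  qed
  have **: "emeasure (density lborel (\<lambda>s. ennreal (4 * pi * s\<^sup>2) * indicator {0..} s)) {..r}
      = ennreal (4 / 3 * pi * max 0 r ^ 3)" for r :: real
  proof -
    have "emeasure (density lborel (\<lambda>s. ennreal (4 * pi * s\<^sup>2) * indicator {0..} s)) {..r}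
        = (\<integral>\<^sup>+ s. ennreal (4 * pi * s\<^sup>2) * indicator {0..max 0 r} s \<partial>lborel)"
    proof (subst emeasure_density, simp, simp, rule nn_integral_cong_AE)
      have "AE s in lborel. s \<noteq> (0::real)" by (rule AE_lborel_singleton)
      then show "AE s in lborel. ennreal (4 * pi * s\<^sup>2) * indicator {0..} s * indicator {..r} s
          = ennreal (4 * pi * s\<^sup>2) * indicator {0..max 0 r} s"
        by eventually_elim (auto simp: indicator_def max_def)
    qed
    also have "\<dots> = ennreal (4 / 3 * pi * max 0 r ^ 3 - 4 / 3 * pi * 0 ^ 3)"
      by (rule nn_integral_FTC_Icc)
        (auto intro!: derivative_eq_intros simp: has_real_derivative_iff_has_vector_derivative[symmetric])
    finally show ?thesis by simp
  qed
  show "emeasure (distr (lborel :: (real^3) measure) borel norm) X = emeasure (density lborel (\<lambda>s. ennreal (4 * pi * s\<^sup>2) * indicator {0..} s)) X"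
    if "X \<in> range (\<lambda>r::real. {..r})" for X using that * ** by auto
  show "emeasure (distr (lborel :: (real^3) measure) borel norm) {..real i} \<noteq> \<infinity>" for i
    unfolding * by simp
  show "(\<Union>i. {..real i}) = UNIV" using real_arch_simple by auto
qed (auto simp: borel_eq_atMost intro!: sets_measure_of[THEN trans])

lemma nn_integral_radial:
  assumes "g \<in> borel_measurable borel"
  shows "nn_integral lborel (\<lambda>y::real^3. g (norm y)) = (\<integral>\<^sup>+ s. ennreal (4 * pi * s\<^sup>2) * indicator {0..} s * g s \<partial>lborel)"
proof -
  have "nn_integral lborel (\<lambda>y::real^3. g (norm y)) = (\<integral>\<^sup>+ s. g s \<partial>distr (lborel :: (real^3) measure) borel norm)"
    using assms by (subst nn_integral_distr) auto
  then show ?thesis unfolding distr_norm_lborel using assms by (simp add: nn_integral_density)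
qed

text \<open>The function \<open>f\<close> may be singular at 0, where only the product with
  \<open>s^2\<close> extends. Therefore \<open>F'\<close> is given separately and tied to
  \<open>f\<close> for positive \<open>s\<close> only.\<close>

lemma nn_integral_radial_FTC:
  fixes f :: "real \<Rightarrow> real"
  assumes f: "f \<in> borel_measurable borel" "\<And>s. 0 < s \<Longrightarrow> 0 \<le> f s"
    and F: "\<And>s. 0 \<le> s \<Longrightarrow> (F has_real_derivative F' s) (at s)" "\<And>s. 0 < s \<Longrightarrow> F' s = 4 * pi * s\<^sup>2 * f s"
    and F': "F' \<in> borel_measurable borel" "0 \<le> F' 0"
    and lim: "(F \<longlongrightarrow> T) at_top"
  shows "nn_integral lborel (\<lambda>y::real^3. ennreal (f (norm y))) = ennreal (T - F 0)"
proof -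
  have "nn_integral lborel (\<lambda>y::real^3. ennreal (f (norm y)))
      = (\<integral>\<^sup>+ s. ennreal (4 * pi * s\<^sup>2) * indicator {0..} s * ennreal (f s) \<partial>lborel)"
    using f by (intro nn_integral_radial[where g="\<lambda>s. ennreal (f s)"]) auto
  also have "\<dots> = (\<integral>\<^sup>+ s. ennreal (F' s) * indicator {0..} s \<partial>lborel)"
  proof (rule nn_integral_cong_AE)
    have "AE s in lborel. s \<noteq> (0::real)" by (rule AE_lborel_singleton)
    then show "AE s in lborel. ennreal (4 * pi * s\<^sup>2) * indicator {0..} s * ennreal (f s)
        = ennreal (F' s) * indicator {0..} s"
      by eventually_elim (use f F in \<open>auto simp: indicator_def ennreal_mult''\<close>)
  qed
  also have "\<dots> = ennreal (T - F 0)"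
  proof (rule nn_integral_FTC_atLeast)
    show "0 \<le> F' s" if "0 \<le> s" for s
      using that F'(2) F(2)[of s] f(2)[of s] by (cases "s = 0") auto
  qed (use assms in auto)
  finally show ?thesis .
qed

section \<open>Retarded and advanced potentials\<close>

text \<open>The fundamental solution of minus the Laplacian. Its value at the origin is 0 by the
  convention for division.\<close>

definition newton :: "real^3 \<Rightarrow> real" where
  "newton y = 1 / (4 * pi * norm y)"

lemma newton_nonneg: "0 \<le> newton y"
  by (simp add: newton_def)

lemma newton_measurable [measurable]: "newton \<in> borel_measurable borel"
  unfolding newton_def[abs_def] by measurable

text \<open>In polar coordinates this is the integral of \<open>s exp (- l s)\<close> over the half
  line. It is the only source of the gain \<open>1 / l^2\<close> in all weighted estimates of
  potentials.\<close>

lemma nn_integral_exp_newton: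
  assumes "0 < l"
  shows "nn_integral lborel (\<lambda>y::real^3. ennreal (exp (- l * norm y) * newton y)) = ennreal (1 / l\<^sup>2)"
proof -
  let ?F = "\<lambda>s. - (s / l + 1 / l\<^sup>2) * exp (- l * s)"
  have "nn_integral lborel (\<lambda>y::real^3. ennreal (exp (- l * norm y) * (1 / (4 * pi * norm y)))) = ennreal (0 - ?F 0)"
  proof (rule nn_integral_radial_FTC)
    show "(?F has_real_derivative s * exp (- l * s)) (at s)" for s
      using assms by (auto intro!: derivative_eq_intros simp: field_simps power2_eq_square)
    show "(?F \<longlongrightarrow> 0) at_top"
      using assms by real_asymp
  qed (auto simp: power2_eq_square)
  then show ?thesis by (simp add: newton_def)
qed

lemma integrable_exp_newton:
  assumes "0 < l"
  shows "integrable lborel (\<lambda>y. exp (- l * norm y) * newton y)"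
  by (rule integrableI_nonneg) (use nn_integral_exp_newton[OF assms] newton_nonneg in auto)

text \<open>This function dominates every integrand below that is singular at the origin and has
  compact support.\<close>

definition sing_bound :: "real^3 \<Rightarrow> real" where
  "sing_bound y = 1 / ((norm y)\<^sup>2 * (1 + (norm y)\<^sup>2))"

lemma integrable_sing_bound: "integrable lborel sing_bound"
proof (rule integrableI_nonneg)
  have "nn_integral lborel (\<lambda>y::real^3. ennreal (1 / ((norm y)\<^sup>2 * (1 + (norm y)\<^sup>2))))
      = ennreal (4 * pi * (pi / 2) - 4 * pi * arctan 0)"
  proof (rule nn_integral_radial_FTC)
    show "((\<lambda>s. 4 * pi * arctan s) has_real_derivative 4 * pi / (1 + s\<^sup>2)) (at s)" for s
      by (auto intro!: derivative_eq_intros simp: field_simps)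
    show "((\<lambda>s. 4 * pi * arctan s) \<longlongrightarrow> 4 * pi * (pi / 2)) at_top"
      by (intro tendsto_intros tendsto_arctan_at_top)
    show "4 * pi / (1 + s\<^sup>2) = 4 * pi * s\<^sup>2 * (1 / (s\<^sup>2 * (1 + s\<^sup>2)))" if "0 < s" for s :: real
      using that by simp
  qed auto
  then show "nn_integral lborel (\<lambda>y. ennreal (sing_bound y)) < \<infinity>"
    by (simp add: sing_bound_def)
qed (auto simp: sing_bound_def[abs_def])

text \<open>The integrand is minus the Laplacian of \<open>1 / sqrt (|y|^2 + e^2)\<close>, an
  approximation of \<open>4 pi\<close> times the Dirac delta. The flux of the gradient through the
  sphere of radius \<open>s\<close> supplies the antiderivative
  \<open>4 pi s^3 / (s^2 + e^2)^(3/2)\<close>.\<close>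

lemma integral_regularized_delta:
  assumes e: "0 < e"
  shows "integrable lborel (\<lambda>y::real^3. 3 * e\<^sup>2 * inverse (sqrt ((norm y)\<^sup>2 + e\<^sup>2)) ^ 5)"
    and "integral\<^sup>L lborel (\<lambda>y::real^3. 3 * e\<^sup>2 * inverse (sqrt ((norm y)\<^sup>2 + e\<^sup>2)) ^ 5) = 4 * pi"
proof -
  let ?k = "\<lambda>s. inverse (sqrt (s\<^sup>2 + e\<^sup>2))"
  have pos: "0 < s\<^sup>2 + e\<^sup>2" for s :: real using e by (intro add_nonneg_pos) auto
  have k2: "?k s ^ 2 * (s\<^sup>2 + e\<^sup>2) = 1" for s
    using pos[of s] less_imp_neq[OF pos[of s], symmetric] by (simp add: power_inverse)
  have dk: "(?k has_real_derivative - s * ?k s ^ 3) (at s)" for s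
    using pos[of s] by (auto intro!: derivative_eq_intros simp: field_simps power2_eq_square power3_eq_cube)
  have *: "nn_integral lborel (\<lambda>y::real^3. ennreal (3 * e\<^sup>2 * ?k (norm y) ^ 5))
      = ennreal (4 * pi - 4 * pi * (0 ^ 3 * ?k 0 ^ 3))"
  proof (rule nn_integral_radial_FTC)
    fix s :: real
    have e2: "(3::nat) - Suc 0 = 2" by simp
    have d: "((\<lambda>s. 4 * pi * (s ^ 3 * ?k s ^ 3)) has_real_derivative
        4 * pi * (real 3 * s ^ (3 - Suc 0) * ?k s ^ 3 + real 3 * (- s * ?k s ^ 3 * ?k s ^ (3 - Suc 0)) * s ^ 3)) (at s)"
      by (rule DERIV_cmult[OF DERIV_mult[OF DERIV_pow DERIV_power[OF dk]]])
    have "4 * pi * (3 * s ^ 2 * ?k s ^ 3 + 3 * (- s * ?k s ^ 3 * ?k s ^ 2) * s ^ 3)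
        = 4 * pi * s\<^sup>2 * (3 * e\<^sup>2 * ?k s ^ 5)"
      using k2[of s] by algebra
    from DERIV_cong[OF d[unfolded e2 of_nat_numeral] this]
    show "((\<lambda>s. 4 * pi * (s ^ 3 * ?k s ^ 3)) has_real_derivative 4 * pi * s\<^sup>2 * (3 * e\<^sup>2 * ?k s ^ 5)) (at s)" .
  next
    show "((\<lambda>s. 4 * pi * (s ^ 3 * ?k s ^ 3)) \<longlongrightarrow> 4 * pi) at_top"
      by real_asymp
  qed auto
  show int: "integrable lborel (\<lambda>y::real^3. 3 * e\<^sup>2 * ?k (norm y) ^ 5)"
    by (rule integrableI_nonneg) (use * in auto)
  show "integral\<^sup>L lborel (\<lambda>y::real^3. 3 * e\<^sup>2 * ?k (norm y) ^ 5) = 4 * pi"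
    by (subst integral_eq_nn_integral) (use * in auto)
qed

text \<open>The retarded potential for \<open>\<sigma> = -1\<close> and the advanced potential for
  \<open>\<sigma> = 1\<close>, in the form of a convolution with a measure on a light cone.\<close>

definition potential :: "real \<Rightarrow> (spacetime \<Rightarrow> complex) \<Rightarrow> spacetime \<Rightarrow> complex" where
  "potential \<sigma> F p = (\<integral>y. newton y *\<^sub>R F (p + (y, \<sigma> * norm y)) \<partial>lborel)"

text \<open>The condition on \<open>\<mu> * \<sigma>\<close> makes the weight decay like
  \<open>exp (- l |y|)\<close> along the cone of integration: \<open>exp (l t)\<close> for the
  retarded and \<open>exp (- l t)\<close> for the advanced potential. Being a convolution, the
  potential commutes with derivatives, so one bound serves all orders.\<close>

lemma Ckb_potential:
  assumes F: "Ckb k (\<lambda>p. A * exp (\<mu> * snd p)) F" and l: "0 < l" "\<mu> * \<sigma> = - l"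
  shows "Ckb k (\<lambda>p. A / l\<^sup>2 * exp (\<mu> * snd p)) (potential \<sigma> F)"
    and "0 < k \<Longrightarrow> b \<in> Basis \<Longrightarrow> partial_deriv b (potential \<sigma> F) = potential \<sigma> (partial_deriv b F)"
proof -
  have A: "0 \<le> A"
    using Ckb_weight_nonneg[OF F, of 0] by simp
  let ?w = "\<lambda>y p. newton y * (A * exp (\<mu> * snd (p + (y, \<sigma> * norm y))))"
  have w: "?w y p = A * exp (\<mu> * snd p) * (exp (- l * norm y) * newton y)" for y p
  proof -
    have "\<mu> * (\<sigma> * norm y) = - l * norm y"
      by (metis l(2) mult.assoc)
    then have "\<mu> * snd (p + (y, \<sigma> * norm y)) = \<mu> * snd p + - l * norm y"
      by (simp add: distrib_left)
    then show ?thesis by (simp only: exp_add) simp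
  qed
  have 1: "Ckb k (?w y) (\<lambda>p. newton y *\<^sub>R F (p + (y, \<sigma> * norm y)))" for y
    using Ckb_scaleR[OF Ckb_translate[OF F, of "(y, \<sigma> * norm y)"], of "newton y"] newton_nonneg[of y]
    by simp
  have 2: "(\<lambda>y. newton y *\<^sub>R F (p + (y, \<sigma> * norm y))) \<in> borel_measurable lborel" for p
  proof -
    have "continuous_on UNIV (\<lambda>y. F (p + (y, \<sigma> * norm y)))"
      by (rule continuous_on_compose2[OF Ckb_continuous[OF F]]) (auto intro!: continuous_intros)
    from borel_measurable_continuous_onI[OF this] show ?thesis by measurable
  qed
  \<comment> \<open>On a ball of radius 1 the time changes by at most 1, hence the weight by a
    factor of at most \<open>exp \<bar>\<mu>\<bar>\<close>.\<close>
  have 3: "\<exists>r>0. \<exists>g. integrable lborel g \<and> (\<forall>y. \<forall>x\<in>ball p r. ?w y x \<le> g y)" for p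
  proof (intro exI conjI allI ballI)
    show "integrable lborel (\<lambda>y. A * exp (\<mu> * snd p + \<bar>\<mu>\<bar>) * (exp (- l * norm y) * newton y))"
      using integrable_exp_newton[OF l(1)] by simp
    fix y and x :: spacetime assume x: "x \<in> ball p 1"
    have "\<bar>snd x - snd p\<bar> \<le> 1"
      using x norm_snd_le[of "snd (x - p)" "fst (x - p)"]
      by (simp add: dist_norm norm_minus_commute del: fst_diff snd_diff) simp
    then have "\<mu> * (snd x - snd p) \<le> \<bar>\<mu>\<bar> * 1"
      by (metis abs_ge_self abs_mult abs_ge_zero mult_left_mono order_trans)
    then have "exp (\<mu> * snd x) \<le> exp (\<mu> * snd p + \<bar>\<mu>\<bar>)"
      by (simp add: algebra_simps)
    then show "?w y x \<le> A * exp (\<mu> * snd p + \<bar>\<mu>\<bar>) * (exp (- l * norm y) * newton y)"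
      unfolding w using A newton_nonneg by (intro mult_right_mono mult_left_mono) auto
  qed auto
  have 4: "(\<integral>\<^sup>+ y. ennreal (?w y p) \<partial>lborel) \<le> ennreal (A / l\<^sup>2 * exp (\<mu> * snd p))" for p
  proof -
    have "(\<integral>\<^sup>+ y. ennreal (?w y p) \<partial>lborel)
        = ennreal (A * exp (\<mu> * snd p)) * (\<integral>\<^sup>+ y. ennreal (exp (- l * norm y) * newton y) \<partial>lborel)"
      unfolding w using A newton_nonneg by (subst nn_integral_cmult[symmetric]) (auto simp: ennreal_mult')
    also have "\<dots> = ennreal (A * exp (\<mu> * snd p) * (1 / l\<^sup>2))"
      unfolding nn_integral_exp_newton[OF l(1)] using A by (subst ennreal_mult') auto
    finally show ?thesis by simp
  qed
  have 5: "0 \<le> A / l\<^sup>2 * exp (\<mu> * snd p)" for p using A by simp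
  note * = Ckb_integral[where f="\<lambda>y p. newton y *\<^sub>R F (p + (y, \<sigma> * norm y))" and w="?w", OF 1 2 3 4 5]
  show "Ckb k (\<lambda>p. A / l\<^sup>2 * exp (\<mu> * snd p)) (potential \<sigma> F)"
    unfolding potential_def[abs_def] by (rule *(1))
  assume k: "0 < k" and b: "b \<in> Basis"
  have dF: "\<And>x. F differentiable (at x)"
    using Ckb_order_mono[OF F, of "Suc 0"] k by auto
  have "partial_deriv b (\<lambda>p. newton y *\<^sub>R F (p + (y, \<sigma> * norm y))) p
      = newton y *\<^sub>R partial_deriv b F (p + (y, \<sigma> * norm y))" for y p
  proof (subst partial_deriv_scaleR)
    have "Ckb (Suc 0) (\<lambda>p. A * exp (\<mu> * snd (p + (y, \<sigma> * norm y)))) (\<lambda>p. F (p + (y, \<sigma> * norm y)))"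
      by (rule Ckb_translate[OF Ckb_order_mono[OF F]]) (use k in simp)
    then show "(\<lambda>p. F (p + (y, \<sigma> * norm y))) differentiable (at p)"
      unfolding Ckb.simps by blast
  qed (simp add: partial_deriv_translate[OF dF b])
  then show "partial_deriv b (potential \<sigma> F) = potential \<sigma> (partial_deriv b F)"
    using *(2)[OF k b] unfolding potential_def[abs_def] by simp
qed

section \<open>The wave operator\<close>

abbreviation dx :: "3 \<Rightarrow> (spacetime \<Rightarrow> 'b::real_normed_vector) \<Rightarrow> spacetime \<Rightarrow> 'b" where
  "dx i \<equiv> partial_deriv (axis i 1, 0)"

abbreviation dt :: "(spacetime \<Rightarrow> 'b::real_normed_vector) \<Rightarrow> spacetime \<Rightarrow> 'b" where
  "dt \<equiv> partial_deriv (0, 1)"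

definition wave_op :: "(spacetime \<Rightarrow> complex) \<Rightarrow> spacetime \<Rightarrow> complex" where
  "wave_op \<phi> p = dt (dt \<phi>) p - (\<Sum>i\<in>UNIV. dx i (dx i \<phi>) p)"

lemma axis_in_Basis3 [simp]: "axis i 1 \<in> (Basis :: (real^3) set)"
  by (auto simp: Basis_vec_def)

lemma spacetime_Basis: "(Basis :: spacetime set) = insert (0, 1) (range (\<lambda>i. (axis i 1, 0)))"
  by (auto simp: Basis_prod_def Basis_vec_def)

lemma dx_dt_Basis [simp]: "(axis i 1, 0) \<in> (Basis :: spacetime set)" "(0, 1) \<in> (Basis :: spacetime set)"
  by (auto simp: spacetime_Basis)

lemma sum_Basis3: "(\<Sum>b\<in>(Basis :: (real^3) set). g b) = (\<Sum>i\<in>UNIV. g (axis i 1))"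
proof -
  have *: "(Basis :: (real^3) set) = range (\<lambda>i. axis i 1)" by (auto simp: Basis_vec_def)
  have "inj (\<lambda>i::3. axis i (1::real))" by (auto simp: inj_on_def axis_eq_axis)
  then show ?thesis unfolding * by (simp add: sum.reindex)
qed

lemma sum_spacetime_Basis:
  "(\<Sum>b\<in>(Basis :: spacetime set). g b) = g (0, 1) + (\<Sum>i\<in>UNIV. g (axis i 1, 0))"
  unfolding spacetime_Basis
  by (subst sum.insert) (auto simp: sum.reindex inj_on_def axis_eq_axis)

lemma spacetime_has_derivative:
  fixes h :: "spacetime \<Rightarrow> 'b::real_normed_vector"
  assumes "h differentiable (at p)"
  shows "(h has_derivative (\<lambda>v. (\<Sum>i\<in>UNIV. (fst v $ i) *\<^sub>R dx i h p) + snd v *\<^sub>R dt h p)) (at p)"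
  using has_derivative_partial[OF assms]
  by (simp add: sum_spacetime_Basis inner_prod_def inner_axis add.commute)

lemma has_derivative_on_graph:
  fixes h :: "spacetime \<Rightarrow> 'b::real_normed_vector"
  assumes "\<And>p. h differentiable (at p)" and "(\<rho> has_derivative \<rho>') (at y)"
  shows "((\<lambda>y. h (p + (y, \<rho> y))) has_derivative
    (\<lambda>v. (\<Sum>i\<in>UNIV. (v $ i) *\<^sub>R dx i h (p + (y, \<rho> y))) + \<rho>' v *\<^sub>R dt h (p + (y, \<rho> y)))) (at y)"
proof -
  have "((\<lambda>y. p + (y, \<rho> y)) has_derivative (\<lambda>v. (v, \<rho>' v))) (at y)"
    using assms(2) by (auto intro!: derivative_eq_intros)
  from has_derivative_compose[OF this spacetime_has_derivative[OF assms(1)]] show ?thesis by simp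
qed

lemma Ck_on_1I:
  assumes "\<And>x. (f has_derivative f' x) (at x)" and "\<And>b. b \<in> Basis \<Longrightarrow> continuous_on UNIV (\<lambda>x. f' x b)"
  shows "Ck_on 1 UNIV f"
proof -
  have "partial_deriv b f = (\<lambda>x. f' x b)" for b
    using partial_deriv_eq[OF assms(1)] by blast
  then show ?thesis using assms by (auto simp: One_nat_def differentiable_def)
qed

lemma compact_fsupp_subset:
  fixes f :: "'a::euclidean_space \<Rightarrow> 'b::zero"
  assumes "compact (fsupp f)" "\<And>x. g x \<noteq> 0 \<Longrightarrow> x \<in> fsupp f"
  shows "compact (fsupp g)"
proof -
  have "fsupp g \<subseteq> fsupp f"
    using assms(2) by (subst fsupp_subset_iff) (auto simp: fsupp_def)
  then show ?thesis
    using assms(1) by (metis closed_closure compact_Int_closed fsupp_def inf.absorb2)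
qed

lemma compact_fsupp_partial_deriv:
  fixes f :: "'a::euclidean_space \<Rightarrow> 'b::real_normed_vector"
  shows "compact (fsupp f) \<Longrightarrow> compact (fsupp (partial_deriv b f))"
  by (rule compact_fsupp_subset) (use partial_deriv_zero_outside_fsupp in blast)+

lemma weighted_bound_compact:
  fixes f :: "'a::euclidean_space \<Rightarrow> 'b::real_normed_vector"
  assumes w: "continuous_on UNIV w" "\<And>x. 0 < w x" and f: "continuous_on UNIV f" "compact (fsupp f)"
  shows "\<exists>A\<ge>0. \<forall>x. norm (f x) \<le> A * w x"
proof -
  have "compact (fsupp (\<lambda>x. inverse (w x) *\<^sub>R f x))"
    using fsupp_zero[of _ f] by (intro compact_fsupp_subset[OF f(2)]) auto
  moreover have "continuous_on UNIV (\<lambda>x. inverse (w x) *\<^sub>R f x)"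
    using w less_imp_neq[OF w(2)] by (intro continuous_intros f) force+
  ultimately obtain A where A: "A \<ge> 0" "\<And>x. norm (inverse (w x) *\<^sub>R f x) \<le> A"
    using bounded_continuous_compact by blast
  have "norm (f x) \<le> A * w x" for x
    using A(2)[of x] w(2)[of x] by (simp add: field_simps)
  with A(1) show ?thesis by blast
qed

text \<open>A positive continuous weight is bounded below on a compact support, so any such weight
  will do, in particular \<open>exp (- l t)\<close> for every \<open>l\<close>.\<close>

lemma Ckb_of_compact:
  fixes f :: "'a::euclidean_space \<Rightarrow> 'b::real_normed_vector"
  assumes w: "continuous_on UNIV w" "\<And>x. 0 < w x"
  shows "Ck_on k UNIV f \<Longrightarrow> compact (fsupp f) \<Longrightarrow> \<exists>A\<ge>0. Ckb k (\<lambda>x. A * w x) f"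
proof (induction k arbitrary: f)
  case 0
  show ?case using weighted_bound_compact[OF w _ 0(2)] 0(1) by auto
next
  case (Suc k)
  have "\<forall>b\<in>Basis. \<exists>A\<ge>0. Ckb k (\<lambda>x. A * w x) (partial_deriv b f)"
    using Suc.prems by (intro ballI Suc.IH compact_fsupp_partial_deriv) auto
  then obtain A where A: "\<And>b. b \<in> Basis \<Longrightarrow> A b \<ge> 0" "\<And>b. b \<in> Basis \<Longrightarrow> Ckb k (\<lambda>x. A b * w x) (partial_deriv b f)"
    by metis
  obtain A' where A': "A' \<ge> 0" "\<And>x. norm (f x) \<le> A' * w x"
    using weighted_bound_compact[OF w Ck_on_imp_continuous_on[OF Suc.prems(1)] Suc.prems(2)] by blast
  define A'' where "A'' = A' + (\<Sum>b\<in>Basis. A b)"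
  have 1: "A' \<le> A''" "0 \<le> A''" using A' A by (auto simp: A''_def sum_nonneg)
  have 2: "A b \<le> A''" if "b \<in> Basis" for b
    unfolding A''_def using A(1) A'(1) that by (intro add_increasing member_le_sum) auto
  have "Ckb (Suc k) (\<lambda>x. A'' * w x) f"
    unfolding Ckb.simps
  proof (intro conjI allI ballI)
    show "norm (f x) \<le> A'' * w x" for x
      using A'(2)[of x] mult_right_mono[OF 1(1), of "w x"] w(2)[of x] by linarith
    show "f differentiable (at x)" for x using Suc.prems by auto
    show "Ckb k (\<lambda>x. A'' * w x) (partial_deriv b f)" if "b \<in> Basis" for b
      by (rule Ckb_mono[OF A(2)[OF that]]) (use 2[OF that] w(2) less_imp_le in \<open>auto intro!: mult_right_mono\<close>)
  qed
  then show ?case using 1 by blast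
qed

lemma Ckb_lipschitz:
  fixes f :: "'a::euclidean_space \<Rightarrow> 'b::real_normed_vector"
  assumes "Ckb 1 (\<lambda>_. A) f"
  shows "norm (f x - f y) \<le> real DIM('a) * A * norm (x - y)"
proof (rule differentiable_bound[of UNIV f "\<lambda>x h. \<Sum>b\<in>Basis. (h \<bullet> b) *\<^sub>R partial_deriv b f x"])
  fix x :: 'a
  show "(f has_derivative (\<lambda>h. \<Sum>b\<in>Basis. (h \<bullet> b) *\<^sub>R partial_deriv b f x)) (at x within UNIV)"
    using assms by (intro has_derivative_partial) (auto simp: One_nat_def)
  show "onorm (\<lambda>h. \<Sum>b\<in>Basis. (h \<bullet> b) *\<^sub>R partial_deriv b f x) \<le> real DIM('a) * A"
  proof (rule onorm_le)
    fix h :: 'a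
    have "norm (\<Sum>b\<in>Basis. (h \<bullet> b) *\<^sub>R partial_deriv b f x) \<le> (\<Sum>b\<in>(Basis :: 'a set). norm h * A)"
    proof (rule sum_norm_le)
      fix b :: 'a assume b: "b \<in> Basis"
      then have "norm (partial_deriv b f x) \<le> A" using assms by (auto simp: One_nat_def)
      then show "norm ((h \<bullet> b) *\<^sub>R partial_deriv b f x) \<le> norm h * A"
        using Basis_le_norm[OF b, of h] by (auto intro!: mult_mono)
    qed
    then show "norm (\<Sum>b\<in>Basis. (h \<bullet> b) *\<^sub>R partial_deriv b f x) \<le> real DIM('a) * A * norm h"
      by (simp add: mult_ac)
  qed
qed auto

lemma compact_fsupp_on_graph:
  fixes h :: "spacetime \<Rightarrow> 'b::zero"
  assumes "compact (fsupp h)"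
  shows "\<exists>N>0. \<forall>y s. N < norm y \<longrightarrow> h (p + (y, s)) = 0"
proof -
  obtain R where R: "\<And>x. R < norm x \<Longrightarrow> h x = 0"
    using assms unfolding compact_fsupp_iff by blast
  have "h (p + (y, s)) = 0" if "max 1 (R + norm p) < norm y" for y s
  proof (rule R)
    have "norm y \<le> norm (y, s)" by (rule norm_fst_le)
    also have "\<dots> \<le> norm (p + (y, s)) + norm p"
      using norm_triangle_ineq4[of "p + (y, s)" p] by simp
    finally show "R < norm (p + (y, s))" using that by simp
  qed
  then show ?thesis by (intro exI[of _ "max 1 (R + norm p)"]) auto
qed

lemma continuous_on_graph:
  fixes h :: "spacetime \<Rightarrow> 'b::real_normed_vector"
  assumes "continuous_on UNIV h" "continuous_on UNIV \<rho>"
  shows "continuous_on UNIV (\<lambda>y. h (p + (y, \<rho> y)))"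
  by (rule continuous_on_compose2[OF assms(1)]) (auto intro!: continuous_intros assms)

section \<open>Inversion of the wave operator by regularization of the light cone\<close>

text \<open>Replaces the cone, singular at its tip, by a smooth hyperboloid. All integrations by
  parts on the cone are done for positive \<open>e\<close>, and then \<open>e\<close> tends to
  0.\<close>

abbreviation reg_norm :: "real \<Rightarrow> real^3 \<Rightarrow> real" where
  "reg_norm e y \<equiv> sqrt ((norm y)\<^sup>2 + e\<^sup>2)"

lemma reg_norm_bounds:
  assumes "0 < e"
  shows "0 < reg_norm e y" "norm y \<le> reg_norm e y" "e \<le> reg_norm e y"
proof -
  have "0 < (norm y)\<^sup>2 + e\<^sup>2" using assms by (intro add_nonneg_pos) auto
  then show "0 < reg_norm e y" by simp
  show "norm y \<le> reg_norm e y" "e \<le> reg_norm e y"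
    by (rule real_le_rsqrt, simp)+
qed

lemma reg_norm_limit: "e \<longlonglongrightarrow> 0 \<Longrightarrow> (\<lambda>n. reg_norm (e n) y) \<longlonglongrightarrow> norm y"
  by (rule tendsto_eq_intros refl | assumption | simp)+

text \<open>A singularity like \<open>1 / |y|^2\<close> is locally integrable in dimension three,
  and the compact support confines \<open>y\<close> to a ball. Hence a multiple of
  \<open>sing_bound\<close> dominates the integrands on all hyperboloids at once.\<close>

lemma graph_integral_limit:
  fixes h :: "spacetime \<Rightarrow> complex"
  assumes h: "continuous_on UNIV h" "compact (fsupp h)" and e: "e \<longlonglongrightarrow> 0"
    and a: "\<And>n. a n \<in> borel_measurable borel" "\<alpha> \<in> borel_measurable borel"
      "\<And>n y. y \<noteq> 0 \<Longrightarrow> \<bar>a n y\<bar> \<le> C * (1 + 1 / (norm y)\<^sup>2)" "\<And>y. y \<noteq> 0 \<Longrightarrow> (\<lambda>n. a n y) \<longlonglongrightarrow> \<alpha> y"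
  shows "(\<lambda>n. \<integral>y. a n y *\<^sub>R h (p + (y, reg_norm (e n) y)) \<partial>lborel)
      \<longlonglongrightarrow> (\<integral>y. \<alpha> y *\<^sub>R h (p + (y, norm y)) \<partial>lborel)"
    and "integrable lborel (\<lambda>y. \<alpha> y *\<^sub>R h (p + (y, norm y)))"
    and "integrable lborel (\<lambda>y. a n y *\<^sub>R h (p + (y, reg_norm (e n) y)))"
proof -
  obtain B where B: "B \<ge> 0" "\<And>x. norm (h x) \<le> B" using bounded_continuous_compact[OF h] by blast
  obtain N where N: "N > 0" "\<And>y s. N < norm y \<Longrightarrow> h (p + (y, s)) = 0"
    using compact_fsupp_on_graph[OF h(2)] by blast
  have C: "0 \<le> C"
  proof (rule ccontr)
    assume "\<not> 0 \<le> C"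
    moreover have "\<bar>a 0 (axis 1 1)\<bar> \<le> C * (1 + 1 / (norm (axis 1 1 :: real^3))\<^sup>2)" by (rule a) (simp add: axis_eq_0_iff)
    moreover have "C * (1 + 1 / (norm (axis 1 1 :: real^3))\<^sup>2) = C * 2" by (simp add: norm_axis_1)
    ultimately show False by linarith
  qed
  have m1: "(\<lambda>y. a n y *\<^sub>R h (p + (y, reg_norm (e n) y))) \<in> borel_measurable lborel" for n
  proof -
    have "(\<lambda>y. h (p + (y, reg_norm (e n) y))) \<in> borel_measurable borel"
      by (intro borel_measurable_continuous_onI continuous_on_graph h continuous_intros)
    then show ?thesis using a(1) by measurable
  qed
  have m2: "(\<lambda>y. \<alpha> y *\<^sub>R h (p + (y, norm y))) \<in> borel_measurable lborel"
  proof -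
    have "(\<lambda>y. h (p + (y, norm y))) \<in> borel_measurable borel"
      by (intro borel_measurable_continuous_onI continuous_on_graph h continuous_intros)
    then show ?thesis using a(2) by measurable
  qed
  have g: "integrable lborel (\<lambda>y. C * B * (1 + N\<^sup>2)\<^sup>2 * sing_bound y)"
    using integrable_sing_bound by simp
  have AE0: "AE y in lborel. y \<noteq> (0 :: real^3)" by (rule AE_lborel_singleton)
  have bd: "norm (c *\<^sub>R h (p + (y, s))) \<le> C * B * (1 + N\<^sup>2)\<^sup>2 * sing_bound y"
    if "y \<noteq> 0" "\<bar>c\<bar> \<le> C * (1 + 1 / (norm y)\<^sup>2)" for y s c
  proof (cases "norm y \<le> N")
    case True
    \<comment> \<open>With \<open>s = |y|^2\<close> one has
      \<open>1 + 1/s = (1 + s)^2 / (s (1 + s))\<close>, which explains the constant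
      \<open>(1 + N^2)^2\<close>.\<close>
    have "1 + 1 / (norm y)\<^sup>2 = (1 + (norm y)\<^sup>2)\<^sup>2 * sing_bound y"
    proof -
      have "1 + 1 / s = (1 + s)\<^sup>2 * (1 / (s * (1 + s)))" if "0 < s" for s :: real
        using that by (simp add: power2_eq_square add_divide_distrib)
      from this[of "(norm y)\<^sup>2"] that(1) show ?thesis by (simp add: sing_bound_def)
    qed
    also have "\<dots> \<le> (1 + N\<^sup>2)\<^sup>2 * sing_bound y"
      using True by (intro mult_right_mono power_mono add_left_mono) (auto simp: sing_bound_def)
    finally have "\<bar>c\<bar> \<le> C * ((1 + N\<^sup>2)\<^sup>2 * sing_bound y)"
      using that(2) C by (meson mult_left_mono order_trans)
    then have "\<bar>c\<bar> * norm (h (p + (y, s))) \<le> C * ((1 + N\<^sup>2)\<^sup>2 * sing_bound y) * B"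
      using B by (intro mult_mono) auto
    then show ?thesis by (simp add: mult_ac)
  next
    case False
    then show ?thesis using N(2)[of y s] B C by (simp add: sing_bound_def)
  qed
  have bound: "AE y in lborel. norm (a n y *\<^sub>R h (p + (y, reg_norm (e n) y))) \<le> C * B * (1 + N\<^sup>2)\<^sup>2 * sing_bound y" for n
    using AE0 by eventually_elim (use bd a(3) in blast)
  have lim: "AE y in lborel. (\<lambda>n. a n y *\<^sub>R h (p + (y, reg_norm (e n) y))) \<longlonglongrightarrow> \<alpha> y *\<^sub>R h (p + (y, norm y))"
    using AE0
  proof eventually_elim
    case (elim y)
    have "(\<lambda>n. p + (y, reg_norm (e n) y)) \<longlonglongrightarrow> p + (y, norm y)"
      by (intro tendsto_intros reg_norm_limit e)
    then have "(\<lambda>n. h (p + (y, reg_norm (e n) y))) \<longlonglongrightarrow> h (p + (y, norm y))"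
      using h(1) by (auto intro: continuous_on_tendsto_compose)
    with a(4)[OF elim] show ?case by (intro tendsto_scaleR)
  qed
  show "(\<lambda>n. \<integral>y. a n y *\<^sub>R h (p + (y, reg_norm (e n) y)) \<partial>lborel)
      \<longlonglongrightarrow> (\<integral>y. \<alpha> y *\<^sub>R h (p + (y, norm y)) \<partial>lborel)"
    by (rule integral_dominated_convergence[OF m2 m1 g lim bound])
  show "integrable lborel (\<lambda>y. \<alpha> y *\<^sub>R h (p + (y, norm y)))"
    by (rule integrable_dominated_convergence[OF m2 m1 g lim bound])
  show "integrable lborel (\<lambda>y. a n y *\<^sub>R h (p + (y, reg_norm (e n) y)))"
    using bound[of n] order_trans[OF _ abs_ge_self]
    by (intro Bochner_Integration.integrable_bound[OF g m1]) (auto elim!: eventually_mono)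
qed

text \<open>Everything is written in terms of the inverse \<open>k\<close> of the regularized norm,
  so that later identities are polynomial in \<open>k\<close> modulo the relation
  \<open>k^2 (|y|^2 + e^2) = 1\<close>.\<close>

lemma reg_norm_derivatives:
  assumes "0 < e"
  shows "(reg_norm e has_derivative (\<lambda>v. (y \<bullet> v) * inverse (reg_norm e y))) (at y)"
    and "((\<lambda>y. inverse (reg_norm e y)) has_derivative (\<lambda>v. - (y \<bullet> v) * inverse (reg_norm e y) ^ 3)) (at y)"
    and "inverse (reg_norm e y) ^ 2 * ((norm y)\<^sup>2 + e\<^sup>2) = 1"
proof -
  have pos: "0 < (norm y)\<^sup>2 + e\<^sup>2" using assms by (intro add_nonneg_pos) auto
  then show "inverse (reg_norm e y) ^ 2 * ((norm y)\<^sup>2 + e\<^sup>2) = 1"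
    using less_imp_neq[OF pos, symmetric] by (simp add: power_inverse)
  have "((\<lambda>y. y \<bullet> y + e\<^sup>2) has_derivative (\<lambda>v. 2 * (y \<bullet> v))) (at y)"
    by (auto intro!: derivative_eq_intros simp: inner_commute)
  then have 1: "((\<lambda>y. sqrt (y \<bullet> y + e\<^sup>2)) has_derivative (\<lambda>v. (y \<bullet> v) * inverse (reg_norm e y))) (at y)"
    by (rule has_derivative_eq_rhs[OF has_derivative_real_sqrt[rotated]])
      (use pos in \<open>auto simp: power2_norm_eq_inner fun_eq_iff\<close>)
  then show "(reg_norm e has_derivative (\<lambda>v. (y \<bullet> v) * inverse (reg_norm e y))) (at y)"
    by (simp add: power2_norm_eq_inner)
  have "((\<lambda>y. inverse (sqrt (y \<bullet> y + e\<^sup>2))) has_derivative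
      (\<lambda>v. - (inverse (sqrt (y \<bullet> y + e\<^sup>2)) * ((y \<bullet> v) * inverse (reg_norm e y)) * inverse (sqrt (y \<bullet> y + e\<^sup>2))))) (at y)"
    using pos by (intro Deriv.has_derivative_inverse 1) (simp add: power2_norm_eq_inner)
  then show "((\<lambda>y. inverse (reg_norm e y)) has_derivative (\<lambda>v. - (y \<bullet> v) * inverse (reg_norm e y) ^ 3)) (at y)"
    by (simp add: power2_norm_eq_inner power3_eq_cube mult_ac)
qed

lemma continuous_on_inverse_reg_norm:
  "0 < e \<Longrightarrow> continuous_on S (\<lambda>y. inverse (reg_norm e y))"
  using reg_norm_bounds(1)[of e] by (intro continuous_intros) (metis less_irrefl)

text \<open>By the chain rule \<open>f i\<close> is the \<open>i\<close>-th partial derivative of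
  the compactly supported function \<open>a y *\<^sub>R h (q y)\<close>.\<close>

lemma graph_divergence:
  fixes h :: "spacetime \<Rightarrow> complex" and p :: spacetime
  assumes h: "Ck_on 1 UNIV h" "compact (fsupp h)" and e: "0 < e"
    and a: "\<And>y. (a has_derivative a' y) (at y)" "\<And>j. continuous_on UNIV (\<lambda>y. a' y (axis j 1))"
  defines "q \<equiv> \<lambda>y. p + (y, reg_norm e y)"
  defines "f \<equiv> \<lambda>i y. a y *\<^sub>R (dx i h (q y) + ((y $ i) * inverse (reg_norm e y)) *\<^sub>R dt h (q y))
    + a' y (axis i 1) *\<^sub>R h (q y)"
  shows "integrable lborel (f i)" "(\<integral>y. f i y \<partial>lborel) = 0"
proof -
  have dh: "\<And>x. h differentiable (at x)" using h(1) by (auto simp: One_nat_def)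
  define g where "g y = a y *\<^sub>R h (q y)" for y
  define g' where "g' y v = a y *\<^sub>R ((\<Sum>i\<in>UNIV. (v $ i) *\<^sub>R dx i h (q y)) + ((y \<bullet> v) * inverse (reg_norm e y)) *\<^sub>R dt h (q y))
    + a' y v *\<^sub>R h (q y)" for y v
  have dg: "(g has_derivative g' y) (at y)" for y
    unfolding g_def[abs_def] g'_def[abs_def] q_def
    by (intro has_derivative_scaleR a(1) has_derivative_on_graph dh reg_norm_derivatives e)
  have g'f: "g' y (axis i 1) = f i y" for y i
  proof -
    have "(\<Sum>j\<in>UNIV. (axis i 1 $ j) *\<^sub>R dx j h (q y)) = (\<Sum>j\<in>UNIV. if j = i then dx j h (q y) else 0)"
      by (intro sum.cong) (auto simp: axis_def)
    then show ?thesis by (simp add: g'_def f_def inner_axis)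
  qed
  have ca: "continuous_on UNIV a"
    using has_derivative_continuous[OF a(1)] by (auto intro!: continuous_at_imp_continuous_on)
  have ch: "continuous_on UNIV (\<lambda>y. h (q y))" "continuous_on UNIV (\<lambda>y. dx i h (q y))" "continuous_on UNIV (\<lambda>y. dt h (q y))" for i
    unfolding q_def using h Ck_on_imp_continuous_on[OF h(1)]
    by (auto intro!: continuous_on_graph continuous_intros simp: One_nat_def)
  have cf: "continuous_on UNIV (f i)" for i
    unfolding f_def using e by (intro continuous_intros ca ch a(2) continuous_on_inverse_reg_norm) auto
  have "Ck_on 1 UNIV g"
    by (rule Ck_on_1I[OF dg]) (use cf g'f in \<open>auto simp: Basis_vec_def\<close>)
  moreover have "compact (fsupp g)"
    unfolding compact_fsupp_iff using compact_fsupp_on_graph[OF h(2), of p] by (auto simp: g_def q_def)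
  moreover have pg: "partial_deriv (axis i 1) g = f i" for i
    using partial_deriv_eq[OF dg] g'f by fastforce
  ultimately show "(\<integral>y. f i y \<partial>lborel) = 0"
    using integral_partial_deriv_zero[of g "axis i 1"] by simp
  show "integrable lborel (f i)"
    using integrable_continuous_compact[OF cf] compact_fsupp_partial_deriv[OF \<open>compact (fsupp g)\<close>, of "axis i 1"]
    by (simp add: pg)
qed

text \<open>\<open>A\<close>, \<open>B\<close>, \<open>C\<close> and \<open>L\<close> stand for the
  second and first time derivative, the value and the Laplacian of the test function,
  \<open>N\<close> for \<open>|y|^2\<close>, and \<open>K\<close> for the inverse regularized
  norm.\<close>

lemma regularized_wave_algebra:
  fixes K N E A B C L :: complex
  shows "K\<^sup>2 * (N + E\<^sup>2) = 1 \<Longrightarrow>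
    K * (A - L) - E\<^sup>2 * K ^ 3 * A + 3 * E\<^sup>2 * K ^ 4 * B - 3 * E\<^sup>2 * K ^ 5 * C
    = - K * L + N * (K ^ 3 * A - 3 * K ^ 4 * B + 3 * K ^ 5 * C) + 3 * (K\<^sup>2 * B - K ^ 3 * C)"
  by algebra

text \<open>Green's identity on the hyperboloid, for the kernel \<open>k\<close>. The last term of
  \<open>f\<close> contains the Laplacian of \<open>k\<close> and concentrates at \<open>p\<close>;
  the two terms before it appear because the hyperboloid, unlike the cone, is not
  characteristic.\<close>

lemma regularized_wave_identity:
  fixes \<phi> :: "spacetime \<Rightarrow> complex" and p :: spacetime
  assumes \<phi>: "Ck_on 2 UNIV \<phi>" "compact (fsupp \<phi>)" and e: "0 < e"
  defines "q \<equiv> \<lambda>y. p + (y, reg_norm e y)" and "k \<equiv> \<lambda>y. inverse (reg_norm e y)"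
  defines "f \<equiv> \<lambda>y. k y *\<^sub>R wave_op \<phi> (q y) - (e\<^sup>2 * k y ^ 3) *\<^sub>R dt (dt \<phi>) (q y)
    + (3 * e\<^sup>2 * k y ^ 4) *\<^sub>R dt \<phi> (q y) - (3 * e\<^sup>2 * k y ^ 5) *\<^sub>R \<phi> (q y)"
  shows "integrable lborel f" "(\<integral>y. f y \<partial>lborel) = 0"
proof -
  have dk: "(k has_derivative (\<lambda>v. - (y \<bullet> v) * k y ^ 3)) (at y)" for y
    unfolding k_def by (rule reg_norm_derivatives(2)[OF e])
  have k2: "k y ^ 2 * ((norm y)\<^sup>2 + e\<^sup>2) = 1" for y
    unfolding k_def by (rule reg_norm_derivatives(3)[OF e])
  have ck: "continuous_on UNIV k" unfolding k_def by (rule continuous_on_inverse_reg_norm[OF e])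
  have \<phi>1: "Ck_on 1 UNIV \<phi>" "Ck_on 1 UNIV (dt \<phi>)" "Ck_on 1 UNIV (dx i \<phi>)" for i
    using Ck_on_mono[OF \<phi>(1), of 1] \<phi>(1) by (auto simp: numeral_2_eq_2 One_nat_def)
  have \<phi>2: "compact (fsupp (partial_deriv b \<phi>))" for b
    by (rule compact_fsupp_partial_deriv[OF \<phi>(2)])
  \<comment> \<open>The functions \<open>f1 i\<close>, \<open>f2 i\<close>, \<open>f3 i\<close> are
    the \<open>i\<close>-th derivatives of \<open>k dx i \<phi>\<close>,
    \<open>y $ i * k^2 dt \<phi>\<close> and \<open>y $ i * k^3 \<phi>\<close> restricted to the
    hyperboloid; here \<open>y $ i * k^3\<close> is minus the \<open>i\<close>-th derivative of
    \<open>k\<close>.\<close>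
  define f1 where "f1 i y = k y *\<^sub>R (dx i (dx i \<phi>) (q y) + (y $ i * k y) *\<^sub>R dt (dx i \<phi>) (q y))
    + (- (y $ i) * k y ^ 3) *\<^sub>R dx i \<phi> (q y)" for i y
  define f2 where "f2 i y = (y $ i * k y ^ 2) *\<^sub>R (dx i (dt \<phi>) (q y) + (y $ i * k y) *\<^sub>R dt (dt \<phi>) (q y))
    + (k y ^ 2 - 2 * (y $ i)\<^sup>2 * k y ^ 4) *\<^sub>R dt \<phi> (q y)" for i y
  define f3 where "f3 i y = (y $ i * k y ^ 3) *\<^sub>R (dx i \<phi> (q y) + (y $ i * k y) *\<^sub>R dt \<phi> (q y))
    + (k y ^ 3 - 3 * (y $ i)\<^sup>2 * k y ^ 5) *\<^sub>R \<phi> (q y)" for i y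
  have c1: "continuous_on UNIV (\<lambda>y. - (y \<bullet> axis j 1) * k y ^ 3)"
    and c2: "continuous_on UNIV (\<lambda>y. (axis j 1 :: real^3) $ i * k y ^ 2 - 2 * (y $ i) * (y \<bullet> axis j 1) * k y ^ 4)"
    and c3: "continuous_on UNIV (\<lambda>y. (axis j 1 :: real^3) $ i * k y ^ 3 - 3 * (y $ i) * (y \<bullet> axis j 1) * k y ^ 5)" for i j
    by (intro continuous_intros ck)+
  have 1: "integrable lborel (f1 i)" "(\<integral>y. f1 i y \<partial>lborel) = 0" for i
    unfolding f1_def[abs_def]
    using graph_divergence[OF \<phi>1(3)[of i] \<phi>2 e dk c1, where p=p and i=i]
    by (simp_all add: q_def k_def inner_axis)
  have d2: "((\<lambda>y. y $ i * k y ^ 2) has_derivative (\<lambda>v. v $ i * k y ^ 2 - 2 * (y $ i) * (y \<bullet> v) * k y ^ 4)) (at y)" for i y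
    by (rule has_derivative_eq_rhs[OF has_derivative_mult[OF bounded_linear.has_derivative[OF bounded_linear_vec_nth has_derivative_ident] has_derivative_power[OF dk]]])
      (auto simp: fun_eq_iff algebra_simps power_numeral_reduce)
  have 2: "integrable lborel (f2 i)" "(\<integral>y. f2 i y \<partial>lborel) = 0" for i
    unfolding f2_def[abs_def]
    using graph_divergence[OF \<phi>1(2) \<phi>2 e d2[of i] c2, where p=p and i=i]
    by (simp_all add: q_def k_def inner_axis power2_eq_square mult_ac)
  have d3: "((\<lambda>y. y $ i * k y ^ 3) has_derivative (\<lambda>v. v $ i * k y ^ 3 - 3 * (y $ i) * (y \<bullet> v) * k y ^ 5)) (at y)" for i y
    by (rule has_derivative_eq_rhs[OF has_derivative_mult[OF bounded_linear.has_derivative[OF bounded_linear_vec_nth has_derivative_ident] has_derivative_power[OF dk]]])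
      (auto simp: fun_eq_iff algebra_simps power_numeral_reduce)
  have 3: "integrable lborel (f3 i)" "(\<integral>y. f3 i y \<partial>lborel) = 0" for i
    unfolding f3_def[abs_def]
    using graph_divergence[OF \<phi>1(1) \<phi>(2) e d3[of i] c3, where p=p and i=i]
    by (simp_all add: q_def k_def inner_axis power2_eq_square mult_ac)
  have f: "f y = (\<Sum>i\<in>UNIV. f2 i y - f1 i y - f3 i y)" for y
  proof -
    let ?K = "complex_of_real (k y)" and ?Z = "complex_of_real (k y) ^ 3 * dt (dt \<phi>) (q y)
      - 3 * complex_of_real (k y) ^ 4 * dt \<phi> (q y) + 3 * complex_of_real (k y) ^ 5 * \<phi> (q y)"
    have "f2 i y - f1 i y - f3 i y = - ?K * dx i (dx i \<phi>) (q y) + complex_of_real ((y $ i)\<^sup>2) * ?Z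
        + (?K\<^sup>2 * dt \<phi> (q y) - ?K ^ 3 * \<phi> (q y))" for i
    proof -
      have c: "dx i (dt \<phi>) = dt (dx i \<phi>)"
        by (rule partial_deriv_commute[OF \<phi>(1)]) auto
      show ?thesis
        by (simp only: f1_def f2_def f3_def c scaleR_conv_of_real of_real_mult of_real_power
            of_real_diff of_real_minus of_real_numeral) algebra
    qed
    then have "(\<Sum>i\<in>UNIV. f2 i y - f1 i y - f3 i y) = - ?K * (\<Sum>i\<in>UNIV. dx i (dx i \<phi>) (q y))
        + complex_of_real (\<Sum>i\<in>UNIV. (y $ i)\<^sup>2) * ?Z + 3 * (?K\<^sup>2 * dt \<phi> (q y) - ?K ^ 3 * \<phi> (q y))"
      by (simp add: sum.distrib sum_distrib_left sum_distrib_right of_real_sum sum_subtractf sum_negf)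
    moreover have n2: "(\<Sum>i\<in>UNIV. (y $ i)\<^sup>2) = (norm y)\<^sup>2"
      by (simp only: power2_norm_eq_inner inner_vec_def) (simp add: power2_eq_square)
    moreover have "?K\<^sup>2 * (complex_of_real ((norm y)\<^sup>2) + (complex_of_real e)\<^sup>2) = 1"
      using arg_cong[OF k2[of y], of complex_of_real] by simp
    from regularized_wave_algebra[OF this]
    have "f y = - ?K * (\<Sum>i\<in>UNIV. dx i (dx i \<phi>) (q y))
        + complex_of_real ((norm y)\<^sup>2) * ?Z + 3 * (?K\<^sup>2 * dt \<phi> (q y) - ?K ^ 3 * \<phi> (q y))"
      unfolding f_def wave_op_def scaleR_conv_of_real of_real_mult of_real_power of_real_numeral .
    ultimately show ?thesis by (simp only:)
  qed
  show "integrable lborel f" unfolding f[abs_def] using 1 2 3 by auto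
  show "(\<integral>y. f y \<partial>lborel) = 0" unfolding f using 1 2 3 by (simp add: Bochner_Integration.integral_sum)
qed

lemma inverse_reg_norm_bounds:
  assumes "0 < e" "y \<noteq> 0"
  shows "0 < inverse (reg_norm e y)" "inverse (reg_norm e y) \<le> 1 / norm y" "e * inverse (reg_norm e y) \<le> 1"
    "inverse (reg_norm e y) \<le> 1 + 1 / (norm y)\<^sup>2" "inverse (reg_norm e y) ^ 2 \<le> 1 / (norm y)\<^sup>2"
proof -
  note b = reg_norm_bounds[OF assms(1), of y]
  show 1: "0 < inverse (reg_norm e y)" using b by simp
  show 2: "inverse (reg_norm e y) \<le> 1 / norm y"
    using b assms by (simp add: inverse_eq_divide frac_le)
  show "e * inverse (reg_norm e y) \<le> 1" using b by (simp add: field_simps)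
  have "0 \<le> (1 / norm y - 1)\<^sup>2 + (1 / norm y)\<^sup>2 + 1" by simp
  then have "1 / norm y \<le> 1 + (1 / norm y)\<^sup>2"
    by (simp add: power2_eq_square algebra_simps)
  with 2 show "inverse (reg_norm e y) \<le> 1 + 1 / (norm y)\<^sup>2" by (simp add: power_one_over)
  show "inverse (reg_norm e y) ^ 2 \<le> 1 / (norm y)\<^sup>2"
    using power_mono[OF 2, of 2] 1 by (simp add: power_one_over)
qed

lemma inverse_reg_norm_limit:
  assumes "e \<longlonglongrightarrow> 0" "y \<noteq> 0"
  shows "(\<lambda>n. inverse (reg_norm (e n) y)) \<longlonglongrightarrow> inverse (norm y)"
  using assms by (intro tendsto_inverse reg_norm_limit) auto

text \<open>The kernels have mass \<open>4 pi\<close> and tend to 0 away from the origin, while the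
  point of evaluation moves on the hyperboloid. It suffices to show that the integral of the kernel
  against the difference to \<open>\<phi> p\<close> tends to 0, by dominated convergence.\<close>

lemma regularized_delta_limit:
  fixes \<phi> :: "spacetime \<Rightarrow> complex"
  assumes \<phi>: "Ck_on 1 UNIV \<phi>" "compact (fsupp \<phi>)" and e: "e \<longlonglongrightarrow> 0" "\<And>n. 0 < e n" "\<And>n. e n \<le> 1"
  shows "(\<lambda>n. \<integral>y. (3 * (e n)\<^sup>2 * inverse (reg_norm (e n) y) ^ 5) *\<^sub>R \<phi> (p + (y, reg_norm (e n) y)) \<partial>lborel)
    \<longlonglongrightarrow> complex_of_real (4 * pi) * \<phi> p"
proof -
  define k where "k n y = inverse (reg_norm (e n) y)" for n y
  define q where "q n y = p + (y, reg_norm (e n) y)" for n y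
  define A where "A n y = 3 * (e n)\<^sup>2 * k n y ^ 5" for n y
  obtain B where B: "B \<ge> 0" "\<And>x. norm (\<phi> x) \<le> B"
    using bounded_continuous_compact[OF Ck_on_imp_continuous_on[OF \<phi>(1)] \<phi>(2)] by blast
  obtain M where M: "M \<ge> 0" "Ckb 1 (\<lambda>_. M) \<phi>"
    using Ckb_of_compact[of "\<lambda>_. 1" 1 \<phi>] \<phi> by auto
  define L where "L = real DIM(spacetime) * M"
  have L: "L \<ge> 0" "\<And>x y. norm (\<phi> x - \<phi> y) \<le> L * norm (x - y)"
    using M Ckb_lipschitz[OF M(2)] by (auto simp: L_def)
  have kb: "0 < k n y" "k n y \<le> 1 / norm y" "e n * k n y \<le> 1" "k n y ^ 2 \<le> 1 / (norm y)\<^sup>2"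
    if "y \<noteq> 0" for n y
    unfolding k_def by (rule inverse_reg_norm_bounds[OF e(2) that])+
  have Aint: "integrable lborel (A n)" "(\<integral>y. A n y \<partial>lborel) = 4 * pi" for n
    using integral_regularized_delta[OF e(2)[of n]] by (simp_all add: A_def[abs_def] k_def)
  have ck: "continuous_on UNIV (k n)" for n
    unfolding k_def by (rule continuous_on_inverse_reg_norm[OF e(2)])
  have cphi: "continuous_on UNIV (\<lambda>y. \<phi> (q n y))" for n
    unfolding q_def by (intro continuous_on_graph Ck_on_imp_continuous_on[OF \<phi>(1)] continuous_intros)
  have "A n \<in> borel_measurable borel" "(\<lambda>y. \<phi> (q n y)) \<in> borel_measurable borel" for n
    unfolding A_def[abs_def] by (intro borel_measurable_continuous_onI continuous_intros ck cphi)+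
  note meas[measurable] = this
  have Bq: "norm (\<phi> (q n y)) \<le> B" for n y by (rule B(2))
  have intA: "integrable lborel (\<lambda>y. A n y *\<^sub>R \<phi> (q n y))" for n
  proof (rule Bochner_Integration.integrable_bound)
    show "integrable lborel (\<lambda>y. B * A n y)" using Aint by simp
    show "AE y in lborel. norm (A n y *\<^sub>R \<phi> (q n y)) \<le> norm (B * A n y)"
      using B(1) Bq by (auto simp: abs_mult mult.commute[of B] intro!: mult_left_mono)
  qed measurable
  have "(\<lambda>n. \<integral>y. A n y *\<^sub>R (\<phi> (q n y) - \<phi> p) \<partial>lborel) \<longlonglongrightarrow> (\<integral>y. 0 \<partial>(lborel :: (real^3) measure))"
  proof (rule integral_dominated_convergence)
    show "integrable lborel (\<lambda>y. 12 * (B + L) * sing_bound y)" using integrable_sing_bound by simp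
    have AE0: "AE y in lborel. y \<noteq> (0 :: real^3)" by (rule AE_lborel_singleton)
    show "AE y in lborel. (\<lambda>n. A n y *\<^sub>R (\<phi> (q n y) - \<phi> p)) \<longlonglongrightarrow> 0"
      using AE0
    proof eventually_elim
      case (elim y)
      have "(\<lambda>n. A n y) \<longlonglongrightarrow> 3 * 0\<^sup>2 * inverse (norm y) ^ 5"
        unfolding A_def k_def by (intro tendsto_intros e inverse_reg_norm_limit elim)
      moreover have "(\<lambda>n. \<phi> (q n y)) \<longlonglongrightarrow> \<phi> (p + (y, norm y))"
        unfolding q_def using Ck_on_imp_continuous_on[OF \<phi>(1)]
        by (rule continuous_on_tendsto_compose) (auto intro!: tendsto_intros reg_norm_limit e)
      ultimately have "(\<lambda>n. A n y *\<^sub>R (\<phi> (q n y) - \<phi> p)) \<longlonglongrightarrow> (3 * 0\<^sup>2 * inverse (norm y) ^ 5) *\<^sub>R (\<phi> (p + (y, norm y)) - \<phi> p)"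
        by (intro tendsto_intros)
      then show ?case by simp
    qed
    show "AE y in lborel. norm (A n y *\<^sub>R (\<phi> (q n y) - \<phi> p)) \<le> 12 * (B + L) * sing_bound y" for n
      using AE0
    proof eventually_elim
      case (elim y)
      let ?r = "norm y"
      note kb = kb[OF elim, where n=n]
      have r: "0 < ?r" using elim by simp
      have k0: "0 \<le> k n y" using kb by simp
      have sb: "0 \<le> sing_bound y" by (simp add: sing_bound_def)
      have Ann: "0 \<le> A n y" using kb(1) by (simp add: A_def)
      show ?case
      proof (cases "?r \<le> 1")
        \<comment> \<open>Near the origin the kernel alone has no integrable majorant. The Lipschitz
          bound supplies a factor \<open>1 / k\<close>, which leaves
          \<open>(e k)^2 k^2 <= 1 / |y|^2\<close>.\<close>
        case True
        have "norm (\<phi> (q n y) - \<phi> p) \<le> L * norm (y, reg_norm (e n) y)"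
          using L(2)[of "q n y" p] by (simp add: q_def)
        also have "norm (y, reg_norm (e n) y) \<le> ?r + reg_norm (e n) y"
          using norm_Pair_le[of y "reg_norm (e n) y"] reg_norm_bounds(1)[OF e(2), of y n] by simp
        also have "\<dots> \<le> 2 * reg_norm (e n) y" using reg_norm_bounds(2)[OF e(2), of y n] by simp
        finally have "norm (\<phi> (q n y) - \<phi> p) \<le> L * (2 * reg_norm (e n) y)" using L(1) by (simp add: mult_left_mono)
        then have "A n y * norm (\<phi> (q n y) - \<phi> p) \<le> A n y * (L * (2 * reg_norm (e n) y))"
          using Ann by (rule mult_left_mono)
        also have "\<dots> = 6 * L * (e n * k n y)\<^sup>2 * k n y ^ 2 * (k n y * reg_norm (e n) y)"
          by (simp add: A_def power2_eq_square numeral_eq_Suc)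
        also have "k n y * reg_norm (e n) y = 1"
          unfolding k_def using reg_norm_bounds(1)[OF e(2), of y n] by (intro left_inverse) auto
        also have "6 * L * (e n * k n y)\<^sup>2 * k n y ^ 2 * 1 \<le> 6 * L * 1 * (1 / ?r\<^sup>2) * 1"
          using kb e(2)[of n] L(1) by (intro mult_mono power_le_one) auto
        also have "\<dots> \<le> 6 * L * (2 * sing_bound y)"
        proof -
          have "?r\<^sup>2 \<le> 1" using True r by (simp add: power_le_one)
          then have "1 / ?r\<^sup>2 \<le> 2 * sing_bound y"
            using r by (simp add: sing_bound_def divide_simps add_pos_pos)
          from mult_left_mono[OF this, of "6 * L"] L(1) show ?thesis by simp
        qed
        also have "\<dots> \<le> 12 * (B + L) * sing_bound y"
          using B(1) sb by (simp add: algebra_simps)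
        finally show ?thesis using Ann by simp
      next
        \<comment> \<open>Away from the origin the boundedness of \<open>\<phi>\<close> suffices, as
          the kernel decays like \<open>1 / |y|^4\<close>.\<close>
        case False
        have "norm (\<phi> (q n y) - \<phi> p) \<le> 2 * B"
          using B(2)[of "q n y"] B(2)[of p] norm_triangle_ineq4[of "\<phi> (q n y)" "\<phi> p"] by linarith
        then have "A n y * norm (\<phi> (q n y) - \<phi> p) \<le> A n y * (2 * B)"
          using Ann by (rule mult_left_mono)
        also have "\<dots> = 6 * B * (e n)\<^sup>2 * (k n y * (k n y ^ 2)\<^sup>2)"
          by (simp add: A_def power2_eq_square numeral_eq_Suc)
        also have "\<dots> \<le> 6 * B * 1 * (1 * (1 / ?r\<^sup>2)\<^sup>2)"
        proof -
          have "1 / ?r \<le> 1" using False r by (simp add: field_simps)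
          then have "k n y \<le> 1" using kb(2) by linarith
          then show ?thesis
            using kb e(2,3)[of n] B(1) by (intro mult_mono power_mono power_le_one) auto
        qed
        also have "\<dots> \<le> 6 * B * (2 * sing_bound y)"
        proof -
          have "1 \<le> ?r\<^sup>2" using False by (intro one_le_power) simp
          moreover have "(1 / s)\<^sup>2 \<le> 2 * (1 / (s * (1 + s)))" if "1 \<le> s" for s :: real
          proof -
            have "s * (1 + s) \<le> 2 * (s * s)" using mult_left_mono[of 1 s s] that by (simp add: algebra_simps)
            then have "2 * (1 / (2 * (s * s))) \<le> 2 * (1 / (s * (1 + s)))"
              using that by (intro mult_left_mono divide_left_mono) auto
            then show ?thesis by (simp add: power2_eq_square)
          qed
          ultimately have "(1 / ?r\<^sup>2)\<^sup>2 \<le> 2 * sing_bound y"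
            unfolding sing_bound_def by blast
          from mult_left_mono[OF this, of "6 * B"] B(1) show ?thesis by simp
        qed
        also have "\<dots> \<le> 12 * (B + L) * sing_bound y"
          using L(1) sb by (simp add: algebra_simps)
        finally show ?thesis using Ann by simp
      qed
    qed
  qed measurable
  moreover have "(\<integral>y. A n y *\<^sub>R (\<phi> (q n y) - \<phi> p) \<partial>lborel)
      = (\<integral>y. A n y *\<^sub>R \<phi> (q n y) \<partial>lborel) - complex_of_real (4 * pi) * \<phi> p" for n
    using intA[of n] Aint[of n] by (simp add: scaleR_diff_right scaleR_conv_of_real[of "4 * pi"])
  ultimately have "(\<lambda>n. (\<integral>y. A n y *\<^sub>R \<phi> (q n y) \<partial>lborel) - complex_of_real (4 * pi) * \<phi> p) \<longlonglongrightarrow> 0"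
    by simp
  then show ?thesis unfolding A_def k_def q_def by (rule LIM_zero_cancel)
qed

text \<open>Kirchhoff's formula as a limit of the regularized identity. As \<open>e k <= 1\<close>,
  the terms with \<open>e^2 k^3\<close> and \<open>e^2 k^4\<close> are dominated and vanish in the
  limit; the term with \<open>e^2 k^5\<close> yields \<open>4 pi \<phi> p\<close>.\<close>

theorem potential_wave_op:
  fixes \<phi> :: "spacetime \<Rightarrow> complex"
  assumes \<phi>: "Ck_on 2 UNIV \<phi>" "compact (fsupp \<phi>)"
  shows "potential 1 (wave_op \<phi>) p = \<phi> p"
proof -
  define e where "e n = inverse (real (Suc n))" for n
  have e: "e \<longlonglongrightarrow> 0" "\<And>n. 0 < e n" "\<And>n. e n \<le> 1"
    using LIMSEQ_inverse_real_of_nat by (auto simp: e_def[abs_def] inverse_le_1_iff)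
  define k where "k n y = inverse (reg_norm (e n) y)" for n y
  define q where "q n y = p + (y, reg_norm (e n) y)" for n y
  have \<phi>1: "Ck_on 1 UNIV \<phi>" "Ck_on 1 UNIV (dt \<phi>)" "Ck_on 1 UNIV (dx i \<phi>)" for i
    using Ck_on_mono[OF \<phi>(1), of 1] \<phi>(1) by (auto simp: numeral_2_eq_2 One_nat_def)
  have c: "continuous_on UNIV \<phi>" "continuous_on UNIV (dt \<phi>)" "continuous_on UNIV (dt (dt \<phi>))" "continuous_on UNIV (dx i (dx i \<phi>))" for i
    using \<phi>(1) Ck_on_imp_continuous_on[OF \<phi>1(1)] Ck_on_imp_continuous_on[OF \<phi>1(2)]
    by (auto simp: numeral_2_eq_2)
  have s: "compact (fsupp (partial_deriv b \<phi>))" "compact (fsupp (partial_deriv b (partial_deriv b \<phi>)))" for b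
    using \<phi>(2) compact_fsupp_partial_deriv by blast+
  have cw: "continuous_on UNIV (wave_op \<phi>)"
    unfolding wave_op_def[abs_def] by (intro continuous_intros c)
  have sw: "compact (fsupp (wave_op \<phi>))"
  proof (rule compact_fsupp_subset[OF \<phi>(2)], rule ccontr)
    fix x assume "wave_op \<phi> x \<noteq> 0" and x: "x \<notin> fsupp \<phi>"
    moreover have "partial_deriv b (partial_deriv b \<phi>) x = 0" for b
      using x fsupp_partial_deriv[of b \<phi>] partial_deriv_zero_outside_fsupp by blast
    ultimately show False by (simp add: wave_op_def)
  qed
  have mk: "k n \<in> borel_measurable borel" for n
    unfolding k_def by (intro borel_measurable_continuous_onI continuous_on_inverse_reg_norm e)
  have kb: "0 < k n y" "k n y \<le> 1 / norm y" "e n * k n y \<le> 1"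
    "k n y \<le> 1 + 1 / (norm y)\<^sup>2" "k n y ^ 2 \<le> 1 / (norm y)\<^sup>2" if "y \<noteq> 0" for n y
    unfolding k_def by (rule inverse_reg_norm_bounds[OF e(2) that])+
  have kl: "(\<lambda>n. k n y) \<longlonglongrightarrow> inverse (norm y)" if "y \<noteq> 0" for y
    unfolding k_def by (rule inverse_reg_norm_limit[OF e(1) that])
  have ek: "(e n * k n y)\<^sup>2 \<le> 1" if "y \<noteq> 0" for n y
    using kb[OF that, of n] e(2)[of n] by (intro power_le_one) auto
  have L1: "(\<lambda>n. \<integral>y. k n y *\<^sub>R wave_op \<phi> (q n y) \<partial>lborel)
      \<longlonglongrightarrow> (\<integral>y. inverse (norm y) *\<^sub>R wave_op \<phi> (p + (y, norm y)) \<partial>lborel)"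
    and I1: "\<And>n. integrable lborel (\<lambda>y. k n y *\<^sub>R wave_op \<phi> (q n y))"
    unfolding q_def
    using graph_integral_limit[OF cw sw e(1), where a=k and \<alpha>="\<lambda>y. inverse (norm y)" and C=1 and p=p] mk kb kl
    by (auto simp: abs_of_pos)
  have L2: "(\<lambda>n. \<integral>y. ((e n)\<^sup>2 * k n y ^ 3) *\<^sub>R dt (dt \<phi>) (q n y) \<partial>lborel)
      \<longlonglongrightarrow> (\<integral>y. 0 *\<^sub>R dt (dt \<phi>) (p + (y, norm y)) \<partial>lborel)"
    and I2: "\<And>n. integrable lborel (\<lambda>y. ((e n)\<^sup>2 * k n y ^ 3) *\<^sub>R dt (dt \<phi>) (q n y))"
  proof -
    have "\<bar>(e n)\<^sup>2 * k n y ^ 3\<bar> \<le> 1 * (1 + 1 / (norm y)\<^sup>2)" if "y \<noteq> 0" for n y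
    proof -
      have "(e n)\<^sup>2 * k n y ^ 3 = (e n * k n y)\<^sup>2 * k n y" by (simp add: power2_eq_square power3_eq_cube)
      also have "\<dots> \<le> 1 * (1 + 1 / (norm y)\<^sup>2)"
        using kb[OF that, of n] ek[OF that, of n] by (intro mult_mono) auto
      finally show ?thesis using kb(1)[OF that, of n] by simp
    qed
    moreover have "(\<lambda>n. (e n)\<^sup>2 * k n y ^ 3) \<longlonglongrightarrow> 0" if "y \<noteq> 0" for y
      using tendsto_mult[OF tendsto_power[OF e(1), of 2] tendsto_power[OF kl[OF that], of 3]] by simp
    ultimately show "(\<lambda>n. \<integral>y. ((e n)\<^sup>2 * k n y ^ 3) *\<^sub>R dt (dt \<phi>) (q n y) \<partial>lborel)
      \<longlonglongrightarrow> (\<integral>y. 0 *\<^sub>R dt (dt \<phi>) (p + (y, norm y)) \<partial>lborel)"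
      and "\<And>n. integrable lborel (\<lambda>y. ((e n)\<^sup>2 * k n y ^ 3) *\<^sub>R dt (dt \<phi>) (q n y))"
      unfolding q_def
      using graph_integral_limit[OF c(3) s(2) e(1), where a="\<lambda>n y. (e n)\<^sup>2 * k n y ^ 3" and \<alpha>="\<lambda>y. 0" and C=1 and p=p] mk by auto
  qed
  have L3: "(\<lambda>n. \<integral>y. (3 * (e n)\<^sup>2 * k n y ^ 4) *\<^sub>R dt \<phi> (q n y) \<partial>lborel)
      \<longlonglongrightarrow> (\<integral>y. 0 *\<^sub>R dt \<phi> (p + (y, norm y)) \<partial>lborel)"
    and I3: "\<And>n. integrable lborel (\<lambda>y. (3 * (e n)\<^sup>2 * k n y ^ 4) *\<^sub>R dt \<phi> (q n y))"
  proof -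
    have "\<bar>3 * (e n)\<^sup>2 * k n y ^ 4\<bar> \<le> 3 * (1 + 1 / (norm y)\<^sup>2)" if "y \<noteq> 0" for n y
    proof -
      have "3 * (e n)\<^sup>2 * k n y ^ 4 = 3 * ((e n * k n y)\<^sup>2 * k n y ^ 2)" by (simp add: power2_eq_square numeral_eq_Suc)
      also have "\<dots> \<le> 3 * (1 * (1 + 1 / (norm y)\<^sup>2))"
        using kb[OF that, of n] ek[OF that, of n] by (intro mult_mono) auto
      finally show ?thesis by simp
    qed
    moreover have "(\<lambda>n. 3 * (e n)\<^sup>2 * k n y ^ 4) \<longlonglongrightarrow> 0" if "y \<noteq> 0" for y
      using tendsto_mult[OF tendsto_mult[OF tendsto_const[of "3::real"] tendsto_power[OF e(1), of 2]] tendsto_power[OF kl[OF that], of 4]] by simp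
    ultimately show "(\<lambda>n. \<integral>y. (3 * (e n)\<^sup>2 * k n y ^ 4) *\<^sub>R dt \<phi> (q n y) \<partial>lborel)
      \<longlonglongrightarrow> (\<integral>y. 0 *\<^sub>R dt \<phi> (p + (y, norm y)) \<partial>lborel)"
      and "\<And>n. integrable lborel (\<lambda>y. (3 * (e n)\<^sup>2 * k n y ^ 4) *\<^sub>R dt \<phi> (q n y))"
      unfolding q_def
      using graph_integral_limit[OF c(2) s(1) e(1), where a="\<lambda>n y. 3 * (e n)\<^sup>2 * k n y ^ 4" and \<alpha>="\<lambda>y. 0" and C=3 and p=p] mk by auto
  qed
  have L4: "(\<lambda>n. \<integral>y. (3 * (e n)\<^sup>2 * k n y ^ 5) *\<^sub>R \<phi> (q n y) \<partial>lborel) \<longlonglongrightarrow> complex_of_real (4 * pi) * \<phi> p"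
    unfolding k_def q_def by (rule regularized_delta_limit[OF \<phi>1(1) \<phi>(2) e])
  \<comment> \<open>Integrability of the concentrating term is read off from the identity itself, in
    which all other terms are integrable.\<close>
  have I4: "integrable lborel (\<lambda>y. (3 * (e n)\<^sup>2 * k n y ^ 5) *\<^sub>R \<phi> (q n y))" for n
  proof -
    have "integrable lborel (\<lambda>y. k n y *\<^sub>R wave_op \<phi> (q n y) - ((e n)\<^sup>2 * k n y ^ 3) *\<^sub>R dt (dt \<phi>) (q n y)
        + (3 * (e n)\<^sup>2 * k n y ^ 4) *\<^sub>R dt \<phi> (q n y)
        - (k n y *\<^sub>R wave_op \<phi> (q n y) - ((e n)\<^sup>2 * k n y ^ 3) *\<^sub>R dt (dt \<phi>) (q n y)
        + (3 * (e n)\<^sup>2 * k n y ^ 4) *\<^sub>R dt \<phi> (q n y) - (3 * (e n)\<^sup>2 * k n y ^ 5) *\<^sub>R \<phi> (q n y)))"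
      by (intro Bochner_Integration.integrable_diff Bochner_Integration.integrable_add I1 I2 I3
          regularized_wave_identity(1)[OF \<phi> e(2), of n p, folded k_def q_def])
    then show ?thesis by simp
  qed
  have "(\<integral>y. k n y *\<^sub>R wave_op \<phi> (q n y) \<partial>lborel) = (\<integral>y. ((e n)\<^sup>2 * k n y ^ 3) *\<^sub>R dt (dt \<phi>) (q n y) \<partial>lborel)
      - (\<integral>y. (3 * (e n)\<^sup>2 * k n y ^ 4) *\<^sub>R dt \<phi> (q n y) \<partial>lborel)
      + (\<integral>y. (3 * (e n)\<^sup>2 * k n y ^ 5) *\<^sub>R \<phi> (q n y) \<partial>lborel)" for n
    using regularized_wave_identity(2)[OF \<phi> e(2), of n p, folded k_def q_def] I1[of n] I2[of n] I3[of n] I4[of n]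
    by (simp add: algebra_simps)
  with L1 have "(\<lambda>n. (\<integral>y. ((e n)\<^sup>2 * k n y ^ 3) *\<^sub>R dt (dt \<phi>) (q n y) \<partial>lborel)
      - (\<integral>y. (3 * (e n)\<^sup>2 * k n y ^ 4) *\<^sub>R dt \<phi> (q n y) \<partial>lborel)
      + (\<integral>y. (3 * (e n)\<^sup>2 * k n y ^ 5) *\<^sub>R \<phi> (q n y) \<partial>lborel))
      \<longlonglongrightarrow> (\<integral>y. inverse (norm y) *\<^sub>R wave_op \<phi> (p + (y, norm y)) \<partial>lborel)" by simp
  moreover have "(\<lambda>n. (\<integral>y. ((e n)\<^sup>2 * k n y ^ 3) *\<^sub>R dt (dt \<phi>) (q n y) \<partial>lborel)
      - (\<integral>y. (3 * (e n)\<^sup>2 * k n y ^ 4) *\<^sub>R dt \<phi> (q n y) \<partial>lborel)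
      + (\<integral>y. (3 * (e n)\<^sup>2 * k n y ^ 5) *\<^sub>R \<phi> (q n y) \<partial>lborel)) \<longlonglongrightarrow> complex_of_real (4 * pi) * \<phi> p"
    using tendsto_add[OF tendsto_diff[OF L2 L3] L4] by simp
  ultimately have eq: "(\<integral>y. inverse (norm y) *\<^sub>R wave_op \<phi> (p + (y, norm y)) \<partial>lborel) = complex_of_real (4 * pi) * \<phi> p"
    by (rule LIMSEQ_unique)
  have "potential 1 (wave_op \<phi>) p = (\<integral>y. inverse (4 * pi) *\<^sub>R (inverse (norm y) *\<^sub>R wave_op \<phi> (p + (y, norm y))) \<partial>lborel)"
    by (simp add: potential_def newton_def inverse_eq_divide mult.commute)
  also have "\<dots> = inverse (4 * pi) *\<^sub>R (complex_of_real (4 * pi) * \<phi> p)"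
    by (subst integral_scaleR_right) (simp add: eq)
  also have "\<dots> = \<phi> p" by (simp add: scaleR_conv_of_real)
  finally show ?thesis .
qed

section \<open>Integration by parts in the forward cone\<close>

definition fwd_cone :: "real^3 \<Rightarrow> spacetime set" where
  "fwd_cone a = {(x, t). norm (x - a) < t}"

lemma open_fwd_cone: "open (fwd_cone a)"
  unfolding fwd_cone_def case_prod_beta by (intro open_Collect_less continuous_intros)

lemma sets_fwd_cone [measurable]: "fwd_cone a \<in> sets borel"
  using open_fwd_cone by simp

definition unit_coord :: "3 \<Rightarrow> real^3 \<Rightarrow> real" where
  "unit_coord i y = y $ i * inverse (norm y)"

lemma unit_coord_measurable [measurable]: "unit_coord i \<in> borel_measurable borel"
  unfolding unit_coord_def[abs_def]
  by (intro borel_measurable_times borel_measurable_inverse borel_measurable_norm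
      borel_measurable_continuous_onI continuous_intros measurable_ident_sets)

lemma abs_unit_coord_le: "\<bar>unit_coord i y\<bar> \<le> 1"
  using component_le_norm_cart[of y i]
  by (cases "y = 0") (simp_all add: unit_coord_def abs_mult field_simps)

text \<open>Limits of \<open>graph_divergence\<close> with the factors \<open>1\<close> and
  \<open>y $ i / reg_norm e y\<close>, the latter summed over \<open>i\<close>. Only derivatives
  tangential to the cone occur, and \<open>2 / |y|\<close> is the divergence of the radial unit
  field.\<close>

lemma cone_surface_identities:
  fixes h :: "spacetime \<Rightarrow> complex"
  assumes h: "Ck_on 1 UNIV h" "compact (fsupp h)"
  shows "(\<integral>y. dx i h (p + (y, norm y)) + unit_coord i y *\<^sub>R dt h (p + (y, norm y)) \<partial>lborel) = 0"
    and "(\<integral>y. (\<Sum>i\<in>UNIV. unit_coord i y *\<^sub>R dx i h (p + (y, norm y))) + dt h (p + (y, norm y))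
      + (2 / norm y) *\<^sub>R h (p + (y, norm y)) \<partial>lborel) = 0"
proof -
  define e where "e n = inverse (real (Suc n))" for n
  have e: "e \<longlonglongrightarrow> 0" "\<And>n. 0 < e n"
    using LIMSEQ_inverse_real_of_nat by (auto simp: e_def[abs_def])
  define k where "k n y = inverse (reg_norm (e n) y)" for n y
  have c: "continuous_on UNIV h" "continuous_on UNIV (dt h)" "continuous_on UNIV (dx i h)" for i
    using h(1) Ck_on_imp_continuous_on[OF h(1)] by (auto simp: One_nat_def)
  note s = compact_fsupp_partial_deriv[OF h(2)]
  have mk[measurable]: "k n \<in> borel_measurable borel" for n
    unfolding k_def by (intro borel_measurable_continuous_onI continuous_on_inverse_reg_norm e)
  have my[measurable]: "(\<lambda>y::real^3. y $ i) \<in> borel_measurable borel" for i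
    by (intro borel_measurable_continuous_onI continuous_intros)
  have kb: "0 < k n y" "k n y \<le> 1 / norm y" "k n y \<le> 1 + 1 / (norm y)\<^sup>2" if "y \<noteq> 0" for n y
    unfolding k_def by (rule inverse_reg_norm_bounds[OF e(2) that])+
  have kl: "(\<lambda>n. k n y) \<longlonglongrightarrow> inverse (norm y)" if "y \<noteq> 0" for y
    unfolding k_def by (rule inverse_reg_norm_limit[OF e(1) that])
  have yk: "\<bar>y $ i * k n y\<bar> \<le> 1" if "y \<noteq> 0" for y i n
  proof -
    have "\<bar>y $ i * k n y\<bar> \<le> norm y * (1 / norm y)"
      unfolding abs_mult using kb[OF that, of n] component_le_norm_cart[of y i] by (intro mult_mono) auto
    then show ?thesis using that by simp
  qed
  have ykl: "(\<lambda>n. y $ i * k n y) \<longlonglongrightarrow> unit_coord i y" if "y \<noteq> 0" for y i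
    unfolding unit_coord_def by (intro tendsto_intros kl that)
  have le1: "z \<le> 1 * (1 + 1 / (norm y)\<^sup>2)" if "z \<le> 1" for z and y :: "real^3"
    using that by (simp add: add_increasing2)
  have L1: "(\<lambda>n. \<integral>y. 1 *\<^sub>R dx i h (p + (y, reg_norm (e n) y)) \<partial>lborel) \<longlonglongrightarrow> (\<integral>y. 1 *\<^sub>R dx i h (p + (y, norm y)) \<partial>lborel)"
    and I1: "integrable lborel (\<lambda>y. 1 *\<^sub>R dx i h (p + (y, norm y)))"
      "\<And>n. integrable lborel (\<lambda>y. 1 *\<^sub>R dx i h (p + (y, reg_norm (e n) y)))" for i
    using graph_integral_limit[OF c(3) s e(1), where a="\<lambda>n y. 1" and \<alpha>="\<lambda>y. 1" and C=1 and p=p] by auto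
  have L2: "(\<lambda>n. \<integral>y. (y $ i * k n y) *\<^sub>R dt h (p + (y, reg_norm (e n) y)) \<partial>lborel)
      \<longlonglongrightarrow> (\<integral>y. unit_coord i y *\<^sub>R dt h (p + (y, norm y)) \<partial>lborel)"
    and I2: "integrable lborel (\<lambda>y. unit_coord i y *\<^sub>R dt h (p + (y, norm y)))"
      "\<And>n. integrable lborel (\<lambda>y. (y $ i * k n y) *\<^sub>R dt h (p + (y, reg_norm (e n) y)))" for i
    using graph_integral_limit[OF c(2) s e(1), where a="\<lambda>n y. y $ i * k n y" and \<alpha>="unit_coord i" and C=1 and p=p]
      le1[OF yk] ykl by auto
  have "(\<integral>y. 1 *\<^sub>R dx i h (p + (y, reg_norm (e n) y)) \<partial>lborel)
      + (\<integral>y. (y $ i * k n y) *\<^sub>R dt h (p + (y, reg_norm (e n) y)) \<partial>lborel) = 0" for n i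
    using graph_divergence(2)[OF h e(2)[of n], where a="\<lambda>y. 1" and a'="\<lambda>y v. 0" and p=p and i=i] I1(2) I2(2)
    by (simp add: k_def)
  then have "(\<integral>y. 1 *\<^sub>R dx i h (p + (y, norm y)) \<partial>lborel) + (\<integral>y. unit_coord i y *\<^sub>R dt h (p + (y, norm y)) \<partial>lborel) = 0"
    using tendsto_add[OF L1[of i] L2[of i]] by (simp add: LIMSEQ_const_iff)
  then show "(\<integral>y. dx i h (p + (y, norm y)) + unit_coord i y *\<^sub>R dt h (p + (y, norm y)) \<partial>lborel) = 0"
    using I1(1)[of i] I2(1)[of i] by simp
  have dk: "(k n has_derivative (\<lambda>v. - (y \<bullet> v) * k n y ^ 3)) (at y)" for n y
    unfolding k_def by (rule reg_norm_derivatives(2)[OF e(2)])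
  have ck: "continuous_on UNIV (k n)" for n
    unfolding k_def by (rule continuous_on_inverse_reg_norm[OF e(2)])
  have d: "((\<lambda>y. y $ i * k n y) has_derivative (\<lambda>v. v $ i * k n y - (y $ i) * (y \<bullet> v) * k n y ^ 3)) (at y)" for i y n
    by (rule has_derivative_eq_rhs[OF has_derivative_mult[OF bounded_linear.has_derivative[OF bounded_linear_vec_nth has_derivative_ident] dk]])
      (auto simp: fun_eq_iff algebra_simps)
  have cd: "continuous_on UNIV (\<lambda>y. (axis j 1 :: real^3) $ i * k n y - (y $ i) * (y \<bullet> axis j 1) * k n y ^ 3)" for i j n
    by (intro continuous_intros ck)
  have L3: "(\<lambda>n. \<integral>y. (y $ i * k n y) *\<^sub>R dx i h (p + (y, reg_norm (e n) y)) \<partial>lborel)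
      \<longlonglongrightarrow> (\<integral>y. unit_coord i y *\<^sub>R dx i h (p + (y, norm y)) \<partial>lborel)"
    and I3: "integrable lborel (\<lambda>y. unit_coord i y *\<^sub>R dx i h (p + (y, norm y)))"
      "\<And>n. integrable lborel (\<lambda>y. (y $ i * k n y) *\<^sub>R dx i h (p + (y, reg_norm (e n) y)))" for i
    using graph_integral_limit[OF c(3) s e(1), where a="\<lambda>n y. y $ i * k n y" and \<alpha>="unit_coord i" and C=1 and p=p]
      le1[OF yk] ykl by auto
  have L4: "(\<lambda>n. \<integral>y. (y $ i * k n y)\<^sup>2 *\<^sub>R dt h (p + (y, reg_norm (e n) y)) \<partial>lborel)
      \<longlonglongrightarrow> (\<integral>y. (unit_coord i y)\<^sup>2 *\<^sub>R dt h (p + (y, norm y)) \<partial>lborel)"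
    and I4: "integrable lborel (\<lambda>y. (unit_coord i y)\<^sup>2 *\<^sub>R dt h (p + (y, norm y)))"
      "\<And>n. integrable lborel (\<lambda>y. (y $ i * k n y)\<^sup>2 *\<^sub>R dt h (p + (y, reg_norm (e n) y)))" for i
  proof -
    have "\<bar>(y $ i * k n y)\<^sup>2\<bar> \<le> 1" if "y \<noteq> 0" for y n
      using yk[OF that, of i n] by (simp add: abs_square_le_1)
    then show "(\<lambda>n. \<integral>y. (y $ i * k n y)\<^sup>2 *\<^sub>R dt h (p + (y, reg_norm (e n) y)) \<partial>lborel)
      \<longlonglongrightarrow> (\<integral>y. (unit_coord i y)\<^sup>2 *\<^sub>R dt h (p + (y, norm y)) \<partial>lborel)"
      "integrable lborel (\<lambda>y. (unit_coord i y)\<^sup>2 *\<^sub>R dt h (p + (y, norm y)))"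
      "\<And>n. integrable lborel (\<lambda>y. (y $ i * k n y)\<^sup>2 *\<^sub>R dt h (p + (y, reg_norm (e n) y)))"
      using graph_integral_limit[OF c(2) s e(1), where a="\<lambda>n y. (y $ i * k n y)\<^sup>2" and \<alpha>="\<lambda>y. (unit_coord i y)\<^sup>2" and C=1 and p=p]
        le1 tendsto_power[OF ykl, of _ _ 2] by auto
  qed
  have L5: "(\<lambda>n. \<integral>y. (k n y - (y $ i)\<^sup>2 * k n y ^ 3) *\<^sub>R h (p + (y, reg_norm (e n) y)) \<partial>lborel)
      \<longlonglongrightarrow> (\<integral>y. (inverse (norm y) - (unit_coord i y)\<^sup>2 * inverse (norm y)) *\<^sub>R h (p + (y, norm y)) \<partial>lborel)"
    and I5: "integrable lborel (\<lambda>y. (inverse (norm y) - (unit_coord i y)\<^sup>2 * inverse (norm y)) *\<^sub>R h (p + (y, norm y)))"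
      "\<And>n. integrable lborel (\<lambda>y. (k n y - (y $ i)\<^sup>2 * k n y ^ 3) *\<^sub>R h (p + (y, reg_norm (e n) y)))" for i
  proof -
    have b: "\<bar>k n y - (y $ i)\<^sup>2 * k n y ^ 3\<bar> \<le> 1 * (1 + 1 / (norm y)\<^sup>2)" if "y \<noteq> 0" for y n
    proof -
      have "k n y - (y $ i)\<^sup>2 * k n y ^ 3 = k n y * (1 - (y $ i * k n y)\<^sup>2)"
        by (simp add: power2_eq_square power3_eq_cube algebra_simps)
      then have "\<bar>k n y - (y $ i)\<^sup>2 * k n y ^ 3\<bar> = k n y * \<bar>1 - (y $ i * k n y)\<^sup>2\<bar>"
        using kb(1)[OF that, of n] by (simp add: abs_mult)
      moreover have "(y $ i * k n y)\<^sup>2 \<le> 1" using yk[OF that, of i n] by (simp add: abs_square_le_1)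
      then have "k n y * \<bar>1 - (y $ i * k n y)\<^sup>2\<bar> \<le> k n y * 1"
        using kb(1)[OF that, of n] by (intro mult_left_mono) auto
      ultimately have "\<bar>k n y - (y $ i)\<^sup>2 * k n y ^ 3\<bar> \<le> k n y" by (simp only: mult_1_right)
      from order_trans[OF this kb(3)[OF that]] show ?thesis by simp
    qed
    have "(\<lambda>n. k n y - (y $ i)\<^sup>2 * k n y ^ 3) \<longlonglongrightarrow> inverse (norm y) - (unit_coord i y)\<^sup>2 * inverse (norm y)" if "y \<noteq> 0" for y
    proof -
      have "(\<lambda>n. k n y - (y $ i)\<^sup>2 * k n y ^ 3) \<longlonglongrightarrow> inverse (norm y) - (y $ i)\<^sup>2 * inverse (norm y) ^ 3"
        by (intro tendsto_intros kl that)
      then show ?thesis by (simp add: unit_coord_def power2_eq_square power3_eq_cube mult_ac)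
    qed
    with b show "(\<lambda>n. \<integral>y. (k n y - (y $ i)\<^sup>2 * k n y ^ 3) *\<^sub>R h (p + (y, reg_norm (e n) y)) \<partial>lborel)
      \<longlonglongrightarrow> (\<integral>y. (inverse (norm y) - (unit_coord i y)\<^sup>2 * inverse (norm y)) *\<^sub>R h (p + (y, norm y)) \<partial>lborel)"
      "integrable lborel (\<lambda>y. (inverse (norm y) - (unit_coord i y)\<^sup>2 * inverse (norm y)) *\<^sub>R h (p + (y, norm y)))"
      "\<And>n. integrable lborel (\<lambda>y. (k n y - (y $ i)\<^sup>2 * k n y ^ 3) *\<^sub>R h (p + (y, reg_norm (e n) y)))"
      using graph_integral_limit[OF c(1) h(2) e(1), where a="\<lambda>n y. k n y - (y $ i)\<^sup>2 * k n y ^ 3"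
          and \<alpha>="\<lambda>y. inverse (norm y) - (unit_coord i y)\<^sup>2 * inverse (norm y)" and C=1 and p=p]
      by auto
  qed
  have "(\<integral>y. (y $ i * k n y) *\<^sub>R dx i h (p + (y, reg_norm (e n) y)) \<partial>lborel)
      + (\<integral>y. (y $ i * k n y)\<^sup>2 *\<^sub>R dt h (p + (y, reg_norm (e n) y)) \<partial>lborel)
      + (\<integral>y. (k n y - (y $ i)\<^sup>2 * k n y ^ 3) *\<^sub>R h (p + (y, reg_norm (e n) y)) \<partial>lborel) = 0" for n i
  proof -
    have d': "((\<lambda>y. y $ i * k n y) has_derivative (\<lambda>v. v $ i * k n y - (y $ i) * (y \<bullet> v) * k n y ^ 3)) (at y)" for y
      by (rule d)
    have cd': "continuous_on UNIV (\<lambda>y. (axis j 1 :: real^3) $ i * k n y - (y $ i) * (y \<bullet> axis j 1) * k n y ^ 3)" for j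
      by (rule cd)
    have "(y $ i * k n y) *\<^sub>R (dx i h (p + (y, reg_norm (e n) y)) + (y $ i * k n y) *\<^sub>R dt h (p + (y, reg_norm (e n) y)))
        + (axis i 1 $ i * k n y - y $ i * (y \<bullet> axis i 1) * k n y ^ 3) *\<^sub>R h (p + (y, reg_norm (e n) y))
      = (y $ i * k n y) *\<^sub>R dx i h (p + (y, reg_norm (e n) y))
        + (y $ i * k n y)\<^sup>2 *\<^sub>R dt h (p + (y, reg_norm (e n) y))
        + (k n y - (y $ i)\<^sup>2 * k n y ^ 3) *\<^sub>R h (p + (y, reg_norm (e n) y))" for y
      by (simp add: inner_axis scaleR_add_right power2_eq_square[of "y $ i * k n y"] power2_eq_square[of "y $ i"])
    then show ?thesis
      using graph_divergence(2)[OF h e(2)[of n] d' cd', where p=p and i=i, folded k_def] I3(2) I4(2) I5(2)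
      by simp
  qed
  then have Z: "(\<integral>y. unit_coord i y *\<^sub>R dx i h (p + (y, norm y)) \<partial>lborel)
      + (\<integral>y. (unit_coord i y)\<^sup>2 *\<^sub>R dt h (p + (y, norm y)) \<partial>lborel)
      + (\<integral>y. (inverse (norm y) - (unit_coord i y)\<^sup>2 * inverse (norm y)) *\<^sub>R h (p + (y, norm y)) \<partial>lborel) = 0" for i
    using tendsto_add[OF tendsto_add[OF L3[of i] L4[of i]] L5[of i]] by (simp add: LIMSEQ_const_iff)
  have uc: "(\<Sum>i\<in>UNIV. (unit_coord i y)\<^sup>2) = 1" if "y \<noteq> 0" for y
  proof -
    have "(\<Sum>i\<in>UNIV. (y $ i)\<^sup>2) = (norm y)\<^sup>2"
      by (simp only: power2_norm_eq_inner inner_vec_def) (simp add: power2_eq_square)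
    then show ?thesis
      using that by (simp add: unit_coord_def power_mult_distrib sum_distrib_right[symmetric] power_inverse)
  qed
  have "(\<integral>y. (\<Sum>i\<in>UNIV. unit_coord i y *\<^sub>R dx i h (p + (y, norm y))) + dt h (p + (y, norm y))
      + (2 / norm y) *\<^sub>R h (p + (y, norm y)) \<partial>lborel)
    = (\<integral>y. (\<Sum>i\<in>UNIV. unit_coord i y *\<^sub>R dx i h (p + (y, norm y)) + (unit_coord i y)\<^sup>2 *\<^sub>R dt h (p + (y, norm y))
      + (inverse (norm y) - (unit_coord i y)\<^sup>2 * inverse (norm y)) *\<^sub>R h (p + (y, norm y))) \<partial>lborel)"
  proof (rule integral_cong_AE)
    have "AE y in lborel. y \<noteq> (0 :: real^3)" by (rule AE_lborel_singleton)
    then show "AE y in lborel. (\<Sum>i\<in>UNIV. unit_coord i y *\<^sub>R dx i h (p + (y, norm y))) + dt h (p + (y, norm y))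
      + (2 / norm y) *\<^sub>R h (p + (y, norm y)) = (\<Sum>i\<in>UNIV. unit_coord i y *\<^sub>R dx i h (p + (y, norm y)) + (unit_coord i y)\<^sup>2 *\<^sub>R dt h (p + (y, norm y))
      + (inverse (norm y) - (unit_coord i y)\<^sup>2 * inverse (norm y)) *\<^sub>R h (p + (y, norm y)))"
    proof eventually_elim
      case (elim y)
      have "(\<Sum>i\<in>(UNIV::3 set). inverse (norm y) - (unit_coord i y)\<^sup>2 * inverse (norm y)) = 2 / norm y"
      proof -
        have "(\<Sum>i\<in>(UNIV::3 set). inverse (norm y) - (unit_coord i y)\<^sup>2 * inverse (norm y))
            = (\<Sum>i\<in>(UNIV::3 set). inverse (norm y)) - (\<Sum>i\<in>(UNIV::3 set). (unit_coord i y)\<^sup>2) * inverse (norm y)"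
          by (simp only: sum_subtractf sum_distrib_right)
        then show ?thesis using uc[OF elim] by (simp add: inverse_eq_divide)
      qed
      then show ?case
        using uc[OF elim] by (simp add: sum.distrib scaleR_sum_left[symmetric])
    qed
    have "(\<lambda>y. h (p + (y, norm y))) \<in> borel_measurable borel" "(\<lambda>y. dt h (p + (y, norm y))) \<in> borel_measurable borel"
      "(\<lambda>y. dx i h (p + (y, norm y))) \<in> borel_measurable borel" for i
      by (intro borel_measurable_continuous_onI continuous_on_graph c continuous_intros)+
    note [measurable] = this
    show "(\<lambda>y. (\<Sum>i\<in>UNIV. unit_coord i y *\<^sub>R dx i h (p + (y, norm y))) + dt h (p + (y, norm y))
      + (2 / norm y) *\<^sub>R h (p + (y, norm y))) \<in> borel_measurable lborel" by measurable
    show "(\<lambda>y. \<Sum>i\<in>UNIV. unit_coord i y *\<^sub>R dx i h (p + (y, norm y)) + (unit_coord i y)\<^sup>2 *\<^sub>R dt h (p + (y, norm y))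
      + (inverse (norm y) - (unit_coord i y)\<^sup>2 * inverse (norm y)) *\<^sub>R h (p + (y, norm y))) \<in> borel_measurable lborel"
      by measurable
  qed
  also have "\<dots> = 0"
    using Z I3(1) I4(1) I5(1) by (subst Bochner_Integration.integral_sum) auto
  finally show "(\<integral>y. (\<Sum>i\<in>UNIV. unit_coord i y *\<^sub>R dx i h (p + (y, norm y))) + dt h (p + (y, norm y))
      + (2 / norm y) *\<^sub>R h (p + (y, norm y)) \<partial>lborel) = 0" .
qed

section \<open>The divergence theorem in the solid cone\<close>

text \<open>The coordinates \<open>y\<close> and \<open>s\<close> with \<open>t = |y| + s\<close>
  foliate the solid cone by vertical translates of its surface as well as by vertical rays. Time
  derivatives are integrated along rays and tangential ones over the translates, so both orders of
  integration are needed.\<close>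

lemma cone_fubini:
  fixes h :: "spacetime \<Rightarrow> complex" and p :: spacetime
  assumes h: "continuous_on UNIV h" "compact (fsupp h)"
    and \<alpha>: "\<alpha> \<in> borel_measurable borel" "\<And>y. \<bar>\<alpha> y\<bar> \<le> 1"
  defines "F \<equiv> \<lambda>y s. (indicator {0<..} s * \<alpha> y) *\<^sub>R h (p + (y, norm y + s))"
  shows "integrable (lborel \<Otimes>\<^sub>M lborel) (\<lambda>(y, s). F y s)"
    and "(\<integral>y. \<integral>s. F y s \<partial>lborel \<partial>lborel) = (\<integral>s. \<integral>y. F y s \<partial>lborel \<partial>lborel)"
    and "\<And>s. integrable lborel (\<lambda>y. F y s)" and "\<And>y. integrable lborel (\<lambda>s. F y s)"
    and "integrable lborel (\<lambda>y. \<integral>s. F y s \<partial>lborel)" "integrable lborel (\<lambda>s. \<integral>y. F y s \<partial>lborel)"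
proof -
  obtain B where B: "B \<ge> 0" "\<And>x. norm (h x) \<le> B" using bounded_continuous_compact[OF h] by blast
  obtain R where R: "\<And>x. R < norm x \<Longrightarrow> h x = 0" using h(2) unfolding compact_fsupp_iff by blast
  define N where "N = R + norm p"
  \<comment> \<open>In the interior of the cone the compact support bounds both \<open>|y|\<close>
    and \<open>s\<close>.\<close>
  have z: "h (p + (y, norm y + s)) = 0" if "N < norm y \<or> N < s" "0 < s" for y s
  proof (rule R)
    have "norm y \<le> norm (y, norm y + s)" by (rule norm_fst_le)
    moreover have "s \<le> norm (y, norm y + s)"
      using norm_snd_le[of "norm y + s" y] norm_ge_zero[of y] unfolding real_norm_def by linarith
    moreover have "norm (y, norm y + s) \<le> norm (p + (y, norm y + s)) + norm p"
      using norm_triangle_ineq4[of "p + (y, norm y + s)" p] by simp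
    ultimately show "R < norm (p + (y, norm y + s))" using that by (auto simp: N_def)
  qed
  have c: "continuous_on UNIV (\<lambda>z::(real^3) \<times> real. h (p + (fst z, norm (fst z) + snd z)))"
    by (rule continuous_on_compose2[OF h(1)]) (auto intro!: continuous_intros)
  have [measurable]: "\<alpha> \<in> borel_measurable borel" by fact
  have mh: "(\<lambda>z::(real^3) \<times> real. h (p + (fst z, norm (fst z) + snd z))) \<in> borel_measurable (lborel \<Otimes>\<^sub>M lborel)"
    unfolding lborel_prod using borel_measurable_continuous_onI[OF c] by simp
  have m: "(\<lambda>(y, s). F y s) \<in> borel_measurable (lborel \<Otimes>\<^sub>M lborel)"
    unfolding F_def case_prod_beta
    by (intro borel_measurable_scaleR mh) measurable
  show int: "integrable (lborel \<Otimes>\<^sub>M lborel) (\<lambda>(y, s). F y s)"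
  proof (rule Bochner_Integration.integrable_bound[OF _ m])
    have "integrable lborel (\<lambda>z::(real^3) \<times> real. indicator (cball 0 N \<times> {0..N}) z *\<^sub>R B)"
      by (intro borel_integrable_compact compact_Times) auto
    then show "integrable (lborel \<Otimes>\<^sub>M lborel) (\<lambda>z::(real^3) \<times> real. indicator (cball 0 N \<times> {0..N}) z *\<^sub>R B)"
      unfolding lborel_prod .
    have "norm (F y s) \<le> indicator (cball 0 N \<times> {0..N}) (y, s) *\<^sub>R B" for y s
    proof (cases "0 < s \<and> norm y \<le> N \<and> s \<le> N")
      case True
      have "\<bar>\<alpha> y\<bar> * norm (h (p + (y, norm y + s))) \<le> 1 * B"
        using \<alpha>(2) B by (intro mult_mono) auto
      then show ?thesis using True by (simp add: F_def indicator_def)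
    next
      case False
      then have "F y s = 0" using z[of y s] by (auto simp: F_def indicator_def)
      then show ?thesis using B(1) by simp
    qed
    then show "AE z in lborel \<Otimes>\<^sub>M lborel. norm (case z of (y, s) \<Rightarrow> F y s) \<le> norm (indicator (cball 0 N \<times> {0..N}) z *\<^sub>R B)"
      using B(1) by (intro AE_I2) (auto simp: case_prod_beta abs_mult)
  qed
  show "(\<integral>y. \<integral>s. F y s \<partial>lborel \<partial>lborel) = (\<integral>s. \<integral>y. F y s \<partial>lborel \<partial>lborel)"
    using lborel_pair.Fubini_integral[OF int] by simp
  show 1: "integrable lborel (\<lambda>y. F y s)" for s
  proof -
    have "continuous_on UNIV (\<lambda>y. h (p + (y, norm y + s)))"
      by (intro continuous_on_graph h continuous_intros)
    moreover obtain N' where "\<And>y. N' < norm y \<Longrightarrow> h (p + (y, norm y + s)) = 0"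
      using compact_fsupp_on_graph[OF h(2), of p] by blast
    ultimately have "integrable lborel (\<lambda>y. h (p + (y, norm y + s)))"
      by (intro integrable_continuous_compact) (auto simp: compact_fsupp_iff)
    then show ?thesis
      by (rule Bochner_Integration.integrable_bound)
        (use \<alpha>(2) borel_measurable_continuous_onI[OF \<open>continuous_on UNIV (\<lambda>y. h (p + (y, norm y + s)))\<close>]
          in \<open>auto simp: F_def indicator_def intro!: mult_left_le_one_le\<close>)
  qed
  show "integrable lborel (\<lambda>s. F y s)" for y
  proof -
    have c: "continuous_on UNIV (\<lambda>s. h (p + (y, norm y + s)))"
      by (rule continuous_on_compose2[OF h(1)]) (auto intro!: continuous_intros)
    have "integrable lborel (\<lambda>s. indicator {0..N} s *\<^sub>R h (p + (y, norm y + s)))"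
      by (intro borel_integrable_compact continuous_on_subset[OF c]) auto
    then show ?thesis
    proof (rule Bochner_Integration.integrable_bound)
      show "F y \<in> borel_measurable lborel"
        using borel_measurable_continuous_onI[OF c] by (simp add: F_def)
      show "AE s in lborel. norm (F y s) \<le> norm (indicator {0..N} s *\<^sub>R h (p + (y, norm y + s)))"
        using z[of y] \<alpha>(2)[of y] by (intro AE_I2) (auto simp: F_def indicator_def intro!: mult_left_le_one_le)
    qed
  qed
  show "integrable lborel (\<lambda>y. \<integral>s. F y s \<partial>lborel)"
    using lborel_pair.integrable_fst[OF int] .
  show "integrable lborel (\<lambda>s. \<integral>y. F y s \<partial>lborel)"
    using lborel_pair.integrable_snd[OF int] .
qed

text \<open>The fundamental theorem of calculus on a ray; compact support removes the upper end. The
  factor \<open>c\<close> will be a component of the radial unit vector, which is constant along the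
  ray.\<close>

lemma ray_dt_integral:
  fixes h :: "spacetime \<Rightarrow> complex"
  assumes h: "Ck_on 1 UNIV h" "compact (fsupp h)"
  shows "(\<integral>s. (indicator {0<..} s * c) *\<^sub>R dt h (p + (y, norm y + s)) \<partial>lborel) = - c *\<^sub>R h (p + (y, norm y))"
proof -
  have dh: "\<And>x. h differentiable (at x)" and ct: "continuous_on UNIV (dt h)" using h(1) by (auto simp: One_nat_def)
  obtain R where R: "\<And>x. R < norm x \<Longrightarrow> h x = 0" using h(2) unfolding compact_fsupp_iff by blast
  define N where "N = \<bar>R\<bar> + norm p + 1"
  have z: "h (p + (y, norm y + s)) = 0" if "N \<le> s" for s
  proof (rule R)
    have "s \<le> norm (y, norm y + s)"
      using norm_snd_le[of "norm y + s" y] norm_ge_zero[of y] unfolding real_norm_def by linarith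
    moreover have "norm (y, norm y + s) \<le> norm (p + (y, norm y + s)) + norm p"
      using norm_triangle_ineq4[of "p + (y, norm y + s)" p] by simp
    ultimately show "R < norm (p + (y, norm y + s))" using that by (auto simp: N_def)
  qed
  have z': "dt h (p + (y, norm y + s)) = 0" if "N \<le> s" for s
  proof -
    have "R + norm p < norm (y, norm y + s)"
      using norm_snd_le[of "norm y + s" y] norm_ge_zero[of y] that unfolding real_norm_def N_def by linarith
    then have "R < norm (p + (y, norm y + s))"
      using norm_triangle_ineq4[of "p + (y, norm y + s)" p] by simp
    then have "p + (y, norm y + s) \<notin> cball 0 R" by (simp only: mem_cball_0 not_le)
    moreover have "fsupp h \<subseteq> cball 0 R" using R by (subst fsupp_subset_iff) (auto simp: dist_norm)
    ultimately show ?thesis using partial_deriv_zero_outside_fsupp by blast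
  qed
  have N: "0 \<le> N" by (simp add: N_def)
  have der: "((\<lambda>s. h (p + (y, norm y + s))) has_vector_derivative dt h (p + (y, norm y + s))) (at s within {0..N})" for s
  proof -
    have "((\<lambda>s. p + (y, norm y + s)) has_derivative (\<lambda>v. (0, v))) (at s within {0..N})"
      by (auto intro!: derivative_eq_intros)
    from has_derivative_compose[OF this spacetime_has_derivative[OF dh]] show ?thesis
      by (simp add: has_vector_derivative_def)
  qed
  have c: "continuous_on UNIV (\<lambda>s. dt h (p + (y, norm y + s)))"
    by (rule continuous_on_compose2[OF ct]) (auto intro!: continuous_intros)
  have "(\<integral>s. indicator {0..N} s *\<^sub>R dt h (p + (y, norm y + s)) \<partial>lborel) = h (p + (y, norm y + N)) - h (p + (y, norm y + 0))"
    using der by (intro integral_FTC_atLeastAtMost N continuous_on_subset[OF c]) auto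
  also have "\<dots> = - h (p + (y, norm y))" using z[of N] by simp
  finally have I: "(\<integral>s. indicator {0..N} s *\<^sub>R dt h (p + (y, norm y + s)) \<partial>lborel) = - h (p + (y, norm y))" .
  have "(\<integral>s. (indicator {0<..} s * c) *\<^sub>R dt h (p + (y, norm y + s)) \<partial>lborel)
      = (\<integral>s. c *\<^sub>R (indicator {0..N} s *\<^sub>R dt h (p + (y, norm y + s))) \<partial>lborel)"
  proof (rule integral_cong_AE)
    have "AE s in lborel. s \<noteq> (0 :: real)" by (rule AE_lborel_singleton)
    then show "AE s in lborel. (indicator {0<..} s * c) *\<^sub>R dt h (p + (y, norm y + s))
        = c *\<^sub>R (indicator {0..N} s *\<^sub>R dt h (p + (y, norm y + s)))"
      by eventually_elim (use z' in \<open>auto simp: indicator_def\<close>)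
  qed (use borel_measurable_continuous_onI[OF c] in auto)
  also have "\<dots> = c *\<^sub>R (- h (p + (y, norm y)))" by (subst integral_scaleR_right) (simp add: I)
  finally show ?thesis by simp
qed

text \<open>The change to \<open>y\<close> and \<open>s\<close> is a translation in \<open>x\<close>
  followed, for each fixed \<open>y\<close>, by a translation in \<open>t\<close>. Thus no Jacobian
  arises.\<close>

lemma cone_integral_rays:
  fixes h :: "spacetime \<Rightarrow> complex"
  assumes h: "continuous_on UNIV h" "compact (fsupp h)"
  shows "(\<integral>z. indicator (fwd_cone a) z *\<^sub>R h z \<partial>lborel)
    = (\<integral>y. \<integral>s. (indicator {0<..} s * 1) *\<^sub>R h ((a, 0) + (y, norm y + s)) \<partial>lborel \<partial>lborel)"
    and "integrable lborel (\<lambda>z. indicator (fwd_cone a) z *\<^sub>R h z)"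
proof -
  show int: "integrable lborel (\<lambda>z. indicator (fwd_cone a) z *\<^sub>R h z)"
    by (rule Bochner_Integration.integrable_bound[OF integrable_continuous_compact[OF h]])
      (use borel_measurable_continuous_onI[OF h(1)] in \<open>auto simp: indicator_def\<close>)
  have "(\<integral>z. indicator (fwd_cone a) z *\<^sub>R h z \<partial>lborel) = (\<integral>x. \<integral>t. indicator (fwd_cone a) (x, t) *\<^sub>R h (x, t) \<partial>lborel \<partial>lborel)"
    using lborel_pair.integral_fst'[of "\<lambda>z. indicator (fwd_cone a) z *\<^sub>R h z"] int by (simp add: lborel_prod)
  also have "\<dots> = (\<integral>y. \<integral>t. indicator (fwd_cone a) (y + a, t) *\<^sub>R h (y + a, t) \<partial>lborel \<partial>lborel)"
    by (rule integral_lborel_translate(1)[symmetric])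
  also have "\<dots> = (\<integral>y. \<integral>s. indicator (fwd_cone a) (y + a, s + norm y) *\<^sub>R h (y + a, s + norm y) \<partial>lborel \<partial>lborel)"
    by (intro Bochner_Integration.integral_cong refl integral_lborel_translate(1)[symmetric])
  also have "\<dots> = (\<integral>y. \<integral>s. (indicator {0<..} s * 1) *\<^sub>R h ((a, 0) + (y, norm y + s)) \<partial>lborel \<partial>lborel)"
    by (intro Bochner_Integration.integral_cong refl) (auto simp: fwd_cone_def indicator_def add_ac)
  finally show "(\<integral>z. indicator (fwd_cone a) z *\<^sub>R h z \<partial>lborel)
    = (\<integral>y. \<integral>s. (indicator {0<..} s * 1) *\<^sub>R h ((a, 0) + (y, norm y + s)) \<partial>lborel \<partial>lborel)" .
qed

lemma cone_integral_dt:
  fixes h :: "spacetime \<Rightarrow> complex"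
  assumes h: "Ck_on 1 UNIV h" "compact (fsupp h)"
  shows "(\<integral>z. indicator (fwd_cone a) z *\<^sub>R dt h z \<partial>lborel) = - (\<integral>y. h ((a, 0) + (y, norm y)) \<partial>lborel)"
proof -
  have c: "continuous_on UNIV (dt h)" using h(1) by (auto simp: One_nat_def)
  show ?thesis
    unfolding cone_integral_rays[OF c compact_fsupp_partial_deriv[OF h(2)]] ray_dt_integral[OF h] by simp
qed

text \<open>On each translate of the surface the first surface identity trades the space derivative
  for a time derivative times the radial component. That one is integrated along the rays.\<close>

lemma cone_integral_dx:
  fixes h :: "spacetime \<Rightarrow> complex"
  assumes h: "Ck_on 1 UNIV h" "compact (fsupp h)"
  shows "(\<integral>z. indicator (fwd_cone a) z *\<^sub>R dx i h z \<partial>lborel) = (\<integral>y. unit_coord i y *\<^sub>R h ((a, 0) + (y, norm y)) \<partial>lborel)"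
proof -
  have c: "continuous_on UNIV (dt h)" "continuous_on UNIV (dx i h)" using h(1) by (auto simp: One_nat_def)
  note s = compact_fsupp_partial_deriv[OF h(2)]
  let ?p = "(a, 0) :: spacetime"
  note f1 = cone_fubini[OF c(2) s, of "\<lambda>y. 1", simplified]
  note f2 = cone_fubini[OF c(1) s unit_coord_measurable[of i] abs_unit_coord_le]
  have "(\<integral>y. dx i h (?p + (y, norm y + s)) + unit_coord i y *\<^sub>R dt h (?p + (y, norm y + s)) \<partial>lborel) = 0" for s
    using cone_surface_identities(1)[OF h, of i "(a, s)"] by (simp add: add.commute)
  then have 0: "(\<integral>y. indicator {0<..} s *\<^sub>R (dx i h (?p + (y, norm y + s)) + unit_coord i y *\<^sub>R dt h (?p + (y, norm y + s))) \<partial>lborel) = 0" for s :: real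
    by (cases "0 < s") simp_all
  have "(\<integral>y. indicator {0<..} s *\<^sub>R dx i h (?p + (y, norm y + s)) \<partial>lborel)
      + (\<integral>y. (indicator {0<..} s * unit_coord i y) *\<^sub>R dt h (?p + (y, norm y + s)) \<partial>lborel) = 0" for s :: real
    using 0[of s] f1(3)[of s ?p] f2(3)[of s ?p] by (simp add: scaleR_add_right)
  then have "(\<integral>s. \<integral>y. indicator {0<..} s *\<^sub>R dx i h (?p + (y, norm y + s)) \<partial>lborel \<partial>lborel)
      = (\<integral>s. - (\<integral>y. (indicator {0<..} s * unit_coord i y) *\<^sub>R dt h (?p + (y, norm y + s)) \<partial>lborel) \<partial>lborel)"
    by (intro Bochner_Integration.integral_cong refl) (simp add: eq_neg_iff_add_eq_0)
  also have "\<dots> = - (\<integral>y. \<integral>s. (indicator {0<..} s * unit_coord i y) *\<^sub>R dt h (?p + (y, norm y + s)) \<partial>lborel \<partial>lborel)"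
    using f2(2)[of ?p] by simp
  also have "\<dots> = (\<integral>y. unit_coord i y *\<^sub>R h (?p + (y, norm y)) \<partial>lborel)"
    unfolding ray_dt_integral[OF h] by simp
  finally show ?thesis
    using f1(2)[of ?p] unfolding cone_integral_rays[OF c(2) s] by simp
qed

text \<open>The light cone is characteristic: the boundary term contains only the tangential
  derivative \<open>L = d_t + d_r\<close>, in the combination \<open>\<psi> L \<phi> - \<phi> L
  \<psi> = L (\<psi> \<phi>) - 2 \<phi> L \<psi>\<close>. The second surface identity replaces
  \<open>L (\<psi> \<phi>)\<close> by \<open>- (2 / |y|) \<psi> \<phi>\<close>, so that only the
  outgoing transport operator of \<open>\<psi>\<close> remains.\<close>

theorem cone_green:
  fixes \<psi> \<phi> :: "spacetime \<Rightarrow> complex"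
  assumes \<psi>: "Ck_on 2 UNIV \<psi>" and \<phi>: "Ck_on 2 UNIV \<phi>" "compact (fsupp \<phi>)"
  shows "(\<integral>z. indicator (fwd_cone a) z *\<^sub>R (\<psi> z * wave_op \<phi> z - wave_op \<psi> z * \<phi> z) \<partial>lborel)
    = 2 * (\<integral>y. \<phi> ((a, 0) + (y, norm y)) * (inverse (norm y) *\<^sub>R \<psi> ((a, 0) + (y, norm y)) + dt \<psi> ((a, 0) + (y, norm y))
      + (\<Sum>i\<in>UNIV. unit_coord i y *\<^sub>R dx i \<psi> ((a, 0) + (y, norm y)))) \<partial>lborel)"
proof -
  let ?p = "(a, 0) :: spacetime"
  have \<psi>1: "Ck_on 1 UNIV \<psi>" and \<phi>1: "Ck_on 1 UNIV \<phi>"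
    using Ck_on_mono[OF \<psi>, of 1] Ck_on_mono[OF \<phi>(1), of 1] by simp_all
  have \<psi>': "Ck_on 1 UNIV (partial_deriv b \<psi>)" and \<phi>': "Ck_on 1 UNIV (partial_deriv b \<phi>)" if "b \<in> Basis" for b
    using \<psi> \<phi>(1) that by (auto simp: numeral_2_eq_2 One_nat_def)
  have d: "\<And>x. \<psi> differentiable (at x)" "\<And>x. \<phi> differentiable (at x)"
    "\<And>x b. b \<in> Basis \<Longrightarrow> partial_deriv b \<psi> differentiable (at x)" "\<And>x b. b \<in> Basis \<Longrightarrow> partial_deriv b \<phi> differentiable (at x)"
    using \<psi> \<phi>(1) by (auto simp: numeral_2_eq_2)
  have c: "continuous_on UNIV \<psi>" "continuous_on UNIV \<phi>"
    "\<And>b. b \<in> Basis \<Longrightarrow> continuous_on UNIV (partial_deriv b \<psi>)" "\<And>b. b \<in> Basis \<Longrightarrow> continuous_on UNIV (partial_deriv b \<phi>)"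
    using Ck_on_imp_continuous_on \<psi>1 \<phi>1 \<psi>' \<phi>' by blast+
  define J where "J b z = \<psi> z * partial_deriv b \<phi> z - partial_deriv b \<psi> z * \<phi> z" for b z
  have J1: "Ck_on 1 UNIV (J b)" if "b \<in> Basis" for b
    unfolding J_def[abs_def] by (intro Ck_on_diff Ck_on_mult \<psi>1 \<phi>1 \<psi>' \<phi>' that)
  have J2: "compact (fsupp (J b))" for b
    by (rule compact_fsupp_subset[OF \<phi>(2)], rule ccontr)
      (simp add: J_def fsupp_zero partial_deriv_zero_outside_fsupp)
  have pJ: "partial_deriv b (J b) z = \<psi> z * partial_deriv b (partial_deriv b \<phi>) z - partial_deriv b (partial_deriv b \<psi>) z * \<phi> z"
    if "b \<in> Basis" for b z
    unfolding J_def[abs_def]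
    using that d by (subst partial_deriv_diff) (auto simp: partial_deriv_mult intro!: differentiable_mult)
  have cJ: "continuous_on UNIV (J b)" "continuous_on UNIV (partial_deriv b (J b))" if "b \<in> Basis" for b
    using J1[OF that] Ck_on_imp_continuous_on[OF J1[OF that]] that by (auto simp: One_nat_def)
  have eq: "\<psi> z * wave_op \<phi> z - wave_op \<psi> z * \<phi> z = dt (J (0, 1)) z - (\<Sum>i\<in>UNIV. dx i (J (axis i 1, 0)) z)" for z
    by (simp add: pJ wave_op_def sum_subtractf sum_distrib_left sum_distrib_right algebra_simps)
  \<comment> \<open>The integrand is the divergence of the current \<open>J\<close> with the
    signature of the wave operator.\<close>
  have "(\<integral>z. indicator (fwd_cone a) z *\<^sub>R (\<psi> z * wave_op \<phi> z - wave_op \<psi> z * \<phi> z) \<partial>lborel)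
      = (\<integral>z. indicator (fwd_cone a) z *\<^sub>R dt (J (0, 1)) z \<partial>lborel)
        - (\<Sum>i\<in>UNIV. \<integral>z. indicator (fwd_cone a) z *\<^sub>R dx i (J (axis i 1, 0)) z \<partial>lborel)"
  proof -
    have i: "integrable lborel (\<lambda>z. indicator (fwd_cone a) z *\<^sub>R partial_deriv b (J b) z)" if "b \<in> Basis" for b
      by (rule cone_integral_rays(2)[OF cJ(2)[OF that] compact_fsupp_partial_deriv[OF J2]])
    show ?thesis
      by (simp only: eq scaleR_diff_right scaleR_sum_right dx_dt_Basis
          Bochner_Integration.integral_diff[OF i Bochner_Integration.integrable_sum[OF i]]
          Bochner_Integration.integral_sum[OF i])
  qed
  also have "\<dots> = - (\<integral>y. J (0, 1) (?p + (y, norm y)) \<partial>lborel)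
        - (\<Sum>i\<in>UNIV. \<integral>y. unit_coord i y *\<^sub>R J (axis i 1, 0) (?p + (y, norm y)) \<partial>lborel)"
    using cone_integral_dt[OF J1 J2] cone_integral_dx[OF J1 J2] by simp
  also have "\<dots> = - (\<integral>y. J (0, 1) (?p + (y, norm y)) + (\<Sum>i\<in>UNIV. unit_coord i y *\<^sub>R J (axis i 1, 0) (?p + (y, norm y))) \<partial>lborel)"
  proof -
    have "integrable lborel (\<lambda>y. 1 *\<^sub>R J (0, 1) (?p + (y, norm y)))"
      "integrable lborel (\<lambda>y. unit_coord i y *\<^sub>R J (axis i 1, 0) (?p + (y, norm y)))" for i
      using graph_integral_limit(2)[OF cJ(1) J2, of _ "\<lambda>n. 0" "\<lambda>n y. 1" "\<lambda>y. 1" 1 ?p]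
        graph_integral_limit(2)[OF cJ(1) J2, of _ "\<lambda>n. 0" "\<lambda>n. unit_coord i" "unit_coord i" 1 ?p]
        order_trans[OF abs_unit_coord_le] by (auto simp: add_increasing2)
    then show ?thesis by (subst Bochner_Integration.integral_add) (auto simp: Bochner_Integration.integral_sum)
  qed
  also have "\<dots> = 2 * (\<integral>y. \<phi> (?p + (y, norm y)) * (inverse (norm y) *\<^sub>R \<psi> (?p + (y, norm y)) + dt \<psi> (?p + (y, norm y))
      + (\<Sum>i\<in>UNIV. unit_coord i y *\<^sub>R dx i \<psi> (?p + (y, norm y)))) \<partial>lborel)"
  proof -
    define h where "h z = \<psi> z * \<phi> z" for z
    have h: "Ck_on 1 UNIV h" "compact (fsupp h)"
      unfolding h_def[abs_def] by (intro Ck_on_mult \<psi>1 \<phi>1, rule compact_fsupp_subset[OF \<phi>(2)])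
        (use fsupp_zero[of _ \<phi>] in auto)
    have ph: "partial_deriv b h z = partial_deriv b \<psi> z * \<phi> z + \<psi> z * partial_deriv b \<phi> z" for b z
      unfolding h_def[abs_def] by (rule partial_deriv_mult[OF d(1,2)])
    let ?S = "\<lambda>y. (\<Sum>i\<in>UNIV. unit_coord i y *\<^sub>R dx i h (?p + (y, norm y))) + dt h (?p + (y, norm y))
      + (2 / norm y) *\<^sub>R h (?p + (y, norm y))"
    let ?X = "\<lambda>y. \<phi> (?p + (y, norm y)) * (inverse (norm y) *\<^sub>R \<psi> (?p + (y, norm y)) + dt \<psi> (?p + (y, norm y))
      + (\<Sum>i\<in>UNIV. unit_coord i y *\<^sub>R dx i \<psi> (?p + (y, norm y))))"
    have id: "J (0, 1) (?p + (y, norm y)) + (\<Sum>i\<in>UNIV. unit_coord i y *\<^sub>R J (axis i 1, 0) (?p + (y, norm y)))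
      = ?S y - 2 * ?X y" for y
      by (simp add: J_def ph h_def scaleR_conv_of_real sum.distrib sum_distrib_left sum_distrib_right sum_subtractf
          inverse_eq_divide algebra_simps)
    have ch: "continuous_on UNIV h" "\<And>b. b \<in> Basis \<Longrightarrow> continuous_on UNIV (partial_deriv b h)"
      using h(1) Ck_on_imp_continuous_on[OF h(1)] by (auto simp: One_nat_def)
    have le: "\<bar>2 / norm y\<bar> \<le> 2 * (1 + 1 / (norm y)\<^sup>2)" if "y \<noteq> 0" for y :: "real^3"
    proof -
      have "0 \<le> (1 / norm y - 1)\<^sup>2 + (1 / norm y)\<^sup>2 + 1" by simp
      then show ?thesis by (simp add: power2_eq_square algebra_simps)
    qed
    have "integrable lborel (\<lambda>y. unit_coord i y *\<^sub>R dx i h (?p + (y, norm y)))" for i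
      using graph_integral_limit(2)[OF ch(2) compact_fsupp_partial_deriv[OF h(2)], of _ "\<lambda>n. 0" "\<lambda>n. unit_coord i" "unit_coord i" 1 ?p]
        order_trans[OF abs_unit_coord_le] by (auto simp: add_increasing2)
    moreover have "integrable lborel (\<lambda>y. 1 *\<^sub>R dt h (?p + (y, norm y)))"
      using graph_integral_limit(2)[OF ch(2) compact_fsupp_partial_deriv[OF h(2)], of _ "\<lambda>n. 0" "\<lambda>n y. 1" "\<lambda>y. 1" 1 ?p]
      by (auto simp: add_increasing2)
    moreover have "integrable lborel (\<lambda>y. (2 / norm y) *\<^sub>R h (?p + (y, norm y)))"
      using graph_integral_limit(2)[OF ch(1) h(2), of "\<lambda>n. 0" "\<lambda>n y. 2 / norm y" "\<lambda>y. 2 / norm y" 2 ?p] le by auto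
    ultimately have iS: "integrable lborel ?S" by auto
    have "integrable lborel (\<lambda>y. ?S y - (J (0, 1) (?p + (y, norm y)) + (\<Sum>i\<in>UNIV. unit_coord i y *\<^sub>R J (axis i 1, 0) (?p + (y, norm y)))))"
    proof (intro Bochner_Integration.integrable_diff iS Bochner_Integration.integrable_add Bochner_Integration.integrable_sum)
      show "integrable lborel (\<lambda>y. J (0, 1) (?p + (y, norm y)))"
        using graph_integral_limit(2)[OF cJ(1) J2, of _ "\<lambda>n. 0" "\<lambda>n y. 1" "\<lambda>y. 1" 1 ?p] by (auto simp: add_increasing2)
      show "integrable lborel (\<lambda>y. unit_coord i y *\<^sub>R J (axis i 1, 0) (?p + (y, norm y)))" for i
        using graph_integral_limit(2)[OF cJ(1) J2, of _ "\<lambda>n. 0" "\<lambda>n. unit_coord i" "unit_coord i" 1 ?p]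
        order_trans[OF abs_unit_coord_le] by (auto simp: add_increasing2)
    qed
    then have iX: "integrable lborel (\<lambda>y. 2 * ?X y)" unfolding id by simp
    show ?thesis
      unfolding id using iS iX cone_surface_identities(2)[OF h, of ?p] by simp
  qed
  finally show ?thesis .
qed

section \<open>Transport equations along rays\<close>

text \<open>This is the solution \<open>u\<close> of \<open>(k + 1) u + (x - a) . grad u = h\<close>
  that is regular at \<open>a\<close>. Using the unit interval as parameter domain avoids dividing
  by the distance to \<open>a\<close>.\<close>

definition ray_mean :: "nat \<Rightarrow> real^3 \<Rightarrow> (real^3 \<Rightarrow> complex) \<Rightarrow> real^3 \<Rightarrow> complex" where
  "ray_mean k a h x = (\<integral>s. (indicator {0..1} s * s ^ k) *\<^sub>R h (a + s *\<^sub>R (x - a)) \<partial>lborel)"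

text \<open>Means over the ray cost neither derivatives nor constants: a derivative only brings out
  another factor \<open>s\<close>, which is at most 1. The bounds are therefore uniform in
  \<open>a\<close>.\<close>

lemma ray_mean_facts:
  assumes h: "Ckb m (\<lambda>_. A) h"
  shows "Ckb m (\<lambda>_. A) (ray_mean k a h)"
    and "0 < m \<Longrightarrow> b \<in> Basis \<Longrightarrow> partial_deriv b (ray_mean k a h) = ray_mean (Suc k) a (partial_deriv b h)"
    and "integrable lborel (\<lambda>s. (indicator {0..1} s * s ^ k) *\<^sub>R h (a + s *\<^sub>R (x - a)))"
proof -
  have A: "0 \<le> A" using Ckb_weight_nonneg[OF h] .
  \<comment> \<open>\<open>Ckb_compose_linear\<close> needs a contraction for every real
    \<open>s\<close>. Outside the unit interval the indicator annihilates the integrand, so the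
    scaling factor may be set to 0 there.\<close>
  define c where "c s = (if 0 \<le> s \<and> s \<le> 1 then s else 0)" for s :: real
  define f where "f s x = (indicator {0..1} s * s ^ k) *\<^sub>R h (c s *\<^sub>R x + (a - c s *\<^sub>R a))" for s and x :: "real^3"
  have f_eq: "f s x = (indicator {0..1} s * s ^ k) *\<^sub>R h (a + s *\<^sub>R (x - a))" for s x
    by (simp add: f_def c_def indicator_def algebra_simps)
  have lin: "bounded_linear (\<lambda>x::real^3. c s *\<^sub>R x)" "\<And>b::real^3. b \<in> Basis \<Longrightarrow> c s *\<^sub>R b = c s *\<^sub>R b \<and> b \<in> Basis \<and> \<bar>c s\<bar> \<le> 1" for s
    by (auto simp: c_def bounded_linear_scaleR_right)
  let ?w = "\<lambda>(s::real) (x::real^3). indicator {0..1} s * A"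
  have 0: "Ckb m (\<lambda>_. A) (\<lambda>x. h (c s *\<^sub>R x + (a - c s *\<^sub>R a)))" for s
    by (rule Ckb_compose_linear(1)[OF lin h])
  have 1: "Ckb m (?w s) (f s)" for s
  proof -
    have "\<bar>indicator {0..1} s * s ^ k\<bar> * A \<le> indicator {0..1} s * A"
      using A by (auto simp: indicator_def intro!: mult_left_le_one_le power_le_one)
    then show ?thesis
      unfolding f_def by (intro Ckb_mono[OF Ckb_scaleR[OF 0]]) auto
  qed
  have 2: "(\<lambda>s. f s x) \<in> borel_measurable lborel" for x
  proof -
    have "continuous_on UNIV (\<lambda>s::real. h (a + s *\<^sub>R (x - a)))"
      by (rule continuous_on_compose2[OF Ckb_continuous[OF h]]) (auto intro!: continuous_intros)
    from borel_measurable_continuous_onI[OF this] show ?thesis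
      unfolding f_eq by measurable
  qed
  have int: "integrable lborel (\<lambda>s::real. indicator {0..1} s * A)"
    using borel_integrable_compact[of "{0..1::real}" "\<lambda>_. A"] by (simp add: mult.commute)
  have 3: "\<exists>r>0. \<exists>g. integrable lborel g \<and> (\<forall>s. \<forall>x\<in>ball p r. ?w s x \<le> g s)" for p
  proof (intro exI conjI ballI allI)
    show "(0::real) < 1" by simp
    show "integrable lborel (\<lambda>s::real. indicator {0..1} s * A)" by (rule int)
  qed auto
  have 4: "(\<integral>\<^sup>+ s. ennreal (?w s x) \<partial>lborel) \<le> ennreal A" for x :: "real^3"
  proof -
    have "(\<integral>\<^sup>+ s. ennreal (?w s x) \<partial>lborel) = (\<integral>\<^sup>+ s. ennreal A * indicator {0..1::real} s \<partial>lborel)"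
      by (intro nn_integral_cong) (auto simp: indicator_def)
    also have "\<dots> = ennreal A" by (subst nn_integral_cmult_indicator) auto
    finally show ?thesis by simp
  qed
  note * = Ckb_integral[where f=f and w="?w", OF 1 2 3 4 A]
  have eq: "ray_mean k a h = (\<lambda>x. \<integral>s. f s x \<partial>lborel)"
    unfolding ray_mean_def[abs_def] f_eq ..
  show "Ckb m (\<lambda>_. A) (ray_mean k a h)" unfolding eq by (rule *(1))
  have "integrable lborel (\<lambda>s. f s x)"
    using Ckb_bound[OF 1] A
    by (intro Bochner_Integration.integrable_bound[OF int 2]) (auto intro!: order_trans[OF _ abs_ge_self])
  then show "integrable lborel (\<lambda>s. (indicator {0..1} s * s ^ k) *\<^sub>R h (a + s *\<^sub>R (x - a)))"
    unfolding f_eq .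
  assume m: "0 < m" and b: "b \<in> Basis"
  have dh: "\<And>x. h differentiable (at x)" using Ckb_order_mono[OF h, of "Suc 0"] m by auto
  have "partial_deriv b (f s) x = (indicator {0..1} s * s ^ Suc k) *\<^sub>R partial_deriv b h (a + s *\<^sub>R (x - a))" for s x
  proof -
    have "(\<lambda>x. h (c s *\<^sub>R x + (a - c s *\<^sub>R a))) differentiable (at x)"
      using Ckb_order_mono[OF 0[of s], of "Suc 0"] m by auto
    then have "partial_deriv b (f s) x = (indicator {0..1} s * s ^ k) *\<^sub>R (c s *\<^sub>R partial_deriv b h (c s *\<^sub>R x + (a - c s *\<^sub>R a)))"
      unfolding f_def by (simp add: partial_deriv_scaleR Ckb_compose_linear(2)[OF lin dh b])
    then show ?thesis by (simp add: c_def indicator_def algebra_simps)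
  qed
  then show "partial_deriv b (ray_mean k a h) = ray_mean (Suc k) a (partial_deriv b h)"
    unfolding eq *(2)[OF m b] by (simp add: ray_mean_def[abs_def])
qed

text \<open>Integrate the derivative of
  \<open>s ^ Suc k *\<^sub>R h (a + s *\<^sub>R (x - a))\<close> over the unit interval: the end
  point 1 gives \<open>h x\<close>, and the positive power removes the end point 0.\<close>

lemma ray_mean_transport:
  assumes h: "Ckb 1 (\<lambda>_. A) h"
  shows "of_nat (Suc k) * ray_mean k a h x
    + (\<Sum>i\<in>UNIV. ((x - a) $ i) *\<^sub>R partial_deriv (axis i 1) (ray_mean k a h) x) = h x"
proof -
  have dh: "\<And>x. h differentiable (at x)" and ch: "continuous_on UNIV h"
    and cd: "\<And>i. continuous_on UNIV (partial_deriv (axis i 1) h)"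
    using h Ckb_continuous[OF h] by (auto simp: One_nat_def)
  have hd: "Ckb 0 (\<lambda>_. A) (partial_deriv (axis i 1) h)" for i using h by (auto simp: One_nat_def)
  define z where "z = x - a"
  define g where "g s = s ^ Suc k *\<^sub>R h (a + s *\<^sub>R z)" for s :: real
  define g' where "g' s = (of_nat (Suc k) * s ^ k) *\<^sub>R h (a + s *\<^sub>R z)
    + s ^ Suc k *\<^sub>R (\<Sum>i\<in>UNIV. (z $ i) *\<^sub>R partial_deriv (axis i 1) h (a + s *\<^sub>R z))" for s :: real
  have der: "(g has_vector_derivative g' s) (at s within {0..1})" for s
  proof -
    have "((\<lambda>s. a + s *\<^sub>R z) has_derivative (\<lambda>v. v *\<^sub>R z)) (at s within {0..1})"
      by (auto intro!: derivative_eq_intros)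
    from has_derivative_compose[OF this has_derivative_partial[OF dh]]
    have d1: "((\<lambda>s. h (a + s *\<^sub>R z)) has_vector_derivative (\<Sum>i\<in>UNIV. (z $ i) *\<^sub>R partial_deriv (axis i 1) h (a + s *\<^sub>R z))) (at s within {0..1})"
      by (simp add: has_vector_derivative_def sum_Basis3 inner_axis scaleR_sum_right)
    have d2: "((\<lambda>s. s ^ Suc k) has_real_derivative of_nat (Suc k) * s ^ k) (at s within {0..1})"
      using DERIV_pow[of "Suc k" s "{0..1}"] by simp
    show ?thesis
      unfolding g_def[abs_def] g'_def using has_vector_derivative_scaleR[OF d2 d1] by (simp only: add.commute)
  qed
  have c1: "continuous_on S (\<lambda>s::real. h (a + s *\<^sub>R z))" "continuous_on S (\<lambda>s::real. partial_deriv (axis i 1) h (a + s *\<^sub>R z))" for S i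
    by (auto intro!: continuous_on_compose2[OF ch] continuous_on_compose2[OF cd] continuous_intros)
  have "(\<integral>s. indicator {0..1} s *\<^sub>R g' s \<partial>lborel) = g 1 - g 0"
    using der unfolding g'_def by (intro integral_FTC_atLeastAtMost) (auto intro!: continuous_intros c1)
  also have "\<dots> = h x" by (simp add: g_def z_def)
  finally have I: "(\<integral>s. indicator {0..1} s *\<^sub>R g' s \<partial>lborel) = h x" .
  have "indicator {0..1} s *\<^sub>R g' s = of_nat (Suc k) * ((indicator {0..1} s * s ^ k) *\<^sub>R h (a + s *\<^sub>R (x - a)))
      + (\<Sum>i\<in>UNIV. (z $ i) *\<^sub>R ((indicator {0..1} s * s ^ Suc k) *\<^sub>R partial_deriv (axis i 1) h (a + s *\<^sub>R (x - a))))" for s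
    by (cases "s \<in> {0..1}")
      (simp_all add: g'_def z_def scaleR_sum_right scaleR_conv_of_real[where 'a=complex] sum_distrib_left mult_ac)
  note eq = this
  have i1: "integrable lborel (\<lambda>s. of_nat (Suc k) * ((indicator {0..1} s * s ^ k) *\<^sub>R h (a + s *\<^sub>R (x - a))))"
    by (intro integrable_mult_right ray_mean_facts(3)[OF h])
  have i2: "integrable lborel (\<lambda>s. (z $ i) *\<^sub>R ((indicator {0..1} s * s ^ Suc k) *\<^sub>R partial_deriv (axis i 1) h (a + s *\<^sub>R (x - a))))" for i
    by (intro integrable_scaleR_right ray_mean_facts(3)[OF hd])
  have "(\<integral>s. indicator {0..1} s *\<^sub>R g' s \<partial>lborel) = of_nat (Suc k) * ray_mean k a h x
      + (\<Sum>i\<in>UNIV. (z $ i) *\<^sub>R ray_mean (Suc k) a (partial_deriv (axis i 1) h) x)"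
    unfolding eq Bochner_Integration.integral_add[OF i1 Bochner_Integration.integrable_sum[OF i2]]
      Bochner_Integration.integral_sum[OF i2] ray_mean_def integral_mult_right_zero integral_scaleR_right ..
  with I show ?thesis
    by (simp add: z_def ray_mean_facts(2)[OF h])
qed

lemma ray_mean_linear:
  assumes "Ckb 0 (\<lambda>_. A) f" "Ckb 0 (\<lambda>_. B) g"
  shows "ray_mean k a (\<lambda>x. f x - g x) = (\<lambda>x. ray_mean k a f x - ray_mean k a g x)"
  using ray_mean_facts(3)[OF assms(1)] ray_mean_facts(3)[OF assms(2)]
  by (auto simp: ray_mean_def fun_eq_iff scaleR_diff_right Bochner_Integration.integral_diff[symmetric] simp del: Bochner_Integration.integral_diff)

section \<open>Functions of space and polynomials\<close>

lemma Ckb_fst: "Ckb k w f \<Longrightarrow> Ckb k (\<lambda>p. w (fst p)) (\<lambda>p :: spacetime. f (fst p))"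
  and dx_fst: "(\<And>x. f differentiable (at x)) \<Longrightarrow> dx i (\<lambda>p. f (fst p)) = (\<lambda>p. partial_deriv (axis i 1) f (fst p))"
  and dt_fst: "(\<And>x. f differentiable (at x)) \<Longrightarrow> dt (\<lambda>p. f (fst p)) = (\<lambda>p. 0)"
  for f :: "real^3 \<Rightarrow> 'b::real_normed_vector"
proof -
  \<comment> \<open>The time direction is sent to 0, i.e. to 0 times a basis vector;
    \<open>axis 1 1\<close> is an arbitrary choice for it.\<close>
  let ?\<alpha> = "\<lambda>b::spacetime. if fst b = 0 then 0 else 1 :: real"
  let ?\<beta> = "\<lambda>b::spacetime. if fst b = 0 then axis 1 1 else fst b"
  have lb: "fst b = ?\<alpha> b *\<^sub>R ?\<beta> b \<and> ?\<beta> b \<in> Basis \<and> \<bar>?\<alpha> b\<bar> \<le> 1" if "b \<in> Basis" for b :: spacetime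
    using that by (auto simp: spacetime_Basis)
  note * = Ckb_compose_linear[OF bounded_linear_fst lb, where v=0, simplified]
  show "Ckb k w f \<Longrightarrow> Ckb k (\<lambda>p. w (fst p)) (\<lambda>p :: spacetime. f (fst p))"
    using *(1)[of k w f] by simp
  show "(\<And>x. f differentiable (at x)) \<Longrightarrow> dx i (\<lambda>p. f (fst p)) = (\<lambda>p. partial_deriv (axis i 1) f (fst p))"
    using *(2)[of f "(axis i 1, 0)"] by (simp add: axis_eq_0_iff)
  show "(\<And>x. f differentiable (at x)) \<Longrightarrow> dt (\<lambda>p. f (fst p)) = (\<lambda>p. 0)"
    using *(2)[of f "(0, 1)"] by simp
qed

lemma linear_Ck:
  fixes l :: "'a::euclidean_space \<Rightarrow> real"
  assumes "bounded_linear l"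
  shows "partial_deriv b (\<lambda>x. complex_of_real (l x + c)) = (\<lambda>x. complex_of_real (l b))"
    and "Ck_on k UNIV (\<lambda>x. complex_of_real (l x + c))"
proof -
  have d: "((\<lambda>x. complex_of_real (l x + c)) has_derivative (\<lambda>v. complex_of_real (l v))) (at x)" for x
    using bounded_linear.has_derivative[OF assms has_derivative_ident]
    by (auto intro!: derivative_eq_intros)
  show p: "partial_deriv b (\<lambda>x. complex_of_real (l x + c)) = (\<lambda>x. complex_of_real (l b))" for b
    using partial_deriv_eq[OF d] by blast
  show "Ck_on k UNIV (\<lambda>x. complex_of_real (l x + c))"
  proof (cases k)
    case 0
    show ?thesis
      unfolding 0 Ck_on.simps by (intro continuous_intros linear_continuous_on assms)
  next
    case (Suc j)
    show ?thesis
      unfolding Suc Ck_on.simps p using d Ck_on_const by (auto simp: differentiable_def simp del: of_real_add)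
  qed
qed

definition time_coord :: "spacetime \<Rightarrow> complex" where
  "time_coord p = complex_of_real (snd p)"

definition rel_coord :: "real^3 \<Rightarrow> 3 \<Rightarrow> spacetime \<Rightarrow> complex" where
  "rel_coord a i p = complex_of_real ((fst p - a) $ i)"

text \<open>The expansion parameter s, the squared Lorentz distance from \<open>(a, 0)\<close>. It
  is given as a polynomial in coordinate functions so that regularity and derivatives come from the
  product and sum rules.\<close>

definition cone_fun :: "real^3 \<Rightarrow> spacetime \<Rightarrow> complex" where
  "cone_fun a p = time_coord p * time_coord p - (\<Sum>i\<in>UNIV. rel_coord a i p * rel_coord a i p)"

lemma cone_fun_eq: "cone_fun a p = complex_of_real ((snd p)\<^sup>2 - (norm (fst p - a))\<^sup>2)"
proof -
  have "(norm (fst p - a))\<^sup>2 = (\<Sum>i\<in>UNIV. (fst p - a) $ i * (fst p - a) $ i)"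
    by (simp only: power2_norm_eq_inner inner_vec_def) simp
  then show ?thesis by (simp add: cone_fun_def time_coord_def rel_coord_def power2_eq_square)
qed

lemma coord_facts:
  "Ck_on k UNIV time_coord" "Ck_on k UNIV (rel_coord a i)"
  "dt time_coord = (\<lambda>_. 1)" "dx j time_coord = (\<lambda>_. 0)"
  "dt (rel_coord a i) = (\<lambda>_. 0)" "dx j (rel_coord a i) = (\<lambda>_. if i = j then 1 else 0)"
proof -
  have 1: "time_coord = (\<lambda>p. complex_of_real (snd p + 0))" by (simp add: time_coord_def fun_eq_iff)
  have 2: "rel_coord a i = (\<lambda>p. complex_of_real (fst p $ i + - a $ i))" by (simp add: rel_coord_def fun_eq_iff)
  have l: "bounded_linear (\<lambda>p::spacetime. fst p $ i)"
    using bounded_linear_compose[OF bounded_linear_vec_nth bounded_linear_fst] .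
  show "Ck_on k UNIV time_coord" "dt time_coord = (\<lambda>_. 1)" "dx j time_coord = (\<lambda>_. 0)"
    by (simp_all only: 1 linear_Ck[OF bounded_linear_snd] snd_conv of_real_1 of_real_0)
  show "Ck_on k UNIV (rel_coord a i)"
  "dt (rel_coord a i) = (\<lambda>_. 0)" "dx j (rel_coord a i) = (\<lambda>_. if i = j then 1 else 0)"
    by (simp_all only: 2 linear_Ck[OF l] fst_conv zero_index of_real_0) (auto simp: axis_def)
qed

lemma Ck_on_cone_fun: "Ck_on k UNIV (cone_fun a)"
  unfolding cone_fun_def[abs_def] by (intro Ck_on_diff Ck_on_mult Ck_on_sum coord_facts) auto

lemma Ck_on_differentiable: "Ck_on (Suc k) UNIV f \<Longrightarrow> f differentiable (at x)"
  by simp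

lemma partial_deriv_mult_fun:
  fixes f g :: "'a::euclidean_space \<Rightarrow> 'b::real_normed_algebra"
  assumes "Ck_on (Suc 0) UNIV f" "Ck_on (Suc 0) UNIV g"
  shows "partial_deriv b (\<lambda>x. f x * g x) = (\<lambda>x. partial_deriv b f x * g x + f x * partial_deriv b g x)"
  using assms by (intro ext partial_deriv_mult) auto

lemma partial_deriv_add_fun:
  assumes "Ck_on (Suc 0) UNIV f" "Ck_on (Suc 0) UNIV g"
  shows "partial_deriv b (\<lambda>x. f x + g x) = (\<lambda>x. partial_deriv b f x + partial_deriv b g x)"
  using assms by (intro ext partial_deriv_add) auto

lemma partial_deriv_diff_fun:
  assumes "Ck_on (Suc 0) UNIV f" "Ck_on (Suc 0) UNIV g"
  shows "partial_deriv b (\<lambda>x. f x - g x) = (\<lambda>x. partial_deriv b f x - partial_deriv b g x)"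
  using assms by (intro ext partial_deriv_diff) auto

lemma partial_deriv_sum_fun:
  assumes "finite I" "\<And>i. i \<in> I \<Longrightarrow> Ck_on (Suc 0) UNIV (f i)"
  shows "partial_deriv b (\<lambda>x. \<Sum>i\<in>I. f i x) = (\<lambda>x. \<Sum>i\<in>I. partial_deriv b (f i) x)"
  using assms
proof (induction I rule: finite_induct)
  case (insert i I)
  then have "partial_deriv b (\<lambda>x. f i x + (\<Sum>i\<in>I. f i x)) = (\<lambda>x. partial_deriv b (f i) x + partial_deriv b (\<lambda>x. \<Sum>i\<in>I. f i x) x)"
    by (intro partial_deriv_add_fun Ck_on_sum) auto
  with insert show ?case by simp
qed simp

lemma cone_fun_derivs:
  "dt (cone_fun a) = (\<lambda>p. 2 * time_coord p)" "dx i (cone_fun a) = (\<lambda>p. - 2 * rel_coord a i p)"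
proof -
  have *: "partial_deriv b (cone_fun a) = (\<lambda>p. partial_deriv b time_coord p * time_coord p + time_coord p * partial_deriv b time_coord p
      - (\<Sum>i\<in>UNIV. partial_deriv b (rel_coord a i) p * rel_coord a i p + rel_coord a i p * partial_deriv b (rel_coord a i) p))" for b
    unfolding cone_fun_def[abs_def]
    by (subst partial_deriv_diff_fun) (auto intro!: Ck_on_mult Ck_on_sum coord_facts
        simp: partial_deriv_mult_fun[OF coord_facts(1) coord_facts(1)] partial_deriv_sum_fun Ck_on_mult coord_facts partial_deriv_mult_fun[OF coord_facts(2) coord_facts(2)]
        simp del: Ck_on.simps)
  show "dt (cone_fun a) = (\<lambda>p. 2 * time_coord p)" unfolding * by (simp add: coord_facts)
  show "dx i (cone_fun a) = (\<lambda>p. - 2 * rel_coord a i p)"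
    unfolding * by (simp add: coord_facts if_distrib[of "\<lambda>c. c * _"] if_distrib[of "\<lambda>c. _ * c"] sum.distrib cong: if_cong)
qed

lemma wave_op_mult:
  assumes f: "Ck_on 2 UNIV f" and g: "Ck_on 2 UNIV g"
  shows "wave_op (\<lambda>p. f p * g p) p = wave_op f p * g p + f p * wave_op g p
    + 2 * (dt f p * dt g p - (\<Sum>i\<in>UNIV. dx i f p * dx i g p))"
proof -
  have 1: "Ck_on (Suc 0) UNIV f" "Ck_on (Suc 0) UNIV g"
    "\<And>b. b \<in> Basis \<Longrightarrow> Ck_on (Suc 0) UNIV (partial_deriv b f)" "\<And>b. b \<in> Basis \<Longrightarrow> Ck_on (Suc 0) UNIV (partial_deriv b g)"
    using Ck_on_mono[OF f, of "Suc 0"] Ck_on_mono[OF g, of "Suc 0"] f g by (auto simp: numeral_2_eq_2 simp del: Ck_on.simps(2)) (auto simp: numeral_2_eq_2)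
  have 2: "partial_deriv b (partial_deriv b (\<lambda>p. f p * g p)) p = partial_deriv b (partial_deriv b f) p * g p
      + 2 * (partial_deriv b f p * partial_deriv b g p) + f p * partial_deriv b (partial_deriv b g) p" if "b \<in> Basis" for b
    unfolding partial_deriv_mult_fun[OF 1(1,2)]
    using 1(1,2) 1(3)[OF that] 1(4)[OF that] by (subst partial_deriv_add_fun) (auto intro!: Ck_on_mult simp: partial_deriv_mult_fun algebra_simps simp del: Ck_on.simps)
  show ?thesis
    unfolding wave_op_def by (simp add: 2 sum.distrib sum_distrib_left sum_distrib_right algebra_simps sum_subtractf)
qed

text \<open>For s the wave operator gives \<open>2 + 3 * 2\<close>. The Lorentz square of the
  gradient is \<open>4 s\<close>, hence the value for the square is
  \<open>2 * 8 s + 2 * 4 s\<close>. These numbers determine the transport equations below.\<close>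

lemma wave_op_cone_fun: "wave_op (cone_fun a) p = 8"
  "wave_op (\<lambda>p. cone_fun a p * cone_fun a p) p = 24 * cone_fun a p"
proof -
  have c: "(\<lambda>p. complex_of_real c * f p) = (\<lambda>p. (\<lambda>_. complex_of_real c) p * f p)" for c and f :: "spacetime \<Rightarrow> complex" by simp
  have p: "partial_deriv b (\<lambda>p. c * f p) = (\<lambda>p. c * partial_deriv b f p)" if "Ck_on (Suc 0) UNIV f" for b c and f :: "spacetime \<Rightarrow> complex"
    using partial_deriv_mult_fun[OF Ck_on_const that, of b c] by simp
  show 1: "wave_op (cone_fun a) p = 8"
    by (simp only: wave_op_def cone_fun_derivs p coord_facts) simp
  show "wave_op (\<lambda>p. cone_fun a p * cone_fun a p) p = 24 * cone_fun a p"
    unfolding wave_op_mult[OF Ck_on_cone_fun Ck_on_cone_fun] 1 cone_fun_derivs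
    by (simp add: cone_fun_def algebra_simps sum_distrib_left sum.distrib[symmetric])
qed

section \<open>Duality and the Neumann series\<close>

text \<open>Retarded and advanced potentials are adjoint by Fubini, the reflection of
  \<open>y\<close> and a translation in spacetime. The weights of \<open>F\<close> and
  \<open>\<psi>\<close> cancel up to \<open>exp (- l |y|)\<close>, which makes the double integral
  converge absolutely.\<close>

lemma potential_duality:
  assumes F: "continuous_on UNIV F" "\<And>p. norm (F p) \<le> A * exp (l * snd p)" and l: "0 < l"
    and \<psi>: "continuous_on UNIV \<psi>" "compact (fsupp \<psi>)"
  shows "(\<integral>p. potential (-1) F p * \<psi> p \<partial>lborel) = (\<integral>p. F p * potential 1 \<psi> p \<partial>lborel)"
proof -
  have A: "0 \<le> A" using order_trans[OF norm_ge_zero F(2)[of 0]] by simp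
  have "\<exists>B\<ge>0. \<forall>p. norm (\<psi> p) \<le> B * exp (- l * snd p)"
    by (rule weighted_bound_compact) (auto intro!: continuous_intros \<psi>)
  then obtain B where B: "B \<ge> 0" "\<And>p. norm (\<psi> p) \<le> B * exp (- l * snd p)" by blast
  define n where "n = (\<lambda>y. exp (- l * norm y) * newton y)"
  have n: "integrable lborel n" "\<And>y. 0 \<le> n y"
    unfolding n_def using integrable_exp_newton[OF l] newton_nonneg by auto
  have cF: "continuous_on UNIV (\<lambda>z :: spacetime \<times> (real^3). F (fst z + (snd z, - norm (snd z))) * \<psi> (fst z))"
    by (intro continuous_intros continuous_on_compose2[OF F(1)] continuous_on_compose2[OF \<psi>(1)]) auto
  have cG: "continuous_on UNIV (\<lambda>z :: spacetime \<times> (real^3). F (fst z) * \<psi> (fst z + (snd z, norm (snd z))))"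
    by (intro continuous_intros continuous_on_compose2[OF F(1)] continuous_on_compose2[OF \<psi>(1)]) auto
  let ?H = "\<lambda>p y. newton y *\<^sub>R (F (p + (y, - norm y)) * \<psi> p)"
  let ?G = "\<lambda>p y. newton y *\<^sub>R (F p * \<psi> (p + (y, norm y)))"
  have mn: "(\<lambda>z :: spacetime \<times> (real^3). newton (snd z)) \<in> borel_measurable (lborel \<Otimes>\<^sub>M lborel)"
    by measurable
  have mH: "(\<lambda>(p, y). ?H p y) \<in> borel_measurable (lborel \<Otimes>\<^sub>M lborel)"
    and mG: "(\<lambda>(p, y). ?G p y) \<in> borel_measurable (lborel \<Otimes>\<^sub>M lborel)"
    using borel_measurable_continuous_onI[OF cF] borel_measurable_continuous_onI[OF cG] mn
    unfolding case_prod_beta lborel_prod by (auto intro!: borel_measurable_scaleR)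
  obtain R where R: "\<And>p. R < norm p \<Longrightarrow> \<psi> p = 0" using \<psi>(2) unfolding compact_fsupp_iff by blast
  define K where "K = (\<lambda>p::spacetime. indicator (cball 0 R) p * (A * B) :: real)"
  have K: "integrable lborel K" "\<And>p. 0 \<le> K p"
    using borel_integrable_compact[of "cball 0 R :: spacetime set" "\<lambda>_. A * B"] A B
    by (auto simp: K_def indicator_def)
  have bH: "norm (?H p y) \<le> K p * n y" for p y
  proof (cases "norm p \<le> R")
    case True
    have "norm (F (p + (y, - norm y)) * \<psi> p) \<le> A * exp (l * snd (p + (y, - norm y))) * (B * exp (- l * snd p))"
      unfolding norm_mult using A B by (intro mult_mono F(2)) auto
    also have "\<dots> = A * B * exp (- l * norm y)"
      by (simp add: algebra_simps exp_add exp_diff exp_minus field_simps)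
    finally have "newton y * norm (F (p + (y, - norm y)) * \<psi> p) \<le> newton y * (A * B * exp (- l * norm y))"
      using newton_nonneg by (rule mult_left_mono)
    then show ?thesis using True newton_nonneg[of y] by (simp add: K_def n_def mult_ac)
  next
    case False
    then show ?thesis using R[of p] K(2)[of p] n(2)[of y] by simp
  qed
  have int_prod: "integrable (lborel \<Otimes>\<^sub>M lborel) (\<lambda>(p, y). K p * n y)"
    using K n by (intro lborel_pair.Fubini_integrable) (auto intro!: integrable_mult_right)
  have iH: "integrable (lborel \<Otimes>\<^sub>M lborel) (\<lambda>(p, y). ?H p y)"
  proof (rule Bochner_Integration.integrable_bound[OF int_prod mH])
    show "AE z in lborel \<Otimes>\<^sub>M lborel. norm (case z of (p, y) \<Rightarrow> ?H p y) \<le> norm (case z of (p, y) \<Rightarrow> K p * n y)"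
      unfolding real_norm_def case_prod_beta by (intro AE_I2 order_trans[OF bH abs_ge_self])
  qed
  \<comment> \<open>The shift by the null vector \<open>(y, norm y)\<close> carries one integrand
    into the other; the reflection is needed because the two cones open in opposite
    directions.\<close>
  have GH: "?G p y = ?H (p + (y, norm y)) (- y)" for p y
  proof -
    have "p + (y, norm y) + (- y, - norm y) = p" by (cases p) simp
    then show ?thesis by (simp only: newton_def norm_minus_cancel)
  qed
  have bG: "norm (?G p y) \<le> K (p + (y, norm y)) * n y" for p y
    unfolding GH by (rule order_trans[OF bH]) (simp add: n_def newton_def)
  have iG: "integrable (lborel \<Otimes>\<^sub>M lborel) (\<lambda>(p, y). ?G p y)"
  proof -
    have cK: "(\<lambda>z :: spacetime \<times> (real^3). K (fst z + (snd z, norm (snd z)))) \<in> borel_measurable (lborel \<Otimes>\<^sub>M lborel)"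
    proof -
      have 1: "(\<lambda>z :: spacetime \<times> (real^3). fst z + (snd z, norm (snd z))) \<in> borel_measurable borel"
        by (intro borel_measurable_continuous_onI continuous_intros)
      have "K \<in> borel_measurable borel" using borel_measurable_integrable[OF K(1)] by simp
      from measurable_compose[OF 1 this] show ?thesis unfolding lborel_prod by simp
    qed
    have "integrable (lborel \<Otimes>\<^sub>M lborel) (\<lambda>(y, p). K (p + (y, norm y)) * n y)"
    proof (rule lborel_pair.Fubini_integrable)
      show "(\<lambda>(y, p). K (p + (y, norm y)) * n y) \<in> borel_measurable (lborel \<Otimes>\<^sub>M lborel)"
      proof -
        have "K \<in> borel_measurable borel" using borel_measurable_integrable[OF K(1)] by simp
        moreover have "(\<lambda>z :: (real^3) \<times> spacetime. snd z + (fst z, norm (fst z))) \<in> borel_measurable borel"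
          by (intro borel_measurable_continuous_onI continuous_intros)
        ultimately have "(\<lambda>z :: (real^3) \<times> spacetime. K (snd z + (fst z, norm (fst z)))) \<in> borel_measurable (lborel \<Otimes>\<^sub>M lborel)"
          unfolding lborel_prod using measurable_compose by fastforce
        moreover have "(\<lambda>z :: (real^3) \<times> spacetime. n (fst z)) \<in> borel_measurable (lborel \<Otimes>\<^sub>M lborel)"
          unfolding n_def by measurable
        ultimately show ?thesis unfolding case_prod_beta by (rule borel_measurable_times)
      qed
      show "integrable lborel (\<lambda>y. \<integral>p. norm (case (y, p) of (y, p) \<Rightarrow> K (p + (y, norm y)) * n y) \<partial>lborel)"
        using n K by (simp add: abs_mult integral_lborel_translate(1)[of K])
      show "AE y in lborel. integrable lborel (\<lambda>p. case (y, p) of (y, p) \<Rightarrow> K (p + (y, norm y)) * n y)"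
        using K(1) by (simp add: integral_lborel_translate(2))
    qed
    from lborel_pair.integrable_product_swap[OF this]
    have "integrable (lborel \<Otimes>\<^sub>M lborel) (\<lambda>(p, y). K (p + (y, norm y)) * n y)"
      by (simp add: case_prod_beta)
    then show ?thesis
    proof (rule Bochner_Integration.integrable_bound[OF _ mG])
      show "AE z in lborel \<Otimes>\<^sub>M lborel. norm (case z of (p, y) \<Rightarrow> ?G p y) \<le> norm (case z of (p, y) \<Rightarrow> K (p + (y, norm y)) * n y)"
        unfolding real_norm_def case_prod_beta by (intro AE_I2 order_trans[OF bG abs_ge_self])
    qed
  qed
  have mK: "(\<lambda>y. F (p + (y, - norm y))) \<in> borel_measurable borel" "(\<lambda>y. \<psi> (p + (y, norm y))) \<in> borel_measurable borel" for p
    by (intro borel_measurable_continuous_onI continuous_on_graph F \<psi> continuous_intros)+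
  have "(\<integral>p. potential (-1) F p * \<psi> p \<partial>lborel) = (\<integral>p. \<integral>y. ?H p y \<partial>lborel \<partial>lborel)"
    by (simp add: potential_def mult_scaleR_left[symmetric] del: mult_scaleR_left)
  also have "\<dots> = (\<integral>y. \<integral>p. ?H p y \<partial>lborel \<partial>lborel)"
    using lborel_pair.Fubini_integral[OF iH] by simp
  also have "\<dots> = (\<integral>y. \<integral>p. ?H p (- y) \<partial>lborel \<partial>lborel)"
    using lborel_pair.integrable_snd[OF iH] by (intro integral_lborel_minus[symmetric]) (auto dest: borel_measurable_integrable)
  also have "\<dots> = (\<integral>y. \<integral>p. ?G p y \<partial>lborel \<partial>lborel)"
    unfolding GH by (intro Bochner_Integration.integral_cong refl integral_lborel_translate(1)[symmetric])
  also have "\<dots> = (\<integral>p. \<integral>y. ?G p y \<partial>lborel \<partial>lborel)"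
    using lborel_pair.Fubini_integral[OF iG] by simp
  also have "\<dots> = (\<integral>p. F p * potential 1 \<psi> p \<partial>lborel)"
  proof -
    have "(\<integral>y. ?G p y \<partial>lborel) = F p * potential 1 \<psi> p" for p
      by (simp add: potential_def mult_scaleR_right[symmetric] del: mult_scaleR_right)
    then show ?thesis by simp
  qed
  finally show ?thesis .
qed

section \<open>The Volterra equation\<close>

text \<open>A series is an integral over the counting measure, so that termwise differentiation is
  an instance of \<open>Ckb_integral\<close>.\<close>

lemma Ckb_series:
  fixes f :: "nat \<Rightarrow> 'a::euclidean_space \<Rightarrow> complex"
  assumes f: "\<And>n. Ckb k (\<lambda>x. a n * w x) (f n)" and a: "summable a" "\<And>n. 0 \<le> a n"
    and w: "continuous_on UNIV w" "\<And>x. 0 < w x"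
  shows "Ckb k (\<lambda>x. suminf a * w x) (\<lambda>x. \<Sum>n. f n x)"
proof -
  have int: "integrable (count_space UNIV) (\<lambda>n. a n * c)" for c
    using a by (auto simp: integrable_count_space_nat_iff intro!: summable_mult2)
  have sum: "summable (\<lambda>n. norm (f n x))" for x
    by (rule summable_comparison_test'[OF summable_mult2[OF a(1), of "w x"]]) (use Ckb_bound[OF f] in auto)
  have eq: "(\<lambda>x. \<Sum>n. f n x) = (\<lambda>x. \<integral>n. f n x \<partial>count_space UNIV)"
    using sum by (auto simp: fun_eq_iff integrable_count_space_nat_iff intro!: integral_count_space_nat[symmetric])
  show ?thesis
    unfolding eq
  proof (rule Ckb_integral(1)[where w="\<lambda>n x. a n * w x"])
    fix p :: 'a
    obtain r where r: "r > 0" "\<And>x. dist x p < r \<Longrightarrow> w x < w p + 1"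
      using w(1) unfolding continuous_on_iff dist_real_def
      by (metis UNIV_I abs_less_iff add.commute less_diff_eq zero_less_one diff_less_eq)
    have "\<forall>n. \<forall>x\<in>ball p r. a n * w x \<le> a n * (w p + 1)"
      using r(2) a(2) by (auto simp: dist_commute less_imp_le intro!: mult_left_mono)
    with r(1) int show "\<exists>r>0. \<exists>g. integrable (count_space UNIV) g \<and> (\<forall>n. \<forall>x\<in>ball p r. a n * w x \<le> g n)"
      by blast
    have "(\<integral>\<^sup>+ n. ennreal (a n * w p) \<partial>count_space UNIV) = (\<Sum>n. ennreal (a n * w p))"
      by (rule nn_integral_count_space_nat)
    also have "\<dots> = ennreal (suminf a * w p)"
      using a w(2)[of p] by (subst suminf_ennreal2) (auto intro!: summable_mult2 simp: suminf_mult2 less_imp_le)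
    finally show "(\<integral>\<^sup>+ n. ennreal (a n * w p) \<partial>count_space UNIV) \<le> ennreal (suminf a * w p)" by simp
    show "0 \<le> suminf a * w p" using a w(2)[of p] by (simp add: suminf_nonneg less_imp_le)
  qed (use f in auto)
qed

text \<open>The weight \<open>exp (l t)\<close> with large \<open>l\<close> turns the Volterra operator \<open>F \<mapsto> q \<cdot> potential F\<close> into a contraction.\<close>

lemma volterra_solution:
  assumes q: "Ckb 1 (\<lambda>_. M) q" and G: "Ckb 1 (\<lambda>p. A * exp (l * snd p)) G"
    and l: "l = 1 + 4 * M"
  shows "\<exists>W. Ckb 1 (\<lambda>p. 2 * A * exp (l * snd p)) W \<and> W = potential (-1) (\<lambda>p. G p + q p * W p) \<and>
    ((\<forall>p. snd p < norm (fst p - a) \<longrightarrow> G p = 0) \<longrightarrow> (\<forall>p. snd p < norm (fst p - a) \<longrightarrow> W p = 0))"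
proof -
  have M: "0 \<le> M" using Ckb_weight_nonneg[OF q] .
  have A: "0 \<le> A" using Ckb_weight_nonneg[OF G, of 0] by simp
  have l1: "1 \<le> l" "0 < l" using M l by auto
  have l2: "1 \<le> l\<^sup>2" "l \<le> l\<^sup>2" using l1 by (auto intro: one_le_power self_le_power)
  have dl: "c / l\<^sup>2 \<le> c" if "0 \<le> c" for c using that l2(1) frac_le[of c c 1 "l\<^sup>2"] by simp
  define F where "F n = ((\<lambda>F p. q p * potential (-1) F p) ^^ n) G" for n
  have F_Suc: "F (Suc n) = (\<lambda>p. q p * potential (-1) (F n) p)" for n by (simp add: F_def)
  have pot: "Ckb 1 (\<lambda>p. a / l\<^sup>2 * exp (l * snd p)) (potential (-1) H)" if "Ckb 1 (\<lambda>p. a * exp (l * snd p)) H" for H a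
    using Ckb_potential(1)[OF that l1(2)] by simp
  have F: "Ckb 1 (\<lambda>p. A * (1/2) ^ n * exp (l * snd p)) (F n)" for n
  proof (induction n)
    case 0 then show ?case using G by (simp add: F_def)
  next
    case (Suc n)
    \<comment> \<open>Here \<open>4 M <= l <= l^2\<close> by the choice of \<open>l\<close>. The 2
      in \<open>2 M\<close> is the Leibniz factor of \<open>Ckb_mult\<close> at order 1.\<close>
    have "2 * M / l\<^sup>2 \<le> 1 / 2" using l2 l1 M l by (simp add: divide_simps)
    then have "2 * M / l\<^sup>2 * (A * (1/2) ^ n * exp (l * snd p)) \<le> 1 / 2 * (A * (1/2) ^ n * exp (l * snd p))" for p :: spacetime
      using A by (intro mult_right_mono) auto
    then show ?case
      unfolding F_Suc by (intro Ckb_mono[OF Ckb_mult[OF q pot[OF Suc]]]) (simp add: mult_ac)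
  qed
  define W where "W p = (\<Sum>n. potential (-1) (F n) p)" for p
  have PF: "Ckb 1 (\<lambda>p. (A * (1/2) ^ n) * exp (l * snd p)) (potential (-1) (F n))" for n
  proof (rule Ckb_mono[OF pot[OF F]])
    show "A * (1/2) ^ n / l\<^sup>2 * exp (l * snd p) \<le> A * (1/2) ^ n * exp (l * snd p)" for p :: spacetime
      using A by (intro mult_right_mono dl) auto
  qed
  have sA: "summable (\<lambda>n. A * (1/2) ^ n)" "(\<Sum>n. A * (1/2) ^ n) = 2 * A"
    using suminf_mult[OF summable_geometric[of "1/2::real"], of A] suminf_geometric[of "1/2::real"]
    by (auto intro!: summable_mult summable_geometric)
  have W: "Ckb 1 (\<lambda>p. 2 * A * exp (l * snd p)) W"
  proof -
    have "Ckb 1 (\<lambda>p. (\<Sum>n. A * (1/2) ^ n) * exp (l * snd p)) W"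
      unfolding W_def[abs_def]
      by (rule Ckb_series[OF PF sA(1)]) (use A in \<open>auto intro!: continuous_intros\<close>)
    then show ?thesis unfolding sA(2) .
  qed
  have sF: "summable (\<lambda>n. norm (F n p))" for p
    by (rule summable_comparison_test'[OF summable_mult2[OF sA(1), of "exp (l * snd p)"]])
      (use Ckb_bound[OF F] in auto)
  have sPF: "summable (\<lambda>n. potential (-1) (F n) p)" for p
    by (rule summable_norm_cancel, rule summable_comparison_test'[OF summable_mult2[OF sA(1), of "exp (l * snd p)"]])
      (use Ckb_bound[OF PF] in auto)
  \<comment> \<open>The right-hand side of the equation reproduces the Neumann series:
    \<open>G\<close> is its first term, and multiplication by \<open>q\<close> after the potential
    shifts it by one.\<close>
  have GW: "(\<lambda>p. G p + q p * W p) = (\<lambda>p. \<Sum>n. F n p)"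
  proof
    fix p
    have "(\<Sum>n. F n p) = F 0 p + (\<Sum>n. F (Suc n) p)"
      using suminf_split_head[OF summable_norm_cancel[OF sF]] by simp
    also have "(\<Sum>n. F (Suc n) p) = q p * W p"
      unfolding F_Suc W_def using suminf_mult[OF sPF] by simp
    finally show "G p + q p * W p = (\<Sum>n. F n p)" by (simp add: F_def)
  qed
  \<comment> \<open>Sum and integral are interchanged by means of the geometric majorant of the
    iterates.\<close>
  have "potential (-1) (\<lambda>p. \<Sum>n. F n p) p = W p" for p
  proof -
    let ?f = "\<lambda>n y. newton y *\<^sub>R F n (p + (y, -1 * norm y))"
    have cF: "continuous_on UNIV (F n)" for n using Ckb_continuous[OF F] .
    have b: "norm (?f n y) \<le> A * (1/2) ^ n * exp (l * snd p) * (exp (- l * norm y) * newton y)" for n y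
    proof -
      have "norm (?f n y) \<le> newton y * (A * (1/2) ^ n * exp (l * snd (p + (y, -1 * norm y))))"
        using mult_left_mono[OF Ckb_bound[OF F[of n], of "p + (y, -1 * norm y)"] newton_nonneg[of y]] newton_nonneg[of y]
        by simp
      also have "\<dots> = A * (1/2) ^ n * exp (l * snd p) * (exp (- l * norm y) * newton y)"
        by (simp add: algebra_simps exp_diff exp_minus field_simps)
      finally show ?thesis .
    qed
    have m: "?f n \<in> borel_measurable lborel" for n
    proof -
      have "continuous_on UNIV (\<lambda>y. F n (p + (y, -1 * norm y)))"
        by (intro continuous_on_graph cF continuous_intros)
      from borel_measurable_continuous_onI[OF this] show ?thesis by (intro borel_measurable_scaleR) auto
    qed
    have int: "integrable lborel (?f n)" for n
      by (rule Bochner_Integration.integrable_bound[OF integrable_mult_right[OF integrable_exp_newton[OF l1(2)], of "A * (1/2) ^ n * exp (l * snd p)"] m])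
        (use b in \<open>auto intro!: order_trans[OF _ abs_ge_self] simp del: norm_scaleR\<close>)
    have s: "summable (\<lambda>n. norm (?f n y))" for y
      by (rule summable_comparison_test'[OF summable_mult2[OF summable_mult2[OF sA(1), of "exp (l * snd p)"], of "exp (- l * norm y) * newton y"]])
        (use b in \<open>auto simp del: norm_scaleR\<close>)
    have si: "summable (\<lambda>n. \<integral>y. norm (?f n y) \<partial>lborel)"
    proof (rule summable_comparison_test'[OF summable_mult2[OF summable_mult2[OF sA(1), of "exp (l * snd p)"], of "\<integral>y. exp (- l * norm y) * newton y \<partial>lborel"]])
      fix n
      have "(\<integral>y. norm (?f n y) \<partial>lborel) \<le> (\<integral>y. A * (1/2) ^ n * exp (l * snd p) * (exp (- l * norm y) * newton y) \<partial>lborel)"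
        by (intro integral_mono integrable_norm int b integrable_mult_right integrable_exp_newton l1)
      then show "norm (\<integral>y. norm (?f n y) \<partial>lborel) \<le> A * (1/2) ^ n * exp (l * snd p) * (\<integral>y. exp (- l * norm y) * newton y \<partial>lborel)"
        by (simp add: integral_nonneg_AE)
    qed
    have "(\<integral>y. (\<Sum>n. ?f n y) \<partial>lborel) = (\<Sum>n. integral\<^sup>L lborel (?f n))"
      by (rule integral_suminf[OF int _ si]) (use s in auto)
    moreover have "(\<Sum>n. ?f n y) = newton y *\<^sub>R (\<Sum>n. F n (p + (y, -1 * norm y)))" for y
      using suminf_scaleR_right[OF summable_norm_cancel[OF sF]] by metis
    ultimately show ?thesis by (simp add: potential_def W_def)
  qed
  then have eq: "W = potential (-1) (\<lambda>p. G p + q p * W p)" unfolding GW by auto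
  have "W p = 0" if G0: "\<And>p. snd p < norm (fst p - a) \<Longrightarrow> G p = 0" and p: "snd p < norm (fst p - a)" for p
  proof -
    \<comment> \<open>The retarded potential at a point outside the forward cone samples only points
      on its backward cone, and these again lie outside the forward cone.\<close>
    have pz: "potential (-1) H p = 0" if H: "\<And>p. snd p < norm (fst p - a) \<Longrightarrow> H p = 0" and p: "snd p < norm (fst p - a)" for H p
    proof -
      have "H (p + (y, -1 * norm y)) = 0" for y
        by (rule H) (use p norm_triangle_ineq4[of "fst p + y - a" y] in simp)
      then show ?thesis by (simp add: potential_def)
    qed
    have "\<forall>p. snd p < norm (fst p - a) \<longrightarrow> F n p = 0" for n
      by (induction n) (use G0 pz in \<open>auto simp: F_def\<close>)
    then have "potential (-1) (F n) p = 0" for n using pz p by blast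
    then show ?thesis by (simp add: W_def)
  qed
  with W eq show ?thesis by blast
qed

text \<open>The equation improves any bound \<open>b\<close> to \<open>A + b / 2\<close>. Iterating
  removes the a priori constant \<open>B\<close> and leaves the fixed point \<open>2 A\<close>,
  which is linear in the source and hence fit for stability estimates.\<close>

lemma volterra_bound:
  assumes q: "Ckb 1 (\<lambda>_. M) q" and S: "Ckb 1 (\<lambda>p. A * exp (l * snd p)) S" and l: "l = 1 + 4 * M"
    and D: "Ckb 1 (\<lambda>p. B * exp (l * snd p)) D" "D = potential (-1) (\<lambda>p. S p + q p * D p)"
  shows "Ckb 1 (\<lambda>p. 2 * A * exp (l * snd p)) D"
proof -
  have M: "0 \<le> M" using Ckb_weight_nonneg[OF q] .
  have A: "0 \<le> A" using Ckb_weight_nonneg[OF S, of 0] by simp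
  have B: "0 \<le> B" using Ckb_weight_nonneg[OF D(1), of 0] by simp
  have l1: "1 \<le> l" "0 < l" using M l by auto
  have l2: "1 \<le> l\<^sup>2" "l \<le> l\<^sup>2" using l1 by (auto intro: one_le_power self_le_power)
  have dl: "c / l\<^sup>2 \<le> c" if "0 \<le> c" for c using that l2(1) frac_le[of c c 1 "l\<^sup>2"] by simp
  have it: "Ckb 1 (\<lambda>p. (A + 1/2 * b) * exp (l * snd p)) D" if "Ckb 1 (\<lambda>p. b * exp (l * snd p)) D" for b
  proof -
    have b: "0 \<le> b" using Ckb_weight_nonneg[OF that, of 0] by simp
    have "Ckb 1 (\<lambda>p. (A + 2 * M * b) * exp (l * snd p)) (\<lambda>p. S p + q p * D p)"
      by (rule Ckb_mono[OF Ckb_add[OF S Ckb_mult[OF q that]]]) (simp add: algebra_simps)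
    from Ckb_potential(1)[OF this l1(2), of "-1"] D(2)
    have 1: "Ckb 1 (\<lambda>p. (A + 2 * M * b) / l\<^sup>2 * exp (l * snd p)) D" by simp
    have "2 * M / l\<^sup>2 \<le> 1 / 2" using l2 l1 M l by (simp add: divide_simps)
    from mult_right_mono[OF this b] have "2 * M * b / l\<^sup>2 \<le> 1/2 * b" by simp
    moreover have "A / l\<^sup>2 \<le> A" by (rule dl[OF A])
    ultimately have "(A + 2 * M * b) / l\<^sup>2 \<le> A + 1/2 * b" by (simp add: add_divide_distrib)
    then show ?thesis by (intro Ckb_mono[OF 1] mult_right_mono) auto
  qed
  have bn: "Ckb 1 (\<lambda>p. (2 * A + (1/2) ^ n * B) * exp (l * snd p)) D" for n
  proof (induction n)
    case 0
    show ?case by (rule Ckb_mono[OF D(1)]) (use A in \<open>auto intro!: mult_right_mono\<close>)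
  next
    case (Suc n)
    from it[OF this] show ?case by (simp add: algebra_simps)
  qed
  have lim: "c \<le> 2 * A * e" if "\<And>n. c \<le> (2 * A + (1/2) ^ n * B) * e" for c e :: real
  proof (rule LIMSEQ_le_const)
    have "(\<lambda>n. (2 * A + (1/2) ^ n * B) * e) \<longlonglongrightarrow> (2 * A + 0 * B) * e"
      by (intro tendsto_intros LIMSEQ_power_zero) auto
    then show "(\<lambda>n. (2 * A + (1/2) ^ n * B) * e) \<longlonglongrightarrow> 2 * A * e" by simp
  qed (use that in auto)
  show ?thesis
    unfolding Ckb_iff_partials
  proof (intro conjI allI impI lim)
    show "Ck_on 1 UNIV D" using Ckb_imp_Ck_on[OF D(1)] .
    fix bs :: "spacetime list" and p n assume "set bs \<subseteq> Basis" "length bs \<le> 1"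
    then show "norm (partials bs D p) \<le> (2 * A + (1/2) ^ n * B) * exp (l * snd p)"
      using bn[of n] unfolding Ckb_iff_partials by blast
  qed
qed

section \<open>The progressing wave expansion\<close>

text \<open>The spatial operator \<open>Laplacian + q\<close>; the homogeneous equation says that it
  gives the second time derivative.\<close>

definition schr :: "(real^3 \<Rightarrow> complex) \<Rightarrow> (real^3 \<Rightarrow> complex) \<Rightarrow> real^3 \<Rightarrow> complex" where
  "schr q u x = (\<Sum>i\<in>UNIV. partial_deriv (axis i 1) (partial_deriv (axis i 1) u) x) + q x * u x"

lemma Ckb_laplace:
  fixes u :: "real^3 \<Rightarrow> complex"
  assumes "Ckb (k + 2) (\<lambda>_. A) u"
  shows "Ckb k (\<lambda>_. 3 * A) (\<lambda>x. \<Sum>i\<in>(UNIV::3 set). partial_deriv (axis i 1) (partial_deriv (axis i 1) u) x)"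
proof -
  have "Ckb k (\<lambda>_. A) (partial_deriv (axis i 1) (partial_deriv (axis i 1) u))" for i :: 3
    using assms by (simp add: numeral_2_eq_2)
  from Ckb_sum[of "UNIV :: 3 set", OF _ this] show ?thesis by simp
qed

lemma Ckb_schr:
  assumes "Ckb j (\<lambda>_. A) u" "k + 2 \<le> j" "Ckb k (\<lambda>_. M) q"
  shows "Ckb k (\<lambda>_. 3 * A + 2 ^ k * (M * A)) (schr q u)"
  unfolding schr_def[abs_def]
  by (intro Ckb_add Ckb_laplace Ckb_mult assms(3) Ckb_order_mono[OF assms(1)]) (use assms(2) in auto)

text \<open>The splitting behind all Lipschitz estimates: one term is small because the coefficients
  are close, the other because the potentials \<open>q\<close> and \<open>p\<close> are.\<close>

lemma schr_diff:
  assumes "Ckb (k + 2) (\<lambda>_. A) u" "Ckb (k + 2) (\<lambda>_. B) v"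
  shows "schr q u x - schr p v x = schr q (\<lambda>x. u x - v x) x + (q x - p x) * v x"
proof -
  have d: "\<And>x. u differentiable (at x)" "\<And>x. v differentiable (at x)"
    "\<And>x i. partial_deriv (axis i 1) u differentiable (at x)" "\<And>x i. partial_deriv (axis i 1) v differentiable (at x)"
    using assms by (auto simp: numeral_2_eq_2)
  have "partial_deriv (axis i 1) (\<lambda>x. u x - v x) = (\<lambda>x. partial_deriv (axis i 1) u x - partial_deriv (axis i 1) v x)" for i
    by (intro ext partial_deriv_diff d)
  then have "partial_deriv (axis i 1) (partial_deriv (axis i 1) (\<lambda>x. u x - v x)) x
      = partial_deriv (axis i 1) (partial_deriv (axis i 1) u) x - partial_deriv (axis i 1) (partial_deriv (axis i 1) v) x" for i
    using partial_deriv_diff[OF d(3,4)] by simp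
  then show ?thesis
    unfolding schr_def by (simp add: sum_subtractf left_diff_distrib right_diff_distrib)
qed

lemma Ckb_schr_diff:
  assumes "Ckb j (\<lambda>_. A) u" "Ckb j (\<lambda>_. B) v" "Ckb j (\<lambda>_. d) (\<lambda>x. u x - v x)" "k + 2 \<le> j"
    and "Ckb k (\<lambda>_. M) q" "Ckb k (\<lambda>_. e) (\<lambda>x. q x - p x)"
  shows "Ckb k (\<lambda>_. 3 * d + 2 ^ k * (M * d) + 2 ^ k * (e * B)) (\<lambda>x. schr q u x - schr p v x)"
  unfolding schr_diff[OF Ckb_order_mono[OF assms(1,4)] Ckb_order_mono[OF assms(2,4)]]
  by (intro Ckb_add Ckb_schr[OF assms(3-5)] Ckb_mult assms(6) Ckb_order_mono[OF assms(2)]) (use assms(4) in simp)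

section \<open>The coefficients of the expansion\<close>

text \<open>The constant \<open>1 / (8 pi)\<close> comes from the jump condition on the cone,
  derived in the third part of \<open>prog_wave_facts\<close>. The order 0 of the mean belongs to
  the operator \<open>1 + (x - a) . grad\<close>.\<close>

definition amp1 :: "(real^3 \<Rightarrow> complex) \<Rightarrow> real^3 \<Rightarrow> real^3 \<Rightarrow> complex" where
  "amp1 q a x = (1 / (8 * pi)) *\<^sub>R ray_mean 0 a q x"

text \<open>The power s to the first in the wave operator brings \<open>8 + 4 (x - a) . grad\<close>
  to act on this coefficient; dividing by 4 gives the mean of order 1 and the factor
  \<open>1 / 4\<close>. For \<open>amp3\<close> the operator is
  \<open>12 + 4 (x - a) . grad\<close>, whence the order 2.\<close>

definition amp2 :: "(real^3 \<Rightarrow> complex) \<Rightarrow> real^3 \<Rightarrow> real^3 \<Rightarrow> complex" where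
  "amp2 q a x = (1 / 4) *\<^sub>R ray_mean 1 a (schr q (amp1 q a)) x"

definition amp3 :: "(real^3 \<Rightarrow> complex) \<Rightarrow> real^3 \<Rightarrow> real^3 \<Rightarrow> complex" where
  "amp3 q a x = (1 / 4) *\<^sub>R ray_mean 2 a (schr q (amp2 q a)) x"

text \<open>What no further coefficient cancels; half of it, times the square of s, is the source
  left for the remainder.\<close>

definition amp_rest :: "(real^3 \<Rightarrow> complex) \<Rightarrow> real^3 \<Rightarrow> real^3 \<Rightarrow> complex" where
  "amp_rest q a = schr q (amp3 q a)"

text \<open>The bound \<open>3 A + 2 ^ k * (M * A)\<close> of \<open>Ckb_schr\<close>, iterated with
  \<open>k = 5, 3, 1\<close>. The \<open>dbnd\<close> are the corresponding Lipschitz constants with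
  respect to \<open>q\<close>, from \<open>Ckb_schr_diff\<close>.\<close>

definition bnd2 :: "real \<Rightarrow> real" where "bnd2 M = 3 * M + 32 * (M * M)"
definition bnd3 :: "real \<Rightarrow> real" where "bnd3 M = 3 * bnd2 M + 8 * (M * bnd2 M)"
definition bnd4 :: "real \<Rightarrow> real" where "bnd4 M = 3 * bnd3 M + 2 * (M * bnd3 M)"
definition dbnd2 :: "real \<Rightarrow> real" where "dbnd2 M = 3 + 32 * M + 32 * M"
definition dbnd3 :: "real \<Rightarrow> real" where "dbnd3 M = 3 * dbnd2 M + 8 * (M * dbnd2 M) + 8 * bnd2 M"
definition dbnd4 :: "real \<Rightarrow> real" where "dbnd4 M = 3 * dbnd3 M + 2 * (M * dbnd3 M) + 2 * bnd3 M"

lemma Ckb_shrink: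
  assumes "Ckb k (\<lambda>_. A) f" "\<bar>c\<bar> \<le> 1"
  shows "Ckb k (\<lambda>_. A) (\<lambda>x. c *\<^sub>R f x)"
  using assms mult_left_le_one_le[of A "\<bar>c\<bar>"] Ckb_weight_nonneg[OF assms(1)]
  by (intro Ckb_mono[OF Ckb_scaleR[OF assms(1)]]) auto

lemma pi8: "\<bar>1 / (8 * pi)\<bar> \<le> 1"
  using pi_gt3 by simp

text \<open>Each use of \<open>schr\<close> lowers the order by two and the means over rays keep it,
  so the orders run through 7, 5, 3, 1. The last one is just enough for a \<open>C^1\<close>
  source.\<close>

lemma amp_bounds:
  assumes q: "Ckb 7 (\<lambda>_. M) q"
  shows "Ckb 7 (\<lambda>_. M) (amp1 q a)" "Ckb 5 (\<lambda>_. bnd2 M) (schr q (amp1 q a))" "Ckb 5 (\<lambda>_. bnd2 M) (amp2 q a)"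
    "Ckb 3 (\<lambda>_. bnd3 M) (schr q (amp2 q a))" "Ckb 3 (\<lambda>_. bnd3 M) (amp3 q a)" "Ckb 1 (\<lambda>_. bnd4 M) (amp_rest q a)"
proof -
  have qk: "Ckb k (\<lambda>_. M) q" if "k \<le> 7" for k using Ckb_order_mono[OF q that] .
  show 1: "Ckb 7 (\<lambda>_. M) (amp1 q a)"
    unfolding amp1_def[abs_def] by (rule Ckb_shrink[OF ray_mean_facts(1)[OF q] pi8])
  show 2: "Ckb 5 (\<lambda>_. bnd2 M) (schr q (amp1 q a))"
    by (rule Ckb_mono[OF Ckb_schr[OF 1 _ qk]]) (simp_all add: bnd2_def)
  show 3: "Ckb 5 (\<lambda>_. bnd2 M) (amp2 q a)"
    unfolding amp2_def[abs_def] by (rule Ckb_shrink[OF ray_mean_facts(1)[OF 2]]) simp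
  show 4: "Ckb 3 (\<lambda>_. bnd3 M) (schr q (amp2 q a))"
    by (rule Ckb_mono[OF Ckb_schr[OF 3 _ qk]]) (simp_all add: bnd3_def)
  show 5: "Ckb 3 (\<lambda>_. bnd3 M) (amp3 q a)"
    unfolding amp3_def[abs_def] by (rule Ckb_shrink[OF ray_mean_facts(1)[OF 4]]) simp
  show "Ckb 1 (\<lambda>_. bnd4 M) (amp_rest q a)"
    unfolding amp_rest_def by (rule Ckb_mono[OF Ckb_schr[OF 5 _ qk]]) (simp_all add: bnd4_def)
qed

lemma amp_diff_bounds:
  assumes q: "Ckb 7 (\<lambda>_. M) q" and p: "Ckb 7 (\<lambda>_. M) p" and e: "Ckb 7 (\<lambda>_. e) (\<lambda>x. q x - p x)"
  shows "Ckb 7 (\<lambda>_. e) (\<lambda>x. amp1 q a x - amp1 p a x)"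
    "Ckb 5 (\<lambda>_. dbnd2 M * e) (\<lambda>x. amp2 q a x - amp2 p a x)"
    "Ckb 3 (\<lambda>_. dbnd3 M * e) (\<lambda>x. amp3 q a x - amp3 p a x)"
    "Ckb 1 (\<lambda>_. dbnd4 M * e) (\<lambda>x. amp_rest q a x - amp_rest p a x)"
proof -
  have qk: "Ckb k (\<lambda>_. M) q" if "k \<le> 7" for k using Ckb_order_mono[OF q that] .
  have ek: "Ckb k (\<lambda>_. e) (\<lambda>x. q x - p x)" if "k \<le> 7" for k using Ckb_order_mono[OF e that] .
  note bq = amp_bounds[OF q, of a] and bp = amp_bounds[OF p, of a]
  have lin: "(\<lambda>x. c *\<^sub>R ray_mean k a f x - c *\<^sub>R ray_mean k a g x) = (\<lambda>x. c *\<^sub>R ray_mean k a (\<lambda>x. f x - g x) x)"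
    if "Ckb j (\<lambda>_. A) f" "Ckb j (\<lambda>_. A) g" for c k j A f g
    using ray_mean_linear[OF Ckb_order_mono[OF that(1)] Ckb_order_mono[OF that(2)], of k a]
    by (simp add: scaleR_diff_right)
  show 1: "Ckb 7 (\<lambda>_. e) (\<lambda>x. amp1 q a x - amp1 p a x)"
    unfolding amp1_def lin[OF q p] by (rule Ckb_shrink[OF ray_mean_facts(1)[OF e] pi8])
  have 2: "Ckb 5 (\<lambda>_. dbnd2 M * e) (\<lambda>x. schr q (amp1 q a) x - schr p (amp1 p a) x)"
    by (rule Ckb_mono[OF Ckb_schr_diff[OF bq(1) bp(1) 1 _ qk ek]]) (simp_all add: dbnd2_def algebra_simps)
  show 3: "Ckb 5 (\<lambda>_. dbnd2 M * e) (\<lambda>x. amp2 q a x - amp2 p a x)"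
    unfolding amp2_def lin[OF bq(2) bp(2)] by (rule Ckb_shrink[OF ray_mean_facts(1)[OF 2]]) simp
  have 4: "Ckb 3 (\<lambda>_. dbnd3 M * e) (\<lambda>x. schr q (amp2 q a) x - schr p (amp2 p a) x)"
    by (rule Ckb_mono[OF Ckb_schr_diff[OF bq(3) bp(3) 3 _ qk ek]]) (simp_all add: dbnd3_def algebra_simps)
  show 5: "Ckb 3 (\<lambda>_. dbnd3 M * e) (\<lambda>x. amp3 q a x - amp3 p a x)"
    unfolding amp3_def lin[OF bq(4) bp(4)] by (rule Ckb_shrink[OF ray_mean_facts(1)[OF 4]]) simp
  show "Ckb 1 (\<lambda>_. dbnd4 M * e) (\<lambda>x. amp_rest q a x - amp_rest p a x)"
    unfolding amp_rest_def
    by (rule Ckb_mono[OF Ckb_schr_diff[OF bq(5) bp(5) 5 _ qk ek]]) (simp_all add: dbnd4_def algebra_simps)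
qed

lemma amp_transport:
  assumes q: "Ckb 7 (\<lambda>_. M) q"
  shows "amp1 q a x + (\<Sum>i\<in>UNIV. ((x - a) $ i) *\<^sub>R partial_deriv (axis i 1) (amp1 q a) x) = (1 / (8 * pi)) *\<^sub>R q x"
    and "8 * amp2 q a x + 4 * (\<Sum>i\<in>UNIV. ((x - a) $ i) *\<^sub>R partial_deriv (axis i 1) (amp2 q a) x) = schr q (amp1 q a) x"
    and "12 * amp3 q a x + 4 * (\<Sum>i\<in>UNIV. ((x - a) $ i) *\<^sub>R partial_deriv (axis i 1) (amp3 q a) x) = schr q (amp2 q a) x"
proof -
  have *: "of_nat (Suc k) * (c *\<^sub>R ray_mean k a h x) + (\<Sum>i\<in>UNIV. ((x - a) $ i) *\<^sub>R partial_deriv (axis i 1) (\<lambda>x. c *\<^sub>R ray_mean k a h x) x) = c *\<^sub>R h x"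
    if h: "Ckb (Suc j) (\<lambda>_. A) h" for c k j A h
  proof -
    have h1: "Ckb 1 (\<lambda>_. A) h" using Ckb_order_mono[OF h, of 1] by simp
    have "\<And>x. ray_mean k a h differentiable (at x)" using ray_mean_facts(1)[OF h] by simp
    then have "partial_deriv (axis i 1) (\<lambda>x. c *\<^sub>R ray_mean k a h x) x = c *\<^sub>R partial_deriv (axis i 1) (ray_mean k a h) x" for i
      by (rule partial_deriv_scaleR)
    then show ?thesis
      unfolding ray_mean_transport[OF h1, of k a x, symmetric]
      by (simp add: scaleR_add_right scaleR_sum_right mult.commute[of c])
  qed
  have s: "(7::nat) = Suc 6" "(5::nat) = Suc 4" "(3::nat) = Suc 2" by auto
  note b = amp_bounds[OF q, of a]
  show "amp1 q a x + (\<Sum>i\<in>UNIV. ((x - a) $ i) *\<^sub>R partial_deriv (axis i 1) (amp1 q a) x) = (1 / (8 * pi)) *\<^sub>R q x"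
    using *[OF q[unfolded s], of 0 "1 / (8 * pi)"] unfolding amp1_def[abs_def] by simp
  have "of_nat (Suc 1) * amp2 q a x + (\<Sum>i\<in>UNIV. ((x - a) $ i) *\<^sub>R partial_deriv (axis i 1) (amp2 q a) x) = (1 / 4) *\<^sub>R schr q (amp1 q a) x"
    using *[OF b(2)[unfolded s], of 1 "1 / 4"] unfolding amp2_def[abs_def] .
  from arg_cong[OF this, of "\<lambda>z. 4 * z"]
  show "8 * amp2 q a x + 4 * (\<Sum>i\<in>UNIV. ((x - a) $ i) *\<^sub>R partial_deriv (axis i 1) (amp2 q a) x) = schr q (amp1 q a) x"
    by (simp add: distrib_left scaleR_conv_of_real)
  have "of_nat (Suc 2) * amp3 q a x + (\<Sum>i\<in>UNIV. ((x - a) $ i) *\<^sub>R partial_deriv (axis i 1) (amp3 q a) x) = (1 / 4) *\<^sub>R schr q (amp2 q a) x"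
    using *[OF b(4)[unfolded s], of 2 "1 / 4"] unfolding amp3_def[abs_def] .
  from arg_cong[OF this, of "\<lambda>z. 4 * z"]
  show "12 * amp3 q a x + 4 * (\<Sum>i\<in>UNIV. ((x - a) $ i) *\<^sub>R partial_deriv (axis i 1) (amp3 q a) x) = schr q (amp2 q a) x"
    by (simp add: distrib_left scaleR_conv_of_real)
qed

definition prog_wave :: "(real^3 \<Rightarrow> complex) \<Rightarrow> real^3 \<Rightarrow> spacetime \<Rightarrow> complex" where
  "prog_wave q a p = amp1 q a (fst p) + cone_fun a p * amp2 q a (fst p)
    + (cone_fun a p * cone_fun a p) * ((1 / 2) *\<^sub>R amp3 q a (fst p))"

text \<open>Bookkeeping by powers of \<open>G\<close>, the value of s. The transport equations
  cancel \<open>s1\<close> at power 0 and \<open>s2\<close> at power 1; only \<open>r\<close> at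
  power 2 is left. \<open>S2\<close> and \<open>S3\<close> are the derivatives along the
  ray.\<close>

lemma prog_wave_algebra:
  fixes u v w G r s1 s2 S2 S3 Q :: complex
  assumes "8 * v + 4 * S2 = s1" "12 * w + 4 * S3 = s2"
  shows "- (s1 - Q * u) + (8 * v + G * - (s2 - Q * v) + 4 * S2)
    + (24 * G * ((1 / 2) *\<^sub>R w) + G * G * (- (1 / 2) *\<^sub>R (r - Q * w)) + 4 * G * S3)
    = Q * (u + G * v + G * G * ((1 / 2) *\<^sub>R w)) - G * G * ((1 / 2) *\<^sub>R r)"
  unfolding assms[symmetric] by (simp add: scaleR_conv_of_real field_simps)

text \<open>The second part is the expansion inside the cone: all powers of s below the square
  cancel. The third part evaluates the boundary integrand of \<open>cone_green\<close>, which
  reduces to the transport equation of the first coefficient.\<close>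

lemma prog_wave_facts:
  assumes q: "Ckb 7 (\<lambda>_. M) q"
  shows "Ck_on 2 UNIV (prog_wave q a)"
    and "wave_op (prog_wave q a) p = q (fst p) * prog_wave q a p
      - (cone_fun a p * cone_fun a p) * ((1 / 2) *\<^sub>R amp_rest q a (fst p))"
    and "inverse (norm y) *\<^sub>R prog_wave q a ((a, 0) + (y, norm y)) + dt (prog_wave q a) ((a, 0) + (y, norm y))
      + (\<Sum>i\<in>UNIV. unit_coord i y *\<^sub>R dx i (prog_wave q a) ((a, 0) + (y, norm y)))
      = (1 / (8 * pi * norm y)) *\<^sub>R q (a + y)"
proof -
  note b = amp_bounds[OF q, of a]
  let ?u = "\<lambda>p::spacetime. amp1 q a (fst p)" and ?v = "\<lambda>p::spacetime. amp2 q a (fst p)" and ?w = "\<lambda>p::spacetime. (1 / 2) *\<^sub>R amp3 q a (fst p)"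
  have w3: "Ckb 3 (\<lambda>_. bnd3 M) (\<lambda>x. (1 / 2) *\<^sub>R amp3 q a x)" by (rule Ckb_shrink[OF b(5)]) simp
  have C: "Ck_on 2 UNIV ?u" "Ck_on 2 UNIV ?v" "Ck_on 2 UNIV ?w"
    using Ckb_imp_Ck_on[OF Ckb_fst[OF Ckb_order_mono[OF b(1), of 2]]]
      Ckb_imp_Ck_on[OF Ckb_fst[OF Ckb_order_mono[OF b(3), of 2]]]
      Ckb_imp_Ck_on[OF Ckb_fst[OF Ckb_order_mono[OF w3, of 2]]] by simp_all
  note G = Ck_on_cone_fun[of 2 a]
  note GG = Ck_on_mult[OF G G]
  show P: "Ck_on 2 UNIV (prog_wave q a)"
    unfolding prog_wave_def[abs_def] by (intro Ck_on_add Ck_on_mult C G)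
  have d: "\<And>x. amp1 q a differentiable (at x)" "\<And>x. amp2 q a differentiable (at x)" "\<And>x. amp3 q a differentiable (at x)"
    using Ckb_order_mono[OF b(1), of "Suc 0"] Ckb_order_mono[OF b(3), of "Suc 0"] Ckb_order_mono[OF b(5), of "Suc 0"] by auto
  have dd: "\<And>x i. partial_deriv (axis i 1) (amp1 q a) differentiable (at x)" "\<And>x i. partial_deriv (axis i 1) (amp2 q a) differentiable (at x)" "\<And>x i. partial_deriv (axis i 1) (amp3 q a) differentiable (at x)"
    using Ckb_order_mono[OF b(1), of "Suc (Suc 0)"] Ckb_order_mono[OF b(3), of "Suc (Suc 0)"] Ckb_order_mono[OF b(5), of "Suc (Suc 0)"] by auto
  have w: "\<And>x. (\<lambda>x. (1 / 2) *\<^sub>R amp3 q a x) differentiable (at x)" using Ckb_order_mono[OF w3, of "Suc 0"] by auto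
  have pw: "partial_deriv c (\<lambda>x. (1 / 2) *\<^sub>R amp3 q a x) = (\<lambda>x. (1 / 2) *\<^sub>R partial_deriv c (amp3 q a) x)" for c
    by (intro ext partial_deriv_scaleR d)
  have t: "dt ?u = (\<lambda>p. 0)" "dt ?v = (\<lambda>p. 0)" "dt ?w = (\<lambda>p. 0)"
    using dt_fst[OF d(1)] dt_fst[OF d(2)] dt_fst[OF w] by auto
  have x: "dx i ?u = (\<lambda>p. partial_deriv (axis i 1) (amp1 q a) (fst p))" "dx i ?v = (\<lambda>p. partial_deriv (axis i 1) (amp2 q a) (fst p))"
    "dx i ?w = (\<lambda>p. (1 / 2) *\<^sub>R partial_deriv (axis i 1) (amp3 q a) (fst p))" for i
    using dx_fst[OF d(1)] dx_fst[OF d(2)] dx_fst[OF w] by (auto simp: pw)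
  have wu: "wave_op ?u p = - (schr q (amp1 q a) (fst p) - q (fst p) * amp1 q a (fst p))"
    unfolding wave_op_def t x dx_fst[OF dd(1)] by (simp add: schr_def)
  have wv: "wave_op ?v p = - (schr q (amp2 q a) (fst p) - q (fst p) * amp2 q a (fst p))"
    unfolding wave_op_def t x dx_fst[OF dd(2)] by (simp add: schr_def)
  have ddw: "\<And>x i. (\<lambda>x. (1 / 2) *\<^sub>R partial_deriv (axis i 1) (amp3 q a) x) differentiable (at x)"
    using dd(3) by (intro differentiable_scaleR) auto
  have ww: "wave_op ?w p = - (1 / 2) *\<^sub>R (amp_rest q a (fst p) - q (fst p) * amp3 q a (fst p))"
    unfolding wave_op_def t x dx_fst[OF ddw] partial_deriv_scaleR[OF dd(3)]
    by (simp add: schr_def amp_rest_def scaleR_sum_right sum_negf)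
  have add: "wave_op (\<lambda>p. f p + g p) p = wave_op f p + wave_op g p" if fg: "Ck_on 2 UNIV f" "Ck_on 2 UNIV g" for f g
  proof -
    have "partial_deriv b (partial_deriv b (\<lambda>p. f p + g p)) p = partial_deriv b (partial_deriv b f) p + partial_deriv b (partial_deriv b g) p"
      if b: "b \<in> Basis" for b
    proof -
      have 1: "Ck_on (Suc 0) UNIV f" "Ck_on (Suc 0) UNIV g"
        using Ck_on_mono[OF fg(1), of "Suc 0"] Ck_on_mono[OF fg(2), of "Suc 0"] by auto
      have 2: "Ck_on (Suc 0) UNIV (partial_deriv b f)" "Ck_on (Suc 0) UNIV (partial_deriv b g)"
        using fg b by (auto simp: numeral_2_eq_2)
      show ?thesis unfolding partial_deriv_add_fun[OF 1] partial_deriv_add_fun[OF 2] ..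
    qed
    then show ?thesis by (simp add: wave_op_def sum.distrib)
  qed
  have dGG: "dt (\<lambda>p. cone_fun a p * cone_fun a p) = (\<lambda>p. 4 * time_coord p * cone_fun a p)"
    "dx i (\<lambda>p. cone_fun a p * cone_fun a p) = (\<lambda>p. - 4 * rel_coord a i p * cone_fun a p)" for i
    using partial_deriv_mult_fun[OF Ck_on_cone_fun Ck_on_cone_fun] by (auto simp: cone_fun_derivs)
  let ?S = "\<lambda>f. (\<Sum>i\<in>UNIV. rel_coord a i p * partial_deriv (axis i 1) f (fst p))"
  have S: "(\<Sum>i\<in>UNIV. ((fst p - a) $ i) *\<^sub>R partial_deriv (axis i 1) f (fst p)) = ?S f" for f
    by (simp add: rel_coord_def scaleR_conv_of_real)
  have S2: "2 * (2 * time_coord p * 0 - (\<Sum>i\<in>UNIV. - 2 * rel_coord a i p * partial_deriv (axis i 1) (amp2 q a) (fst p))) = 4 * ?S (amp2 q a)"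
    by (simp add: sum_negf sum_distrib_left mult_ac)
  have S3: "2 * (4 * time_coord p * cone_fun a p * 0 - (\<Sum>i\<in>UNIV. - 4 * rel_coord a i p * cone_fun a p * ((1 / 2) *\<^sub>R partial_deriv (axis i 1) (amp3 q a) (fst p))))
      = 4 * cone_fun a p * ?S (amp3 q a)"
    by (simp add: sum_negf sum_distrib_left scaleR_conv_of_real mult_ac)
  have "wave_op (prog_wave q a) p = wave_op ?u p + wave_op (\<lambda>p. cone_fun a p * ?v p) p
      + wave_op (\<lambda>p. (cone_fun a p * cone_fun a p) * ?w p) p"
    unfolding prog_wave_def[abs_def] by (simp only: add Ck_on_add Ck_on_mult C G)
  then show "wave_op (prog_wave q a) p = q (fst p) * prog_wave q a p
      - (cone_fun a p * cone_fun a p) * ((1 / 2) *\<^sub>R amp_rest q a (fst p))"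
    unfolding wave_op_mult[OF G C(2)] wave_op_mult[OF GG C(3)] wave_op_cone_fun t x cone_fun_derivs dGG S2 S3 wu wv ww
    using amp_transport(2,3)[OF q, of a "fst p"] unfolding S prog_wave_def
    by (simp only: prog_wave_algebra)
  let ?p = "(a + y, norm y)"
  have pe: "(a, 0) + (y, norm y) = ?p" by simp
  have G0: "cone_fun a ?p = 0" by (simp add: cone_fun_eq)
  have c1: "Ck_on (Suc 0) UNIV ?u" and c2: "Ck_on (Suc 0) UNIV ?v" and c3: "Ck_on (Suc 0) UNIV ?w"
    using Ck_on_mono[OF C(1), of "Suc 0"] Ck_on_mono[OF C(2), of "Suc 0"] Ck_on_mono[OF C(3), of "Suc 0"] by simp_all
  note g1 = Ck_on_cone_fun[of "Suc 0" a]
  have pd: "partial_deriv b (prog_wave q a) ?p = partial_deriv b ?u ?p + (partial_deriv b (cone_fun a) ?p * amp2 q a (a + y)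
      + cone_fun a ?p * partial_deriv b ?v ?p)
      + ((partial_deriv b (cone_fun a) ?p * cone_fun a ?p + cone_fun a ?p * partial_deriv b (cone_fun a) ?p) * ?w ?p
        + cone_fun a ?p * cone_fun a ?p * partial_deriv b ?w ?p)" for b
    by (simp only: prog_wave_def[abs_def] fst_conv
      partial_deriv_add_fun[OF Ck_on_add[OF c1 Ck_on_mult[OF g1 c2]] Ck_on_mult[OF Ck_on_mult[OF g1 g1] c3]]
      partial_deriv_add_fun[OF c1 Ck_on_mult[OF g1 c2]] partial_deriv_mult_fun[OF g1 c2]
      partial_deriv_mult_fun[OF Ck_on_mult[OF g1 g1] c3] partial_deriv_mult_fun[OF g1 g1])
  have S0: "(\<Sum>i\<in>UNIV. unit_coord i y * y $ i) = norm y"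
  proof -
    have "(\<Sum>i\<in>UNIV. y $ i * y $ i) = (norm y)\<^sup>2"
      by (simp only: power2_norm_eq_inner inner_vec_def) simp
    moreover have "(\<Sum>i\<in>UNIV. unit_coord i y * y $ i) = inverse (norm y) * (\<Sum>i\<in>UNIV. y $ i * y $ i)"
      by (simp add: unit_coord_def sum_distrib_left mult_ac)
    ultimately show ?thesis by (cases "y = 0") (simp_all add: power2_eq_square)
  qed
  \<comment> \<open>On the cone s vanishes, so only its own derivatives can bring in
    \<open>amp2\<close>. The radial one contributes \<open>- 2 |y| amp2\<close>, which cancels the
    contribution of the time derivative.\<close>
  have "(\<Sum>i\<in>UNIV. unit_coord i y *\<^sub>R dx i (prog_wave q a) ?p)
      = (\<Sum>i\<in>UNIV. unit_coord i y *\<^sub>R partial_deriv (axis i 1) (amp1 q a) (a + y)) - 2 * (complex_of_real (\<Sum>i\<in>UNIV. unit_coord i y * y $ i) * amp2 q a (a + y))"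
    by (simp add: pd G0 x cone_fun_derivs rel_coord_def scaleR_conv_of_real sum.distrib sum_distrib_left sum_distrib_right algebra_simps sum_subtractf)
  moreover have "dt (prog_wave q a) ?p = 2 * (complex_of_real (norm y) * amp2 q a (a + y))"
    by (simp add: pd G0 t cone_fun_derivs time_coord_def)
  moreover have "(\<Sum>i\<in>UNIV. unit_coord i y *\<^sub>R partial_deriv (axis i 1) (amp1 q a) (a + y))
      = inverse (norm y) *\<^sub>R (\<Sum>i\<in>UNIV. (y $ i) *\<^sub>R partial_deriv (axis i 1) (amp1 q a) (a + y))"
    by (simp add: unit_coord_def scaleR_sum_right mult.commute)
  moreover have "prog_wave q a ?p = amp1 q a (a + y)" using G0 by (simp add: prog_wave_def)
  ultimately have "inverse (norm y) *\<^sub>R prog_wave q a ?p + dt (prog_wave q a) ?p + (\<Sum>i\<in>UNIV. unit_coord i y *\<^sub>R dx i (prog_wave q a) ?p)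
      = inverse (norm y) *\<^sub>R (amp1 q a (a + y) + (\<Sum>i\<in>UNIV. (y $ i) *\<^sub>R partial_deriv (axis i 1) (amp1 q a) (a + y)))"
    unfolding S0 by (simp add: scaleR_add_right)
  also have "\<dots> = (1 / (8 * pi * norm y)) *\<^sub>R q (a + y)"
    using amp_transport(1)[OF q, of a "a + y"] by (simp add: inverse_eq_divide mult.commute)
  finally show "inverse (norm y) *\<^sub>R prog_wave q a ((a, 0) + (y, norm y)) + dt (prog_wave q a) ((a, 0) + (y, norm y))
      + (\<Sum>i\<in>UNIV. unit_coord i y *\<^sub>R dx i (prog_wave q a) ((a, 0) + (y, norm y)))
      = (1 / (8 * pi * norm y)) *\<^sub>R q (a + y)" unfolding pe .
qed

section \<open>The remainder and the solution\<close>

lemma quadratic_zero_derivative: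
  fixes f :: "'a::real_normed_vector \<Rightarrow> 'b::real_normed_vector"
  assumes "f x = 0" "0 \<le> C" "\<And>h. norm h < 1 \<Longrightarrow> norm (f (x + h)) \<le> C * (norm h)\<^sup>2"
  shows "(f has_derivative (\<lambda>_. 0)) (at x)"
  unfolding has_derivative_at
proof (intro conjI)
  show "((\<lambda>h. norm (f (x + h) - f x - 0) / norm h) \<longlongrightarrow> 0) (at 0)"
  proof (rule Lim_null_comparison[where g="\<lambda>h. C * norm h"])
    have "norm (norm (f (x + h) - f x - 0) / norm h) \<le> C * norm h" if "h \<noteq> 0" "norm h < 1" for h
    proof -
      have "norm (f (x + h)) / norm h \<le> C * (norm h)\<^sup>2 / norm h"
        using assms(3)[OF that(2)] by (intro divide_right_mono) auto
      then show ?thesis using that assms(1) by (simp add: power2_eq_square)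
    qed
    then show "\<forall>\<^sub>F h in at 0. norm (norm (f (x + h) - f x - 0) / norm h) \<le> C * norm h"
      unfolding eventually_at by (intro exI[of _ 1]) (auto simp: dist_norm)
    show "((\<lambda>h. C * norm h) \<longlongrightarrow> 0) (at 0)"
      by (rule tendsto_eq_intros refl | simp)+
  qed
qed auto

lemma power_le_exp: "0 \<le> x \<Longrightarrow> x ^ n \<le> fact n * exp (x::real)"
proof -
  assume x: "0 \<le> x"
  have "x ^ n /\<^sub>R fact n \<le> (\<Sum>k. x ^ k /\<^sub>R fact k)"
    using sum_le_suminf[OF summable_exp_generic[of x], of "{n}"] x by simp
  then show ?thesis by (simp add: exp_def field_simps)
qed

definition cone_sq :: "real^3 \<Rightarrow> spacetime \<Rightarrow> complex" where
  "cone_sq a p = (if p \<in> fwd_cone a then cone_fun a p * cone_fun a p else 0)"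

text \<open>The function s cut off to the forward cone. It vanishes in the backward cone too, where
  s is positive; this form shows continuity across the cone and at the tip.\<close>

definition cone_pos :: "real^3 \<Rightarrow> spacetime \<Rightarrow> real" where
  "cone_pos a p = max 0 (snd p - norm (fst p - a)) * (snd p + norm (fst p - a))"

lemma fwd_cone_iff: "p \<in> fwd_cone a \<longleftrightarrow> norm (fst p - a) < snd p"
  by (auto simp: fwd_cone_def case_prod_beta)

lemma cone_pos_eq: "complex_of_real (cone_pos a p) = (if p \<in> fwd_cone a then cone_fun a p else 0)"
  by (auto simp: cone_pos_def fwd_cone_iff cone_fun_eq max_def power2_eq_square algebra_simps)

lemma cone_pos_bounds:
  assumes "p \<in> fwd_cone a"
  shows "0 \<le> cone_pos a p" "cone_pos a p \<le> (snd p)\<^sup>2" "0 \<le> snd p" "norm (fst p - a) \<le> snd p"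
proof -
  have r: "norm (fst p - a) < snd p" using assms by (simp add: fwd_cone_iff)
  then show 1: "0 \<le> snd p" "norm (fst p - a) \<le> snd p" using norm_ge_zero[of "fst p - a"] by linarith+
  have "cone_pos a p = (snd p)\<^sup>2 - (norm (fst p - a))\<^sup>2"
    using r by (simp add: cone_pos_def max_def power2_eq_square algebra_simps)
  moreover have "(norm (fst p - a))\<^sup>2 \<le> (snd p)\<^sup>2" using r by (intro power_mono) auto
  ultimately show "0 \<le> cone_pos a p" "cone_pos a p \<le> (snd p)\<^sup>2" by simp_all
qed

text \<open>Off the open cone the derivative vanishes because the function is quadratically small
  near each such point. The 24 covers the value, \<open>t^4 <= 4! exp t\<close>, and the
  derivatives, \<open>4 t^3 <= 4 * 3! exp t\<close>.\<close>

lemma Ckb_cone_sq: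
  assumes l: "1 \<le> l"
  shows "Ckb 1 (\<lambda>p. 24 * exp (l * snd p)) (cone_sq a)"
proof -
  let ?M = "\<lambda>p. complex_of_real (cone_pos a p)"
  define f' where "f' p v = (\<Sum>i\<in>UNIV. (fst v $ i) *\<^sub>R (- 4 * rel_coord a i p * ?M p)) + snd v *\<^sub>R (4 * time_coord p * ?M p)" for p v :: spacetime
  have GG: "Ck_on (Suc 0) UNIV (\<lambda>p. cone_fun a p * cone_fun a p)"
    by (intro Ck_on_mult Ck_on_cone_fun)
  have dGG: "dt (\<lambda>p. cone_fun a p * cone_fun a p) = (\<lambda>p. 4 * time_coord p * cone_fun a p)"
    "dx i (\<lambda>p. cone_fun a p * cone_fun a p) = (\<lambda>p. - 4 * rel_coord a i p * cone_fun a p)" for i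
    using partial_deriv_mult_fun[OF Ck_on_cone_fun Ck_on_cone_fun] by (auto simp: cone_fun_derivs)
  have der: "(cone_sq a has_derivative f' p) (at p)" for p
  proof (cases "p \<in> fwd_cone a")
    case True
    have "((\<lambda>p. cone_fun a p * cone_fun a p) has_derivative f' p) (at p)"
      using spacetime_has_derivative[OF Ck_on_differentiable[OF GG], of p] True
      unfolding f'_def cone_pos_eq dGG by simp
    then show ?thesis
      by (rule has_derivative_transform_within_open[OF _ open_fwd_cone True]) (simp add: cone_sq_def)
  next
    case False
    then have "f' p = (\<lambda>_. 0)" by (auto simp: f'_def cone_pos_eq)
    moreover have "(cone_sq a has_derivative (\<lambda>_. 0)) (at p)"
    proof (rule quadratic_zero_derivative)
      show "cone_sq a p = 0" using False by (simp add: cone_sq_def)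
      fix h :: spacetime assume h: "norm h < 1"
      \<comment> \<open>As \<open>p\<close> lies outside the cone, \<open>t - r\<close> at
        \<open>p + h\<close> is at most \<open>2 |h|\<close>, and \<open>t + r\<close> is at most
        \<open>2 (|t| + 1)\<close> with the time of \<open>p\<close> on the right; the constant is
        the square of the product.\<close>
      show "norm (cone_sq a (p + h)) \<le> (4 * (\<bar>snd p\<bar> + 1))\<^sup>2 * (norm h)\<^sup>2"
      proof (cases "p + h \<in> fwd_cone a")
        case True
        let ?t = "snd (p + h)" and ?R = "norm (fst (p + h) - a)"
        have hh: "\<bar>snd h\<bar> \<le> norm h" "norm (fst h) \<le> norm h"
          using norm_snd_le[of "snd h" "fst h"] norm_fst_le[of "fst h" "snd h"] by simp_all
        have R: "?R < ?t" using True by (simp add: fwd_cone_iff)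
        have "norm (fst p - a) \<le> ?R + norm (fst h)"
          using norm_triangle_ineq4[of "fst (p + h) - a" "fst h"] by (simp add: algebra_simps)
        then have "?t - ?R \<le> 2 * norm h" using False hh unfolding fwd_cone_iff snd_add by linarith
        moreover have "?t + ?R \<le> 2 * (\<bar>snd p\<bar> + 1)"
        proof -
          have "snd h < 1" using abs_le_D1[OF hh(1)] h by (rule le_less_trans)
          then have "?t \<le> \<bar>snd p\<bar> + 1" using abs_ge_self[of "snd p"] by simp
          moreover have "t + r \<le> 2 * (s + 1)" if "r < t" "t \<le> s + 1" for r s t :: real
          proof -
            have "t + r \<le> (s + 1) + (s + 1)" using that by (intro add_mono) auto
            then show ?thesis by (simp only: mult_2)
          qed
          ultimately show ?thesis using R by blast
        qed
        ultimately have "(?t - ?R) * (?t + ?R) \<le> (2 * norm h) * (2 * (\<bar>snd p\<bar> + 1))"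
          using R norm_ge_zero[of "fst (p + h) - a"] by (intro mult_mono) linarith+
        moreover have cp: "cone_pos a (p + h) = (?t - ?R) * (?t + ?R)" using R by (simp add: cone_pos_def)
        ultimately have "cone_pos a (p + h) \<le> 4 * (\<bar>snd p\<bar> + 1) * norm h" by (simp add: algebra_simps)
        then have "(cone_pos a (p + h))\<^sup>2 \<le> (4 * (\<bar>snd p\<bar> + 1) * norm h)\<^sup>2"
          using cone_pos_bounds(1)[OF True] by (intro power_mono)
        moreover have "norm (cone_sq a (p + h)) = (cone_pos a (p + h))\<^sup>2"
        proof -
          have "cone_sq a (p + h) = complex_of_real ((cone_pos a (p + h))\<^sup>2)"
            using True cone_pos_eq[of a "p + h"] by (simp add: cone_sq_def power2_eq_square)
          then show ?thesis by (simp only: norm_of_real) simp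
        qed
        ultimately show ?thesis by (simp add: power_mult_distrib)
      qed (simp add: cone_sq_def)
    qed simp
    ultimately show ?thesis by simp
  qed
  have cM: "continuous_on UNIV (\<lambda>p. complex_of_real (cone_pos a p))"
    unfolding cone_pos_def by (intro continuous_intros)
  have C1: "Ck_on 1 UNIV (cone_sq a)"
  proof (rule Ck_on_1I[OF der])
    show "continuous_on UNIV (\<lambda>p. f' p b)" for b
      unfolding f'_def rel_coord_def time_coord_def by (intro continuous_intros cM)
  qed
  have pd: "dt (cone_sq a) p = 4 * time_coord p * ?M p" "dx i (cone_sq a) p = - 4 * rel_coord a i p * ?M p" for p i
  proof -
    show "dt (cone_sq a) p = 4 * time_coord p * ?M p"
      using partial_deriv_eq[OF der, of "(0,1)" p] by (simp add: f'_def)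
    have "(\<Sum>j\<in>UNIV. (axis i 1 $ j) *\<^sub>R (- 4 * rel_coord a j p * ?M p)) = (\<Sum>j\<in>UNIV. if j = i then - 4 * rel_coord a j p * ?M p else 0)"
      by (intro sum.cong) (auto simp: axis_def)
    then show "dx i (cone_sq a) p = - 4 * rel_coord a i p * ?M p"
      using partial_deriv_eq[OF der, of "(axis i 1, 0)" p] by (simp add: f'_def)
  qed
  have ex: "exp (snd p) \<le> exp (l * snd p)" if "0 \<le> snd p" for p :: spacetime
    using l that by (simp add: mult_le_cancel_right1)
  have b0: "norm (cone_sq a p) \<le> 24 * exp (l * snd p)" for p
  proof (cases "p \<in> fwd_cone a")
    case True
    note cb = cone_pos_bounds[OF True]
    have "cone_sq a p = complex_of_real ((cone_pos a p)\<^sup>2)"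
      using True cone_pos_eq[of a p] by (simp add: cone_sq_def power2_eq_square)
    then have "norm (cone_sq a p) = (cone_pos a p)\<^sup>2" by (simp only: norm_of_real) simp
    also have "\<dots> \<le> ((snd p)\<^sup>2)\<^sup>2" using cb by (intro power_mono) auto
    also have "\<dots> = snd p ^ 4" by (simp add: power_mult[symmetric])
    also have "\<dots> \<le> 24 * exp (snd p)" using power_le_exp[OF cb(3), of 4] by (simp add: fact_numeral)
    finally show ?thesis using ex[OF cb(3)] by linarith
  qed (simp add: cone_sq_def)
  have b1: "4 * \<bar>c\<bar> * \<bar>cone_pos a p\<bar> \<le> 24 * exp (l * snd p)" if "p \<in> fwd_cone a \<Longrightarrow> \<bar>c\<bar> \<le> snd p" for c p
  proof (cases "p \<in> fwd_cone a")
    case True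
    note cb = cone_pos_bounds[OF True]
    have "4 * \<bar>c\<bar> * \<bar>cone_pos a p\<bar> \<le> 4 * snd p * (snd p)\<^sup>2"
      using cb that[OF True] by (intro mult_mono) auto
    also have "\<dots> = 4 * snd p ^ 3" by (simp add: power2_eq_square power3_eq_cube)
    also have "\<dots> \<le> 4 * (6 * exp (snd p))" using power_le_exp[OF cb(3), of 3] by (simp add: fact_numeral)
    finally show ?thesis using ex[OF cb(3)] by linarith
  next
    case False
    then have "cone_pos a p = 0" using cone_pos_eq[of a p] by simp
    then show ?thesis by simp
  qed
  have "norm (partial_deriv b (cone_sq a) p) \<le> 24 * exp (l * snd p)" if b: "b \<in> Basis" for b p
  proof -
    consider "b = (0, 1)" | i where "b = (axis i 1, 0)" using b by (auto simp: spacetime_Basis)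
    then show ?thesis
    proof cases
      case 1
      then show ?thesis
        using b1[of p "snd p"] cone_pos_bounds(3)[of p a] by (simp add: pd norm_mult time_coord_def)
    next
      case (2 i)
      have "\<bar>(fst p - a) $ i\<bar> \<le> snd p" if "p \<in> fwd_cone a"
        by (rule order_trans[OF component_le_norm_cart cone_pos_bounds(4)[OF that]])
      from b1[OF this] 2 show ?thesis
        by (simp add: pd norm_mult rel_coord_def mult_ac del: vector_minus_component of_real_diff)
    qed
  qed
  then show ?thesis using C1 b0 by (auto simp: One_nat_def)
qed

definition rem_source :: "(real^3 \<Rightarrow> complex) \<Rightarrow> real^3 \<Rightarrow> spacetime \<Rightarrow> complex" where
  "rem_source q a p = cone_sq a p * ((1 / 2) *\<^sub>R amp_rest q a (fst p))"

text \<open>Collects what later arguments use of \<open>W\<close>: bound, equation and support. In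
  96 = 2 * 48 the 48 = 2 * 24 bounds \<open>rem_source\<close>, and solving the Volterra equation
  doubles it.\<close>

definition wave_remainder :: "real \<Rightarrow> (real^3 \<Rightarrow> complex) \<Rightarrow> real^3 \<Rightarrow> (spacetime \<Rightarrow> complex) \<Rightarrow> bool" where
  "wave_remainder M q a W \<longleftrightarrow> Ckb 1 (\<lambda>p. 96 * bnd4 M * exp ((1 + 4 * M) * snd p)) W \<and>
     W = potential (-1) (\<lambda>p. rem_source q a p + q (fst p) * W p) \<and> (\<forall>p. snd p < norm (fst p - a) \<longrightarrow> W p = 0)"

lemma rem_source_Ckb:
  assumes "Ckb 7 (\<lambda>_. M) q" "1 \<le> l"
  shows "Ckb 1 (\<lambda>p. 48 * bnd4 M * exp (l * snd p)) (rem_source q a)"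
proof -
  have "Ckb 1 (\<lambda>_. bnd4 M) (\<lambda>x. (1 / 2) *\<^sub>R amp_rest q a x)"
    by (rule Ckb_shrink[OF amp_bounds(6)[OF assms(1)]]) simp
  from Ckb_mult[OF Ckb_cone_sq[OF assms(2)] Ckb_fst[OF this]] show ?thesis
    unfolding rem_source_def[abs_def] by (simp add: mult_ac)
qed

lemma wave_remainder_exists:
  assumes q: "Ckb 7 (\<lambda>_. M) q"
  shows "\<exists>W. wave_remainder M q a W"
proof -
  have M: "0 \<le> M" using Ckb_weight_nonneg[OF q] .
  have q1: "Ckb 1 (\<lambda>_. M) (\<lambda>p::spacetime. q (fst p))"
    using Ckb_fst[OF Ckb_order_mono[OF q, of 1]] by simp
  have S: "Ckb 1 (\<lambda>p. 48 * bnd4 M * exp ((1 + 4 * M) * snd p)) (rem_source q a)"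
    by (rule rem_source_Ckb[OF q]) (use M in auto)
  have "rem_source q a p = 0" if "snd p < norm (fst p - a)" for p
    using that by (simp add: rem_source_def cone_sq_def fwd_cone_iff)
  then show ?thesis
    using volterra_solution[OF q1 S refl, of a] unfolding wave_remainder_def by (auto simp: mult_ac)
qed

lemma potential_integrable:
  fixes F :: "spacetime \<Rightarrow> complex"
  assumes F: "continuous_on UNIV F" "\<And>p. norm (F p) \<le> A * exp (\<mu> * snd p)" and l: "0 < l" "\<mu> * \<sigma> = - l"
  shows "integrable lborel (\<lambda>y. newton y *\<^sub>R F (p + (y, \<sigma> * norm y)))"
proof (rule Bochner_Integration.integrable_bound)
  show "integrable lborel (\<lambda>y. A * exp (\<mu> * snd p) * (exp (- l * norm y) * newton y))"
    by (intro integrable_mult_right integrable_exp_newton l)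
  have "continuous_on UNIV (\<lambda>y. F (p + (y, \<sigma> * norm y)))"
    by (intro continuous_on_graph F continuous_intros)
  from borel_measurable_continuous_onI[OF this]
  show "(\<lambda>y. newton y *\<^sub>R F (p + (y, \<sigma> * norm y))) \<in> borel_measurable lborel" by simp
  show "AE y in lborel. norm (newton y *\<^sub>R F (p + (y, \<sigma> * norm y))) \<le> norm (A * exp (\<mu> * snd p) * (exp (- l * norm y) * newton y))"
  proof (rule AE_I2)
    fix y :: "real^3"
    have "\<mu> * (\<sigma> * norm y) = - l * norm y" by (metis l(2) mult.assoc)
    then have "exp (\<mu> * snd (p + (y, \<sigma> * norm y))) = exp (\<mu> * snd p) * exp (- l * norm y)"
      by (simp add: distrib_left exp_add[symmetric])
    then have "norm (newton y *\<^sub>R F (p + (y, \<sigma> * norm y))) \<le> newton y * (A * (exp (\<mu> * snd p) * exp (- l * norm y)))"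
      using mult_left_mono[OF F(2)[of "p + (y, \<sigma> * norm y)"] newton_nonneg[of y]] newton_nonneg[of y] by simp
    also have "\<dots> = A * exp (\<mu> * snd p) * (exp (- l * norm y) * newton y)" by simp
    finally show "norm (newton y *\<^sub>R F (p + (y, \<sigma> * norm y))) \<le> norm (A * exp (\<mu> * snd p) * (exp (- l * norm y) * newton y))"
      unfolding real_norm_def by (rule order_trans[OF _ abs_ge_self])
  qed
qed

text \<open>The difference of the remainders again solves a Volterra equation with \<open>q\<close>,
  whose source is proportional to the difference of the potentials. The crude bound of the
  difference is only the starting point for \<open>volterra_bound\<close>.\<close>

lemma wave_remainder_diff:
  assumes q: "Ckb 7 (\<lambda>_. M) q" and p: "Ckb 7 (\<lambda>_. M) p" and e: "Ckb 7 (\<lambda>_. e) (\<lambda>x. q x - p x)"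
    and W: "wave_remainder M q a W" and V: "wave_remainder M p a V"
  shows "Ckb 1 (\<lambda>z. 2 * ((48 * dbnd4 M + 192 * bnd4 M) * e) * exp ((1 + 4 * M) * snd z)) (\<lambda>z. W z - V z)"
proof -
  let ?l = "1 + 4 * M"
  have M: "0 \<le> M" using Ckb_weight_nonneg[OF q] .
  have l: "1 \<le> ?l" "0 < ?l" using M by auto
  have W1: "Ckb 1 (\<lambda>p. 96 * bnd4 M * exp (?l * snd p)) W" "W = potential (-1) (\<lambda>z. rem_source q a z + q (fst z) * W z)"
    and V1: "Ckb 1 (\<lambda>p. 96 * bnd4 M * exp (?l * snd p)) V" "V = potential (-1) (\<lambda>z. rem_source p a z + p (fst z) * V z)"
    using W V unfolding wave_remainder_def by blast+
  have q1: "Ckb 1 (\<lambda>_. M) (\<lambda>p::spacetime. q (fst p))" and p1: "Ckb 1 (\<lambda>_. M) (\<lambda>z::spacetime. p (fst z))"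
    and e1: "Ckb 1 (\<lambda>_. e) (\<lambda>z::spacetime. q (fst z) - p (fst z))"
    using Ckb_fst[OF Ckb_order_mono[OF q, of 1]] Ckb_fst[OF Ckb_order_mono[OF p, of 1]] Ckb_fst[OF Ckb_order_mono[OF e, of 1]] by simp_all
  \<comment> \<open>The first summand has the constant \<open>2 * 24 * dbnd4 M * e\<close>, the
    second one \<open>2 * e * 96 * bnd4 M\<close>.\<close>
  define S where "S z = cone_sq a z * ((1 / 2) *\<^sub>R (amp_rest q a (fst z) - amp_rest p a (fst z))) + (q (fst z) - p (fst z)) * V z" for z
  have S: "Ckb 1 (\<lambda>z. (48 * dbnd4 M + 192 * bnd4 M) * e * exp (?l * snd z)) S"
  proof -
    have "Ckb 1 (\<lambda>_. dbnd4 M * e) (\<lambda>x. (1 / 2) *\<^sub>R (amp_rest q a x - amp_rest p a x))"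
      by (rule Ckb_shrink[OF amp_diff_bounds(4)[OF q p e]]) simp
    from Ckb_add[OF Ckb_mult[OF Ckb_cone_sq[OF l(1)] Ckb_fst[OF this]] Ckb_mult[OF e1 V1(1)]]
    show ?thesis unfolding S_def[abs_def] by (rule Ckb_mono) (simp add: algebra_simps)
  qed
  have F1: "Ckb 1 (\<lambda>z. (48 * bnd4 M + 2 * (M * (96 * bnd4 M))) * exp (?l * snd z)) (\<lambda>z. rem_source q a z + q (fst z) * W z)"
    by (rule Ckb_mono[OF Ckb_add[OF rem_source_Ckb[OF q l(1)] Ckb_mult[OF q1 W1(1)]]]) (simp add: algebra_simps)
  have F2: "Ckb 1 (\<lambda>z. (48 * bnd4 M + 2 * (M * (96 * bnd4 M))) * exp (?l * snd z)) (\<lambda>z. rem_source p a z + p (fst z) * V z)"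
    by (rule Ckb_mono[OF Ckb_add[OF rem_source_Ckb[OF p l(1)] Ckb_mult[OF p1 V1(1)]]]) (simp add: algebra_simps)
  have "W z - V z = potential (-1) (\<lambda>z. S z + q (fst z) * (W z - V z)) z" for z
  proof -
    have "W z - V z = potential (-1) (\<lambda>z. rem_source q a z + q (fst z) * W z) z - potential (-1) (\<lambda>z. rem_source p a z + p (fst z) * V z) z"
      using W1(2) V1(2) by metis
    also have "\<dots> = potential (-1) (\<lambda>z. (rem_source q a z + q (fst z) * W z) - (rem_source p a z + p (fst z) * V z)) z"
      unfolding potential_def scaleR_diff_right
      by (intro Bochner_Integration.integral_diff[symmetric] potential_integrable[OF Ckb_continuous[OF F1] Ckb_bound[OF F1] l(2)]
          potential_integrable[OF Ckb_continuous[OF F2] Ckb_bound[OF F2] l(2)]) simp_all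
    also have "(\<lambda>z. (rem_source q a z + q (fst z) * W z) - (rem_source p a z + p (fst z) * V z)) = (\<lambda>z. S z + q (fst z) * (W z - V z))"
      by (simp add: fun_eq_iff S_def rem_source_def scaleR_diff_right algebra_simps)
    finally show ?thesis .
  qed
  then have eq: "(\<lambda>z. W z - V z) = potential (-1) (\<lambda>z. S z + q (fst z) * (W z - V z))" by blast
  have "Ckb 1 (\<lambda>z. (192 * bnd4 M) * exp (?l * snd z)) (\<lambda>z. W z - V z)"
    by (rule Ckb_mono[OF Ckb_diff[OF W1(1) V1(1)]]) (simp add: algebra_simps)
  from volterra_bound[OF q1 S refl this eq] show ?thesis by (simp add: mult_ac)
qed

section \<open>The wave equation for the constructed solution\<close>

text \<open>Defined on arbitrary functions rather than test functions, so that it may be applied to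
  \<open>q \<phi>\<close>. The first term is the delta shell, written as an advanced potential at
  the source point.\<close>

definition cone_solution :: "(real^3 \<Rightarrow> complex) \<Rightarrow> real^3 \<Rightarrow> (spacetime \<Rightarrow> complex) \<Rightarrow> (spacetime \<Rightarrow> complex) \<Rightarrow> complex" where
  "cone_solution q a W f = potential 1 f (a, 0) + (\<integral>z. indicator (fwd_cone a) z *\<^sub>R (prog_wave q a z * f z) \<partial>lborel)
     + (\<integral>z. W z * f z \<partial>lborel)"

text \<open>The delta shell produces \<open>\<phi> (a, 0)\<close> by Kirchhoff's formula and leaves
  minus the advanced potential of \<open>q \<phi>\<close>. The boundary term of Green's identity
  compensates this potential. The source left inside the cone is compensated by \<open>W\<close>,
  through duality.\<close>

theorem cone_solution_wave_equation:
  assumes q: "Ckb 7 (\<lambda>_. M) q" and W: "wave_remainder M q a W"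
    and \<phi>: "Ck_on 2 UNIV \<phi>" "compact (fsupp \<phi>)"
  shows "cone_solution q a W (wave_op \<phi>) - cone_solution q a W (\<lambda>z. q (fst z) * \<phi> z) = \<phi> (a, 0)"
proof -
  let ?l = "1 + 4 * M"
  have M: "0 \<le> M" using Ckb_weight_nonneg[OF q] .
  have l: "1 \<le> ?l" "0 < ?l" using M by auto
  have W1: "Ckb 1 (\<lambda>p. 96 * bnd4 M * exp (?l * snd p)) W" "W = potential (-1) (\<lambda>z. rem_source q a z + q (fst z) * W z)"
    using W unfolding wave_remainder_def by blast+
  have q1: "Ckb 1 (\<lambda>_. M) (\<lambda>p::spacetime. q (fst p))"
    using Ckb_fst[OF Ckb_order_mono[OF q, of 1]] by simp
  have F1: "Ckb 1 (\<lambda>z. (48 * bnd4 M + 2 * (M * (96 * bnd4 M))) * exp (?l * snd z)) (\<lambda>z. rem_source q a z + q (fst z) * W z)"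
    by (rule Ckb_mono[OF Ckb_add[OF rem_source_Ckb[OF q l(1)] Ckb_mult[OF q1 W1(1)]]]) (simp add: algebra_simps)
  note cq = Ckb_continuous[OF q1] and cW = Ckb_continuous[OF W1(1)] and cS = Ckb_continuous[OF rem_source_Ckb[OF q l(1)]]
  have \<psi>: "Ck_on 2 UNIV (prog_wave q a)" by (rule prog_wave_facts(1)[OF q])
  note c\<psi> = Ck_on_imp_continuous_on[OF \<psi>] and c\<phi> = Ck_on_imp_continuous_on[OF \<phi>(1)]
  have cwave: "continuous_on UNIV (wave_op f)" if "Ck_on 2 UNIV f" for f
    unfolding wave_op_def[abs_def] using that
    by (intro continuous_intros) (auto simp: numeral_2_eq_2)
  have sw: "compact (fsupp (wave_op \<phi>))"
  proof (rule compact_fsupp_subset[OF \<phi>(2)], rule ccontr)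
    fix x assume "wave_op \<phi> x \<noteq> 0" and x: "x \<notin> fsupp \<phi>"
    moreover have "partial_deriv b (partial_deriv b \<phi>) x = 0" for b
      using x fsupp_partial_deriv[of b \<phi>] partial_deriv_zero_outside_fsupp by blast
    ultimately show False by (simp add: wave_op_def)
  qed
  have supp: "compact (fsupp (\<lambda>z. f z * \<phi> z))" "compact (fsupp (\<lambda>z. f z * wave_op \<phi> z))" for f :: "spacetime \<Rightarrow> complex"
    by (rule compact_fsupp_subset[OF \<phi>(2)] compact_fsupp_subset[OF sw], rule ccontr, simp add: fsupp_zero)+
  have eW: "wave_op (prog_wave q a) z * \<phi> z = q (fst z) * prog_wave q a z * \<phi> z
      - (cone_fun a z * cone_fun a z) * ((1 / 2) *\<^sub>R amp_rest q a (fst z)) * \<phi> z" for z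
    unfolding prog_wave_facts(2)[OF q] by (simp add: algebra_simps)
  let ?I = "\<lambda>f. \<integral>z. indicator (fwd_cone a) z *\<^sub>R (f z :: complex) \<partial>lborel"
  have i1: "integrable lborel (\<lambda>z. indicator (fwd_cone a) z *\<^sub>R (prog_wave q a z * wave_op \<phi> z))"
    by (intro cone_integral_rays(2) continuous_intros c\<psi> cwave \<phi> supp)
  have i2: "integrable lborel (\<lambda>z. indicator (fwd_cone a) z *\<^sub>R (q (fst z) * prog_wave q a z * \<phi> z))"
    by (intro cone_integral_rays(2) continuous_intros c\<psi> cq c\<phi> supp)
  have i3: "integrable lborel (\<lambda>z. rem_source q a z * \<phi> z)"
    by (intro integrable_continuous_compact continuous_intros cS c\<phi> supp)
  have i4: "integrable lborel (\<lambda>z. q (fst z) * W z * \<phi> z)"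
    by (intro integrable_continuous_compact continuous_intros cq cW c\<phi> supp)
  have "indicator (fwd_cone a) z *\<^sub>R (prog_wave q a z * wave_op \<phi> z - wave_op (prog_wave q a) z * \<phi> z)
      = indicator (fwd_cone a) z *\<^sub>R (prog_wave q a z * wave_op \<phi> z)
        - indicator (fwd_cone a) z *\<^sub>R (q (fst z) * prog_wave q a z * \<phi> z) + rem_source q a z * \<phi> z" for z
    unfolding eW by (simp add: rem_source_def cone_sq_def indicator_def)
  then have "?I (\<lambda>z. prog_wave q a z * wave_op \<phi> z) - ?I (\<lambda>z. q (fst z) * prog_wave q a z * \<phi> z) + (\<integral>z. rem_source q a z * \<phi> z \<partial>lborel)
      = ?I (\<lambda>z. prog_wave q a z * wave_op \<phi> z - wave_op (prog_wave q a) z * \<phi> z)"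
    using i1 i2 i3 by simp
  also have "\<dots> = 2 * (\<integral>y. \<phi> ((a, 0) + (y, norm y)) * ((1 / (8 * pi * norm y)) *\<^sub>R q (a + y)) \<partial>lborel)"
    unfolding cone_green[OF \<psi> \<phi>] prog_wave_facts(3)[OF q] ..
  also have "\<dots> = potential 1 (\<lambda>z. q (fst z) * \<phi> z) (a, 0)"
  proof -
    \<comment> \<open>The factor 2 of Green's identity turns \<open>1 / (8 pi |y|)\<close> into the
      kernel \<open>1 / (4 pi |y|)\<close>.\<close>
    have "2 * (\<phi> ((a, 0) + (y, norm y)) * ((1 / (8 * pi * norm y)) *\<^sub>R q (a + y)))
        = newton y *\<^sub>R (q (fst ((a, 0) + (y, 1 * norm y))) * \<phi> ((a, 0) + (y, 1 * norm y)))" for y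
      by (simp add: newton_def scaleR_conv_of_real)
    then show ?thesis unfolding potential_def integral_mult_right_zero[symmetric] by simp
  qed
  finally have A: "?I (\<lambda>z. prog_wave q a z * wave_op \<phi> z) - ?I (\<lambda>z. q (fst z) * prog_wave q a z * \<phi> z) + (\<integral>z. rem_source q a z * \<phi> z \<partial>lborel)
      = potential 1 (\<lambda>z. q (fst z) * \<phi> z) (a, 0)" .
  have "(\<integral>z. W z * wave_op \<phi> z \<partial>lborel) = (\<integral>z. (rem_source q a z + q (fst z) * W z) * potential 1 (wave_op \<phi>) z \<partial>lborel)"
    using potential_duality[OF Ckb_continuous[OF F1] Ckb_bound[OF F1] l(2) cwave[OF \<phi>(1)] sw] W1(2) by simp
  also have "\<dots> = (\<integral>z. rem_source q a z * \<phi> z \<partial>lborel) + (\<integral>z. q (fst z) * W z * \<phi> z \<partial>lborel)"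
    unfolding potential_wave_op[OF \<phi>] distrib_right using i3 i4 by simp
  finally have B: "(\<integral>z. W z * wave_op \<phi> z \<partial>lborel) = (\<integral>z. rem_source q a z * \<phi> z \<partial>lborel) + (\<integral>z. q (fst z) * W z * \<phi> z \<partial>lborel)" .
  have C: "?I (\<lambda>z. prog_wave q a z * (q (fst z) * \<phi> z)) = ?I (\<lambda>z. q (fst z) * prog_wave q a z * \<phi> z)"
    "(\<integral>z. W z * (q (fst z) * \<phi> z) \<partial>lborel) = (\<integral>z. q (fst z) * W z * \<phi> z \<partial>lborel)"
    by (simp_all add: mult_ac)
  show ?thesis
    unfolding cone_solution_def C B potential_wave_op[OF \<phi>] A[symmetric] by simp
qed

section \<open>Bump functions and mollification\<close>

text \<open>Carrying a polynomial in \<open>1 / s\<close> makes the family closed under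
  differentiation, so smoothness follows by induction over all polynomials at once.\<close>

definition flat :: "real poly \<Rightarrow> real \<Rightarrow> real" where
  "flat p s = (if 0 < s then poly p (1 / s) * exp (- (1 / s)) else 0)"

text \<open>The factor \<open>[:0, 0, 1:]\<close> is the \<open>1 / s^2\<close> from the chain rule;
  the exponential yields \<open>p\<close> and the polynomial yields
  \<open>- pderiv p\<close>.\<close>

definition flat_step :: "real poly \<Rightarrow> real poly" where
  "flat_step p = [:0, 0, 1:] * (p - pderiv p)"

lemma poly_exp_limit: "((\<lambda>x. poly p x * exp (- x)) \<longlongrightarrow> 0) (at_top :: real filter)"
proof -
  have "((\<lambda>x. \<Sum>i\<le>degree p. coeff p i * (x ^ i / exp x)) \<longlongrightarrow> (\<Sum>i\<le>degree p. coeff p i * 0)) at_top"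
    by (intro tendsto_sum tendsto_mult tendsto_const tendsto_power_div_exp_0)
  then show ?thesis
    by (simp add: poly_altdef sum_distrib_left exp_minus divide_inverse mult_ac)
qed

lemma flat_derivative: "(flat p has_real_derivative flat (flat_step p) s) (at s)"
proof -
  consider "0 < s" | "s < 0" | "s = 0" by linarith
  then show ?thesis
  proof cases
    case 1
    have "((\<lambda>s. poly p (1 / s) * exp (- (1 / s))) has_real_derivative
        poly (pderiv p) (1 / s) * (- 1 / s\<^sup>2) * exp (- (1 / s)) + exp (- (1 / s)) * (1 / s\<^sup>2) * poly p (1 / s)) (at s)"
      using 1 by (auto intro!: derivative_eq_intros DERIV_chain2[OF poly_DERIV] simp: power2_eq_square)
    moreover have "poly (pderiv p) (1 / s) * (- 1 / s\<^sup>2) * exp (- (1 / s)) + exp (- (1 / s)) * (1 / s\<^sup>2) * poly p (1 / s) = flat (flat_step p) s"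
      using 1 by (simp add: flat_def flat_step_def field_simps power2_eq_square)
    ultimately have "((\<lambda>s. poly p (1 / s) * exp (- (1 / s))) has_real_derivative flat (flat_step p) s) (at s)" by simp
    then show ?thesis
      by (rule has_field_derivative_transform_within_open[of _ _ _ "{0<..}"]) (use 1 in \<open>auto simp: flat_def\<close>)
  next
    case 2
    have "((\<lambda>s. 0) has_real_derivative flat (flat_step p) s) (at s)" using 2 by (simp add: flat_def)
    then show ?thesis
      by (rule has_field_derivative_transform_within_open[of _ _ _ "{..<0}"]) (use 2 in \<open>auto simp: flat_def\<close>)
  next
    case 3
    have "((\<lambda>h. (flat p (0 + h) - flat p 0) / h) \<longlongrightarrow> 0) (at 0)"
    proof (rule filterlim_split_at)
      show "((\<lambda>h. (flat p (0 + h) - flat p 0) / h) \<longlongrightarrow> 0) (at_left 0)"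
        by (rule tendsto_eventually) (auto simp: eventually_at_left_field flat_def intro!: exI[of _ "-1"])
      \<comment> \<open>The factor \<open>[:0, 1:]\<close> is the division by \<open>h\<close> in
        the difference quotient at 0.\<close>
      have "((\<lambda>x. poly ([:0, 1:] * p) x * exp (- x)) \<longlongrightarrow> 0) at_top" by (rule poly_exp_limit)
      then have "((\<lambda>h. poly ([:0, 1:] * p) (inverse h) * exp (- inverse h)) \<longlongrightarrow> 0) (at_right 0)"
        by (rule filterlim_compose[OF _ filterlim_inverse_at_top_right])
      then show "((\<lambda>h. (flat p (0 + h) - flat p 0) / h) \<longlongrightarrow> 0) (at_right 0)"
        by (rule Lim_transform_eventually)
          (auto simp: eventually_at_right_field flat_def divide_inverse intro!: exI[of _ 1])
    qed
    then show ?thesis using 3 by (simp add: DERIV_def flat_def)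
  qed
qed

definition bump_arg :: "'a::euclidean_space \<Rightarrow> real" where
  "bump_arg x = 1 - x \<bullet> x"

lemma flat_bump_Ck: "Ck_on k UNIV (\<lambda>x::'a::euclidean_space. complex_of_real (flat p (bump_arg x)))"
proof (induction k arbitrary: p)
  case 0
  have "continuous_on UNIV (flat p)"
    using DERIV_isCont[OF flat_derivative] by (auto intro!: continuous_at_imp_continuous_on)
  then show ?case
    by (auto simp: bump_arg_def intro!: continuous_intros continuous_on_compose2[of UNIV "flat p"])
next
  case (Suc k)
  have d: "((\<lambda>x::'a. complex_of_real (flat p (bump_arg x))) has_derivative
      (\<lambda>v. complex_of_real (flat (flat_step p) (bump_arg x)) * complex_of_real (- 2 * (x \<bullet> v)))) (at x)" for x
  proof -
    have "(bump_arg has_derivative (\<lambda>v. - 2 * (x \<bullet> v))) (at x)"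
      unfolding bump_arg_def[abs_def] by (auto intro!: derivative_eq_intros simp: inner_commute)
    moreover have "(flat p has_derivative (*) (flat (flat_step p) (bump_arg x))) (at (bump_arg x))"
      using flat_derivative by (simp add: has_field_derivative_def)
    ultimately have "((\<lambda>x. flat p (bump_arg x)) has_derivative (\<lambda>v. flat (flat_step p) (bump_arg x) * (- 2 * (x \<bullet> v)))) (at x)"
      by (rule has_derivative_compose)
    from bounded_linear.has_derivative[OF bounded_linear_of_real this] show ?thesis by simp
  qed
  have A: "partial_deriv b (\<lambda>x::'a. complex_of_real (flat p (bump_arg x)))
      = (\<lambda>x. complex_of_real (flat (flat_step p) (bump_arg x)) * complex_of_real ((\<lambda>x. - 2 * (x \<bullet> b)) x + 0))" for b
    using partial_deriv_eq[OF d] by auto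
  have B: "Ck_on k UNIV (\<lambda>x::'a. complex_of_real ((\<lambda>x. - 2 * (x \<bullet> b)) x + 0))" for b
    by (rule linear_Ck(2)) (intro bounded_linear_const_mult bounded_linear_inner_left)
  have "Ck_on k UNIV (partial_deriv b (\<lambda>x::'a. complex_of_real (flat p (bump_arg x))))" for b
    unfolding A by (rule Ck_on_mult[OF Suc B])
  then show ?case using d by (auto simp: differentiable_def)
qed

definition bump :: "'a::euclidean_space \<Rightarrow> complex" where
  "bump x = complex_of_real (flat 1 (bump_arg x))"

lemma bump_facts:
  fixes x :: "'a::euclidean_space"
  shows "Ck_on k UNIV (bump :: 'a \<Rightarrow> complex)" "bump x = complex_of_real (Re (bump x))" "0 \<le> Re (bump x)"
    "1 \<le> norm x \<Longrightarrow> bump x = 0" "norm x < 1 \<Longrightarrow> 0 < Re (bump x)"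
proof -
  show "Ck_on k UNIV (bump :: 'a \<Rightarrow> complex)" unfolding bump_def[abs_def] by (rule flat_bump_Ck)
  show "bump x = complex_of_real (Re (bump x))" "0 \<le> Re (bump x)" by (auto simp: bump_def flat_def)
  have *: "bump_arg x = 1 - (norm x)\<^sup>2" by (simp add: bump_arg_def power2_norm_eq_inner)
  show "1 \<le> norm x \<Longrightarrow> bump x = 0"
    using one_le_power[of "norm x" 2] by (simp add: bump_def flat_def * not_less)
  show "norm x < 1 \<Longrightarrow> 0 < Re (bump x)" using power_less_one_iff[of "norm x" 2] by (simp add: bump_def flat_def *)
qed

lemma Ck_on_dilate:
  fixes f :: "'a::euclidean_space \<Rightarrow> complex"
  shows "Ck_on k UNIV f \<Longrightarrow> Ck_on k UNIV (\<lambda>x. f (c *\<^sub>R (x - v)))"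
proof (induction k arbitrary: f)
  case 0
  then show ?case by (auto intro!: continuous_on_compose2[of UNIV f] continuous_intros)
next
  case (Suc k)
  have d: "((\<lambda>x. f (c *\<^sub>R (x - v))) has_derivative (\<lambda>h. frechet_derivative f (at (c *\<^sub>R (x - v))) (c *\<^sub>R h))) (at x)" for x
  proof -
    have 1: "((\<lambda>x. c *\<^sub>R (x - v)) has_derivative (\<lambda>h. c *\<^sub>R h)) (at x)"
      by (auto intro!: derivative_eq_intros)
    have 2: "(f has_derivative frechet_derivative f (at (c *\<^sub>R (x - v)))) (at (c *\<^sub>R (x - v)))"
      using Suc.prems frechet_derivative_works by auto
    show ?thesis by (rule has_derivative_compose[OF 1 2])
  qed
  have "partial_deriv b (\<lambda>x. f (c *\<^sub>R (x - v))) = (\<lambda>x. complex_of_real c * partial_deriv b f (c *\<^sub>R (x - v)))" for b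
  proof
    fix x
    have "linear (frechet_derivative f (at (c *\<^sub>R (x - v))))"
      using Suc.prems has_derivative_linear[OF frechet_derivative_works[THEN iffD1]] by auto
    then show "partial_deriv b (\<lambda>x. f (c *\<^sub>R (x - v))) x = complex_of_real c * partial_deriv b f (c *\<^sub>R (x - v))"
      using partial_deriv_eq[OF d, of b x] by (simp add: linear_scale partial_deriv_def scaleR_conv_of_real)
  qed
  then have "Ck_on k UNIV (partial_deriv b (\<lambda>x. f (c *\<^sub>R (x - v))))" if "b \<in> Basis" for b
    using Ck_on_mult[OF Ck_on_const Suc.IH[of "partial_deriv b f"]] Suc.prems that by simp
  then show ?case using d by (auto simp: differentiable_def)
qed

section \<open>Mollification\<close>

definition mollifier :: "nat \<Rightarrow> 'a::euclidean_space \<Rightarrow> real" where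
  "mollifier n x = Re (bump (real (Suc n) *\<^sub>R x)) / (\<integral>y. Re (bump (real (Suc n) *\<^sub>R (y :: 'a))) \<partial>lborel)"

lemma scaled_bump_facts:
  fixes c :: real
  assumes c: "0 < c"
  shows "Ck_on k UNIV (\<lambda>x::'a::euclidean_space. bump (c *\<^sub>R x))" "compact (fsupp (\<lambda>x::'a. bump (c *\<^sub>R x)))"
    "integrable lborel (\<lambda>x::'a. Re (bump (c *\<^sub>R x)))" "0 < integral\<^sup>L lborel (\<lambda>x::'a. Re (bump (c *\<^sub>R x)))"
proof -
  show 1: "Ck_on k UNIV (\<lambda>x::'a. bump (c *\<^sub>R x))" for k
    using Ck_on_dilate[OF bump_facts(1), of k c 0] by simp
  show 2: "compact (fsupp (\<lambda>x::'a. bump (c *\<^sub>R x)))"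
    unfolding compact_fsupp_iff
  proof (intro exI allI impI)
    fix x :: 'a assume "1 / c < norm x"
    then have "1 \<le> norm (c *\<^sub>R x)" using c by (simp add: field_simps)
    then show "bump (c *\<^sub>R x) = 0" by (rule bump_facts(4))
  qed
  have i: "integrable lborel (\<lambda>x::'a. bump (c *\<^sub>R x))"
    using 1[of 0] 2 by (intro integrable_continuous_compact) auto
  then show 3: "integrable lborel (\<lambda>x::'a. Re (bump (c *\<^sub>R x)))" by simp
  have "integral\<^sup>L lborel (\<lambda>x::'a. Re (bump (c *\<^sub>R x))) \<noteq> 0"
  proof
    assume "integral\<^sup>L lborel (\<lambda>x::'a. Re (bump (c *\<^sub>R x))) = 0"
    then have "AE x in lborel. Re (bump (c *\<^sub>R (x::'a))) = 0"
      using integral_nonneg_eq_0_iff_AE[OF 3] bump_facts(3) by blast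
    then have "AE x in lborel. (x::'a) \<notin> ball 0 (1 / c)"
    proof eventually_elim
      case (elim x)
      then show ?case using bump_facts(5)[of "c *\<^sub>R x"] c by (auto simp: field_simps)
    qed
    then have "emeasure lborel (ball (0::'a) (1 / c)) = 0"
      by (subst (asm) AE_iff_measurable[OF _ refl]) (auto simp: ball_def)
    then show False using c unit_ball_vol_pos[of "real DIM('a)"] by (simp add: emeasure_ball)
  qed
  moreover have "0 \<le> integral\<^sup>L lborel (\<lambda>x::'a. Re (bump (c *\<^sub>R x)))"
    by (intro integral_nonneg_AE AE_I2 bump_facts(3))
  ultimately show "0 < integral\<^sup>L lborel (\<lambda>x::'a. Re (bump (c *\<^sub>R x)))" by linarith
qed

lemma mollifier_facts:
  shows "Ck_on k UNIV (\<lambda>x::'a::euclidean_space. complex_of_real (mollifier n x))" "0 \<le> mollifier n (x::'a)"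
    "integrable lborel (mollifier n :: 'a \<Rightarrow> real)" "(\<integral>x. mollifier n (x::'a) \<partial>lborel) = 1"
    "1 \<le> real (Suc n) * norm (x::'a) \<Longrightarrow> mollifier n x = 0"
    "compact (fsupp (\<lambda>x::'a. complex_of_real (mollifier n x)))"
proof -
  have c: "0 < real (Suc n)" by simp
  let ?I = "\<integral>y. Re (bump (real (Suc n) *\<^sub>R (y :: 'a))) \<partial>lborel"
  note b = scaled_bump_facts[OF c, where 'a='a]
  have eq: "complex_of_real (mollifier n x) = complex_of_real (1 / ?I) * bump (real (Suc n) *\<^sub>R x)" for x :: 'a
    unfolding mollifier_def using bump_facts(2)[of "real (Suc n) *\<^sub>R x"]
    by (metis mult.commute of_real_mult times_divide_eq_right mult.right_neutral)
  show "Ck_on k UNIV (\<lambda>x::'a. complex_of_real (mollifier n x))"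
    unfolding eq by (intro Ck_on_mult Ck_on_const b)
  show "0 \<le> mollifier n x" unfolding mollifier_def using b(4) bump_facts(3) by (intro divide_nonneg_pos)
  show "integrable lborel (mollifier n :: 'a \<Rightarrow> real)" unfolding mollifier_def[abs_def] using b(3) by simp
  show "(\<integral>x. mollifier n (x::'a) \<partial>lborel) = 1" unfolding mollifier_def using b(4) by simp
  show "1 \<le> real (Suc n) * norm x \<Longrightarrow> mollifier n x = 0"
    unfolding mollifier_def using bump_facts(4)[of "real (Suc n) *\<^sub>R x"] by simp
  show "compact (fsupp (\<lambda>x::'a. complex_of_real (mollifier n x)))"
  proof (rule compact_fsupp_subset[OF b(2)], rule ccontr)
    fix x :: 'a
    assume "complex_of_real (mollifier n x) \<noteq> 0" and "x \<notin> fsupp (\<lambda>x. bump (real (Suc n) *\<^sub>R x))"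
    then show False using fsupp_zero[of x "\<lambda>x. bump (real (Suc n) *\<^sub>R x)"] unfolding eq by simp
  qed
qed

definition mollify :: "nat \<Rightarrow> ('a::euclidean_space \<Rightarrow> complex) \<Rightarrow> 'a \<Rightarrow> complex" where
  "mollify n f x = (\<integral>y. mollifier n y *\<^sub>R f (x - y) \<partial>lborel)"

lemma mollify_support:
  fixes f :: "'a::euclidean_space \<Rightarrow> complex"
  shows "mollify n f x \<noteq> 0 \<Longrightarrow> \<exists>y. norm y \<le> 1 \<and> f (x - y) \<noteq> 0"
proof (rule ccontr)
  assume *: "mollify n f x \<noteq> 0" "\<not> (\<exists>y. norm y \<le> 1 \<and> f (x - y) \<noteq> 0)"
  have "mollifier n y *\<^sub>R f (x - y) = 0" for y
  proof (cases "norm y \<le> 1")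
    case False
    then have "1 * 1 \<le> real (Suc n) * norm y" by (intro mult_mono) auto
    then show ?thesis using mollifier_facts(5)[of n y] by simp
  qed (use * in auto)
  then have "mollify n f x = (\<integral>y. 0 \<partial>(lborel :: 'a measure))"
    unfolding mollify_def by (intro Bochner_Integration.integral_cong) auto
  then show False using *(1) by simp
qed

lemma compact_mollify:
  assumes "compact (fsupp f)"
  shows "compact (fsupp (mollify n f))"
proof -
  obtain R where R: "\<And>x. R < norm x \<Longrightarrow> f x = 0" using assms unfolding compact_fsupp_iff by blast
  have "mollify n f x = 0" if x: "R + 1 < norm x" for x
  proof (rule ccontr)
    assume "mollify n f x \<noteq> 0"
    then obtain y where "norm y \<le> 1" "f (x - y) \<noteq> 0" using mollify_support by blast
    then show False using R[of "x - y"] norm_triangle_ineq2[of x y] x by force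
  qed
  then show ?thesis unfolding compact_fsupp_iff by blast
qed

lemma Ckb_compact:
  fixes f :: "'a::euclidean_space \<Rightarrow> 'b::real_normed_vector"
  assumes "Ck_on k UNIV f" "compact (fsupp f)"
  shows "\<exists>A\<ge>0. Ckb k (\<lambda>_. A) f"
  using Ckb_of_compact[of "\<lambda>_. 1" k f] assms by auto

lemma mollify_deriv:
  fixes f :: "'a::euclidean_space \<Rightarrow> complex"
  assumes f: "Ck_on (Suc k) UNIV f" "compact (fsupp f)" and b: "b \<in> Basis"
  shows "partial_deriv b (mollify n f) = mollify n (partial_deriv b f)"
    and "Ck_on (Suc k) UNIV (mollify n f)"
proof -
  obtain A where A: "A \<ge> 0" "Ckb (Suc k) (\<lambda>_. A) f" using Ckb_compact[OF f] by blast
  have 1: "Ckb (Suc k) (\<lambda>_. mollifier n y * A) (\<lambda>x. mollifier n y *\<^sub>R f (x - y))" for y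
    using Ckb_scaleR[OF Ckb_translate[OF A(2), of "- y"], of "mollifier n y"] mollifier_facts(2)[of n y] by (simp del: Ckb.simps)
  have cont: "continuous_on UNIV (\<lambda>y. f (x - y))" for x
    by (rule continuous_on_compose2[OF Ckb_continuous[OF A(2)]]) (auto intro!: continuous_intros)
  have 2: "(\<lambda>y. mollifier n y *\<^sub>R f (x - y)) \<in> borel_measurable lborel" for x
    using borel_measurable_continuous_onI[OF cont] borel_measurable_integrable[OF mollifier_facts(3)[of n]]
    by (intro borel_measurable_scaleR) auto
  have i: "integrable lborel (\<lambda>y::'a. mollifier n y * A)" using mollifier_facts(3) by auto
  have 3: "\<exists>r>0. \<exists>g. integrable lborel g \<and> (\<forall>y::'a. \<forall>x\<in>ball p r. mollifier n y * A \<le> g y)" for p :: 'a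
    by (intro exI[of _ 1] conjI exI[of _ "\<lambda>y::'a. mollifier n y * A"] i) auto
  have 4: "(\<integral>\<^sup>+ y. ennreal (mollifier n (y::'a) * A) \<partial>lborel) \<le> ennreal A"
    using mollifier_facts(2)[of n, where 'a='a] A(1) mollifier_facts(4)[of n, where 'a='a]
    by (subst nn_integral_eq_integral[OF i]) auto
  note * = Ckb_integral[where f="\<lambda>y x. mollifier n y *\<^sub>R f (x - y)" and w="\<lambda>y _. mollifier n y * A", OF 1 2 3 4 A(1)]
  show "Ck_on (Suc k) UNIV (mollify n f)"
    unfolding mollify_def[abs_def] by (rule Ckb_imp_Ck_on[OF *(1)])
  have df: "\<And>x. f differentiable (at x)" using f(1) by auto
  have "partial_deriv b (\<lambda>x. mollifier n y *\<^sub>R f (x - y)) x = mollifier n y *\<^sub>R partial_deriv b f (x - y)" for y x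
    using partial_deriv_scaleR[of "\<lambda>x. f (x + - y)" x b "mollifier n y"] partial_deriv_translate[OF df b, of "- y"]
      Ckb_translate[OF A(2), of "- y"] by simp
  then show "partial_deriv b (mollify n f) = mollify n (partial_deriv b f)"
    unfolding mollify_def[abs_def] using *(2)[OF _ b] by simp
qed

text \<open>Convergence of all derivatives up to order \<open>k\<close> follows from uniform
  continuity applied to each of them, as mollification commutes with derivatives.\<close>

lemma mollify_approx:
  fixes f :: "'a::euclidean_space \<Rightarrow> complex"
  shows "Ck_on k UNIV f \<Longrightarrow> compact (fsupp f) \<Longrightarrow> 0 < e \<Longrightarrow>
    \<forall>\<^sub>F n in sequentially. Ckb k (\<lambda>_. e) (\<lambda>x. mollify n f x - f x)"
proof (induction k arbitrary: f)
  have base: "\<forall>\<^sub>F n in sequentially. \<forall>x. norm (mollify n f x - f x) \<le> e"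
    if f: "continuous_on UNIV f" "compact (fsupp f)" and e: "0 < e" for f :: "'a \<Rightarrow> complex"
  proof -
    obtain B where B: "B \<ge> 0" "\<And>x. norm (f x) \<le> B" using bounded_continuous_compact[OF f] by blast
    obtain R where R: "\<And>x. R < norm x \<Longrightarrow> f x = 0" using f(2) unfolding compact_fsupp_iff by blast
    have "uniformly_continuous_on (cball 0 (R + 2)) f"
      using f(1) by (intro compact_uniformly_continuous) (auto intro: continuous_on_subset)
    then obtain d where d: "d > 0" "\<And>x y. x \<in> cball 0 (R + 2) \<Longrightarrow> y \<in> cball 0 (R + 2) \<Longrightarrow> dist y x < d \<Longrightarrow> dist (f y) (f x) < e"
      using e unfolding uniformly_continuous_on_def by metis
    have d': "norm (f (x - y) - f x) \<le> e" if y: "norm y < min d 1" for x y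
    proof (cases "norm x \<le> R + 1")
      case True
      then have "norm (x - y) \<le> R + 2" using norm_triangle_ineq4[of x y] y by linarith
      then have "x - y \<in> cball 0 (R + 2)" unfolding mem_cball_0 .
      moreover have "x \<in> cball 0 (R + 2)" unfolding mem_cball_0 using True by simp
      moreover have "dist (x - y) x < d" using y by (simp add: dist_norm)
      ultimately have "dist (f (x - y)) (f x) < e" by (intro d(2))
      then show ?thesis by (simp add: dist_norm)
    next
      case False
      then have "R < norm (x - y)" using norm_triangle_ineq2[of x y] y by linarith
      then show ?thesis using R[of x] R[of "x - y"] False e by simp
    qed
    obtain N where N: "1 / real (Suc N) < min d 1" using d(1) reals_Archimedean[of "min d 1"] by (auto simp: inverse_eq_divide)
    have "norm (mollify n f x - f x) \<le> e" if n: "n \<ge> N" for n x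
    proof -
      have mf: "(\<lambda>y. f (x - y)) \<in> borel_measurable borel"
        by (intro borel_measurable_continuous_onI continuous_on_compose2[OF f(1)]) (auto intro!: continuous_intros)
      have i1: "integrable lborel (\<lambda>y. mollifier n y *\<^sub>R f (x - y))"
      proof (rule Bochner_Integration.integrable_bound)
        show "integrable lborel (\<lambda>y::'a. mollifier n y * B)" using mollifier_facts(3) by auto
        show "(\<lambda>y. mollifier n y *\<^sub>R f (x - y)) \<in> borel_measurable lborel"
          using mf borel_measurable_integrable[OF mollifier_facts(3)[of n]] by (intro borel_measurable_scaleR) auto
        show "AE y in lborel. norm (mollifier n y *\<^sub>R f (x - y)) \<le> norm (mollifier n y * B)"
          using B mollifier_facts(2) by (intro AE_I2) (simp add: abs_mult mult_left_mono)
      qed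
      have i2: "integrable lborel (\<lambda>y::'a. mollifier n y *\<^sub>R f x)" using mollifier_facts(3) by auto
      have "mollify n f x - f x = (\<integral>y. mollifier n y *\<^sub>R f (x - y) \<partial>lborel) - (\<integral>y. mollifier n (y::'a) *\<^sub>R f x \<partial>lborel)"
        using mollifier_facts(3,4)[of n, where 'a='a] by (simp add: mollify_def)
      also have "\<dots> = (\<integral>y. mollifier n y *\<^sub>R (f (x - y) - f x) \<partial>lborel)"
        using i1 i2 by (simp add: scaleR_diff_right)
      also have "norm \<dots> \<le> (\<integral>y. mollifier n (y::'a) * e \<partial>lborel)"
      proof (rule order_trans[OF integral_norm_bound integral_mono])
        show "integrable lborel (\<lambda>y. norm (mollifier n y *\<^sub>R (f (x - y) - f x)))"
          by (rule integrable_norm) (use i1 i2 in \<open>simp add: scaleR_diff_right\<close>)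
        show "integrable lborel (\<lambda>y::'a. mollifier n y * e)" using mollifier_facts(3) by auto
        show "norm (mollifier n y *\<^sub>R (f (x - y) - f x)) \<le> mollifier n y * e" for y
        proof (cases "real (Suc n) * norm y < 1")
          case True
          have "norm y < 1 / real (Suc n)" using True by (simp add: field_simps)
          also have "\<dots> \<le> 1 / real (Suc N)" using n by (simp add: frac_le)
          also have "\<dots> < min d 1" by (rule N)
          finally have "norm y < min d 1" .
          from d'[OF this] show ?thesis using mollifier_facts(2)[of n y] by (simp add: mult_left_mono)
        next
          case False
          then show ?thesis using mollifier_facts(5)[of n y] by simp
        qed
      qed
      also have "\<dots> = e" using mollifier_facts(4)[of n, where 'a='a] by simp
      finally show ?thesis .
    qed
    then show ?thesis unfolding eventually_sequentially by blast
  qed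
  {
    case 0
    then have c: "continuous_on UNIV f" by simp
    have "continuous_on UNIV (mollify n f)" for n
    proof -
      obtain A where A: "A \<ge> 0" "Ckb 0 (\<lambda>_. A) f" using Ckb_compact[OF 0(1,2)] by blast
      have 1: "Ckb 0 (\<lambda>_. mollifier n y * A) (\<lambda>x. mollifier n y *\<^sub>R f (x - y))" for y
        using Ckb_scaleR[OF Ckb_translate[OF A(2), of "- y"], of "mollifier n y"] mollifier_facts(2)[of n y] by (simp del: Ckb.simps)
      have cont: "continuous_on UNIV (\<lambda>y. f (x - y))" for x
        by (rule continuous_on_compose2[OF c]) (auto intro!: continuous_intros)
      have 2: "(\<lambda>y. mollifier n y *\<^sub>R f (x - y)) \<in> borel_measurable lborel" for x
        using borel_measurable_continuous_onI[OF cont] borel_measurable_integrable[OF mollifier_facts(3)[of n]]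
        by (intro borel_measurable_scaleR) auto
      have i: "integrable lborel (\<lambda>y::'a. mollifier n y * A)" using mollifier_facts(3) by auto
      have 3: "\<exists>r>0. \<exists>g. integrable lborel g \<and> (\<forall>y::'a. \<forall>x\<in>ball p r. mollifier n y * A \<le> g y)" for p :: 'a
        by (intro exI[of _ 1] conjI exI[of _ "\<lambda>y::'a. mollifier n y * A"] i) auto
      have 4: "(\<integral>\<^sup>+ y. ennreal (mollifier n (y::'a) * A) \<partial>lborel) \<le> ennreal A"
        using mollifier_facts(2)[of n, where 'a='a] A(1) mollifier_facts(4)[of n, where 'a='a]
        by (subst nn_integral_eq_integral[OF i]) auto
      show ?thesis
        using Ckb_integral(1)[where f="\<lambda>y x. mollifier n y *\<^sub>R f (x - y)" and w="\<lambda>y _. mollifier n y * A", OF 1 2 3 4 A(1)]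
        unfolding mollify_def[abs_def] by simp
    qed
    then show ?case using base[OF c 0(2,3)] c by (auto elim!: eventually_mono intro!: continuous_intros)
  next
    case (Suc k)
    have "\<forall>\<^sub>F n in sequentially. \<forall>b\<in>Basis. Ckb k (\<lambda>_. e) (\<lambda>x. mollify n (partial_deriv b f) x - partial_deriv b f x)"
      using Suc compact_fsupp_partial_deriv[OF Suc.prems(2)] by (intro eventually_ball_finite finite_Basis ballI Suc.IH) auto
    moreover have "\<forall>\<^sub>F n in sequentially. \<forall>x. norm (mollify n f x - f x) \<le> e"
      by (intro base Ck_on_imp_continuous_on[OF Suc.prems(1)] Suc.prems(2,3))
    ultimately show ?case
    proof eventually_elim
      case (elim n)
      have m: "Ck_on (Suc k) UNIV (mollify n f)" by (rule mollify_deriv(2)[OF Suc.prems(1,2) SOME_Basis])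
      have "partial_deriv b (\<lambda>x. mollify n f x - f x) = (\<lambda>x. mollify n (partial_deriv b f) x - partial_deriv b f x)" if "b \<in> Basis" for b
        unfolding mollify_deriv(1)[OF Suc.prems(1,2) that, symmetric]
        using m Suc.prems(1) by (intro ext partial_deriv_diff) auto
      then show ?case using elim m Suc.prems(1) by auto
    qed
  }
qed

text \<open>After a substitution the derivatives fall on the kernel instead of on \<open>f\<close>,
  so continuity of \<open>f\<close> suffices for every order.\<close>

lemma mollify_smooth:
  fixes f :: "'a::euclidean_space \<Rightarrow> complex"
  assumes f: "continuous_on UNIV f" "compact (fsupp f)"
  shows "Ck_on k UNIV (mollify n f)"
proof -
  obtain A where A: "A \<ge> 0" "Ckb k (\<lambda>_. A) (\<lambda>x::'a. complex_of_real (mollifier n x))"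
    using Ckb_compact[OF mollifier_facts(1,6)] by blast
  have eq: "mollify n f x = (\<integral>y. f y * complex_of_real (mollifier n (x - y)) \<partial>lborel)" for x
  proof -
    have "continuous_on UNIV (\<lambda>y. complex_of_real (mollifier n (y::'a)))"
      using mollifier_facts(1)[of 0 n] by simp
    then have m: "(\<lambda>y. complex_of_real (mollifier n y) * f (x - y)) \<in> borel_measurable borel"
      by (intro borel_measurable_continuous_onI continuous_intros continuous_on_compose2[OF f(1)]) auto
    have "mollify n f x = (\<integral>y. complex_of_real (mollifier n y) * f (x - y) \<partial>lborel)"
      by (simp add: mollify_def scaleR_conv_of_real)
    also have "\<dots> = (\<integral>y. complex_of_real (mollifier n (- y)) * f (x - - y) \<partial>lborel)"
      by (rule integral_lborel_minus[OF m, symmetric])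
    also have "\<dots> = (\<integral>y. complex_of_real (mollifier n (- (y - x))) * f (x - - (y - x)) \<partial>lborel)"
      using integral_lborel_translate(1)[of "\<lambda>y. complex_of_real (mollifier n (- y)) * f (x - - y)" "- x"] by simp
    finally show ?thesis by (simp add: mult.commute)
  qed
  have ifA: "integrable lborel (\<lambda>y. norm (f y) * A)"
    using integrable_continuous_compact[OF f] by simp
  have 1: "Ckb k (\<lambda>_. norm (f y) * A) (\<lambda>x. f y * complex_of_real (mollifier n (x - y)))" for y
    using Ckb_cmult[OF Ckb_translate[OF A(2), of "- y"], of "f y"] by (simp del: Ckb.simps)
  have 2: "(\<lambda>y. f y * complex_of_real (mollifier n (x - y))) \<in> borel_measurable lborel" for x
  proof -
    have "continuous_on UNIV (\<lambda>y. complex_of_real (mollifier n (y::'a)))"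
      using mollifier_facts(1)[of 0 n] by simp
    then have "continuous_on UNIV (\<lambda>y. complex_of_real (mollifier n (x - y)))"
      by (rule continuous_on_compose2) (auto intro!: continuous_intros)
    with f(1) show ?thesis using borel_measurable_continuous_onI[OF continuous_on_mult] by fastforce
  qed
  have 3: "\<exists>r>0. \<exists>g. integrable lborel g \<and> (\<forall>y. \<forall>x\<in>ball p r. norm (f y) * A \<le> g y)" for p :: 'a
    by (intro exI[of _ 1] conjI exI[of _ "\<lambda>y. norm (f y) * A"] ifA) auto
  have 4: "(\<integral>\<^sup>+ y. ennreal (norm (f y) * A) \<partial>lborel) \<le> ennreal (\<integral>y. norm (f y) * A \<partial>lborel)"
    using A(1) by (subst nn_integral_eq_integral[OF ifA]) auto
  have 5: "0 \<le> (\<integral>y. norm (f y) * A \<partial>lborel)" using A(1) by (intro integral_nonneg_AE AE_I2) auto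
  show ?thesis
    unfolding eq[abs_def]
    by (rule Ckb_imp_Ck_on[OF Ckb_integral(1)[where w="\<lambda>y _. norm (f y) * A", OF 1 2 3 4 5]])
qed

section \<open>Distributions of finite order\<close>

text \<open>Extension by zero: the set \<open>X\<close> and the complement of the support are open,
  cover the space, and on the latter the function is 0.\<close>

lemma Ck_on_UNIV_of_support:
  assumes "open X" "Ck_on k X f" "fsupp f \<subseteq> X"
  shows "Ck_on k UNIV f"
proof -
  have o: "open (- fsupp f)" by (simp add: fsupp_def open_Compl)
  have "Ck_on k (- fsupp f) f"
    by (rule Ck_on_cong[OF o Ck_on_subset[OF Ck_on_const[of k 0]]]) (auto simp: fsupp_zero)
  moreover have "X \<union> - fsupp f = UNIV" using assms(3) by auto
  ultimately show ?thesis using Ck_on_Un[OF assms(1) o assms(2)] by simp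
qed

lemma Cc_iff: "f \<in> Cc n UNIV \<longleftrightarrow> Ck_on n UNIV f \<and> compact (fsupp f)"
  by (simp add: Cc_def)

lemma test_iff: "f \<in> test_functions UNIV \<longleftrightarrow> (\<forall>k. Ck_on k UNIV f) \<and> compact (fsupp f)"
  by (auto simp: test_functions_def Cc_iff)

lemma test_subset_Cc: "f \<in> test_functions UNIV \<Longrightarrow> f \<in> Cc n UNIV"
  by (simp add: test_functions_def)

lemma Cc_mono: "f \<in> Cc n X \<Longrightarrow> m \<le> n \<Longrightarrow> f \<in> Cc m X"
  using Ck_on_mono by (auto simp: Cc_def)

lemma Cc_open: "open X \<Longrightarrow> f \<in> Cc n X \<Longrightarrow> f \<in> Cc n UNIV"
  using Ck_on_UNIV_of_support by (auto simp: Cc_def)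

lemma test_open: "open X \<Longrightarrow> f \<in> test_functions X \<Longrightarrow> f \<in> test_functions UNIV"
  using Cc_open by (auto simp: test_functions_def)

lemma test_support: "open X \<Longrightarrow> f \<in> test_functions X \<longleftrightarrow> f \<in> test_functions UNIV \<and> fsupp f \<subseteq> X"
  using test_open[of X f] Ck_on_subset[of _ UNIV f X] unfolding test_functions_def Cc_def by auto

lemma compact_fsupp_combine:
  fixes f g :: "'a::euclidean_space \<Rightarrow> 'b::zero"
  assumes "compact (fsupp f)" "compact (fsupp g)" "\<And>x. f x = 0 \<Longrightarrow> g x = 0 \<Longrightarrow> h x = 0"
  shows "compact (fsupp h)"
proof -
  obtain R S where "\<And>x. R < norm x \<Longrightarrow> f x = 0" "\<And>x. S < norm x \<Longrightarrow> g x = 0"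
    using assms(1,2) unfolding compact_fsupp_iff by blast
  then have "\<And>x. max R S < norm x \<Longrightarrow> h x = 0" using assms(3) by simp
  then show ?thesis unfolding compact_fsupp_iff by blast
qed

lemma Cc_add: "f \<in> Cc n UNIV \<Longrightarrow> g \<in> Cc n UNIV \<Longrightarrow> (\<lambda>x. f x + g x) \<in> Cc n UNIV"
  unfolding Cc_iff using compact_fsupp_combine[of f g "\<lambda>x. f x + g x"] Ck_on_add[of n f g] by simp

lemma Cc_diff: "f \<in> Cc n UNIV \<Longrightarrow> g \<in> Cc n UNIV \<Longrightarrow> (\<lambda>x. f x - g x) \<in> Cc n UNIV"
  unfolding Cc_iff using compact_fsupp_combine[of f g "\<lambda>x. f x - g x"] Ck_on_diff[of n f g] by simp

lemma Cc_mult: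
  assumes "Ck_on n UNIV g" "f \<in> Cc n UNIV"
  shows "(\<lambda>x. g x * f x) \<in> Cc n UNIV"
proof -
  have "compact (fsupp (\<lambda>x. g x * f x))"
    using assms(2) unfolding Cc_iff compact_fsupp_iff by force
  then show ?thesis using assms by (auto simp: Cc_iff intro: Ck_on_mult)
qed

lemma test_diff: "f \<in> test_functions UNIV \<Longrightarrow> g \<in> test_functions UNIV \<Longrightarrow> (\<lambda>x. f x - g x) \<in> test_functions UNIV"
  unfolding test_functions_def by (blast intro: Cc_diff)

lemma test_add: "f \<in> test_functions UNIV \<Longrightarrow> g \<in> test_functions UNIV \<Longrightarrow> (\<lambda>x. f x + g x) \<in> test_functions UNIV"
  unfolding test_functions_def by (blast intro: Cc_add)

lemma test_mult: "(\<And>k. Ck_on k UNIV g) \<Longrightarrow> f \<in> test_functions UNIV \<Longrightarrow> (\<lambda>x. g x * f x) \<in> test_functions UNIV"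
  unfolding test_functions_def by (blast intro: Cc_mult)

lemma test_partial_deriv: "f \<in> test_functions UNIV \<Longrightarrow> b \<in> Basis \<Longrightarrow> partial_deriv b f \<in> test_functions UNIV"
  unfolding test_iff using compact_fsupp_partial_deriv by (metis Ck_on.simps(2))

lemma mollify_test: "f \<in> Cc n UNIV \<Longrightarrow> mollify j f \<in> test_functions UNIV"
  unfolding test_iff Cc_iff using mollify_smooth compact_mollify Ck_on_imp_continuous_on by blast

lemma continuous_formsD:
  assumes "U \<in> continuous_forms E n"
  shows "\<phi> \<in> E \<Longrightarrow> \<psi> \<in> E \<Longrightarrow> U (\<lambda>x. \<phi> x + \<psi> x) = U \<phi> + U \<psi>"
    and "\<phi> \<in> E \<Longrightarrow> U (\<lambda>x. c * \<phi> x) = c * U \<phi>"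
  using assms by (auto simp: continuous_forms_def)

lemma continuous_forms_diff:
  assumes "U \<in> continuous_forms E n" "\<And>c \<phi>. \<phi> \<in> E \<Longrightarrow> (\<lambda>x. c * \<phi> x) \<in> E" "\<phi> \<in> E" "\<psi> \<in> E"
  shows "U (\<lambda>x. \<phi> x - \<psi> x) = U \<phi> - U \<psi>"
  using continuous_formsD(1)[OF assms(1,3) assms(2)[OF assms(4), of "-1"]] continuous_formsD(2)[OF assms(1,4), of "-1"]
  by simp

lemma continuous_forms_bound:
  fixes U :: "('a::euclidean_space \<Rightarrow> complex) \<Rightarrow> complex"
  assumes "U \<in> continuous_forms E n" "compact K"
  obtains C where "0 \<le> C" "\<And>\<phi> A. \<phi> \<in> E \<Longrightarrow> fsupp \<phi> \<subseteq> K \<Longrightarrow> Ckb n (\<lambda>_. A) \<phi> \<Longrightarrow> norm (U \<phi>) \<le> C * A"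
proof -
  obtain C where C: "\<And>\<phi>. \<phi> \<in> E \<Longrightarrow> fsupp \<phi> \<subseteq> K \<Longrightarrow> ereal (cmod (U \<phi>)) \<le> ereal C * Ck_norm n UNIV \<phi>"
    using assms unfolding continuous_forms_def mem_Collect_eq by metis
  let ?c = "real (card (multi_indices n :: 'a multiset set))"
  have "norm (U \<phi>) \<le> (\<bar>C\<bar> * ?c) * A" if "\<phi> \<in> E" "fsupp \<phi> \<subseteq> K" "Ckb n (\<lambda>_. A) \<phi>" for \<phi> A
  proof -
    have n: "Ck_norm n UNIV \<phi> \<le> ereal (?c * A)" using Ck_norm_le[OF that(3)] by simp
    have "ereal (cmod (U \<phi>)) \<le> ereal C * Ck_norm n UNIV \<phi>" by (rule C[OF that(1,2)])
    also have "\<dots> \<le> ereal \<bar>C\<bar> * Ck_norm n UNIV \<phi>"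
      by (intro ereal_mult_right_mono Ck_norm_nonneg) auto
    also have "\<dots> \<le> ereal \<bar>C\<bar> * ereal (?c * A)" by (rule ereal_mult_left_mono[OF n]) simp
    finally show ?thesis by (simp add: mult_ac)
  qed
  then show ?thesis by (intro that[of "\<bar>C\<bar> * ?c"]) auto
qed

section \<open>Extension of distributions to \<open>C^n\<close> functions\<close>

lemma mollify_bounded_support:
  assumes "\<And>x. R < norm x \<Longrightarrow> f x = 0" "x \<notin> cball 0 (R + 1)"
  shows "mollify j f x = 0"
proof (rule ccontr)
  assume "mollify j f x \<noteq> 0"
  then obtain y where "norm y \<le> 1" "f (x - y) \<noteq> 0" using mollify_support by blast
  moreover have "R < norm (x - y)"
    using assms(2) \<open>norm y \<le> 1\<close> norm_triangle_ineq2[of x y] unfolding mem_cball_0 by linarith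
  ultimately show False using assms(1) by blast
qed

text \<open>The mollified functions have supports in a common ball and converge in
  \<open>C^n\<close>, and on that ball the form is bounded by the \<open>C^n\<close> norm.\<close>

lemma mollify_Cauchy:
  assumes U: "U \<in> distributions_of_order n" and f: "f \<in> Cc n UNIV"
  shows "convergent (\<lambda>j. U (mollify j f))"
proof -
  obtain R where R: "\<And>x. R < norm x \<Longrightarrow> f x = 0" using f unfolding Cc_iff compact_fsupp_iff by blast
  have supp: "fsupp (mollify j f) \<subseteq> cball 0 (R + 1)" for j
    using mollify_bounded_support[of R f, OF R] by (subst fsupp_subset_iff) auto
  obtain C where C: "0 \<le> C" "\<And>\<phi> A. \<phi> \<in> test_functions UNIV \<Longrightarrow> fsupp \<phi> \<subseteq> cball 0 (R + 1) \<Longrightarrow> Ckb n (\<lambda>_. A) \<phi> \<Longrightarrow> norm (U \<phi>) \<le> C * A"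
    using continuous_forms_bound[OF U[unfolded distributions_of_order_def] compact_cball] by blast
  have test: "(\<lambda>x. c * \<phi> x) \<in> test_functions UNIV" if "\<phi> \<in> test_functions UNIV" for c and \<phi> :: "'a \<Rightarrow> complex"
    using test_mult[OF Ck_on_const that] by simp
  have "Cauchy (\<lambda>j. U (mollify j f))"
  proof (rule metric_CauchyI)
    fix e :: real assume e: "0 < e"
    define d where "d = e / (2 * (C + 1))"
    have d: "0 < d" using e C(1) by (simp add: d_def)
    obtain N where N: "\<And>j. j \<ge> N \<Longrightarrow> Ckb n (\<lambda>_. d) (\<lambda>x. mollify j f x - f x)"
      using mollify_approx[OF _ _ d, of n f] f unfolding Cc_iff eventually_sequentially by blast
    have "dist (U (mollify i f)) (U (mollify j f)) < e" if "i \<ge> N" "j \<ge> N" for i j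
    proof -
      have b: "Ckb n (\<lambda>_. 2 * d) (\<lambda>x. mollify i f x - mollify j f x)"
        using Ckb_diff[OF N[OF that(1)] N[OF that(2)]] by simp
      have s: "fsupp (\<lambda>x. mollify i f x - mollify j f x) \<subseteq> cball 0 (R + 1)"
        using supp[of i] supp[of j] by (simp add: fsupp_subset_iff)
      have "U (mollify i f) - U (mollify j f) = U (\<lambda>x. mollify i f x - mollify j f x)"
        by (rule continuous_forms_diff[OF U[unfolded distributions_of_order_def] test, symmetric]) (use f mollify_test in auto)
      then have "dist (U (mollify i f)) (U (mollify j f)) \<le> C * (2 * d)"
        using C(2)[OF test_diff[OF mollify_test[OF f] mollify_test[OF f]] s b] by (simp add: dist_norm)
      also have "C * (2 * d) = e * (C / (C + 1))" using C(1) by (simp add: d_def field_simps)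
      also have "\<dots> < e * 1" using e C(1) by (intro mult_strict_left_mono) auto
      finally show ?thesis by simp
    qed
    then show "\<exists>M. \<forall>m\<ge>M. \<forall>n\<ge>M. dist (U (mollify m f)) (U (mollify n f)) < e" by blast
  qed
  then show ?thesis by (simp add: Cauchy_convergent_iff)
qed

lemma form_mollify_limit:
  fixes V :: "('a::euclidean_space \<Rightarrow> complex) \<Rightarrow> complex"
  assumes V: "V \<in> continuous_forms (Cc n UNIV) n" and f: "f \<in> Cc n UNIV"
  shows "(\<lambda>j. V (mollify j f)) \<longlonglongrightarrow> V f"
proof -
  obtain R where R: "\<And>x. R < norm x \<Longrightarrow> f x = 0" using f unfolding Cc_iff compact_fsupp_iff by blast
  note supp = mollify_bounded_support[of R f, OF R]
  obtain C where C: "0 \<le> C" "\<And>\<phi> A. \<phi> \<in> Cc n UNIV \<Longrightarrow> fsupp \<phi> \<subseteq> cball 0 (R + 1) \<Longrightarrow> Ckb n (\<lambda>_. A) \<phi> \<Longrightarrow> norm (V \<phi>) \<le> C * A"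
    using continuous_forms_bound[OF V compact_cball] by blast
  have m: "mollify j f \<in> Cc n UNIV" for j using test_subset_Cc[OF mollify_test[OF f]] .
  have Ec: "(\<lambda>x. c * \<phi> x) \<in> Cc n UNIV" if "\<phi> \<in> Cc n UNIV" for c and \<phi> :: "'a \<Rightarrow> complex"
    using Cc_mult[OF Ck_on_const that] by simp
  show ?thesis
  proof (rule metric_LIMSEQ_I)
    fix e :: real assume e: "0 < e"
    define d where "d = e / (C + 1)"
    have d: "0 < d" using e C(1) by (simp add: d_def)
    obtain N where N: "\<And>j. j \<ge> N \<Longrightarrow> Ckb n (\<lambda>_. d) (\<lambda>x. mollify j f x - f x)"
      using mollify_approx[OF _ _ d, of n f] f unfolding Cc_iff eventually_sequentially by blast
    have "dist (V (mollify j f)) (V f) < e" if "j \<ge> N" for j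
    proof -
      have s: "fsupp (\<lambda>x. mollify j f x - f x) \<subseteq> cball 0 (R + 1)"
        using supp R by (simp add: fsupp_subset_iff)
      have "V (mollify j f) - V f = V (\<lambda>x. mollify j f x - f x)"
        by (rule continuous_forms_diff[OF V Ec m f, symmetric])
      then have "dist (V (mollify j f)) (V f) \<le> C * d"
        using C(2)[OF Cc_diff[OF m f] s N[OF that]] by (simp add: dist_norm)
      also have "C * d = e * (C / (C + 1))" using C(1) by (simp add: d_def)
      also have "\<dots> < e * 1" using e C(1) by (intro mult_strict_left_mono) auto
      finally show ?thesis by simp
    qed
    then show "\<exists>no. \<forall>j\<ge>no. dist (V (mollify j f)) (V f) < e" by blast
  qed
qed

lemma order_extension_unique:
  fixes U :: "('a::euclidean_space \<Rightarrow> complex) \<Rightarrow> complex"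
  assumes "V \<in> continuous_forms (Cc n UNIV) n" "\<And>\<phi>. \<phi> \<in> test_functions UNIV \<Longrightarrow> V \<phi> = U \<phi>"
    and "W \<in> continuous_forms (Cc n UNIV) n" "\<And>\<phi>. \<phi> \<in> test_functions UNIV \<Longrightarrow> W \<phi> = U \<phi>"
  shows "V = W"
proof (rule extensionalityI[of _ "Cc n UNIV"])
  show "V \<in> extensional (Cc n UNIV)" "W \<in> extensional (Cc n UNIV)"
    using assms by (auto simp: continuous_forms_def)
  fix f :: "'a \<Rightarrow> complex" assume f: "f \<in> Cc n UNIV"
  have "V (mollify j f) = W (mollify j f)" for j
    using assms(2,4) mollify_test[OF f] by metis
  then show "V f = W f"
    using form_mollify_limit[OF assms(1) f] form_mollify_limit[OF assms(3) f] LIMSEQ_unique by simp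
qed

lemma order_extension_eq:
  assumes "V \<in> continuous_forms (Cc n UNIV) n" "\<And>\<phi>. \<phi> \<in> test_functions UNIV \<Longrightarrow> V \<phi> = U \<phi>"
  shows "order_extension n U = V"
  unfolding order_extension_def using assms order_extension_unique by (intro the_equality) blast+

lemma Ck_norm_ge_sup: "ereal (norm (f x)) \<le> Ck_norm n UNIV f"
  using Ck_norm_ge[OF empty_in_multi_indices, of x UNIV f n] by simp

text \<open>The extension is the limit of \<open>U\<close> along mollifications. This gives
  existence; with the density used in \<open>order_extension_unique\<close> the definite description
  in \<open>order_extension\<close> is justified.\<close>

lemma order_extension_facts:
  fixes U :: "('a::euclidean_space \<Rightarrow> complex) \<Rightarrow> complex"
  assumes U: "U \<in> distributions_of_order n"
  shows "order_extension n U \<in> continuous_forms (Cc n UNIV) n"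
    and "\<And>\<phi>. \<phi> \<in> test_functions UNIV \<Longrightarrow> order_extension n U \<phi> = U \<phi>"
proof -
  define V where "V = (\<lambda>f\<in>Cc n (UNIV :: 'a set). lim (\<lambda>j. U (mollify j f)))"
  have L: "(\<lambda>j. U (mollify j f)) \<longlonglongrightarrow> V f" if "f \<in> Cc n UNIV" for f
    using mollify_Cauchy[OF U that] that by (simp add: V_def convergent_LIMSEQ_iff)
  have U': "U \<in> continuous_forms (test_functions UNIV) n" using U by (simp add: distributions_of_order_def)
  have test: "(\<lambda>x. c * \<phi> x) \<in> test_functions UNIV" if "\<phi> \<in> test_functions UNIV" for c and \<phi> :: "'a \<Rightarrow> complex"
    using test_mult[OF Ck_on_const that] by simp
  \<comment> \<open>The limit is the same along every sequence of test functions that approximates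
    \<open>f\<close> in \<open>C^n\<close> within a fixed ball. Sums and multiples of mollifications
    are such sequences, which yields linearity; a constant sequence shows agreement with
    \<open>U\<close>.\<close>
  have lim_any: "(\<lambda>j. U (g j)) \<longlonglongrightarrow> z"
    if "(\<lambda>j. U (mollify j f)) \<longlonglongrightarrow> z" and f: "f \<in> Cc n UNIV" and g: "\<And>j. g j \<in> test_functions UNIV"
      and sg: "\<And>j x. x \<notin> cball 0 R \<Longrightarrow> g j x = 0"
      and ap: "\<And>e. 0 < e \<Longrightarrow> \<forall>\<^sub>F j in sequentially. Ckb n (\<lambda>_. e) (\<lambda>x. g j x - f x)" for f g z R
  proof -
    obtain R' where R': "\<And>x. R' < norm x \<Longrightarrow> f x = 0" using f unfolding Cc_iff compact_fsupp_iff by blast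
    define S where "S = max R (R' + 1)"
    have supp: "mollify j f x = 0" if "x \<notin> cball 0 S" for j x
      by (rule mollify_bounded_support[of R' f, OF R']) (use that in \<open>simp_all add: S_def\<close>)
    have supp': "g j x = 0" if "x \<notin> cball 0 S" for j x using sg[of x j] that by (simp add: S_def)
    obtain C where C: "0 \<le> C" "\<And>\<phi> A. \<phi> \<in> test_functions UNIV \<Longrightarrow> fsupp \<phi> \<subseteq> cball 0 S \<Longrightarrow> Ckb n (\<lambda>_. A) \<phi> \<Longrightarrow> norm (U \<phi>) \<le> C * A"
      using continuous_forms_bound[OF U' compact_cball] by blast
    have "(\<lambda>j. U (g j) - U (mollify j f)) \<longlonglongrightarrow> 0"
    proof (rule metric_LIMSEQ_I)
      fix e :: real assume e: "0 < e"
      define d where "d = e / (2 * (C + 1))"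
      have d: "0 < d" using e C(1) by (simp add: d_def)
      have "\<forall>\<^sub>F j in sequentially. Ckb n (\<lambda>_. d) (\<lambda>x. g j x - f x) \<and> Ckb n (\<lambda>_. d) (\<lambda>x. mollify j f x - f x)"
        using ap[OF d] mollify_approx[OF _ _ d, of n f] f by (auto simp: Cc_iff eventually_conj_iff)
      then obtain N where N: "\<And>j. j \<ge> N \<Longrightarrow> Ckb n (\<lambda>_. d) (\<lambda>x. g j x - f x) \<and> Ckb n (\<lambda>_. d) (\<lambda>x. mollify j f x - f x)"
        unfolding eventually_sequentially by blast
      have "dist (U (g j) - U (mollify j f)) 0 < e" if "j \<ge> N" for j
      proof -
        have b: "Ckb n (\<lambda>_. 2 * d) (\<lambda>x. g j x - mollify j f x)"
          using Ckb_diff[OF conjunct1[OF N[OF that]] conjunct2[OF N[OF that]]] by simp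
        have s: "fsupp (\<lambda>x. g j x - mollify j f x) \<subseteq> cball 0 S" using supp supp' by (simp add: fsupp_subset_iff)
        have "U (g j) - U (mollify j f) = U (\<lambda>x. g j x - mollify j f x)"
          by (rule continuous_forms_diff[OF U' test g mollify_test[OF f], symmetric])
        then have "dist (U (g j) - U (mollify j f)) 0 \<le> C * (2 * d)"
          using C(2)[OF test_diff[OF g mollify_test[OF f]] s b] by simp
        also have "C * (2 * d) = e * (C / (C + 1))" using C(1) by (simp add: d_def field_simps)
        also have "\<dots> < e * 1" using e C(1) by (intro mult_strict_left_mono) auto
        finally show ?thesis by simp
      qed
      then show "\<exists>no. \<forall>j\<ge>no. dist (U (g j) - U (mollify j f)) 0 < e" by blast
    qed
    from tendsto_add[OF this that(1)] show ?thesis by simp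
  qed
  have ap: "\<forall>\<^sub>F j in sequentially. Ckb n (\<lambda>_. e) (\<lambda>x. mollify j f x - f x)" if "f \<in> Cc n UNIV" "0 < e" for e and f :: "'a \<Rightarrow> complex"
    using mollify_approx[of n f e] that by (simp add: Cc_iff)
  have bs: "\<exists>R. \<forall>j x. x \<notin> cball 0 R \<longrightarrow> mollify j f x = 0" if f: "f \<in> Cc n UNIV" for f :: "'a \<Rightarrow> complex"
  proof -
    obtain R where R: "\<And>x. R < norm x \<Longrightarrow> f x = 0" using f unfolding Cc_iff compact_fsupp_iff by blast
    have "mollify j f x = 0" if "x \<notin> cball 0 (R + 1)" for j x
      using mollify_bounded_support[of R f, OF R that] .
    then show ?thesis by blast
  qed
  have VU: "V \<phi> = U \<phi>" if \<phi>: "\<phi> \<in> test_functions UNIV" for \<phi>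
  proof -
    have \<phi>': "\<phi> \<in> Cc n UNIV" using test_subset_Cc[OF \<phi>] .
    obtain R where "\<And>x. R < norm x \<Longrightarrow> \<phi> x = 0" using \<phi>' unfolding Cc_iff compact_fsupp_iff by blast
    then have "\<And>x. x \<notin> cball 0 R \<Longrightarrow> \<phi> x = 0" unfolding mem_cball_0 by simp
    from lim_any[OF L[OF \<phi>'] \<phi>' \<phi> this] have "(\<lambda>j. U \<phi>) \<longlonglongrightarrow> V \<phi>" by (simp add: Ckb_zero)
    then show ?thesis using LIMSEQ_unique tendsto_const by blast
  qed
  have V: "V \<in> continuous_forms (Cc n UNIV) n"
    unfolding continuous_forms_def
  proof (intro CollectI conjI ballI allI impI)
    show "V \<in> extensional (Cc n UNIV)" by (simp add: V_def)
    fix \<phi> \<psi> :: "'a \<Rightarrow> complex" assume \<phi>: "\<phi> \<in> Cc n UNIV" and \<psi>: "\<psi> \<in> Cc n UNIV"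
    obtain R S where R: "\<And>j x. x \<notin> cball 0 R \<Longrightarrow> mollify j \<phi> x = 0" and S: "\<And>j x. x \<notin> cball 0 S \<Longrightarrow> mollify j \<psi> x = 0"
      using bs[OF \<phi>] bs[OF \<psi>] by blast
    let ?g = "\<lambda>j x. mollify j \<phi> x + mollify j \<psi> x"
    have tg: "?g j \<in> test_functions UNIV" for j
      using test_add[OF mollify_test[OF \<phi>] mollify_test[OF \<psi>]] .
    have sg: "?g j x = 0" if "x \<notin> cball 0 (max R S)" for j x using R[of x j] S[of x j] that by simp
    have ag: "\<forall>\<^sub>F j in sequentially. Ckb n (\<lambda>_. e) (\<lambda>x. ?g j x - (\<phi> x + \<psi> x))" if "0 < e" for e
    proof -
      have "\<forall>\<^sub>F j in sequentially. Ckb n (\<lambda>_. e / 2) (\<lambda>x. mollify j \<phi> x - \<phi> x)" "\<forall>\<^sub>F j in sequentially. Ckb n (\<lambda>_. e / 2) (\<lambda>x. mollify j \<psi> x - \<psi> x)"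
        using ap[OF \<phi>, of "e/2"] ap[OF \<psi>, of "e/2"] that by auto
      then show ?thesis
      proof eventually_elim
        case (elim j)
        from Ckb_add[OF this] show ?case by (simp add: algebra_simps)
      qed
    qed
    have "(\<lambda>j. U (?g j)) \<longlonglongrightarrow> V (\<lambda>x. \<phi> x + \<psi> x)"
      by (rule lim_any[OF L[OF Cc_add[OF \<phi> \<psi>]] Cc_add[OF \<phi> \<psi>] tg sg ag])
    moreover have "(\<lambda>j. U (?g j)) \<longlonglongrightarrow> V \<phi> + V \<psi>"
      unfolding continuous_formsD(1)[OF U' mollify_test[OF \<phi>] mollify_test[OF \<psi>]] by (intro tendsto_add L \<phi> \<psi>)
    ultimately show "V (\<lambda>x. \<phi> x + \<psi> x) = V \<phi> + V \<psi>" by (rule LIMSEQ_unique)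
  next
    fix c and \<phi> :: "'a \<Rightarrow> complex" assume \<phi>: "\<phi> \<in> Cc n UNIV"
    have c\<phi>: "(\<lambda>x. c * \<phi> x) \<in> Cc n UNIV" using Cc_mult[OF Ck_on_const \<phi>] .
    obtain R where R: "\<And>j x. x \<notin> cball 0 R \<Longrightarrow> mollify j \<phi> x = 0" using bs[OF \<phi>] by blast
    let ?g = "\<lambda>j x. c * mollify j \<phi> x"
    have ag: "\<forall>\<^sub>F j in sequentially. Ckb n (\<lambda>_. e) (\<lambda>x. ?g j x - c * \<phi> x)" if "0 < e" for e
    proof -
      have "0 < e / (cmod c + 1)" using that by (simp add: add_nonneg_pos)
      from ap[OF \<phi> this] show ?thesis
      proof eventually_elim
        case (elim j)
        have "cmod c * (e / (cmod c + 1)) = e * (cmod c / (cmod c + 1))" by simp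
        also have "\<dots> \<le> e * 1" using that by (intro mult_left_mono) (auto simp: divide_le_eq_1 add_nonneg_pos)
        finally have "cmod c * (e / (cmod c + 1)) \<le> e" by simp
        with Ckb_cmult[OF elim, of c] show ?case by (auto intro: Ckb_mono simp: right_diff_distrib simp del: Ckb.simps)
      qed
    qed
    have "(\<lambda>j. U (?g j)) \<longlonglongrightarrow> V (\<lambda>x. c * \<phi> x)"
      by (rule lim_any[OF L[OF c\<phi>] c\<phi> test[OF mollify_test[OF \<phi>]] _ ag]) (use R in auto)
    moreover have "(\<lambda>j. U (?g j)) \<longlonglongrightarrow> c * V \<phi>"
      unfolding continuous_formsD(2)[OF U' mollify_test[OF \<phi>]] by (intro tendsto_mult tendsto_const L \<phi>)
    ultimately show "V (\<lambda>x. c * \<phi> x) = c * V \<phi>" by (rule LIMSEQ_unique)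
  next
    fix K :: "'a set" assume K: "compact K"
    obtain S where S: "\<And>x. x \<in> K \<Longrightarrow> norm x \<le> S" using compact_imp_bounded[OF K] by (auto simp: bounded_iff)
    obtain C where C: "0 \<le> C" "\<And>\<phi> A. \<phi> \<in> test_functions UNIV \<Longrightarrow> fsupp \<phi> \<subseteq> cball 0 (S + 1) \<Longrightarrow> Ckb n (\<lambda>_. A) \<phi> \<Longrightarrow> norm (U \<phi>) \<le> C * A"
      using continuous_forms_bound[OF U' compact_cball] by blast
    have "norm (V \<phi>) \<le> C * A" if \<phi>: "\<phi> \<in> Cc n UNIV" "fsupp \<phi> \<subseteq> K" and A: "Ckb n (\<lambda>_. A) \<phi>" for \<phi> A
    proof (rule field_le_epsilon)
      fix e :: real assume e: "0 < e"
      define d where "d = e / (C + 1)"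
      have d: "0 < d" using e C(1) by (simp add: d_def)
      have s: "fsupp (mollify j \<phi>) \<subseteq> cball 0 (S + 1)" for j
      proof -
        have "\<phi> x = 0" if "S < norm x" for x using S[of x] that fsupp_zero[of x \<phi>] \<phi>(2) by fastforce
        from mollify_bounded_support[of S \<phi>, OF this] show ?thesis by (subst fsupp_subset_iff) auto
      qed
      have "\<forall>\<^sub>F j in sequentially. norm (U (mollify j \<phi>)) \<le> C * (A + d)"
        using ap[OF \<phi>(1) d]
      proof eventually_elim
        case (elim j)
        have "Ckb n (\<lambda>_. A + d) (mollify j \<phi>)" using Ckb_add[OF A elim] by simp
        then show ?case by (rule C(2)[OF mollify_test[OF \<phi>(1)] s])
      qed
      then have "norm (V \<phi>) \<le> C * (A + d)"
        using tendsto_upperbound[OF tendsto_norm[OF L[OF \<phi>(1)]]] by auto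
      also have "\<dots> = C * A + e * (C / (C + 1))" using C(1) by (simp add: d_def algebra_simps)
      also have "\<dots> \<le> C * A + e * 1" using e C(1) by (intro add_left_mono mult_left_mono) auto
      finally show "norm (V \<phi>) \<le> C * A + e" by simp
    qed
    note bound = this
    \<comment> \<open>The constant \<open>C + 1\<close> is positive, so the case of an infinite norm
      is trivial; with \<open>C = 0\<close> the product would be 0.\<close>
    have "ereal (cmod (V \<phi>)) \<le> ereal (C + 1) * Ck_norm n UNIV \<phi>" if \<phi>: "\<phi> \<in> Cc n UNIV" "fsupp \<phi> \<subseteq> K" for \<phi>
    proof (cases "Ck_norm n UNIV \<phi>")
      case (real A)
      have A: "Ckb n (\<lambda>_. A) \<phi>" by (rule Ck_norm_imp_Ckb) (use \<phi> real in \<open>auto simp: Cc_iff\<close>)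
      have "0 \<le> A" using Ckb_weight_nonneg[OF A] .
      then have "norm (V \<phi>) \<le> (C + 1) * A" using bound[OF \<phi> A] by (simp add: algebra_simps)
      then show ?thesis using real by simp
    next
      case PInf
      then show ?thesis using C(1) by simp
    next
      case MInf
      then show ?thesis using Ck_norm_nonneg[of UNIV n \<phi>] by simp
    qed
    then show "\<exists>C. \<forall>\<phi>\<in>Cc n UNIV. fsupp \<phi> \<subseteq> K \<longrightarrow> ereal (cmod (V \<phi>)) \<le> ereal C * Ck_norm n UNIV \<phi>" by blast
  qed
  have eq: "order_extension n U = V" by (rule order_extension_eq[OF V VU])
  show "order_extension n U \<in> continuous_forms (Cc n UNIV) n" unfolding eq by (rule V)
  show "\<And>\<phi>. \<phi> \<in> test_functions UNIV \<Longrightarrow> order_extension n U \<phi> = U \<phi>" unfolding eq by (rule VU)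
qed

section \<open>Uniqueness\<close>

text \<open>Constant and exponential weights are comparable only on bounded time intervals. As
  derivatives vanish off the support, comparing the weights there is enough.\<close>

lemma Ckb_on_support:
  fixes f :: "'a::euclidean_space \<Rightarrow> 'b::real_normed_vector"
  shows "Ckb k v f \<Longrightarrow> (\<And>x. x \<in> fsupp f \<Longrightarrow> v x \<le> w x) \<Longrightarrow> (\<And>x. 0 \<le> w x) \<Longrightarrow> Ckb k w f"
proof (induction k arbitrary: f)
  case 0
  have "norm (f x) \<le> w x" for x
    using 0(1) 0(2)[of x] 0(3)[of x] fsupp_zero[of x f] by (cases "x \<in> fsupp f") (auto intro: order_trans)
  then show ?case using 0(1) by simp
next
  case (Suc k)
  have "norm (f x) \<le> w x" for x
    using Suc.prems(1) Suc.prems(2)[of x] Suc.prems(3)[of x] fsupp_zero[of x f]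
    by (cases "x \<in> fsupp f") (auto intro: order_trans)
  moreover have "Ckb k w (partial_deriv b f)" if "b \<in> Basis" for b
    using Suc.prems that fsupp_partial_deriv[of b f] by (intro Suc.IH) auto
  ultimately show ?case using Suc.prems(1) by simp
qed

text \<open>A piecewise linear cutoff is mollified at scale 1. The numbers leave room for this
  scale: the linear cutoff is 1 for \<open>t >= -2\<close> and norm at most \<open>L + 2\<close>,
  and it is 0 for \<open>t <= -3\<close>.\<close>

lemma spacetime_cutoff:
  obtains \<eta> :: "spacetime \<Rightarrow> complex" where "\<And>k. Ck_on k UNIV \<eta>" "compact (fsupp \<eta>)"
    "\<And>p. -1 \<le> snd p \<Longrightarrow> norm p \<le> L \<Longrightarrow> \<eta> p = 1" "\<And>p. snd p \<le> -4 \<Longrightarrow> \<eta> p = 0"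
proof -
  define c :: "real \<Rightarrow> real" where "c s = max 0 (min 1 s)" for s
  define g :: "spacetime \<Rightarrow> complex" where "g p = complex_of_real (c (snd p + 3) * c (L + 3 - norm p))" for p
  have cont: "continuous_on UNIV g"
    unfolding g_def[abs_def] c_def[abs_def] by (intro continuous_intros)
  have far: "g p = 0" if "L + 3 < norm p" for p using that by (simp add: g_def c_def)
  have cpt: "compact (fsupp g)" unfolding compact_fsupp_iff using far by blast
  show ?thesis
  proof (rule that[of "mollify 0 g"])
    show "Ck_on k UNIV (mollify 0 g)" for k by (rule mollify_smooth[OF cont cpt])
    show "compact (fsupp (mollify 0 g))" by (rule compact_mollify[OF cpt])
  next
    fix p :: spacetime assume p: "-1 \<le> snd p" "norm p \<le> L"
    have "mollifier 0 y *\<^sub>R g (p - y) = mollifier 0 y *\<^sub>R 1" for y :: spacetime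
    proof (cases "norm y < 1")
      case True
      have "\<bar>snd y\<bar> \<le> norm y" using norm_snd_le[of "snd y" "fst y"] by simp
      moreover have "norm (p - y) \<le> L + 1" using True p(2) norm_triangle_ineq4[of p y] by linarith
      ultimately have "c (snd (p - y) + 3) = 1" "c (L + 3 - norm (p - y)) = 1"
        using True p by (auto simp: c_def)
      then show ?thesis by (simp add: g_def)
    next
      case False
      then show ?thesis using mollifier_facts(5)[of 0 y] by simp
    qed
    then have "mollify 0 g p = (\<integral>y. mollifier 0 y *\<^sub>R (1::complex) \<partial>(lborel :: spacetime measure))"
      unfolding mollify_def by (intro Bochner_Integration.integral_cong refl)
    also have "\<dots> = 1" using mollifier_facts(3,4)[of 0, where 'a=spacetime] by simp
    finally show "mollify 0 g p = 1" .
  next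
    fix p :: spacetime assume p: "snd p \<le> -4"
    show "mollify 0 g p = 0"
    proof (rule ccontr)
      assume "mollify 0 g p \<noteq> 0"
      then obtain y where y: "norm y \<le> 1" "g (p - y) \<noteq> 0" using mollify_support by blast
      have "\<bar>snd y\<bar> \<le> norm y" using norm_snd_le[of "snd y" "fst y"] by simp
      then have "g (p - y) = 0" using y(1) p by (simp add: g_def c_def)
      then show False using y by simp
    qed
  qed
qed

lemma potential_integrable_compact:
  fixes f :: "spacetime \<Rightarrow> complex"
  assumes "continuous_on UNIV f" "compact (fsupp f)"
  shows "integrable lborel (\<lambda>y. newton y *\<^sub>R f (p + (y, norm y)))"
proof -
  have "continuous_on UNIV (\<lambda>p :: spacetime. exp (- snd p))" by (intro continuous_intros)
  from weighted_bound_compact[OF this exp_gt_zero assms] obtain A where "\<forall>p. norm (f p) \<le> A * exp (- snd p)" by blast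
  then have "norm (f p) \<le> A * exp ((-1) * snd p)" for p unfolding mult_minus1 by blast
  from potential_integrable[OF assms(1) this zero_less_one, of 1 p] show ?thesis by simp
qed

lemma potential_diff:
  assumes "continuous_on UNIV f" "compact (fsupp f)" "continuous_on UNIV g" "compact (fsupp g)"
  shows "potential 1 (\<lambda>p. f p - g p) p = potential 1 f p - potential 1 g p"
  unfolding potential_def
  using potential_integrable_compact[OF assms(1,2), of p] potential_integrable_compact[OF assms(3,4), of p]
  by (simp add: scaleR_diff_right)

lemma potential_sum:
  fixes f :: "'i \<Rightarrow> spacetime \<Rightarrow> complex"
  assumes "\<And>i. continuous_on UNIV (f i)" "\<And>i. compact (fsupp (f i))"
  shows "potential 1 (\<lambda>p. \<Sum>i\<in>I. f i p) p = (\<Sum>i\<in>I. potential 1 (f i) p)"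
  unfolding potential_def
  using potential_integrable_compact[OF assms, of _ p]
  by (simp add: scaleR_sum_right)

lemma wave_op_test:
  assumes "\<psi> \<in> test_functions UNIV"
  shows "wave_op \<psi> \<in> test_functions UNIV"
proof -
  have "(\<lambda>p. \<Sum>i\<in>I. dx i (dx i \<psi>) p) \<in> test_functions UNIV" if "finite I" for I
    using that
  proof (induction I)
    case empty
    have "fsupp (\<lambda>p::spacetime. 0::complex) = {}" by (simp add: fsupp_def)
    then show ?case by (simp add: test_iff Ck_on_const)
  next
    case (insert i I)
    have "dx i (dx i \<psi>) \<in> test_functions UNIV" using assms by (intro test_partial_deriv) auto
    from test_add[OF this insert.IH] show ?case using insert.hyps by simp
  qed
  then have "(\<lambda>p. \<Sum>i\<in>UNIV. dx i (dx i \<psi>) p) \<in> test_functions UNIV" by simp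
  moreover have "dt (dt \<psi>) \<in> test_functions UNIV" using assms by (intro test_partial_deriv) auto
  ultimately show ?thesis unfolding wave_op_def[abs_def] using test_diff by blast
qed

text \<open>The potential commutes with derivatives, so the left inverse of Kirchhoff's formula is a
  right inverse too. The advanced potential need not have compact support, hence the formula cannot
  be applied to it directly.\<close>

lemma potential_right_inverse:
  assumes f: "f \<in> test_functions UNIV"
  shows "Ck_on k UNIV (potential 1 f)" "wave_op (potential 1 f) p = f p"
proof -
  have w: "continuous_on UNIV (\<lambda>p :: spacetime. exp ((-1) * snd p))" by (intro continuous_intros)
  have F: "\<exists>A. Ckb k (\<lambda>p. A * exp ((-1) * snd p)) f" if "f \<in> test_functions UNIV" for k and f :: "spacetime \<Rightarrow> complex"
    using Ckb_of_compact[OF w, of k f] that by (auto simp: test_iff)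
  show "Ck_on k UNIV (potential 1 f)"
    using F[OF f, of k] Ckb_imp_Ck_on Ckb_potential(1)[where \<sigma>=1 and \<mu>="-1" and l=1] by fastforce
  have d: "partial_deriv b (potential 1 h) = potential 1 (partial_deriv b h)"
    if h: "h \<in> test_functions UNIV" "b \<in> Basis" for h b
  proof -
    obtain A where "Ckb 1 (\<lambda>p. A * exp ((-1) * snd p)) h" using F[OF h(1)] by blast
    from Ckb_potential(2)[OF this zero_less_one _ zero_less_one h(2), of 1] show ?thesis by simp
  qed
  have dd: "partial_deriv b (partial_deriv b (potential 1 f)) = potential 1 (partial_deriv b (partial_deriv b f))"
    if "b \<in> Basis" for b
    using d[OF f that] d[OF test_partial_deriv[OF f that] that] by simp
  have t: "partial_deriv b (partial_deriv b f) \<in> test_functions UNIV" if "b \<in> Basis" for b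
    using test_partial_deriv f that by blast
  then have cc: "continuous_on UNIV (partial_deriv b (partial_deriv b f))" "compact (fsupp (partial_deriv b (partial_deriv b f)))"
    if "b \<in> Basis" for b
    using that Ck_on.simps(1) unfolding test_iff by blast+
  have ws: "continuous_on UNIV (\<lambda>p. \<Sum>i\<in>UNIV. dx i (dx i f) p)" by (intro continuous_intros cc) auto
  have cs: "compact (fsupp (\<lambda>p. \<Sum>i\<in>UNIV. dx i (dx i f) p))"
  proof (rule compact_fsupp_subset[of f])
    show "compact (fsupp f)" using f by (simp add: test_iff)
    fix p assume "(\<Sum>i\<in>UNIV. dx i (dx i f) p) \<noteq> 0"
    then obtain i where "dx i (dx i f) p \<noteq> 0" by (rule sum.not_neutral_contains_not_neutral)
    then have "p \<in> fsupp (dx i f)" using partial_deriv_zero_outside_fsupp by blast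
    then show "p \<in> fsupp f" using fsupp_partial_deriv by blast
  qed
  have "wave_op (potential 1 f) p = potential 1 (dt (dt f)) p - (\<Sum>i\<in>UNIV. potential 1 (dx i (dx i f)) p)"
    by (simp add: wave_op_def dd)
  also have "\<dots> = potential 1 (wave_op f) p"
    unfolding wave_op_def[abs_def] using potential_diff[OF cc(1,2) ws cs, of "(0, 1)" p] potential_sum[of "\<lambda>i. dx i (dx i f)" UNIV p] cc
    by simp
  also have "\<dots> = f p" using f by (intro potential_wave_op) (auto simp: test_iff)
  finally show "wave_op (potential 1 f) p = f p" .
qed

lemma zero_if_small:
  fixes z :: "'a::real_normed_vector"
  assumes "\<And>e. 0 < e \<Longrightarrow> norm z \<le> D * e"
  shows "z = 0"
proof (rule ccontr)
  assume "z \<noteq> 0"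
  then have z: "0 < norm z" by simp
  have "norm z \<le> D * (norm z / (2 * (\<bar>D\<bar> + 1)))" using z by (intro assms) simp
  also have "\<dots> \<le> norm z * (\<bar>D\<bar> / (2 * (\<bar>D\<bar> + 1)))"
    using mult_right_mono[OF abs_ge_self[of D], of "norm z / (2 * (\<bar>D\<bar> + 1))"] by (simp add: mult.commute)
  also have "\<dots> < norm z * 1" using z by (intro mult_strict_left_mono) (auto simp: divide_less_eq_1)
  finally show False by simp
qed

text \<open>A form \<open>V\<close> that solves the homogeneous equation and vanishes in the past satisfies \<open>V f = V (S f)\<close>,
  where \<open>S f\<close> is \<open>q\<close> times the solution \<open>u\<close> of \<open>wave_op u = f\<close> that vanishes in the future, cut off in the
  past. As \<open>S\<close> is a contraction for the weight \<open>exp (- l t)\<close> with large \<open>l\<close>, iteration gives \<open>V f = 0\<close>.\<close>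

lemma wave_form_zero:
  fixes V :: spacetime_dist
  assumes lin: "\<And>\<phi> \<psi>. \<phi> \<in> Cc n UNIV \<Longrightarrow> \<psi> \<in> Cc n UNIV \<Longrightarrow> V (\<lambda>p. \<phi> p - \<psi> p) = V \<phi> - V \<psi>"
    and bound: "\<And>K. compact K \<Longrightarrow>
      \<exists>C\<ge>0. \<forall>\<phi>\<in>Cc n UNIV. \<forall>A. fsupp \<phi> \<subseteq> K \<longrightarrow> Ckb n (\<lambda>_. A) \<phi> \<longrightarrow> norm (V \<phi>) \<le> C * A"
    and eq: "\<And>\<psi>. \<psi> \<in> test_functions UNIV \<Longrightarrow> V (wave_op \<psi>) = V (\<lambda>p. q (fst p) * \<psi> p)"
    and zero: "\<And>\<psi>. \<psi> \<in> test_functions UNIV \<Longrightarrow> (\<And>p. -1 < snd p \<Longrightarrow> \<psi> p = 0) \<Longrightarrow> V \<psi> = 0"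
    and q: "Ckb n (\<lambda>_. Mq) q" "\<And>x. 1 < norm x \<Longrightarrow> q x = 0"
    and \<phi>: "\<phi> \<in> Cc n UNIV"
  shows "V \<phi> = 0"
proof -
  obtain R where R: "\<And>p. R < norm p \<Longrightarrow> \<phi> p = 0" using \<phi> unfolding Cc_iff compact_fsupp_iff by blast
  \<comment> \<open>The box of size \<open>R0\<close> must contain the support of
    \<open>\<phi>\<close> and reach down to time -4, where \<open>\<eta>\<close> ends.\<close>
  define R0 where "R0 = max R 4"
  have R0: "4 \<le> R0" "R \<le> R0" by (auto simp: R0_def)
  define carried :: "real \<Rightarrow> (spacetime \<Rightarrow> complex) \<Rightarrow> bool"
    where "carried r f \<longleftrightarrow> (\<forall>p. f p \<noteq> 0 \<longrightarrow> norm (fst p) \<le> r \<and> \<bar>snd p\<bar> \<le> r)" for r f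
  obtain \<eta> :: "spacetime \<Rightarrow> complex" where \<eta>: "\<And>k. Ck_on k UNIV \<eta>" "compact (fsupp \<eta>)"
    "\<And>p. -1 \<le> snd p \<Longrightarrow> norm p \<le> 3 * R0 + 20 \<Longrightarrow> \<eta> p = 1" "\<And>p. snd p \<le> -4 \<Longrightarrow> \<eta> p = 0"
    using spacetime_cutoff by blast
  obtain M where M: "Ckb n (\<lambda>_. M) \<eta>" using Ckb_compact[OF \<eta>(1,2)] by blast
  define S where "S f p = \<eta> p * (q (fst p) * potential 1 f p)" for f p
  \<comment> \<open>The two factors \<open>2 ^ n\<close> come from the two products in
    \<open>S\<close>.\<close>
  define B where "B = 2 ^ n * (M * (2 ^ n * Mq))"
  have B: "0 \<le> B" using Ckb_weight_nonneg[OF M] Ckb_weight_nonneg[OF q(1)] by (simp add: B_def)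
  have S_weight: "Ckb n (\<lambda>p. (B / l\<^sup>2 * A) * exp (- l * snd p)) (S f)"
    if "Ckb n (\<lambda>p. A * exp (- l * snd p)) f" "0 < l" for A l f
  proof -
    have "Ckb n (\<lambda>p. A / l\<^sup>2 * exp (- l * snd p)) (potential 1 f)"
      using Ckb_potential(1)[OF that, of 1] by simp
    from Ckb_mult[OF M Ckb_mult[OF Ckb_fst[OF q(1)] this]] show ?thesis
      unfolding S_def[abs_def] by (rule Ckb_mono) (simp add: B_def mult_ac)
  qed
  have weight: "\<exists>A\<ge>0. Ckb n (\<lambda>p. A * exp (- l * snd p)) f" if "f \<in> Cc n UNIV" for l f
    using that unfolding Cc_iff by (intro Ckb_of_compact) (auto intro!: continuous_intros)
  have S_supp: "fsupp (S f) \<subseteq> fsupp \<eta>" for f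
  proof -
    have c: "closed (fsupp \<eta>)" by (simp add: fsupp_def)
    show ?thesis unfolding fsupp_subset_iff[OF c] by (simp add: S_def fsupp_zero)
  qed
  have S_Cc: "S f \<in> Cc n UNIV" if f: "f \<in> Cc n UNIV" for f
  proof -
    obtain A where "Ckb n (\<lambda>p. A * exp (- 1 * snd p)) f" using weight[OF f, of 1] by blast
    from Ckb_imp_Ck_on[OF S_weight[OF this zero_less_one]] have "Ck_on n UNIV (S f)" .
    moreover have "compact (fsupp (S f))"
      by (rule compact_fsupp_subset[OF \<eta>(2)]) (use S_supp[of f] fsupp_zero[of _ "S f"] in blast)
    ultimately show ?thesis by (simp add: Cc_iff)
  qed
  have past: "-4 \<le> snd p" if "p \<in> fsupp \<eta>" for p
  proof -
    have "closed {p :: spacetime. -4 \<le> snd p}" by (intro closed_Collect_le continuous_intros)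
    from fsupp_subset_iff[OF this, of \<eta>] have "fsupp \<eta> \<subseteq> {p. -4 \<le> snd p}" using \<eta>(4) by auto
    then show ?thesis using that by blast
  qed
  have carried_supp: "norm (fst p) \<le> r \<and> \<bar>snd p\<bar> \<le> r" if "carried r f" "p \<in> fsupp f" for r f p
  proof -
    have "closed {p :: spacetime. norm (fst p) \<le> r \<and> \<bar>snd p\<bar> \<le> r}"
      by (intro closed_Collect_conj closed_Collect_le continuous_intros)
    from fsupp_subset_iff[OF this, of f] have "fsupp f \<subseteq> {p. norm (fst p) \<le> r \<and> \<bar>snd p\<bar> \<le> r}"
      using that(1) unfolding carried_def by blast
    then show ?thesis using that(2) by blast
  qed
  \<comment> \<open>The advanced potential of \<open>f\<close> vanishes at points whose forward cone
    misses the box that carries \<open>f\<close>.\<close>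
  have pot: "snd p \<le> r \<and> norm (fst p) \<le> 2 * r - snd p" if "carried r f" "potential 1 f p \<noteq> 0" for r f p
  proof -
    have "\<exists>y. f (p + (y, norm y)) \<noteq> 0"
    proof (rule ccontr)
      assume "\<not> (\<exists>y. f (p + (y, norm y)) \<noteq> 0)"
      then have "potential 1 f p = 0" by (simp add: potential_def)
      then show False using that(2) by simp
    qed
    then obtain y where "f (p + (y, norm y)) \<noteq> 0" by blast
    with that(1) have "norm (fst (p + (y, norm y))) \<le> r" "\<bar>snd (p + (y, norm y))\<bar> \<le> r"
      unfolding carried_def by blast+
    then have "norm (fst p + y) \<le> r" "\<bar>snd p + norm y\<bar> \<le> r" by simp_all
    moreover have "norm (fst p) \<le> norm (fst p + y) + norm y" "0 \<le> norm y"
      using norm_triangle_ineq4[of "fst p + y" y] by simp_all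
    ultimately show ?thesis by (intro conjI; linarith)
  qed
  \<comment> \<open>The supports do not spread under iteration: \<open>q\<close> confines
    \<open>x\<close> to the unit ball, \<open>\<eta>\<close> bounds time below, and the advanced
    potential does not reach later times than \<open>f\<close>.\<close>
  have S_carried: "carried R0 (S f)" if "carried R0 f" for f
    unfolding carried_def
  proof (intro allI impI)
    fix p assume "S f p \<noteq> 0"
    then have nz: "\<eta> p \<noteq> 0" "q (fst p) \<noteq> 0" "potential 1 f p \<noteq> 0" by (auto simp: S_def)
    have "norm (fst p) \<le> 1" using q(2) nz(2) not_le by blast
    moreover have "-4 < snd p" using \<eta>(4) nz(1) not_le by blast
    ultimately show "norm (fst p) \<le> R0 \<and> \<bar>snd p\<bar> \<le> R0" using pot[OF that nz(3)] R0 by (auto simp: abs_le_iff)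
  qed
  \<comment> \<open>Multiplying the advanced potential by \<open>\<eta>\<close> gives a test
    function \<open>\<psi>\<close> whose wave operator equals \<open>f\<close> for
    \<open>t > -1\<close>; there the support lies where \<open>\<eta>\<close> is 1. The difference
    lives in the past, where \<open>V\<close> vanishes, and the equation replaces
    \<open>wave_op \<psi>\<close> by \<open>q \<psi>\<close>.\<close>
  have step_test: "V f = V (S f)" if f: "f \<in> test_functions UNIV" "carried (R0 + 1) f" for f
  proof -
    define \<psi> where "\<psi> p = \<eta> p * potential 1 f p" for p
    have "compact (fsupp \<psi>)"
      by (rule compact_fsupp_subset[OF \<eta>(2)]) (use fsupp_zero[of _ \<eta>] in \<open>auto simp: \<psi>_def\<close>)
    then have \<psi>: "\<psi> \<in> test_functions UNIV"
      using Ck_on_mult[OF \<eta>(1) potential_right_inverse(1)[OF f(1)]] by (simp add: test_iff \<psi>_def[abs_def])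
    have o: "open {p :: spacetime. -1 < snd p}" by (intro open_Collect_less continuous_intros)
    have agree: "\<psi> p = potential 1 f p" if "p \<in> {p. -1 < snd p}" for p
    proof (cases "potential 1 f p = 0")
      case False
      have "norm p \<le> norm (fst p) + norm (snd p)" using norm_Pair_le[of "fst p" "snd p"] by simp
      then have "norm p \<le> 3 * R0 + 20" using pot[OF f(2) False] that R0 by (auto simp: abs_if split: if_splits)
      then show ?thesis using \<eta>(3)[of p] that by (simp add: \<psi>_def)
    qed (simp add: \<psi>_def)
    have d1: "partial_deriv b \<psi> p = partial_deriv b (potential 1 f) p" if "p \<in> {p. -1 < snd p}" for b p
      by (rule partial_deriv_cong_open[OF o that agree])
    have d2: "partial_deriv b (partial_deriv b \<psi>) p = partial_deriv b (partial_deriv b (potential 1 f)) p"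
      if "p \<in> {p. -1 < snd p}" for b p
      by (rule partial_deriv_cong_open[OF o that d1])
    have w: "wave_op \<psi> p = f p" if "-1 < snd p" for p
      using d2[of p] that potential_right_inverse(2)[OF f(1), of p] by (simp add: wave_op_def)
    have "V f - V (wave_op \<psi>) = V (\<lambda>p. f p - wave_op \<psi> p)"
      by (rule lin[symmetric]) (intro test_subset_Cc f wave_op_test \<psi>)+
    also have "\<dots> = 0"
      by (rule zero[OF test_diff[OF f(1) wave_op_test[OF \<psi>]]]) (simp add: w)
    finally have "V f = V (\<lambda>p. q (fst p) * \<psi> p)" using eq[OF \<psi>] by simp
    also have "(\<lambda>p. q (fst p) * \<psi> p) = S f" by (rule ext) (simp add: S_def \<psi>_def)
    finally show ?thesis .
  qed
  have S_diff: "S (\<lambda>p. f p - g p) = (\<lambda>p. S f p - S g p)" if "f \<in> Cc n UNIV" "g \<in> Cc n UNIV" for f g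
  proof
    fix p
    have "potential 1 (\<lambda>p. f p - g p) p = potential 1 f p - potential 1 g p"
      using that Ck_on_imp_continuous_on unfolding Cc_iff by (intro potential_diff) blast+
    then show "S (\<lambda>p. f p - g p) p = S f p - S g p" by (simp add: S_def right_diff_distrib)
  qed
  \<comment> \<open>\<open>S f\<close> is only \<open>C^n\<close>, so the previous step cannot be
    iterated as it stands. It is extended by mollifying \<open>f\<close>; the enlarged box
    \<open>R0 + 1\<close> accommodates the mollification radius, and both \<open>V\<close> and its
    composition with \<open>S\<close> are controlled by the \<open>C^n\<close> size of the
    error.\<close>
  have step: "V f = V (S f)" if f: "f \<in> Cc n UNIV" "carried R0 f" for f
  proof -
    obtain C1 where C1: "\<And>h A. h \<in> Cc n UNIV \<Longrightarrow> fsupp h \<subseteq> cball 0 (2 * R0 + 2) \<Longrightarrow> Ckb n (\<lambda>_. A) h \<Longrightarrow> norm (V h) \<le> C1 * A"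
      using bound[OF compact_cball, of 0 "2 * R0 + 2"] by blast
    obtain C2 where C2: "\<And>h A. h \<in> Cc n UNIV \<Longrightarrow> fsupp h \<subseteq> fsupp \<eta> \<Longrightarrow> Ckb n (\<lambda>_. A) h \<Longrightarrow> norm (V h) \<le> C2 * A"
      using bound[OF \<eta>(2)] by blast
    have "V f - V (S f) = 0"
    proof (rule zero_if_small)
      fix e :: real assume e: "0 < e"
      have "\<exists>j. Ckb n (\<lambda>_. e) (\<lambda>p. mollify j f p - f p)"
        using eventually_happens[OF mollify_approx[OF _ _ e, of n f]] f(1) unfolding Cc_iff by simp
      then obtain j where j: "Ckb n (\<lambda>_. e) (\<lambda>p. mollify j f p - f p)" by blast
      have m: "mollify j f \<in> Cc n UNIV" using test_subset_Cc[OF mollify_test[OF f(1)]] .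
      have cm: "carried (R0 + 1) (mollify j f)"
        unfolding carried_def
      proof (intro allI impI)
        fix p assume "mollify j f p \<noteq> 0"
        then obtain y where y: "norm y \<le> 1" "f (p - y) \<noteq> 0" using mollify_support by blast
        have "norm (fst y) \<le> 1" "\<bar>snd y\<bar> \<le> 1"
          using y(1) norm_fst_le[of "fst y" "snd y"] norm_snd_le[of "snd y" "fst y"] by simp_all
        moreover have "norm (fst p - fst y) \<le> R0" "\<bar>snd p - snd y\<bar> \<le> R0"
          using f(2) y(2) unfolding carried_def by (metis fst_diff snd_diff)+
        ultimately show "norm (fst p) \<le> R0 + 1 \<and> \<bar>snd p\<bar> \<le> R0 + 1"
          using norm_triangle_sub[of "fst p" "fst y"] by linarith
      qed
      define h where "h p = mollify j f p - f p" for p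
      have h: "h \<in> Cc n UNIV" unfolding h_def[abs_def] by (rule Cc_diff[OF m f(1)])
      have ch: "carried (R0 + 1) h"
        unfolding carried_def
      proof (intro allI impI)
        fix p assume "h p \<noteq> 0"
        then have "mollify j f p \<noteq> 0 \<or> f p \<noteq> 0" by (auto simp: h_def)
        then have "norm (fst p) \<le> R0 + 1 \<and> \<bar>snd p\<bar> \<le> R0 + 1 \<or> norm (fst p) \<le> R0 \<and> \<bar>snd p\<bar> \<le> R0"
          using cm f(2) unfolding carried_def by blast
        then show "norm (fst p) \<le> R0 + 1 \<and> \<bar>snd p\<bar> \<le> R0 + 1" by linarith
      qed
      have hs: "fsupp h \<subseteq> cball 0 (2 * R0 + 2)"
      proof
        fix p assume "p \<in> fsupp h"
        from carried_supp[OF ch this] show "p \<in> cball 0 (2 * R0 + 2)"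
          using norm_Pair_le[of "fst p" "snd p"] by simp
      qed
      have jh: "Ckb n (\<lambda>_. e) h" using j unfolding h_def[abs_def] .
      have "Ckb n (\<lambda>p. (e * exp (R0 + 1)) * exp (- 1 * snd p)) h"
      proof (rule Ckb_on_support[OF jh])
        fix p assume "p \<in> fsupp h"
        then have "snd p \<le> R0 + 1" using carried_supp[OF ch] by fastforce
        then have "e * 1 \<le> e * exp (R0 + 1 - snd p)" using e by (intro mult_left_mono) auto
        then show "e \<le> e * exp (R0 + 1) * exp (- 1 * snd p)" by (simp add: mult_exp_exp mult.assoc)
      qed (use e in simp)
      from S_weight[OF this zero_less_one]
      have "Ckb n (\<lambda>p. (B * (e * exp (R0 + 1))) * exp (- 1 * snd p)) (S h)" by simp
      then have "Ckb n (\<lambda>_. (B * (e * exp (R0 + 1))) * exp 4) (S h)"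
      proof (rule Ckb_on_support)
        fix p assume "p \<in> fsupp (S h)"
        then have "-4 \<le> snd p" using S_supp past by blast
        then show "(B * (e * exp (R0 + 1))) * exp (- 1 * snd p) \<le> (B * (e * exp (R0 + 1))) * exp 4"
          using B e by (intro mult_left_mono) auto
      qed (use B e in simp)
      note C2' = C2[OF S_Cc[OF h] S_supp this]
      have "V h = V (mollify j f) - V f" unfolding h_def[abs_def] by (rule lin[OF m f(1)])
      moreover have "V (S h) = V (S (mollify j f)) - V (S f)"
        unfolding h_def[abs_def] S_diff[OF m f(1)] by (rule lin[OF S_Cc[OF m] S_Cc[OF f(1)]])
      ultimately have "V f - V (S f) = V (S h) - V h" using step_test[OF mollify_test[OF f(1)] cm] by simp
      then have "norm (V f - V (S f)) \<le> norm (V (S h)) + norm (V h)" using norm_triangle_ineq4 by metis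
      also have "\<dots> \<le> C2 * ((B * (e * exp (R0 + 1))) * exp 4) + C1 * e"
        by (rule add_mono[OF C2' C1[OF h hs jh]])
      finally show "norm (V f - V (S f)) \<le> (C2 * ((B * exp (R0 + 1)) * exp 4) + C1) * e"
        by (simp add: algebra_simps)
    qed
    then show ?thesis by simp
  qed
  \<comment> \<open>Chosen such that \<open>2 B <= l <= l^2\<close>, so that \<open>S\<close> halves
    the weighted bound.\<close>
  define l where "l = max 1 (2 * B)"
  have l: "1 \<le> l" "2 * B \<le> l" by (auto simp: l_def)
  have "2 * B \<le> l\<^sup>2" using l self_le_power[of l 2] by simp
  then have half: "B / l\<^sup>2 \<le> 1 / 2" using l by (simp add: divide_le_eq)
  obtain A where A: "0 \<le> A" "Ckb n (\<lambda>p. A * exp (- l * snd p)) \<phi>" using weight[OF \<phi>] by blast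
  have c\<phi>: "carried R0 \<phi>"
    unfolding carried_def
  proof (intro allI impI)
    fix p assume "\<phi> p \<noteq> 0"
    then have "norm p \<le> R" using R not_le by blast
    moreover have "norm (fst p) \<le> norm p" "\<bar>snd p\<bar> \<le> norm p"
      using norm_fst_le[of "fst p" "snd p"] norm_snd_le[of "snd p" "fst p"] by simp_all
    ultimately show "norm (fst p) \<le> R0 \<and> \<bar>snd p\<bar> \<le> R0" using R0(2) by linarith
  qed
  have iter: "(S ^^ k) \<phi> \<in> Cc n UNIV \<and> carried R0 ((S ^^ k) \<phi>) \<and> V \<phi> = V ((S ^^ k) \<phi>) \<and>
      Ckb n (\<lambda>p. ((1 / 2) ^ k * A) * exp (- l * snd p)) ((S ^^ k) \<phi>)" for k
  proof (induction k)
    case 0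
    then show ?case using \<phi> c\<phi> A(2) by (simp del: Ckb.simps)
  next
    case (Suc k)
    then have IH: "(S ^^ k) \<phi> \<in> Cc n UNIV" "carried R0 ((S ^^ k) \<phi>)" "V \<phi> = V ((S ^^ k) \<phi>)"
      "Ckb n (\<lambda>p. ((1 / 2) ^ k * A) * exp (- l * snd p)) ((S ^^ k) \<phi>)" by blast+
    have "0 < l" using l by simp
    from S_weight[OF IH(4) this] have "Ckb n (\<lambda>p. ((1 / 2) ^ Suc k * A) * exp (- l * snd p)) (S ((S ^^ k) \<phi>))"
    proof (rule Ckb_mono)
      fix p :: spacetime
      have "B / l\<^sup>2 * ((1 / 2) ^ k * A) \<le> 1 / 2 * ((1 / 2) ^ k * A)" using half A(1) by (intro mult_right_mono) auto
      then show "B / l\<^sup>2 * ((1 / 2) ^ k * A) * exp (- l * snd p) \<le> (1 / 2) ^ Suc k * A * exp (- l * snd p)"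
        by (intro mult_right_mono) auto
    qed
    then show ?case using S_Cc[OF IH(1)] S_carried[OF IH(2)] step[OF IH(1,2)] IH(3) by (simp del: Ckb.simps)
  qed
  obtain C where C: "0 \<le> C" "\<And>h A. h \<in> Cc n UNIV \<Longrightarrow> fsupp h \<subseteq> cball 0 (2 * R0) \<Longrightarrow> Ckb n (\<lambda>_. A) h \<Longrightarrow> norm (V h) \<le> C * A"
    using bound[OF compact_cball, of 0 "2 * R0"] by blast
  \<comment> \<open>All iterates live in the same box, where the exponential weight is at most
    \<open>exp (l * R0)\<close>; the bound of \<open>V\<close> there has one constant for all
    \<open>k\<close>.\<close>
  have small: "norm (V \<phi>) \<le> C * (((1 / 2) ^ k * A) * exp (l * R0))" for k
  proof -
    note it = iter[of k]
    have "fsupp ((S ^^ k) \<phi>) \<subseteq> cball 0 (2 * R0)"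
    proof
      fix p assume "p \<in> fsupp ((S ^^ k) \<phi>)"
      then have "norm (fst p) \<le> R0 \<and> \<bar>snd p\<bar> \<le> R0" using carried_supp it by blast
      then show "p \<in> cball 0 (2 * R0)" using norm_Pair_le[of "fst p" "snd p"] by simp
    qed
    moreover have "Ckb n (\<lambda>_. ((1 / 2) ^ k * A) * exp (l * R0)) ((S ^^ k) \<phi>)"
    proof (rule Ckb_on_support[OF conjunct2[OF conjunct2[OF conjunct2[OF it]]]])
      fix p assume "p \<in> fsupp ((S ^^ k) \<phi>)"
      then have "\<bar>snd p\<bar> \<le> R0" using carried_supp it by blast
      then have "l * (- snd p) \<le> l * R0" using l by (intro mult_left_mono) auto
      then show "(1 / 2) ^ k * A * exp (- l * snd p) \<le> (1 / 2) ^ k * A * exp (l * R0)"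
        using A(1) by (intro mult_left_mono) auto
    qed (use A(1) in simp)
    ultimately show ?thesis using C(2) it by metis
  qed
  show ?thesis
  proof (rule zero_if_small)
    fix e :: real assume "0 < e"
    then obtain k where k: "(1 / 2) ^ k < e" using real_arch_pow_inv[of e "1 / 2"] by auto
    have "norm (V \<phi>) \<le> (C * (A * exp (l * R0))) * (1 / 2) ^ k" using small[of k] by (simp add: mult_ac)
    also have "\<dots> \<le> (C * (A * exp (l * R0))) * e" using k C(1) A(1) by (intro mult_left_mono) auto
    finally show "norm (V \<phi>) \<le> (C * (A * exp (l * R0))) * e" .
  qed
qed

lemma dist_wave_op_eq:
  assumes U: "U \<in> distributions_of_order n" and \<psi>: "\<psi> \<in> test_functions UNIV"
  shows "dist_wave_op U \<psi> = U (wave_op \<psi>)"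
proof -
  have U': "U \<in> continuous_forms (test_functions UNIV) n" using U by (simp add: distributions_of_order_def)
  have c: "(\<lambda>p. c * \<phi> p) \<in> test_functions UNIV" if "\<phi> \<in> test_functions UNIV" for c and \<phi> :: "spacetime \<Rightarrow> complex"
    using test_mult[OF Ck_on_const that] by simp
  have t: "partial_deriv b \<psi> \<in> test_functions UNIV" "partial_deriv b (partial_deriv b \<psi>) \<in> test_functions UNIV" if "b \<in> Basis" for b
    using test_partial_deriv \<psi> that by blast+
  have d: "dist_deriv b (dist_deriv b U) \<psi> = U (partial_deriv b (partial_deriv b \<psi>))" if "b \<in> Basis" for b
    using \<psi> t[OF that] by (simp add: dist_deriv_def)
  have S: "(\<lambda>p. \<Sum>i\<in>I. dx i (dx i \<psi>) p) \<in> test_functions UNIV \<and>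
      U (\<lambda>p. \<Sum>i\<in>I. dx i (dx i \<psi>) p) = (\<Sum>i\<in>I. U (dx i (dx i \<psi>)))" if "finite I" for I
    using that
  proof (induction I)
    case empty
    have "fsupp (\<lambda>p::spacetime. 0::complex) = {}" by (simp add: fsupp_def)
    then have z: "(\<lambda>p::spacetime. 0::complex) \<in> test_functions UNIV" by (simp add: test_iff Ck_on_const)
    have "U (\<lambda>p. 0) = 0" using continuous_formsD(2)[OF U' z, of 0] by simp
    then show ?case using z by simp
  next
    case (insert i I)
    have "dx i (dx i \<psi>) \<in> test_functions UNIV" by (rule t(2)) simp
    from test_add[OF this] continuous_formsD(1)[OF U' this] show ?case
      using insert by simp
  qed
  have "U (wave_op \<psi>) = U (dt (dt \<psi>)) - U (\<lambda>p. \<Sum>i\<in>UNIV. dx i (dx i \<psi>) p)"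
    unfolding wave_op_def[abs_def]
    by (rule continuous_forms_diff[OF U' c]) (use t(2) S[of UNIV] in auto)
  then show ?thesis
    using S[of UNIV] d by (simp add: dist_wave_op_def)
qed

text \<open>The difference of the two extensions to \<open>C^n\<close> functions is a form as in
  \<open>wave_form_zero\<close>: the delta cancels, and the product with \<open>q\<close> has become
  evaluation at \<open>q \<psi>\<close>.\<close>

lemma point_source_unique:
  assumes q: "q \<in> Cc n (ball 0 1)" and U: "point_source_solution n q a U" and U': "point_source_solution n q a U'"
  shows "U = U'"
proof -
  have q_n: "q \<in> Cc n UNIV" using Cc_open[OF open_ball q] .
  obtain Mq where Mq: "Ckb n (\<lambda>_. Mq) q" using Ckb_compact q_n unfolding Cc_iff by blast
  have q0: "q x = 0" if "1 < norm x" for x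
  proof -
    have "x \<notin> fsupp q" using q that by (auto simp: Cc_def)
    then show ?thesis by (rule fsupp_zero)
  qed
  have d: "U \<in> distributions_of_order n" "U' \<in> distributions_of_order n"
    using U U' by (auto simp: point_source_solution_def)
  note e = order_extension_facts[OF d(1)] and e' = order_extension_facts[OF d(2)]
  define V where "V f = order_extension n U f - order_extension n U' f" for f
  have Ec: "(\<lambda>x. c * \<phi> x) \<in> Cc n UNIV" if "\<phi> \<in> Cc n UNIV" for c and \<phi> :: "spacetime \<Rightarrow> complex"
    using Cc_mult[OF Ck_on_const that] by simp
  have q\<psi>: "(\<lambda>p. q (fst p) * \<psi> p) \<in> Cc n UNIV" if "\<psi> \<in> test_functions UNIV" for \<psi> :: "spacetime \<Rightarrow> complex"
    by (rule Cc_mult[OF Ckb_imp_Ck_on[OF Ckb_fst[OF Mq]] test_subset_Cc[OF that]])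
  have V0: "V \<phi> = 0" if "\<phi> \<in> Cc n UNIV" for \<phi>
  proof (rule wave_form_zero[OF _ _ _ _ Mq q0 that])
    show "V (\<lambda>p. \<phi> p - \<psi> p) = V \<phi> - V \<psi>" if "\<phi> \<in> Cc n UNIV" "\<psi> \<in> Cc n UNIV" for \<phi> \<psi>
      using continuous_forms_diff[OF e(1) Ec that] continuous_forms_diff[OF e'(1) Ec that] by (simp add: V_def)
  next
    fix K :: "spacetime set" assume K: "compact K"
    obtain C where C: "0 \<le> C" "\<And>\<phi> A. \<phi> \<in> Cc n UNIV \<Longrightarrow> fsupp \<phi> \<subseteq> K \<Longrightarrow> Ckb n (\<lambda>_. A) \<phi> \<Longrightarrow> norm (order_extension n U \<phi>) \<le> C * A"
      using continuous_forms_bound[OF e(1) K] by blast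
    obtain C' where C': "0 \<le> C'" "\<And>\<phi> A. \<phi> \<in> Cc n UNIV \<Longrightarrow> fsupp \<phi> \<subseteq> K \<Longrightarrow> Ckb n (\<lambda>_. A) \<phi> \<Longrightarrow> norm (order_extension n U' \<phi>) \<le> C' * A"
      using continuous_forms_bound[OF e'(1) K] by blast
    have "norm (V \<phi>) \<le> (C + C') * A" if "\<phi> \<in> Cc n UNIV" "fsupp \<phi> \<subseteq> K" "Ckb n (\<lambda>_. A) \<phi>" for \<phi> A
      using norm_triangle_le_diff[OF add_mono[OF C(2)[OF that] C'(2)[OF that]]] by (simp add: V_def distrib_right)
    then show "\<exists>C\<ge>0. \<forall>\<phi>\<in>Cc n UNIV. \<forall>A. fsupp \<phi> \<subseteq> K \<longrightarrow> Ckb n (\<lambda>_. A) \<phi> \<longrightarrow> norm (V \<phi>) \<le> C * A"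
      using C(1) C'(1) by (intro exI[of _ "C + C'"]) auto
  next
    fix \<psi> :: "spacetime \<Rightarrow> complex" assume \<psi>: "\<psi> \<in> test_functions UNIV"
    have "U (wave_op \<psi>) - order_extension n U (\<lambda>p. q (fst p) * \<psi> p) = dirac_delta (a, 0) \<psi>"
      "U' (wave_op \<psi>) - order_extension n U' (\<lambda>p. q (fst p) * \<psi> p) = dirac_delta (a, 0) \<psi>"
      using U U' \<psi> dist_wave_op_eq[OF d(1) \<psi>] dist_wave_op_eq[OF d(2) \<psi>]
      by (auto simp: point_source_solution_def dist_mult_def case_prod_beta)
    then show "V (wave_op \<psi>) = V (\<lambda>p. q (fst p) * \<psi> p)"
      using e(2)[OF wave_op_test[OF \<psi>]] e'(2)[OF wave_op_test[OF \<psi>]] by (simp add: V_def algebra_simps)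
  next
    fix \<psi> :: "spacetime \<Rightarrow> complex"
    assume \<psi>: "\<psi> \<in> test_functions UNIV" and past: "\<And>p. -1 < snd p \<Longrightarrow> \<psi> p = 0"
    \<comment> \<open>The margin between -1 and 0 keeps the closed support inside the open half
      space \<open>t < 0\<close>.\<close>
    have c: "closed {p :: spacetime. snd p \<le> -1}" by (intro closed_Collect_le continuous_intros)
    have "fsupp \<psi> \<subseteq> {p. snd p \<le> -1}" unfolding fsupp_subset_iff[OF c] using past by (simp add: not_le)
    then have s: "fsupp \<psi> \<subseteq> {(x, t). t < 0}" by fastforce
    have "{(x :: real^3, t). t < (0::real)} = {p. snd p < 0}" by auto
    then have "open {(x :: real^3, t). t < (0::real)}" by (simp add: open_Collect_less continuous_on_snd)
    with s have "\<psi> \<in> test_functions {(x, t). t < 0}" using test_support \<psi> by blast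
    then have "U \<psi> = 0" "U' \<psi> = 0" using U U' by (auto simp: point_source_solution_def dist_zero_on_def)
    then show "V \<psi> = 0" using e(2)[OF \<psi>] e'(2)[OF \<psi>] by (simp add: V_def)
  qed
  show ?thesis
  proof (rule extensionalityI[of _ "test_functions UNIV"])
    show "U \<in> extensional (test_functions UNIV)" "U' \<in> extensional (test_functions UNIV)"
      using d by (auto simp: distributions_of_order_def continuous_forms_def)
    fix \<phi> :: "spacetime \<Rightarrow> complex" assume \<phi>: "\<phi> \<in> test_functions UNIV"
    show "U \<phi> = U' \<phi>" using V0[OF test_subset_Cc[OF \<phi>]] e(2)[OF \<phi>] e'(2)[OF \<phi>] by (simp add: V_def)
  qed
qed

section \<open>Existence\<close>

lemma cone_solution_integrable:
  fixes f :: "spacetime \<Rightarrow> complex"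
  assumes q: "Ckb 7 (\<lambda>_. M) q" and W: "wave_remainder M q a W" and f: "continuous_on UNIV f" "compact (fsupp f)"
  shows "integrable lborel (\<lambda>z. indicator (fwd_cone a) z *\<^sub>R (prog_wave q a z * f z))"
    and "integrable lborel (\<lambda>z. W z * f z)"
proof -
  have c: "continuous_on UNIV (\<lambda>z. prog_wave q a z * f z)"
    using Ck_on_imp_continuous_on[OF prog_wave_facts(1)[OF q]] f(1) by (intro continuous_intros) auto
  have s: "compact (fsupp (\<lambda>z. g z * f z))" for g
    by (rule compact_fsupp_subset[OF f(2)]) (use fsupp_zero[of _ f] in auto)
  show "integrable lborel (\<lambda>z. indicator (fwd_cone a) z *\<^sub>R (prog_wave q a z * f z))"
    by (rule cone_integral_rays(2)[OF c s])
  have "continuous_on UNIV W" using W Ckb_continuous unfolding wave_remainder_def by blast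
  then have "continuous_on UNIV (\<lambda>z. W z * f z)" using f(1) by (intro continuous_intros)
  then show "integrable lborel (\<lambda>z. W z * f z)" by (rule integrable_continuous_compact[OF _ s])
qed

lemma cone_solution_linear:
  assumes q: "Ckb 7 (\<lambda>_. M) q" and W: "wave_remainder M q a W"
    and f: "continuous_on UNIV f" "compact (fsupp f)" and g: "continuous_on UNIV g" "compact (fsupp g)"
  shows "cone_solution q a W (\<lambda>z. f z + g z) = cone_solution q a W f + cone_solution q a W g"
    and "cone_solution q a W (\<lambda>z. c * f z) = c * cone_solution q a W f"
proof -
  note if1 = cone_solution_integrable[OF q W f] and ig1 = cone_solution_integrable[OF q W g]
  have p: "potential 1 (\<lambda>z. f z + g z) (a, 0) = potential 1 f (a, 0) + potential 1 g (a, 0)"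
    unfolding potential_def
    using potential_integrable_compact[OF f, of "(a, 0)"] potential_integrable_compact[OF g, of "(a, 0)"]
    by (simp add: scaleR_add_right)
  show "cone_solution q a W (\<lambda>z. f z + g z) = cone_solution q a W f + cone_solution q a W g"
    unfolding cone_solution_def p using if1 ig1 by (simp add: distrib_left scaleR_add_right)
  have scale: "(\<integral>z. u z \<partial>lborel) = c * (\<integral>z. v z \<partial>lborel)" if "\<And>z. u z = c * v z"
    for u v :: "'b::euclidean_space \<Rightarrow> complex"
    unfolding that by (rule integral_mult_right_zero)
  have "potential 1 (\<lambda>z. c * f z) (a, 0) = c * potential 1 f (a, 0)"
    unfolding potential_def by (rule scale) simp
  moreover have "(\<integral>z. indicator (fwd_cone a) z *\<^sub>R (prog_wave q a z * (c * f z)) \<partial>lborel)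
      = c * (\<integral>z. indicator (fwd_cone a) z *\<^sub>R (prog_wave q a z * f z) \<partial>lborel)"
    by (rule scale) (simp add: mult.left_commute)
  moreover have "(\<integral>z. W z * (c * f z) \<partial>lborel) = c * (\<integral>z. W z * f z \<partial>lborel)"
    by (rule scale) (simp add: mult.left_commute)
  ultimately show "cone_solution q a W (\<lambda>z. c * f z) = c * cone_solution q a W f"
    unfolding cone_solution_def by (simp only: distrib_left)
qed

text \<open>The supremum alone controls the functional, i.e. the solution has order 0. The constant
  is obtained by integrating the absolute values of the three kernels against a continuous cutoff
  \<open>g\<close> that is 1 on \<open>K\<close>.\<close>

lemma cone_solution_bound:
  assumes q: "Ckb 7 (\<lambda>_. M) q" and W: "wave_remainder M q a W" and K: "compact K"
  shows "\<exists>C\<ge>0. \<forall>f S. continuous_on UNIV f \<longrightarrow> fsupp f \<subseteq> K \<longrightarrow> (\<forall>z. norm (f z) \<le> S) \<longrightarrow>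
    norm (cone_solution q a W f) \<le> C * S"
proof -
  obtain r where r: "\<And>z. z \<in> K \<Longrightarrow> norm z \<le> r" using compact_imp_bounded[OF K] by (auto simp: bounded_iff)
  define g :: "spacetime \<Rightarrow> complex" where "g z = complex_of_real (max 0 (min 1 (r + 1 - norm z)))" for z
  have g: "continuous_on UNIV g" unfolding g_def[abs_def] by (intro continuous_intros)
  have gs: "compact (fsupp g)"
    unfolding compact_fsupp_iff by (intro exI[of _ "r + 1"]) (auto simp: g_def)
  have gK: "norm (g z) = 1" if "z \<in> K" for z using r[OF that] by (simp add: g_def)
  define C where "C = (\<integral>y. norm (newton y *\<^sub>R g ((a, 0) + (y, norm y))) \<partial>lborel)
    + (\<integral>z. norm (indicator (fwd_cone a) z *\<^sub>R (prog_wave q a z * g z)) \<partial>lborel) + (\<integral>z. norm (W z * g z) \<partial>lborel)"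
  have "norm (cone_solution q a W f) \<le> C * S"
    if f: "continuous_on UNIV f" "fsupp f \<subseteq> K" and S: "\<And>z. norm (f z) \<le> S" for f S
  proof -
    have fc: "compact (fsupp f)"
      using compact_Int_closed[OF K, of "fsupp f"] f(2) by (simp add: fsupp_def Int_absorb1)
    have fg: "norm (f z) \<le> S * norm (g z)" for z
    proof (cases "z \<in> K")
      case True
      then show ?thesis using S gK by simp
    next
      case False
      then have "f z = 0" using fsupp_zero[of z f] f(2) by blast
      moreover have "0 \<le> S" using S[of z] norm_ge_zero order_trans by blast
      ultimately show ?thesis by simp
    qed
    have bd: "norm (\<integral>z. u z \<partial>lborel) \<le> (\<integral>z. norm (v z) \<partial>lborel) * S"
      if "integrable lborel u" "integrable lborel v" "\<And>z. norm (u z) \<le> norm (v z) * S"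
      for u v :: "'b::euclidean_space \<Rightarrow> complex"
    proof -
      have "norm (\<integral>z. u z \<partial>lborel) \<le> (\<integral>z. norm (u z) \<partial>lborel)" by (rule integral_norm_bound)
      also have "\<dots> \<le> (\<integral>z. norm (v z) * S \<partial>lborel)"
        using that by (intro integral_mono) auto
      finally show ?thesis by simp
    qed
    have 1: "norm (potential 1 f (a, 0)) \<le> (\<integral>y. norm (newton y *\<^sub>R g ((a, 0) + (y, norm y))) \<partial>lborel) * S"
      unfolding potential_def mult_1
    proof (rule bd[OF potential_integrable_compact[OF f(1) fc] potential_integrable_compact[OF g gs]])
      fix y
      show "norm (newton y *\<^sub>R f ((a, 0) + (y, norm y))) \<le> norm (newton y *\<^sub>R g ((a, 0) + (y, norm y))) * S"
        using mult_left_mono[OF fg[of "(a, 0) + (y, norm y)"] newton_nonneg[of y]] newton_nonneg[of y] by (simp add: mult_ac)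
    qed
    have 2: "norm (\<integral>z. indicator (fwd_cone a) z *\<^sub>R (prog_wave q a z * f z) \<partial>lborel)
        \<le> (\<integral>z. norm (indicator (fwd_cone a) z *\<^sub>R (prog_wave q a z * g z)) \<partial>lborel) * S"
    proof (rule bd[OF cone_solution_integrable(1)[OF q W f(1) fc] cone_solution_integrable(1)[OF q W g gs]])
      fix z
      show "norm (indicator (fwd_cone a) z *\<^sub>R (prog_wave q a z * f z)) \<le> norm (indicator (fwd_cone a) z *\<^sub>R (prog_wave q a z * g z)) * S"
        using mult_left_mono[OF fg[of z], of "norm (prog_wave q a z)"] by (simp add: norm_mult mult_ac indicator_def)
    qed
    have 3: "norm (\<integral>z. W z * f z \<partial>lborel) \<le> (\<integral>z. norm (W z * g z) \<partial>lborel) * S"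
    proof (rule bd[OF cone_solution_integrable(2)[OF q W f(1) fc] cone_solution_integrable(2)[OF q W g gs]])
      fix z
      show "norm (W z * f z) \<le> norm (W z * g z) * S"
        using mult_left_mono[OF fg[of z], of "norm (W z)"] by (simp add: norm_mult mult_ac)
    qed
    show ?thesis
      unfolding cone_solution_def C_def distrib_right
      by (rule norm_triangle_le[OF add_mono[OF norm_triangle_le[OF add_mono[OF 1 2]] 3]])
  qed
  moreover have "0 \<le> C" unfolding C_def by (intro add_nonneg_nonneg Bochner_Integration.integral_nonneg) auto
  ultimately show ?thesis by blast
qed

definition cone_dist :: "(real^3 \<Rightarrow> complex) \<Rightarrow> real^3 \<Rightarrow> (spacetime \<Rightarrow> complex) \<Rightarrow> spacetime_dist" where
  "cone_dist q a W = (\<lambda>\<phi>\<in>test_functions UNIV. cone_solution q a W \<phi>)"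

text \<open>Stated for a general domain \<open>E\<close>, because the same formula gives both the
  distribution on test functions and its extension to \<open>C^n\<close> functions.\<close>

lemma cone_solution_form:
  assumes q: "Ckb 7 (\<lambda>_. M) q" and W: "wave_remainder M q a W"
    and E: "E \<subseteq> Cc n UNIV" "\<And>\<phi> \<psi>. \<phi> \<in> E \<Longrightarrow> \<psi> \<in> E \<Longrightarrow> (\<lambda>x. \<phi> x + \<psi> x) \<in> E" "\<And>c \<phi>. \<phi> \<in> E \<Longrightarrow> (\<lambda>x. c * \<phi> x) \<in> E"
  shows "(\<lambda>\<phi>\<in>E. cone_solution q a W \<phi>) \<in> continuous_forms E n"
  unfolding continuous_forms_def
proof (intro CollectI conjI ballI allI impI)
  have cs: "continuous_on UNIV \<phi>" "compact (fsupp \<phi>)" if "\<phi> \<in> E" for \<phi>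
    using E(1) that Ck_on_imp_continuous_on unfolding Cc_def by blast+
  show "(\<lambda>\<phi>\<in>E. cone_solution q a W \<phi>) \<in> extensional E" by simp
  show "(\<lambda>\<phi>\<in>E. cone_solution q a W \<phi>) (\<lambda>x. \<phi> x + \<psi> x) = (\<lambda>\<phi>\<in>E. cone_solution q a W \<phi>) \<phi> + (\<lambda>\<phi>\<in>E. cone_solution q a W \<phi>) \<psi>"
    if "\<phi> \<in> E" "\<psi> \<in> E" for \<phi> \<psi>
    using that E(2) cone_solution_linear(1)[OF q W cs[OF that(1)] cs[OF that(2)]] by simp
  show "(\<lambda>\<phi>\<in>E. cone_solution q a W \<phi>) (\<lambda>x. c * \<phi> x) = c * (\<lambda>\<phi>\<in>E. cone_solution q a W \<phi>) \<phi>"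
    if "\<phi> \<in> E" for c \<phi>
    using that E(3) cone_solution_linear(2)[OF q W cs[OF that] cs[OF that]] by simp
  fix K :: "spacetime set" assume K: "compact K"
  obtain C where C: "0 \<le> C" "\<And>f S. continuous_on UNIV f \<Longrightarrow> fsupp f \<subseteq> K \<Longrightarrow> (\<And>z. norm (f z) \<le> S) \<Longrightarrow> norm (cone_solution q a W f) \<le> C * S"
    using cone_solution_bound[OF q W K] by blast
  have "ereal (cmod (cone_solution q a W \<phi>)) \<le> ereal (C + 1) * Ck_norm n UNIV \<phi>" if \<phi>: "\<phi> \<in> E" "fsupp \<phi> \<subseteq> K" for \<phi>
  proof (cases "Ck_norm n UNIV \<phi>")
    case (real A)
    have "norm (\<phi> z) \<le> A" for z using Ck_norm_ge_sup[of \<phi> z n] real by simp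
    note b = C(2)[OF cs(1)[OF \<phi>(1)] \<phi>(2) this] and A = order_trans[OF norm_ge_zero this]
    then have "norm (cone_solution q a W \<phi>) \<le> (C + 1) * A" by (simp add: algebra_simps)
    then show ?thesis using real by simp
  next
    case PInf
    then show ?thesis using C(1) by simp
  next
    case MInf
    then show ?thesis using Ck_norm_nonneg[of UNIV n \<phi>] by simp
  qed
  then show "\<exists>C. \<forall>\<phi>\<in>E. fsupp \<phi> \<subseteq> K \<longrightarrow> ereal (cmod ((\<lambda>\<phi>\<in>E. cone_solution q a W \<phi>) \<phi>)) \<le> ereal C * Ck_norm n UNIV \<phi>"
    by (intro exI[of _ "C + 1"]) simp
qed

lemma cone_solution_zero:
  assumes W: "wave_remainder M q a W" and f: "\<And>p. norm (fst p - a) \<le> snd p \<Longrightarrow> f p = 0"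
  shows "cone_solution q a W f = 0"
proof -
  have "potential 1 f (a, 0) = 0"
    by (simp add: potential_def f)
  moreover have "indicator (fwd_cone a) z *\<^sub>R (prog_wave q a z * f z) = 0" for z
    using f[of z] by (auto simp: indicator_def fwd_cone_iff)
  moreover have "W z * f z = 0" for z
  proof (cases "norm (fst z - a) \<le> snd z")
    case True
    then show ?thesis using f by simp
  next
    case False
    then have "W z = 0" using W unfolding wave_remainder_def not_le by blast
    then show ?thesis by simp
  qed
  ultimately show ?thesis unfolding cone_solution_def by (simp only: Bochner_Integration.integral_zero add_0)
qed

text \<open>By uniqueness the order extension of \<open>cone_dist\<close> is
  \<open>cone_solution\<close> itself. The product with \<open>q\<close> is then evaluated at
  \<open>q \<phi>\<close>, and the distributional equation becomes
  \<open>cone_solution_wave_equation\<close>.\<close>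

lemma cone_dist_solution:
  assumes q: "Ckb 7 (\<lambda>_. M) q" and qn: "q \<in> Cc n UNIV" and W: "wave_remainder M q a W" and n: "2 \<le> n"
  shows "point_source_solution n q a (cone_dist q a W)"
proof -
  have c: "(\<lambda>p. c * \<phi> p) \<in> test_functions UNIV" if "\<phi> \<in> test_functions UNIV" for c and \<phi> :: "spacetime \<Rightarrow> complex"
    using test_mult[OF Ck_on_const that] by simp
  have c': "(\<lambda>p. c * \<phi> p) \<in> Cc n UNIV" if "\<phi> \<in> Cc n UNIV" for c and \<phi> :: "spacetime \<Rightarrow> complex"
    using Cc_mult[OF Ck_on_const that] by simp
  have U: "cone_dist q a W \<in> distributions_of_order n"
    unfolding distributions_of_order_def cone_dist_def
    by (rule cone_solution_form[OF q W _ test_add c]) (use test_subset_Cc in blast)+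
  have ext: "order_extension n (cone_dist q a W) = (\<lambda>\<phi>\<in>Cc n UNIV. cone_solution q a W \<phi>)"
    by (rule order_extension_eq[OF cone_solution_form[OF q W order_refl Cc_add c']])
      (auto simp: cone_dist_def test_subset_Cc)
  have "dist_wave_op (cone_dist q a W) \<phi> - dist_mult n (\<lambda>(x, t). q x) (cone_dist q a W) \<phi> = dirac_delta (a, 0) \<phi>"
    if \<phi>: "\<phi> \<in> test_functions UNIV" for \<phi>
  proof -
    obtain A where "Ckb n (\<lambda>_. A) q" using Ckb_compact qn unfolding Cc_iff by blast
    then have "(\<lambda>z. q (fst z) * \<phi> z) \<in> Cc n UNIV"
      using Cc_mult[OF Ckb_imp_Ck_on[OF Ckb_fst] test_subset_Cc[OF \<phi>]] by blast
    then have "dist_wave_op (cone_dist q a W) \<phi> - dist_mult n (\<lambda>(x, t). q x) (cone_dist q a W) \<phi>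
        = cone_solution q a W (wave_op \<phi>) - cone_solution q a W (\<lambda>z. q (fst z) * \<phi> z)"
      using dist_wave_op_eq[OF U \<phi>] wave_op_test[OF \<phi>] \<phi> ext by (simp add: dist_mult_def case_prod_beta cone_dist_def)
    also have "\<dots> = \<phi> (a, 0)"
      using \<phi> by (intro cone_solution_wave_equation[OF q W]) (auto simp: test_iff)
    finally show ?thesis using \<phi> by (simp add: dirac_delta_def)
  qed
  moreover have "dist_zero_on {(x, t). t < 0} (cone_dist q a W)"
    unfolding dist_zero_on_def
  proof
    fix \<phi> :: "spacetime \<Rightarrow> complex" assume "\<phi> \<in> test_functions {(x, t). t < 0}"
    moreover have "{(x :: real^3, t). t < (0::real)} = {p. snd p < 0}" by auto
    then have "open {(x :: real^3, t). t < (0::real)}" by (simp add: open_Collect_less continuous_on_snd)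
    ultimately have \<phi>: "\<phi> \<in> test_functions UNIV" "fsupp \<phi> \<subseteq> {(x, t). t < 0}" using test_support by blast+
    have "\<phi> p = 0" if "norm (fst p - a) \<le> snd p" for p
    proof -
      have "0 \<le> snd p" using that norm_ge_zero[of "fst p - a"] by linarith
      then have "p \<notin> fsupp \<phi>" using \<phi>(2) by auto
      then show ?thesis by (rule fsupp_zero)
    qed
    then have "cone_solution q a W \<phi> = 0" by (rule cone_solution_zero[OF W])
    then show "cone_dist q a W \<phi> = 0" using \<phi>(1) by (simp add: cone_dist_def)
  qed
  ultimately show ?thesis using U by (simp add: point_source_solution_def)
qed

section \<open>The regular part\<close>

text \<open>The regular part of the solution is determined inside the cone only. Replacing \<open>cone_fun\<close> by its
  composition with \<open>clip\<close> keeps it bounded outside.\<close>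

definition clip :: "real \<Rightarrow> real" where
  "clip s = (if 0 \<le> s then s else s / (1 - s))"

definition clip_deriv :: "real \<Rightarrow> real" where
  "clip_deriv s = (if 0 \<le> s then 1 else 1 / (1 - s)\<^sup>2)"

lemma clip_derivative: "(clip has_real_derivative clip_deriv s) (at s)"
proof -
  consider "0 < s" | "s < 0" | "s = 0" by linarith
  then show ?thesis
  proof cases
    case 1
    have "((\<lambda>s. s) has_real_derivative clip_deriv s) (at s)" using 1 by (simp add: clip_deriv_def)
    then show ?thesis
      by (rule has_field_derivative_transform_within_open[of _ _ _ "{0<..}"]) (use 1 in \<open>auto simp: clip_def\<close>)
  next
    case 2
    have "((\<lambda>s. s / (1 - s)) has_real_derivative clip_deriv s) (at s)"
      using 2 by (auto intro!: derivative_eq_intros simp: clip_deriv_def power2_eq_square)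
    then show ?thesis
      by (rule has_field_derivative_transform_within_open[of _ _ _ "{..<0}"]) (use 2 in \<open>auto simp: clip_def\<close>)
  next
    case 3
    \<comment> \<open>The branches meet to second order: for negative \<open>h\<close> the
      difference \<open>clip h - h\<close> is \<open>h^2 / (1 - h)\<close>.\<close>
    have "((\<lambda>s. clip s - s) has_derivative (\<lambda>_. 0)) (at 0)"
    proof (rule quadratic_zero_derivative[of _ _ 1])
      show "clip 0 - 0 = 0" by (simp add: clip_def)
      show "norm (clip (0 + h) - (0 + h)) \<le> 1 * (norm h)\<^sup>2" for h
      proof (cases "0 \<le> h")
        case False
        then have "clip h - h = h\<^sup>2 / (1 - h)" by (simp add: clip_def field_simps power2_eq_square)
        moreover have "h\<^sup>2 / (1 - h) \<le> h\<^sup>2" using False by (simp add: divide_le_eq mult_left_le_one_le)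
        ultimately show ?thesis using False by simp
      qed (simp add: clip_def)
    qed simp
    from has_derivative_add[OF this has_derivative_ident]
    have "(clip has_derivative (\<lambda>h. h)) (at 0)" by simp
    moreover have "(*) 1 = (\<lambda>h :: real. h)" by auto
    ultimately show ?thesis using 3 by (simp add: has_field_derivative_def clip_deriv_def)
  qed
qed

lemma continuous_clip_deriv: "continuous_on UNIV clip_deriv"
proof -
  have "continuous_on ({0..} \<union> {..0}) clip_deriv"
    unfolding clip_deriv_def
    by (rule continuous_on_If) (auto intro!: continuous_intros)
  moreover have "{0..} \<union> {..0::real} = UNIV" by auto
  ultimately show ?thesis by simp
qed

definition clip_cone :: "real^3 \<Rightarrow> spacetime \<Rightarrow> complex" where
  "clip_cone a p = complex_of_real (clip ((snd p)\<^sup>2 - (norm (fst p - a))\<^sup>2))"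

lemma clip_cone_eq:
  assumes "norm (fst p - a) \<le> snd p"
  shows "clip_cone a p = cone_fun a p"
proof -
  have "(norm (fst p - a))\<^sup>2 \<le> (snd p)\<^sup>2" using assms by (intro power_mono) auto
  then show ?thesis by (simp add: clip_cone_def clip_def cone_fun_eq)
qed

text \<open>A common majorant of \<open>t^2 + 1\<close> for the value and \<open>4 |t| + 2\<close>
  for the derivatives of \<open>clip_cone\<close>. It depends on time only, so it is uniform in
  \<open>x\<close> and \<open>a\<close>.\<close>

definition clip_weight :: "real \<Rightarrow> real" where
  "clip_weight t = t\<^sup>2 + 4 * \<bar>t\<bar> + 3"

text \<open>Outside the double cone the gradient of s grows with the distance \<open>r\<close> to
  \<open>a\<close>. The decay of \<open>clip_deriv\<close> compensates this growth, so the bounds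
  extend over all of space.\<close>

lemma Ckb_clip_cone: "Ckb 1 (\<lambda>p. clip_weight (snd p)) (clip_cone a)"
proof -
  define s :: "spacetime \<Rightarrow> real" where "s p = (snd p)\<^sup>2 - (norm (fst p - a))\<^sup>2" for p
  have s': "s p = (snd p)\<^sup>2 - (fst p - a) \<bullet> (fst p - a)" for p by (simp add: s_def power2_norm_eq_inner)
  have ds: "(s has_derivative (\<lambda>v. 2 * snd p * snd v - 2 * ((fst p - a) \<bullet> fst v))) (at p)" for p
    unfolding s'[abs_def] by (auto intro!: derivative_eq_intros simp: inner_commute)
  have d: "(clip_cone a has_derivative (\<lambda>v. complex_of_real (clip_deriv (s p) * (2 * snd p * snd v - 2 * ((fst p - a) \<bullet> fst v))))) (at p)" for p
  proof -
    have "(clip has_derivative (*) (clip_deriv (s p))) (at (s p))"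
      using clip_derivative by (simp add: has_field_derivative_def)
    from has_derivative_compose[OF ds this] have "((\<lambda>p. clip (s p)) has_derivative
      (\<lambda>v. clip_deriv (s p) * (2 * snd p * snd v - 2 * ((fst p - a) \<bullet> fst v)))) (at p)" .
    from bounded_linear.has_derivative[OF bounded_linear_of_real this]
    show ?thesis unfolding clip_cone_def[abs_def] s_def[symmetric] by simp
  qed
  have pd: "partial_deriv b (clip_cone a)
      = (\<lambda>p. complex_of_real (clip_deriv (s p) * (2 * snd p * snd b - 2 * ((fst p - a) \<bullet> fst b))))" for b
    by (rule ext, rule partial_deriv_eq[OF d])
  have "norm (clip_cone a p) \<le> clip_weight (snd p)" for p
  proof -
    have "\<bar>clip (s p)\<bar> \<le> (snd p)\<^sup>2 + 1"
    proof (cases "0 \<le> s p")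
      case True
      then have "\<bar>clip (s p)\<bar> = s p" by (simp add: clip_def)
      then show ?thesis using zero_le_power2[of "norm (fst p - a)"] unfolding s_def by linarith
    next
      case False
      then have "\<bar>clip (s p)\<bar> \<le> 1" by (simp add: clip_def abs_le_iff divide_le_eq le_divide_eq)
      then show ?thesis by (simp add: add_increasing)
    qed
    then show ?thesis unfolding clip_cone_def s_def[symmetric] by (simp add: clip_weight_def)
  qed
  moreover have "norm (partial_deriv b (clip_cone a) p) \<le> clip_weight (snd p)" if b: "b \<in> Basis" for b p
  proof -
    have "norm (fst b) \<le> 1" "\<bar>snd b\<bar> \<le> 1" using b by (auto simp: spacetime_Basis)
    then have "\<bar>2 * snd p * snd b\<bar> \<le> 2 * \<bar>snd p\<bar>" "\<bar>(fst p - a) \<bullet> fst b\<bar> \<le> norm (fst p - a)"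
      using mult_left_mono[of "\<bar>snd b\<bar>" 1 "2 * \<bar>snd p\<bar>"] Cauchy_Schwarz_ineq2[of "fst p - a" "fst b"]
        mult_left_mono[of "norm (fst b)" 1 "norm (fst p - a)"] by (auto simp: abs_mult)
    then have lin: "\<bar>2 * snd p * snd b - 2 * ((fst p - a) \<bullet> fst b)\<bar> \<le> 2 * \<bar>snd p\<bar> + 2 * norm (fst p - a)" by linarith
    have "clip_deriv (s p) * (2 * \<bar>snd p\<bar> + 2 * norm (fst p - a)) \<le> 4 * \<bar>snd p\<bar> + 2"
    proof (cases "0 \<le> s p")
      case True
      then have "norm (fst p - a) \<le> \<bar>snd p\<bar>" by (simp add: s_def abs_le_square_iff[symmetric])
      then show ?thesis using True by (simp add: clip_deriv_def)
    next
      case False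
      \<comment> \<open>With \<open>u = 1 - s\<close> one has
        \<open>r^2 = t^2 + u - 1 <= (|t| + u)^2\<close>; the factor \<open>1 / u^2\<close> of the
        derivative absorbs the \<open>u\<close> in \<open>r <= |t| + u\<close>.\<close>
      define u where "u = 1 - s p"
      have u: "1 \<le> u" using False by (simp add: u_def)
      have "(norm (fst p - a))\<^sup>2 = (snd p)\<^sup>2 + (u - 1)" by (simp add: s_def u_def)
      also have "\<dots> \<le> (\<bar>snd p\<bar> + u)\<^sup>2"
      proof -
        have "u - 1 \<le> u\<^sup>2" using self_le_power[OF u, of 2] by simp
        moreover have "0 \<le> 2 * \<bar>snd p\<bar> * u" using u by simp
        ultimately show ?thesis unfolding power2_sum power2_abs by linarith
      qed
      finally have "norm (fst p - a) \<le> \<bar>snd p\<bar> + u" by (rule power2_le_imp_le) (use u in simp)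
      then have "2 * \<bar>snd p\<bar> + 2 * norm (fst p - a) \<le> 4 * \<bar>snd p\<bar> + 2 * u" by simp
      also have "\<dots> \<le> (4 * \<bar>snd p\<bar> + 2) * u\<^sup>2"
      proof -
        have "u \<le> u\<^sup>2" using self_le_power[OF u, of 2] by simp
        moreover have "\<bar>snd p\<bar> * 1 \<le> \<bar>snd p\<bar> * u\<^sup>2" using u by (intro mult_left_mono) (auto simp: one_le_power)
        ultimately show ?thesis by (simp add: algebra_simps)
      qed
      finally have "(2 * \<bar>snd p\<bar> + 2 * norm (fst p - a)) / u\<^sup>2 \<le> 4 * \<bar>snd p\<bar> + 2" using u by (simp add: divide_le_eq)
      moreover have "clip_deriv (s p) = 1 / u\<^sup>2" using False by (simp add: clip_deriv_def u_def)
      ultimately show ?thesis by simp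
    qed
    moreover have "0 \<le> clip_deriv (s p)" by (simp add: clip_deriv_def)
    ultimately have "clip_deriv (s p) * \<bar>2 * snd p * snd b - 2 * ((fst p - a) \<bullet> fst b)\<bar> \<le> 4 * \<bar>snd p\<bar> + 2"
      using mult_left_mono[OF lin] order_trans by blast
    then have "norm (partial_deriv b (clip_cone a) p) \<le> 4 * \<bar>snd p\<bar> + 2"
      using \<open>0 \<le> clip_deriv (s p)\<close> by (simp only: pd norm_of_real abs_mult abs_of_nonneg)
    then show ?thesis using zero_le_power2[of "snd p"] unfolding clip_weight_def by linarith
  qed
  moreover have "clip_cone a differentiable (at p)" for p using d unfolding differentiable_def by blast
  moreover have "continuous_on UNIV (partial_deriv b (clip_cone a))" for b
    unfolding pd s_def by (intro continuous_intros continuous_on_compose2[OF continuous_clip_deriv]) auto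
  ultimately show ?thesis by (simp del: split_paired_All)
qed

text \<open>The regular part \<open>r\<close> of the theorem: the expansion with the clipped
  parameter, plus \<open>W\<close>. It is \<open>C^1\<close> on the whole spacetime and differs from
  the unclipped expression only outside the forward cone.\<close>

definition tail :: "(real^3 \<Rightarrow> complex) \<Rightarrow> real^3 \<Rightarrow> (spacetime \<Rightarrow> complex) \<Rightarrow> spacetime \<Rightarrow> complex" where
  "tail q a W p = amp1 q a (fst p) + clip_cone a p * amp2 q a (fst p)
    + (clip_cone a p * clip_cone a p) * ((1 / 2) *\<^sub>R amp3 q a (fst p)) + W p"

text \<open>The powers \<open>2 ^ 1\<close> are left as \<open>Ckb_mult\<close> produces them at
  order 1.\<close>

definition tail_weight :: "real \<Rightarrow> real \<Rightarrow> real \<Rightarrow> real \<Rightarrow> real \<Rightarrow> real \<Rightarrow> real" where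
  "tail_weight A1 A2 A3 A4 l t =
    A1 + 2 ^ 1 * (clip_weight t * A2) + 2 ^ 1 * (2 ^ 1 * (clip_weight t * clip_weight t) * A3) + A4 * exp (l * t)"

lemma Ckb_tail_form:
  assumes "Ckb 1 (\<lambda>_. A1) f1" "Ckb 1 (\<lambda>_. A2) f2" "Ckb 1 (\<lambda>_. A3) f3" "Ckb 1 (\<lambda>p. A4 * exp (l * snd p)) W"
  shows "Ckb 1 (\<lambda>p. tail_weight A1 A2 A3 A4 l (snd p)) (\<lambda>p. f1 (fst p) + clip_cone a p * f2 (fst p)
    + (clip_cone a p * clip_cone a p) * ((1 / 2) *\<^sub>R f3 (fst p)) + W p)"
proof -
  have "Ckb 1 (\<lambda>_. A3) (\<lambda>x. (1 / 2) *\<^sub>R f3 x)" by (rule Ckb_shrink[OF assms(3)]) simp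
  from Ckb_add[OF Ckb_add[OF Ckb_add[OF Ckb_fst[OF assms(1)] Ckb_mult[OF Ckb_clip_cone Ckb_fst[OF assms(2)]]]
    Ckb_mult[OF Ckb_mult[OF Ckb_clip_cone Ckb_clip_cone] Ckb_fst[OF this]]] assms(4)]
  show ?thesis unfolding tail_weight_def .
qed

lemma tail_weight_mono:
  assumes "A1 \<le> B1" "A2 \<le> B2" "A3 \<le> B3" "A4 \<le> B4" "l \<le> m" "t \<le> s" "0 \<le> A2" "0 \<le> A3" "0 \<le> A4" "0 \<le> l" "0 \<le> t"
  shows "tail_weight A1 A2 A3 A4 l t \<le> tail_weight B1 B2 B3 B4 m s"
proof -
  have w: "clip_weight t \<le> clip_weight s" "0 \<le> clip_weight t"
    using assms(6,11) power_mono[OF assms(6,11), of 2] by (auto simp: clip_weight_def intro: add_mono)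
  have e: "l * t \<le> m * s" using assms by (intro mult_mono) auto
  show ?thesis
    unfolding tail_weight_def using assms w e
    by (intro add_mono mult_mono mult_nonneg_nonneg) auto
qed

lemma bnd_mono:
  assumes "0 \<le> M" "M \<le> N"
  shows "0 \<le> bnd2 M" "0 \<le> bnd3 M" "0 \<le> bnd4 M" "bnd2 M \<le> bnd2 N" "bnd3 M \<le> bnd3 N" "bnd4 M \<le> bnd4 N"
proof -
  have MM: "M * M \<le> N * N" using assms by (intro mult_mono) auto
  show 2: "0 \<le> bnd2 M" "bnd2 M \<le> bnd2 N" using assms MM by (auto simp: bnd2_def)
  then have "M * bnd2 M \<le> N * bnd2 N" using assms by (intro mult_mono) auto
  then show 3: "0 \<le> bnd3 M" "bnd3 M \<le> bnd3 N" using assms 2 by (auto simp: bnd3_def)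
  then have "M * bnd3 M \<le> N * bnd3 N" using assms by (intro mult_mono) auto
  then show "0 \<le> bnd4 M" "bnd4 M \<le> bnd4 N" using assms 3 by (auto simp: bnd4_def)
qed

definition tail_bound :: "real \<Rightarrow> real \<Rightarrow> real" where
  "tail_bound M t = tail_weight M (bnd2 M) (bnd3 M) (96 * bnd4 M) (1 + 4 * M) t"

lemma Ckb_tail:
  assumes q: "Ckb 7 (\<lambda>_. M) q" and W: "wave_remainder M q a W"
  shows "Ckb 1 (\<lambda>p. tail_bound M (snd p)) (tail q a W)"
proof -
  have W1: "Ckb 1 (\<lambda>p. 96 * bnd4 M * exp ((1 + 4 * M) * snd p)) W" using W unfolding wave_remainder_def by blast
  show ?thesis
    unfolding tail_def[abs_def] tail_bound_def
    by (rule Ckb_tail_form[OF _ _ _ W1]) (rule Ckb_order_mono[OF amp_bounds(1)[OF q]] Ckb_order_mono[OF amp_bounds(3)[OF q]]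
      Ckb_order_mono[OF amp_bounds(5)[OF q]]; simp)+
qed

definition tail_diff_bound :: "real \<Rightarrow> real \<Rightarrow> real" where
  "tail_diff_bound M t = tail_weight 1 (dbnd2 M) (dbnd3 M) (2 * (48 * dbnd4 M + 192 * bnd4 M)) (1 + 4 * M) t"

lemma Ckb_tail_diff:
  assumes q: "Ckb 7 (\<lambda>_. M) q" and p: "Ckb 7 (\<lambda>_. M) p" and e: "Ckb 7 (\<lambda>_. e) (\<lambda>x. q x - p x)"
    and W: "wave_remainder M q a W" and V: "wave_remainder M p a V"
  shows "Ckb 1 (\<lambda>z. e * tail_diff_bound M (snd z)) (\<lambda>z. tail q a W z - tail p a V z)"
proof -
  have "Ckb 1 (\<lambda>z. tail_weight e (dbnd2 M * e) (dbnd3 M * e) (2 * ((48 * dbnd4 M + 192 * bnd4 M) * e)) (1 + 4 * M) (snd z))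
    (\<lambda>z. (amp1 q a (fst z) - amp1 p a (fst z)) + clip_cone a z * (amp2 q a (fst z) - amp2 p a (fst z))
      + (clip_cone a z * clip_cone a z) * ((1 / 2) *\<^sub>R (amp3 q a (fst z) - amp3 p a (fst z))) + (W z - V z))"
    by (rule Ckb_tail_form[OF _ _ _ wave_remainder_diff[OF q p e W V]])
      (rule Ckb_order_mono[OF amp_diff_bounds(1)[OF q p e]] Ckb_order_mono[OF amp_diff_bounds(2)[OF q p e]]
        Ckb_order_mono[OF amp_diff_bounds(3)[OF q p e]]; simp)+
  also have "(\<lambda>z. (amp1 q a (fst z) - amp1 p a (fst z)) + clip_cone a z * (amp2 q a (fst z) - amp2 p a (fst z))
      + (clip_cone a z * clip_cone a z) * ((1 / 2) *\<^sub>R (amp3 q a (fst z) - amp3 p a (fst z))) + (W z - V z))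
    = (\<lambda>z. tail q a W z - tail p a V z)"
    by (rule ext) (simp add: tail_def algebra_simps)
  finally show ?thesis
    by (rule Ckb_mono) (simp add: tail_diff_bound_def tail_weight_def algebra_simps)
qed

section \<open>The formula for the solution and its pointwise values\<close>

lemma tail_on_cone: "norm (fst p - a) \<le> snd p \<Longrightarrow> tail q a W p = prog_wave q a p + W p"
  by (simp add: tail_def prog_wave_def clip_cone_eq)

text \<open>Each vertical line meets the cone in one point. The Heaviside factor includes the cone
  itself while \<open>fwd_cone\<close> is open, and this difference must not matter.\<close>

lemma light_cone_null: "{z :: spacetime. snd z = norm (fst z - a)} \<in> null_sets lborel"
proof -
  let ?N = "{z :: spacetime. snd z = norm (fst z - a)}"
  have "closed ?N" by (intro closed_Collect_eq continuous_intros)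
  then have N: "?N \<in> sets borel" by simp
  then have "?N \<in> sets (lborel \<Otimes>\<^sub>M lborel)" unfolding lborel_prod by simp
  from lborel.emeasure_pair_measure_alt[OF this]
  have "emeasure (lborel \<Otimes>\<^sub>M lborel) ?N = (\<integral>\<^sup>+ x. emeasure lborel (Pair x -` ?N) \<partial>lborel)" .
  also have "\<dots> = (\<integral>\<^sup>+ x. 0 \<partial>(lborel :: (real^3) measure))"
  proof (intro nn_integral_cong)
    fix x
    have "Pair x -` ?N = {norm (x - a)}" by auto
    then show "emeasure lborel (Pair x -` ?N) = 0" by simp
  qed
  finally show ?thesis using N by (simp add: lborel_prod null_sets_def)
qed

lemma cone_dist_formula:
  assumes q: "Ckb 7 (\<lambda>_. M) q" and W: "wave_remainder M q a W" and \<phi>: "\<phi> \<in> test_functions UNIV"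
  shows "cone_dist q a W \<phi> = cone_delta a \<phi>
    + regular_dist (\<lambda>(x, t). heaviside (t - norm (x - a)) * tail q a W (x, t)) \<phi>"
proof -
  have \<phi>c: "continuous_on UNIV \<phi>" "compact (fsupp \<phi>)" using \<phi> Ck_on_imp_continuous_on by (auto simp: test_iff)
  let ?C = "{z :: spacetime. norm (fst z - a) \<le> snd z}"
  define h where "h z = prog_wave q a z * \<phi> z" for z
  have h: "continuous_on UNIV h"
    unfolding h_def[abs_def] using Ck_on_imp_continuous_on[OF prog_wave_facts(1)[OF q]] \<phi>c(1) by (intro continuous_intros) auto
  have C: "?C \<in> sets borel" by (intro borel_closed closed_Collect_le continuous_intros)
  note i = cone_solution_integrable[OF q W \<phi>c]
  have i1: "integrable lborel (\<lambda>z. indicator (fwd_cone a) z *\<^sub>R h z)" using i(1) by (simp add: h_def)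
  have hm: "h \<in> borel_measurable lborel" using borel_measurable_continuous_onI[OF h] by simp
  have m: "(\<lambda>z. indicator ?C z *\<^sub>R h z) \<in> borel_measurable lborel"
    using C hm by (intro borel_measurable_scaleR borel_measurable_indicator) auto
  have ae: "AE z in lborel. indicator ?C z *\<^sub>R h z = indicator (fwd_cone a) z *\<^sub>R h z"
    using AE_not_in[OF light_cone_null[of a]]
    by eventually_elim (auto simp: indicator_def fwd_cone_iff simp del: split_paired_All)
  have i2: "integrable lborel (\<lambda>z. indicator ?C z *\<^sub>R h z)"
    using integrable_cong_AE[OF m borel_measurable_integrable[OF i1] ae] i1 by simp
  have "(case z of (x, t) \<Rightarrow> heaviside (t - norm (x - a)) * tail q a W (x, t)) * \<phi> z
      = indicator ?C z *\<^sub>R h z + W z * \<phi> z" for z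
  proof (cases "norm (fst z - a) \<le> snd z")
    case True
    then show ?thesis
      using tail_on_cone[OF True, of q W] by (simp add: case_prod_beta heaviside_def h_def indicator_def algebra_simps)
  next
    case False
    then have "W z = 0" using W unfolding wave_remainder_def not_le by blast
    then show ?thesis using False by (simp add: case_prod_beta heaviside_def indicator_def)
  qed
  then have "regular_dist (\<lambda>(x, t). heaviside (t - norm (x - a)) * tail q a W (x, t)) \<phi>
      = (\<integral>z. indicator ?C z *\<^sub>R h z + W z * \<phi> z \<partial>lborel)"
    unfolding regular_dist_def using \<phi> by (simp only: restrict_apply if_True)
  also have "\<dots> = (\<integral>z. indicator ?C z *\<^sub>R h z \<partial>lborel) + (\<integral>z. W z * \<phi> z \<partial>lborel)"
    by (rule Bochner_Integration.integral_add[OF i2 i(2)])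
  also have "(\<integral>z. indicator ?C z *\<^sub>R h z \<partial>lborel) = (\<integral>z. indicator (fwd_cone a) z *\<^sub>R h z \<partial>lborel)"
    by (rule integral_cong_AE[OF m borel_measurable_integrable[OF i1] ae])
  finally have r: "regular_dist (\<lambda>(x, t). heaviside (t - norm (x - a)) * tail q a W (x, t)) \<phi>
      = (\<integral>z. indicator (fwd_cone a) z *\<^sub>R h z \<partial>lborel) + (\<integral>z. W z * \<phi> z \<partial>lborel)" .
  have "cone_delta a \<phi> = (\<integral>x. \<phi> (x, norm (x - a)) / complex_of_real (4 * pi * norm (x - a)) \<partial>lborel)"
    using \<phi> by (simp add: cone_delta_def)
  also have "\<dots> = (\<integral>y. \<phi> (y + a, norm (y + a - a)) / complex_of_real (4 * pi * norm (y + a - a)) \<partial>lborel)"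
    by (rule integral_lborel_translate(1)[symmetric])
  also have "\<dots> = potential 1 \<phi> (a, 0)"
    unfolding potential_def
  proof (intro Bochner_Integration.integral_cong refl)
    fix y :: "real^3"
    have e: "(a, 0) + (y, 1 * norm y) = (y + a, norm (y + a - a))" by (simp add: add.commute)
    have g: "z / complex_of_real s = (1 / s) *\<^sub>R z" for z s
      by (simp add: scaleR_conv_of_real)
    show "\<phi> (y + a, norm (y + a - a)) / complex_of_real (4 * pi * norm (y + a - a)) = newton y *\<^sub>R \<phi> ((a, 0) + (y, 1 * norm y))"
      unfolding e g newton_def by simp
  qed
  finally show ?thesis using r \<phi> by (simp add: cone_dist_def cone_solution_def h_def)
qed

lemma open_off_cone: "open {(x :: real^3, t). t \<noteq> norm (x - a)}"
proof -
  have "{(x :: real^3, t). t \<noteq> norm (x - a)} = - {z. snd z = norm (fst z - a)}" by auto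
  then show ?thesis by (simp add: open_Compl closed_Collect_eq continuous_on_snd continuous_on_fst continuous_on_norm continuous_on_diff continuous_on_const)
qed

text \<open>The two open sides of the cone are treated separately, with 0 on the outer one. A test
  function supported off the cone vanishes on it, so the delta shell gives no contribution.\<close>

lemma tail_off_cone:
  assumes q: "Ckb 7 (\<lambda>_. M) q" and W: "wave_remainder M q a W"
  defines "u \<equiv> \<lambda>(x, t). heaviside (t - norm (x - a)) * tail q a W (x, t)"
  shows "Ck_on 1 {(x, t). t \<noteq> norm (x - a)} u" "dist_given_on {(x, t). t \<noteq> norm (x - a)} u (cone_dist q a W)"
proof -
  let ?X = "{z :: spacetime. norm (fst z - a) < snd z}" and ?Y = "{z :: spacetime. snd z < norm (fst z - a)}"
  have o: "open ?X" "open ?Y" by (intro open_Collect_less continuous_intros)+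
  have "Ck_on 1 ?X u"
    by (rule Ck_on_cong[OF o(1) Ck_on_subset[OF Ckb_imp_Ck_on[OF Ckb_tail[OF q W]]]])
      (auto simp: u_def heaviside_def)
  moreover have "Ck_on 1 ?Y u"
    by (rule Ck_on_cong[OF o(2) Ck_on_subset[OF Ck_on_const[of 1 0]]]) (auto simp: u_def heaviside_def)
  moreover have "{(x, t). t \<noteq> norm (x - a)} = ?X \<union> ?Y" by auto
  ultimately show "Ck_on 1 {(x, t). t \<noteq> norm (x - a)} u" using Ck_on_Un[OF o, of 1 u] by (simp only:)
  show "dist_given_on {(x, t). t \<noteq> norm (x - a)} u (cone_dist q a W)"
    unfolding dist_given_on_def
  proof
    fix \<phi> :: "spacetime \<Rightarrow> complex" assume "\<phi> \<in> test_functions {(x, t). t \<noteq> norm (x - a)}"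
    then have \<phi>: "\<phi> \<in> test_functions UNIV" "fsupp \<phi> \<subseteq> {(x, t). t \<noteq> norm (x - a)}"
      using test_support[OF open_off_cone] by blast+
    have "\<phi> (x, norm (x - a)) = 0" for x using \<phi>(2) by (intro fsupp_zero[of _ \<phi>]) auto
    then have "cone_delta a \<phi> = 0" using \<phi>(1) by (simp add: cone_delta_def)
    then show "cone_dist q a W \<phi> = (\<integral>z. u z * \<phi> z \<partial>lborel)"
      using cone_dist_formula[OF q W \<phi>(1)] \<phi>(1) by (simp add: regular_dist_def u_def)
  qed
qed

text \<open>If the values differed, \<open>u - v\<close> would stay within half of
  \<open>|c - d|\<close> of \<open>c - d\<close> near \<open>p\<close>. Testing with a nonnegative
  bump supported there contradicts the equality of the two integrals.\<close>

lemma has_dist_value_unique: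
  fixes U :: "('a::euclidean_space \<Rightarrow> complex) \<Rightarrow> complex"
  assumes "has_dist_value U p c" "has_dist_value U p d"
  shows "c = d"
proof (rule ccontr)
  assume cd: "c \<noteq> d"
  obtain X u where X: "open X" "p \<in> X" "continuous_on X u" "dist_given_on X u U" "u p = c"
    using assms(1) unfolding has_dist_value_def by blast
  obtain Y v where Y: "open Y" "p \<in> Y" "continuous_on Y v" "dist_given_on Y v U" "v p = d"
    using assms(2) unfolding has_dist_value_def by blast
  define Z where "Z = X \<inter> Y"
  have Z: "open Z" "p \<in> Z" "continuous_on Z u" "continuous_on Z v"
    using X Y by (auto simp: Z_def intro: continuous_on_subset)
  have "continuous_on Z (\<lambda>x. u x - v x)" using Z by (intro continuous_intros)
  then have "isCont (\<lambda>x. u x - v x) p" using Z(1,2) by (simp add: continuous_on_eq_continuous_at)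
  then obtain r where r: "0 < r" "\<And>x. norm (x - p) < r \<Longrightarrow> norm ((u x - v x) - (c - d)) < norm (c - d) / 2"
    using cd X(5) Y(5) unfolding isCont_def LIM_def dist_norm
    by (metis (no_types, lifting) diff_self divide_pos_pos norm_zero right_minus_eq zero_less_norm_iff zero_less_numeral)
  obtain s where s: "0 < s" "ball p s \<subseteq> Z" using Z openE by blast
  \<comment> \<open>The bump has unit radius; dilated by \<open>k\<close> it lives within half of
    \<open>min r s\<close>, so that its closed support stays inside the open ball.\<close>
  define k where "k = 2 / min r s"
  have k: "0 < k" using r s by (simp add: k_def)
  define \<phi> :: "'a \<Rightarrow> complex" where "\<phi> x = bump (k *\<^sub>R (x - p))" for x
  have near: "norm (x - p) \<le> min r s / 2" if "\<phi> x \<noteq> 0" for x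
  proof -
    have "norm (k *\<^sub>R (x - p)) < 1" using bump_facts(4)[of "k *\<^sub>R (x - p)"] that not_le unfolding \<phi>_def by blast
    then have "k * norm (x - p) < 1" using k unfolding norm_scaleR by simp
    then have "norm (x - p) < 1 / k" using k by (simp add: field_simps)
    then show ?thesis by (simp add: k_def)
  qed
  have "fsupp \<phi> \<subseteq> cball p (min r s / 2)"
    unfolding fsupp_subset_iff[OF closed_cball] mem_cball dist_norm norm_minus_commute[of p] using near by blast
  also have "\<dots> \<subseteq> ball p s" using r s by (auto simp: subset_iff)
  finally have supp: "fsupp \<phi> \<subseteq> Z" "compact (fsupp \<phi>)"
    using s(2) \<open>fsupp \<phi> \<subseteq> cball p (min r s / 2)\<close> compact_Int_closed[OF compact_cball, of "fsupp \<phi>" p "min r s / 2"]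
    by (auto simp: fsupp_def Int_absorb1)
  have smooth: "Ck_on m UNIV \<phi>" for m unfolding \<phi>_def[abs_def] by (rule Ck_on_dilate[OF bump_facts(1)])
  have test: "\<phi> \<in> test_functions T" if "Z \<subseteq> T" for T
    using supp smooth Ck_on_subset[OF smooth, of T] that by (auto simp: test_functions_def Cc_def)
  have int: "integrable lborel (\<lambda>x. w x * \<phi> x)" if w: "continuous_on Z w" for w
  proof -
    have s: "fsupp (\<lambda>x. w x * \<phi> x) \<subseteq> fsupp \<phi>"
    proof -
      have c: "closed (fsupp \<phi>)" by (simp add: fsupp_def)
      show ?thesis unfolding fsupp_subset_iff[OF c] by (simp add: fsupp_zero)
    qed
    have "continuous_on Z \<phi>" using Ck_on_imp_continuous_on[OF smooth[of 0]] continuous_on_subset by blast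
    with w have "Ck_on 0 Z (\<lambda>x. w x * \<phi> x)" by (auto intro!: continuous_intros)
    then have "Ck_on 0 UNIV (\<lambda>x. w x * \<phi> x)" using Ck_on_UNIV_of_support[OF Z(1)] s supp(1) by blast
    moreover have "compact (fsupp (\<lambda>x. w x * \<phi> x))"
      by (rule compact_fsupp_subset[OF supp(2)]) (use fsupp_zero[of _ \<phi>] in auto)
    ultimately show ?thesis using integrable_continuous_compact by simp
  qed
  have uv: "(\<integral>x. u x * \<phi> x \<partial>lborel) = (\<integral>x. v x * \<phi> x \<partial>lborel)"
    using X(4) Y(4) test[of X] test[of Y] unfolding dist_given_on_def Z_def by auto
  define \<rho> where "\<rho> x = Re (\<phi> x)" for x
  have \<rho>: "\<phi> x = complex_of_real (\<rho> x)" "0 \<le> \<rho> x" for x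
    using bump_facts(2,3)[of "k *\<^sub>R (x - p)"] by (auto simp: \<rho>_def \<phi>_def)
  have "integrable lborel (\<lambda>x. \<phi> x)" using int[of "\<lambda>_. 1"] by simp
  then have \<rho>i: "integrable lborel \<rho>" unfolding \<rho>_def[abs_def] by (rule integrable_Re)
  have \<rho>p: "0 < (\<integral>x. \<rho> x \<partial>lborel)"
    using scaled_bump_facts(4)[OF k, where 'a='a] integral_lborel_translate(1)[of "\<lambda>x::'a. Re (bump (k *\<^sub>R x))" "- p"]
    by (simp add: \<rho>_def \<phi>_def)
  have "(\<integral>x. (c - d) * \<phi> x \<partial>lborel) = (\<integral>x. (c - d) * \<phi> x - (u x * \<phi> x - v x * \<phi> x) \<partial>lborel)"
    using int[OF Z(3)] int[OF Z(4)] int[of "\<lambda>_. c - d"] uv by simp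
  also have "norm \<dots> \<le> (\<integral>x. norm (c - d) / 2 * \<rho> x \<partial>lborel)"
  proof (rule order_trans[OF integral_norm_bound integral_mono])
    show "integrable lborel (\<lambda>x. norm ((c - d) * \<phi> x - (u x * \<phi> x - v x * \<phi> x)))"
      using int[OF Z(3)] int[OF Z(4)] int[of "\<lambda>_. c - d"] by simp
    show "integrable lborel (\<lambda>x. norm (c - d) / 2 * \<rho> x)" using \<rho>i by simp
    fix x
    have eq: "(c - d) * \<phi> x - (u x * \<phi> x - v x * \<phi> x) = - (((u x - v x) - (c - d)) * \<phi> x)" by (simp add: algebra_simps)
    show "norm ((c - d) * \<phi> x - (u x * \<phi> x - v x * \<phi> x)) \<le> norm (c - d) / 2 * \<rho> x"
    proof (cases "\<phi> x = 0")
      case True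
      then show ?thesis using \<rho>(2)[of x] by simp
    next
      case False
      have "norm (x - p) < r" using near[OF False] r(1) s(1) by linarith
      from r(2)[OF this] have "norm ((u x - v x) - (c - d)) * \<rho> x \<le> norm (c - d) / 2 * \<rho> x"
        using \<rho>(2) by (intro mult_right_mono) auto
      then show ?thesis unfolding eq norm_minus_cancel norm_mult using \<rho>[of x] by simp
    qed
  qed
  finally have "norm (\<integral>x. (c - d) * \<phi> x \<partial>lborel) \<le> norm (c - d) / 2 * (\<integral>x. \<rho> x \<partial>lborel)" by simp
  moreover have "(\<integral>x. (c - d) * \<phi> x \<partial>lborel) = (c - d) * complex_of_real (\<integral>x. \<rho> x \<partial>lborel)"
    unfolding \<rho>(1) by simp
  ultimately have "norm (c - d) * (\<integral>x. \<rho> x \<partial>lborel) \<le> norm (c - d) / 2 * (\<integral>x. \<rho> x \<partial>lborel)"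
    using \<rho>p by (simp only: norm_mult norm_of_real abs_of_pos)
  then show False using \<rho>p cd by simp
qed

lemma dist_value_cone_dist:
  assumes q: "Ckb 7 (\<lambda>_. M) q" and W: "wave_remainder M q a W" and \<tau>: "0 < \<tau>"
  shows "has_dist_value (cone_dist q a W) (a, 2 * \<tau>) (tail q a W (a, 2 * \<tau>))"
    and "dist_value (cone_dist q a W) (a, 2 * \<tau>) = tail q a W (a, 2 * \<tau>)"
proof -
  let ?u = "\<lambda>(x, t). heaviside (t - norm (x - a)) * tail q a W (x, t)"
  let ?X = "{(x, t). t \<noteq> norm (x - a)}"
  have "continuous_on ?X ?u" "dist_given_on ?X ?u (cone_dist q a W)"
    using tail_off_cone[OF q W] open_off_cone Ck_on_imp_continuous_on by blast+
  moreover have "(a, 2 * \<tau>) \<in> ?X" "?u (a, 2 * \<tau>) = tail q a W (a, 2 * \<tau>)" using \<tau> by (auto simp: heaviside_def)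
  ultimately show *: "has_dist_value (cone_dist q a W) (a, 2 * \<tau>) (tail q a W (a, 2 * \<tau>))"
    unfolding has_dist_value_def using open_off_cone by blast
  show "dist_value (cone_dist q a W) (a, 2 * \<tau>) = tail q a W (a, 2 * \<tau>)"
    unfolding dist_value_def using * has_dist_value_unique by blast
qed

text \<open>The factor 2 in the weight is the inner derivative of \<open>2 * \<tau>\<close>.\<close>

lemma Ckb_vertical:
  assumes F: "Ckb 1 w F"
  shows "Ckb 1 (\<lambda>\<tau>. 2 * w (a, 2 * \<tau>)) (\<lambda>\<tau>::real. F (a :: real^3, 2 * \<tau>))"
proof -
  have F': "F differentiable (at p)" "norm (F p) \<le> w p" "norm (dt F p) \<le> w p" "continuous_on UNIV (dt F)" for p
    using F by (auto simp del: split_paired_All)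
  have d: "((\<lambda>\<tau>. F (a, 2 * \<tau>)) has_derivative (\<lambda>v. (2 * v) *\<^sub>R dt F (a, 2 * \<tau>))) (at \<tau>)" for \<tau>
  proof -
    have "((\<lambda>\<tau>. (a, 2 * \<tau>)) has_derivative (\<lambda>v. (0, 2 * v))) (at \<tau>)" by (auto intro!: derivative_eq_intros)
    from has_derivative_compose[OF this spacetime_has_derivative[OF F'(1)]] show ?thesis by simp
  qed
  have pd: "partial_deriv b (\<lambda>\<tau>. F (a, 2 * \<tau>)) = (\<lambda>\<tau>. (2 * b) *\<^sub>R dt F (a, 2 * \<tau>))" for b
    using partial_deriv_eq[OF d] by auto
  have "norm (F (a, 2 * \<tau>)) \<le> 2 * w (a, 2 * \<tau>)" for \<tau>
    using F'(2)[of "(a, 2 * \<tau>)"] Ckb_weight_nonneg[OF F, of "(a, 2 * \<tau>)"] by linarith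
  moreover have "continuous_on UNIV (partial_deriv b (\<lambda>\<tau>. F (a, 2 * \<tau>)))" for b :: real
    unfolding pd by (intro continuous_intros continuous_on_compose2[OF F'(4)]) auto
  moreover have "norm (partial_deriv b (\<lambda>\<tau>. F (a, 2 * \<tau>)) \<tau>) \<le> 2 * w (a, 2 * \<tau>)" if "b \<in> Basis" for b \<tau> :: real
    using F'(3)[of "(a, 2 * \<tau>)"] that by (simp add: pd)
  moreover have "(\<lambda>\<tau>. F (a, 2 * \<tau>)) differentiable (at \<tau>)" for \<tau>
    using d by (auto simp: differentiable_def)
  ultimately show ?thesis unfolding One_nat_def Ckb.simps by blast
qed

section \<open>Existence, regularity and stability with explicit constants\<close>

text \<open>Here the potential is the coefficient \<open>q\<close>. Compact support makes its norm
  finite, and \<open>M\<close> is the norm itself rather than an upper bound of it.\<close>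

lemma potential_Ckb:
  assumes "7 \<le> n" "q \<in> Cc n (ball 0 1)"
  obtains M where "Ck_norm 7 UNIV q = ereal M" "Ckb 7 (\<lambda>_. M) q" "q \<in> Cc n UNIV"
proof -
  have qn: "q \<in> Cc n UNIV" using Cc_open[OF open_ball assms(2)] .
  then have q7: "Ck_on 7 UNIV q" "compact (fsupp q)" using Cc_mono[OF qn assms(1)] by (auto simp only: Cc_iff)
  obtain A where "Ckb 7 (\<lambda>_. A) q" using Ckb_compact[OF q7] by blast
  then have "Ck_norm 7 UNIV q \<noteq> \<infinity>" using Ck_norm_le[of 7 "\<lambda>_. A" q UNIV A] by auto
  moreover have "Ck_norm 7 UNIV q \<noteq> - \<infinity>" using Ck_norm_nonneg[of UNIV 7 q] by auto
  ultimately obtain M where M: "Ck_norm 7 UNIV q = ereal M" by (cases "Ck_norm 7 UNIV q") auto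
  then have "Ckb 7 (\<lambda>_. M) q" by (intro Ck_norm_imp_Ckb q7) simp
  with M qn show ?thesis using that by blast
qed

lemma tail_bound_mono:
  assumes "0 \<le> M" "M \<le> N" "0 \<le> t" "t \<le> s"
  shows "tail_bound M t \<le> tail_bound N s"
  unfolding tail_bound_def using bnd_mono[OF assms(1,2)] assms by (intro tail_weight_mono) auto

lemma solution_eq_cone_dist:
  assumes "7 \<le> n" "q \<in> Cc n (ball 0 1)" "Ckb 7 (\<lambda>_. M) q" "wave_remainder M q a W" "point_source_solution n q a U"
  shows "U = cone_dist q a W"
  using assms by (intro point_source_unique[OF assms(2,5)] cone_dist_solution Cc_open[OF open_ball assms(2)]) auto

lemma point_source_existence:
  assumes n: "7 \<le> n" and q: "q \<in> Cc n (ball 0 1)"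
  shows "\<exists>!U. point_source_solution n q a U"
proof -
  obtain M where M: "Ckb 7 (\<lambda>_. M) q" "q \<in> Cc n UNIV" using potential_Ckb[OF n q] by blast
  obtain W where W: "wave_remainder M q a W" using wave_remainder_exists[OF M(1)] by blast
  show ?thesis
  proof (rule ex1I)
    show "point_source_solution n q a (cone_dist q a W)" using n by (intro cone_dist_solution[OF M W]) simp
  qed (rule solution_eq_cone_dist[OF n q M(1) W])
qed

text \<open>The function \<open>r\<close> has to be chosen before \<open>T\<close> and the bound
  \<open>M\<close>. It is therefore built from the exact norm \<open>M0\<close>, and monotonicity of
  \<open>tail_bound\<close> covers every larger \<open>M\<close> and all times up to
  \<open>T\<close>.\<close>

lemma point_source_regularity:
  assumes n: "7 \<le> n" and q: "q \<in> Cc n (ball 0 1)" and U: "point_source_solution n q a U"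
  shows "\<exists>r :: spacetime \<Rightarrow> complex. Ck_on 1 UNIV r \<and>
      (\<forall>\<phi>\<in>test_functions UNIV.
         U \<phi> = cone_delta a \<phi> + regular_dist (\<lambda>(x, t). heaviside (t - norm (x - a)) * r (x, t)) \<phi>) \<and>
      (\<forall>T>0. \<forall>M. Ck_norm 7 UNIV q \<le> ereal M \<longrightarrow>
         Ck_norm 1 (UNIV \<times> {0..T}) r
           \<le> ereal (real (card (multi_indices 1 :: spacetime multiset set)) * tail_bound M T))" (is ?formula)
    and "\<exists>u. Ck_on 1 {(x, t). t \<noteq> norm (x - a)} u \<and> dist_given_on {(x, t). t \<noteq> norm (x - a)} u U"
    and "0 < \<tau> \<Longrightarrow> \<exists>!c. has_dist_value U (a, 2 * \<tau>) c"
    and "Ck_on 1 {0<..<1} (\<lambda>\<tau>::real. dist_value U (a, 2 * \<tau>))"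
proof -
  obtain M0 where M0: "Ck_norm 7 UNIV q = ereal M0" "Ckb 7 (\<lambda>_. M0) q" using potential_Ckb[OF n q] by blast
  obtain W where W: "wave_remainder M0 q a W" using wave_remainder_exists[OF M0(2)] by blast
  have UW: "U = cone_dist q a W" by (rule solution_eq_cone_dist[OF n q M0(2) W U])
  have r: "Ckb 1 (\<lambda>p. tail_bound M0 (snd p)) (tail q a W)" by (rule Ckb_tail[OF M0(2) W])
  have "Ck_norm 1 (UNIV \<times> {0..T}) (tail q a W)
      \<le> ereal (real (card (multi_indices 1 :: spacetime multiset set)) * tail_bound M T)"
    if "0 < T" "Ck_norm 7 UNIV q \<le> ereal M" for T M
  proof (rule Ck_norm_le[OF r])
    show "tail_bound M0 (snd p) \<le> tail_bound M T" if "p \<in> UNIV \<times> {0..T}" for p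
      using that \<open>Ck_norm 7 UNIV q \<le> ereal M\<close> M0(1) Ckb_weight_nonneg[OF M0(2)]
      by (intro tail_bound_mono) auto
  qed (use that in auto)
  then show ?formula
    using Ckb_imp_Ck_on[OF r] cone_dist_formula[OF M0(2) W] unfolding UW by (intro exI[of _ "tail q a W"]) blast
  show "\<exists>u. Ck_on 1 {(x, t). t \<noteq> norm (x - a)} u \<and> dist_given_on {(x, t). t \<noteq> norm (x - a)} u U"
    using tail_off_cone[OF M0(2) W] unfolding UW by blast
  show "\<exists>!c. has_dist_value U (a, 2 * \<tau>) c" if "0 < \<tau>"
    using dist_value_cone_dist(1)[OF M0(2) W that] has_dist_value_unique unfolding UW by blast
  have "Ck_on 1 {0<..<1} (\<lambda>\<tau>::real. tail q a W (a, 2 * \<tau>))"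
    using Ckb_imp_Ck_on[OF Ckb_vertical[OF r]] Ck_on_subset subset_UNIV by blast
  then show "Ck_on 1 {0<..<1} (\<lambda>\<tau>::real. dist_value U (a, 2 * \<tau>))"
    by (rule Ck_on_cong[OF open_greaterThanLessThan]) (use dist_value_cone_dist(2)[OF M0(2) W] UW in auto)
qed

lemma dbnd_nonneg:
  assumes "0 \<le> M"
  shows "0 \<le> dbnd2 M" "0 \<le> dbnd3 M" "0 \<le> dbnd4 M"
proof -
  note b = bnd_mono(1-3)[OF assms order_refl]
  show 2: "0 \<le> dbnd2 M" using assms by (simp add: dbnd2_def)
  show 3: "0 \<le> dbnd3 M" using assms b 2 by (simp add: dbnd3_def)
  show "0 \<le> dbnd4 M" using assms b 3 by (simp add: dbnd4_def)
qed

text \<open>The number \<open>e\<close> is the exact norm of the difference of the potentials, so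
  the estimate is linear in it. In the constant, the factor 2 is the inner derivative of
  \<open>2 * \<tau>\<close>, and the argument 2 bounds the time \<open>2 * \<tau>\<close>.\<close>

lemma point_source_stability:
  assumes n: "7 \<le> n" and q1: "q1 \<in> Cc n (ball 0 1)" and q2: "q2 \<in> Cc n (ball 0 1)"
    and M: "Ck_norm 7 UNIV q1 \<le> ereal M" "Ck_norm 7 UNIV q2 \<le> ereal M"
    and U1: "point_source_solution n q1 a U1" and U2: "point_source_solution n q2 a U2"
    and \<beta>: "\<beta> \<in> {0, 1}" and \<tau>: "\<tau> \<in> {0<..<1}"
  shows "ereal (cmod ((partial_deriv 1 ^^ \<beta>) (\<lambda>\<tau>::real. dist_value U1 (a, 2 * \<tau>) - dist_value U2 (a, 2 * \<tau>)) \<tau>))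
    \<le> ereal (2 * tail_diff_bound M 2) * Ck_norm 7 UNIV (\<lambda>x. q1 x - q2 x)"
proof -
  have c: "q1 \<in> Cc n UNIV" "q2 \<in> Cc n UNIV" using Cc_open[OF open_ball] q1 q2 by auto
  have 7: "Ck_on 7 UNIV q1" "Ck_on 7 UNIV q2" using Cc_mono[OF c(1) n] Cc_mono[OF c(2) n] by (auto simp only: Cc_iff)
  have k: "Ckb 7 (\<lambda>_. M) q1" "Ckb 7 (\<lambda>_. M) q2" using Ck_norm_imp_Ckb 7 M by blast+
  have M0: "0 \<le> M" using Ckb_weight_nonneg[OF k(1)] .
  obtain e where e: "Ck_norm 7 UNIV (\<lambda>x. q1 x - q2 x) = ereal e" "Ckb 7 (\<lambda>_. e) (\<lambda>x. q1 x - q2 x)"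
    using potential_Ckb[OF n, of "\<lambda>x. q1 x - q2 x"]
  proof -
    have "(\<lambda>x. q1 x - q2 x) \<in> Cc n UNIV" by (rule Cc_diff[OF c])
    moreover have "fsupp (\<lambda>x. q1 x - q2 x) \<subseteq> fsupp q1 \<union> fsupp q2"
    proof -
      have cl: "closed (fsupp q1 \<union> fsupp q2)" by (simp add: fsupp_def closed_Un)
      show ?thesis unfolding fsupp_subset_iff[OF cl] by (simp add: fsupp_zero)
    qed
    ultimately have "(\<lambda>x. q1 x - q2 x) \<in> Cc n (ball 0 1)"
      using q1 q2 Ck_on_subset[of n UNIV "\<lambda>x. q1 x - q2 x" "ball 0 1"] by (auto simp: Cc_def)
    then show ?thesis using potential_Ckb[OF n] that by blast
  qed
  obtain W1 where W1: "wave_remainder M q1 a W1" using wave_remainder_exists[OF k(1)] by blast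
  \<comment> \<open>Both remainders are built with the common \<open>M\<close>, hence estimated in
    the same weight. By uniqueness of the solution this choice does not affect \<open>U1\<close> and
    \<open>U2\<close>.\<close>
  obtain W2 where W2: "wave_remainder M q2 a W2" using wave_remainder_exists[OF k(2)] by blast
  define D where "D z = tail q1 a W1 z - tail q2 a W2 z" for z
  have D: "Ckb 1 (\<lambda>\<tau>. 2 * (e * tail_diff_bound M (2 * \<tau>))) (\<lambda>\<tau>::real. D (a, 2 * \<tau>))"
    using Ckb_vertical[OF Ckb_tail_diff[OF k e(2) W1 W2], of a] unfolding D_def by simp
  have eq: "dist_value U1 (a, 2 * \<tau>) - dist_value U2 (a, 2 * \<tau>) = D (a, 2 * \<tau>)" if "\<tau> \<in> {0<..<1}" for \<tau>
    using solution_eq_cone_dist[OF n q1 k(1) W1 U1] solution_eq_cone_dist[OF n q2 k(2) W2 U2] that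
      dist_value_cone_dist(2)[OF k(1) W1, of \<tau>] dist_value_cone_dist(2)[OF k(2) W2, of \<tau>] by (simp add: D_def)
  have "(partial_deriv 1 ^^ \<beta>) (\<lambda>\<tau>. dist_value U1 (a, 2 * \<tau>) - dist_value U2 (a, 2 * \<tau>)) \<tau> = (partial_deriv 1 ^^ \<beta>) (\<lambda>\<tau>. D (a, 2 * \<tau>)) \<tau>"
    using \<beta> eq[OF \<tau>] partial_deriv_cong_open[OF open_greaterThanLessThan \<tau> eq] by auto
  moreover have "cmod ((partial_deriv 1 ^^ \<beta>) (\<lambda>\<tau>. D (a, 2 * \<tau>)) \<tau>) \<le> 2 * (e * tail_diff_bound M (2 * \<tau>))"
    using \<beta> D by auto
  moreover have "2 * (e * tail_diff_bound M (2 * \<tau>)) \<le> 2 * (e * tail_diff_bound M 2)"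
  proof -
    have "tail_diff_bound M (2 * \<tau>) \<le> tail_diff_bound M 2"
      unfolding tail_diff_bound_def
      using dbnd_nonneg[OF M0] bnd_mono(3)[OF M0 order_refl] M0 \<tau> by (intro tail_weight_mono) auto
    then show ?thesis using Ckb_weight_nonneg[OF e(2)] by (intro mult_left_mono) auto
  qed
  ultimately show ?thesis unfolding e(1) by (simp add: mult_ac)
qed

theorem theorem1p2:
  shows "(\<exists>C :: real \<Rightarrow> real \<Rightarrow> real. \<forall>n\<ge>7. \<forall>q\<in>Cc n (ball 0 1). \<forall>a\<in>sphere 0 1.
            (\<exists>!U. point_source_solution n q a U) \<and>
            (\<forall>U. point_source_solution n q a U \<longrightarrow>
               (\<exists>r :: spacetime \<Rightarrow> complex.
                  Ck_on 1 UNIV r \<and>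
                  (\<forall>\<phi>\<in>test_functions UNIV.
                     U \<phi> = cone_delta a \<phi>
                       + regular_dist (\<lambda>(x, t). heaviside (t - norm (x - a)) * r (x, t)) \<phi>) \<and>
                  (\<forall>T>0. \<forall>M. Ck_norm 7 UNIV q \<le> ereal M \<longrightarrow>
                     Ck_norm 1 (UNIV \<times> {0..T}) r \<le> ereal (C T M))) \<and>
               (\<exists>u. Ck_on 1 {(x, t). t \<noteq> norm (x - a)} u \<and>
                  dist_given_on {(x, t). t \<noteq> norm (x - a)} u U) \<and>
               (\<forall>\<tau>\<in>{0<..<1}. \<exists>!c. has_dist_value U (a, 2 * \<tau>) c) \<and>
               Ck_on 1 {0<..<1} (\<lambda>\<tau>::real. dist_value U (a, 2 * \<tau>))))
       \<and> (\<exists>C :: real \<Rightarrow> real. \<forall>n\<ge>7. \<forall>M. \<forall>q1\<in>Cc n (ball 0 1). \<forall>q2\<in>Cc n (ball 0 1). \<forall>U1 U2.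
            Ck_norm 7 UNIV q1 \<le> ereal M \<longrightarrow> Ck_norm 7 UNIV q2 \<le> ereal M \<longrightarrow>
            (\<forall>a\<in>sphere 0 1. point_source_solution n q1 a (U1 a)
               \<and> point_source_solution n q2 a (U2 a)) \<longrightarrow>
            (\<forall>\<beta>\<in>{0, 1}.
               (SUP a\<in>sphere 0 1. SUP \<tau>\<in>{0<..<1}.
                  ereal (cmod ((partial_deriv 1 ^^ \<beta>)
                    (\<lambda>\<tau>::real. dist_value (U1 a) (a, 2 * \<tau>) - dist_value (U2 a) (a, 2 * \<tau>)) \<tau>)))
               \<le> ereal (C M) * Ck_norm 7 UNIV (\<lambda>x. q1 x - q2 x)))"
proof (rule conjI, goal_cases)
  case 1
  \<comment> \<open>The norm is a sum over multi-indices, and \<open>tail_bound M T\<close> bounds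
    each of its terms.\<close>
  let ?C = "\<lambda>T M. real (card (multi_indices 1 :: spacetime multiset set)) * tail_bound M T"
  show ?case
  proof (intro exI[of _ ?C] allI impI ballI conjI)
    fix n :: nat and q :: "real^3 \<Rightarrow> complex" and a :: "real^3" assume a: "7 \<le> n" "q \<in> Cc n (ball 0 1)"
    show "\<exists>!U. point_source_solution n q a U" by (rule point_source_existence[OF a])
    fix U assume U: "point_source_solution n q a U"
    note R = point_source_regularity[OF a U]
    show "\<exists>r :: spacetime \<Rightarrow> complex. Ck_on 1 UNIV r \<and>
      (\<forall>\<phi>\<in>test_functions UNIV.
         U \<phi> = cone_delta a \<phi> + regular_dist (\<lambda>(x, t). heaviside (t - norm (x - a)) * r (x, t)) \<phi>) \<and>
      (\<forall>T>0. \<forall>M. Ck_norm 7 UNIV q \<le> ereal M \<longrightarrow> Ck_norm 1 (UNIV \<times> {0..T}) r \<le> ereal (?C T M))"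
      by (rule R(1))
    show "\<exists>u. Ck_on 1 {(x, t). t \<noteq> norm (x - a)} u \<and> dist_given_on {(x, t). t \<noteq> norm (x - a)} u U" by (rule R(2))
    show "\<exists>!c. has_dist_value U (a, 2 * \<tau>) c" if "\<tau> \<in> {0<..<1}" for \<tau> using R(3) that by simp
    show "Ck_on 1 {0<..<1} (\<lambda>\<tau>::real. dist_value U (a, 2 * \<tau>))" by (rule R(4))
  qed
next
  case 2
  show ?case
    by (intro exI[of _ "\<lambda>M. 2 * tail_diff_bound M 2"] allI impI ballI SUP_least)
      (rule point_source_stability; blast)
qed

end
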